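(* Let $n\le4$ and $(A,b)\in\mathcal B$ (setting $\mathcal B$), let $\gamma:=\frac{\mathrm{tr}(A)}{|A|^2+|b|^2}$, $\tilde A:=\gamma A$, $\tilde b:=\gamma b$. Let $\tilde r\in L^2_{\mathrm{per}}(Y)$ be the unique solution in $L^2_{\mathrm{per}}(Y)$ to $-D^2:(\tilde A\tilde r)+\nabla\cdot(\tilde b\tilde r)=0$ in $Y$, $\tilde r$ $Y$-periodic, $\int_Y\tilde r=1$, let $r:=\frac{1}{\int_Y\gamma\tilde r}\gamma\tilde r$, and suppose that the centering condition $\int_Y r\,b=0$ holds. Let $$B_2(v,w):=\int_Y(\nabla\cdot v)(\tilde A:Dw+\tilde b\cdot w)+\frac12\int_Y(Dv-(Dv)^{\mathrm T}):(Dw-(Dw)^{\mathrm T}),\qquad v,w\in H^1_{\mathrm{per},0}(Y;\mathbb{R}^n).$$ For $1\le j\le n$ let $\chi_j\in H^2_{\mathrm{per},0}(Y)$ be the unique solution to $-A:D^2\chi_j-b\cdot\nabla\chi_j=b_j$ in $Y$, $\chi_j$ $Y$-periodic, $\int_Y\chi_j=0$; set $\chi:=(\chi_1,\dots,\chi_n)$ and $$\overline A:=\int_Y r\,[I_n+D\chi]A[I_n+(D\chi)^{\mathrm T}].$$ Let $\xi_h$ denote a finite element approximation of $D\chi$ whose $j$-th row is $\xi_{j,h}^{\mathrm T}$, where $\xi_{j,h}$ is the unique element of a closed linear subspace $P_h\subset H^1_{\mathrm{per},0}(Y;\mathbb{R}^n)$ with $B_2(w_h,\xi_{j,h})=-\int_Y\tilde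 b_j\nabla\cdot w_h$ for all $w_h\in P_h$, such that $\|D\chi-\xi_h\|_{H^1(Y;\mathbb{R}^{n\times n})}\to0$ as $h\to0$. Let $\tilde r_h:=1-\nabla\cdot\rho_h$ denote a finite element approximation of $\tilde r$, where $\rho_h$ is the unique element of a closed linear subspace $P_h'\subset H^1_{\mathrm{per},0}(Y;\mathbb{R}^n)$ with $B_2(\rho_h,w_h)=\int_Y(\tilde A:Dw_h+\tilde b\cdot w_h)$ for all $w_h\in P_h'$, such that $\|\tilde r-\tilde r_h\|_{L^2(Y)}\to0$ as $h\to0$. Then, for $h>0$ sufficiently small, introducing $$\overline A_h:=\int_Y r_h[I_n+\xi_h]A[I_n+\xi_h^{\mathrm T}],\qquad r_h:=\frac{1}{\int_Y\gamma\tilde r_h}\gamma\tilde r_h,$$ we have the bound $$\left|\overline A-\overline A_h\right|\lesssim\|D\chi-\xi_h\|_{H^1(Y;\mathbb{R}^{n\times n})}\left(1+\|D\chi\|_{H^1(Y;\mathbb{R}^{n\times n})}\right)+\|\tilde r-\tilde r_h\|_{L^2(Y)}\left(1+\|D\chi\|_{H^1(Y;\mathbb{R}^{n\times n})}\right)^2,$$ where the constant absorbed in "$\lesssim$" only depends on $(A,b)$ and $n$.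
   Context: $Y:=(0,1)^n\subset\mathbb{R}^n$. The subscript "per" denotes spaces of $Y$-periodic functions on $\mathbb{R}^n$ with the indicated (local) regularity; the additional subscript $0$ means that (each component of) the function has mean zero over $Y$. $|\cdot|$ on matrices is the Frobenius norm, $|A|=\sqrt{A:A}$, $|b|$ is the Euclidean norm, $M:N=\sum_{ij}M_{ij}N_{ij}$, and $Dw$ is the Jacobian, $(Dw)_{ij}=\partial_jw_i$. Setting $\mathcal B$: $(A,b)\in\mathcal B$ means that $A\in L^\infty_{\mathrm{per}}(Y;\mathbb{R}^{n\times n}_{\mathrm{sym}})$, $b\in L^\infty_{\mathrm{per}}(Y;\mathbb{R}^n)$; $A$ is uniformly elliptic, i.e. there are $\lambda,\Lambda>0$ with $\lambda I_n\le A\le\Lambda I_n$ a.e. in $\mathbb{R}^n$; and the Cordes-type condition holds: there exists $\delta\in\left(\frac{n}{n+\pi^2},1\right]$ such that $\frac{|A|^2+|b|^2}{(\mathrm{tr}(A))^2}\le\frac{1}{n-1+\delta}$ a.e. in $\mathbb{R}^n$. $D^2:(\tilde A u):=\sum_{i,j}\partial^2_{ij}(\tilde a_{ij}u)$. The solution $\tilde r\in L^2_{\mathrm{per}}(Y)$ is understood in the very weak sense: $\int_Y\tilde r\,(\tilde A:D^2\varphi+\tilde b\cdot\nabla\varphi)=0$ for all $\varphi\in H^2_{\mathrm{per}}(Y)$. The equation for $\chi_j$ is understood a.e. The existence and uniqueness of $\tilde r$, $\chi_j$, $\xi_{j,h}$ and $\rho_h$, as well as $\tilde r\ge0$ a.e.,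 are established in the paper. The index $h$ ranges over positive reals tending to $0$, with subspaces $P_h,P_h'$ given for each $h$. *)

theory Defs
  imports "HOL-Analysis.Analysis"
begin

text \<open>
  Functions on the torus are functions on the whole space \<open>real ^ 'n\<close>. Elements of Lebesgue and
  Sobolev spaces are represented by individual Lebesgue measurable functions, and every notion
  below is insensitive to changes on null sets; in particular periodicity is required only almost
  everywhere.

  A matrix \<open>M :: real ^ 'n ^ 'n\<close> is a vector of rows, \<open>M $ i $ j\<close> being the entry in row \<open>i\<close> and
  column \<open>j\<close>. The library's inner product and norm on this type are the Frobenius ones.
\<close>

lemma frobenius_inner:
  fixes M N :: "real ^ 'n ^ 'n"
  shows "M \<bullet> N = (\<Sum>i\<in>UNIV. \<Sum>j\<in>UNIV. M $ i $ j * N $ i $ j)"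
  by (simp add: inner_vec_def)

lemma frobenius_norm:
  fixes M :: "real ^ 'n ^ 'n"
  shows "norm M = sqrt (M \<bullet> M)"
  by (rule norm_eq_sqrt_inner)

definition cell :: "(real ^ 'n) set" where
  "cell = {x. \<forall>i. 0 < x $ i \<and> x $ i < 1}"

definition cell_integral :: "(real ^ 'n \<Rightarrow> 'b::euclidean_space) \<Rightarrow> 'b" where
  "cell_integral f = integral\<^sup>L (lebesgue_on cell) f"

definition periodic :: "(real ^ 'n \<Rightarrow> 'b) \<Rightarrow> bool" where
  "periodic f \<longleftrightarrow> (\<forall>i. AE x in lebesgue. f (x + axis i 1) = f x)"


subsection \<open>Weak derivatives\<close>

primrec Ck :: "nat \<Rightarrow> (real ^ 'n \<Rightarrow> real) \<Rightarrow> bool" where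
  "Ck 0 f \<longleftrightarrow> continuous_on UNIV f"
| "Ck (Suc k) f \<longleftrightarrow> f differentiable_on UNIV \<and>
     (\<forall>i. Ck k (\<lambda>x. frechet_derivative f (at x) (axis i 1)))"

definition test_function :: "(real ^ 'n \<Rightarrow> real) \<Rightarrow> bool" where
  "test_function \<phi> \<longleftrightarrow> (\<forall>k. Ck k \<phi>) \<and> compact (closure {x. \<phi> x \<noteq> 0})"

definition locally_integrable :: "(real ^ 'n \<Rightarrow> real) \<Rightarrow> bool" where
  "locally_integrable u \<longleftrightarrow> (\<forall>K. compact K \<longrightarrow> integrable (lebesgue_on K) u)"

definition has_weak_partial :: "'n \<Rightarrow> (real ^ 'n \<Rightarrow> real) \<Rightarrow> (real ^ 'n \<Rightarrow> real) \<Rightarrow> bool" where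
  "has_weak_partial i u g \<longleftrightarrow> locally_integrable u \<and> locally_integrable g \<and>
     (\<forall>\<phi>. test_function \<phi> \<longrightarrow>
        (LINT x|lebesgue. u x * frechet_derivative \<phi> (at x) (axis i 1))
          = - (LINT x|lebesgue. g x * \<phi> x))"

text \<open>The weak derivative is determined up to null sets; a representative is chosen. The value is
  unspecified if \<open>u\<close> has no weak derivative in direction \<open>i\<close>.\<close>

definition weak_partial :: "'n \<Rightarrow> (real ^ 'n \<Rightarrow> real) \<Rightarrow> real ^ 'n \<Rightarrow> real" where
  "weak_partial i u = (SOME g. has_weak_partial i u g)"

definition weak_grad :: "(real ^ 'n \<Rightarrow> real) \<Rightarrow> real ^ 'n \<Rightarrow> real ^ 'n" where
  "weak_grad u x = (\<chi> i. weak_partial i u x)"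

definition weak_hessian :: "(real ^ 'n \<Rightarrow> real) \<Rightarrow> real ^ 'n \<Rightarrow> real ^ 'n ^ 'n" where
  "weak_hessian u x = (\<chi> i j. weak_partial i (weak_partial j u) x)"

definition weak_jacobian :: "(real ^ 'n \<Rightarrow> real ^ 'n) \<Rightarrow> real ^ 'n \<Rightarrow> real ^ 'n ^ 'n" where
  "weak_jacobian w x = (\<chi> i j. weak_partial j (\<lambda>y. w y $ i) x)"

definition weak_divergence :: "(real ^ 'n \<Rightarrow> real ^ 'n) \<Rightarrow> real ^ 'n \<Rightarrow> real" where
  "weak_divergence w x = (\<Sum>i\<in>UNIV. weak_partial i (\<lambda>y. w y $ i) x)"


subsection \<open>Periodic function spaces\<close>

definition Linf_per :: "(real ^ 'n \<Rightarrow> 'b::euclidean_space) set" where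
  "Linf_per = {f \<in> borel_measurable lebesgue. periodic f \<and>
                 (\<exists>C. AE x in lebesgue. norm (f x) \<le> C)}"

definition L2_per :: "(real ^ 'n \<Rightarrow> 'b::euclidean_space) set" where
  "L2_per = {f \<in> borel_measurable lebesgue. periodic f \<and>
               integrable (lebesgue_on cell) (\<lambda>x. (norm (f x))\<^sup>2)}"

definition H1_per :: "(real ^ 'n \<Rightarrow> real) set" where
  "H1_per = {u \<in> L2_per. \<forall>i. \<exists>g\<in>L2_per. has_weak_partial i u g}"

definition H2_per :: "(real ^ 'n \<Rightarrow> real) set" where
  "H2_per = {u \<in> L2_per. \<forall>i. \<exists>g\<in>H1_per. has_weak_partial i u g}"

definition H2_per0 :: "(real ^ 'n \<Rightarrow> real) set" where
  "H2_per0 = {u \<in> H2_per. cell_integral u = 0}"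

definition H1_per0_vec :: "(real ^ 'n \<Rightarrow> real ^ 'n) set" where
  "H1_per0_vec = {w. \<forall>i. (\<lambda>x. w x $ i) \<in> H1_per \<and> cell_integral (\<lambda>x. w x $ i) = 0}"

definition L2_norm :: "(real ^ 'n \<Rightarrow> 'b::euclidean_space) \<Rightarrow> real" where
  "L2_norm f = sqrt (cell_integral (\<lambda>x. (norm (f x))\<^sup>2))"

text \<open>The components \<open>f y \<bullet> e\<close>, \<open>e \<in> Basis\<close>, are the entries of a vector or of a matrix.\<close>

definition H1_norm :: "(real ^ 'n \<Rightarrow> 'b::euclidean_space) \<Rightarrow> real" where
  "H1_norm f = sqrt (cell_integral (\<lambda>x. (norm (f x))\<^sup>2)
     + (\<Sum>e\<in>Basis. cell_integral (\<lambda>x. (norm (weak_grad (\<lambda>y. f y \<bullet> e) x))\<^sup>2)))"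

definition closed_subspace :: "(real ^ 'n \<Rightarrow> real ^ 'n) set \<Rightarrow> bool" where
  "closed_subspace P \<longleftrightarrow> P \<subseteq> H1_per0_vec \<and> (\<lambda>x. 0) \<in> P \<and>
     (\<forall>v\<in>P. \<forall>w\<in>P. (\<lambda>x. v x + w x) \<in> P) \<and>
     (\<forall>c. \<forall>w\<in>P. (\<lambda>x. c *\<^sub>R w x) \<in> P) \<and>
     (\<forall>s. \<forall>w\<in>H1_per0_vec. (\<forall>k::nat. s k \<in> P) \<longrightarrow>
        (\<lambda>k. H1_norm (\<lambda>x. s k x - w x)) \<longlonglongrightarrow> 0 \<longrightarrow> w \<in> P)"


subsection \<open>Coefficients and the cell problems\<close>

definition setting_B :: "(real ^ 'n \<Rightarrow> real ^ 'n ^ 'n) \<Rightarrow> (real ^ 'n \<Rightarrow> real ^ 'n) \<Rightarrow> bool" where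
  "setting_B A b \<longleftrightarrow>
     A \<in> Linf_per \<and> (AE x in lebesgue. transpose (A x) = A x) \<and> b \<in> Linf_per \<and>
     (\<exists>lam>0. \<exists>Lam>0. AE x in lebesgue. \<forall>v.
        lam * (v \<bullet> v) \<le> v \<bullet> (A x *v v) \<and> v \<bullet> (A x *v v) \<le> Lam * (v \<bullet> v)) \<and>
     (\<exists>\<delta>. real CARD('n) / (real CARD('n) + pi\<^sup>2) < \<delta> \<and> \<delta> \<le> 1 \<and>
        (AE x in lebesgue. ((norm (A x))\<^sup>2 + (norm (b x))\<^sup>2) / (trace (A x))\<^sup>2
            \<le> 1 / (real CARD('n) - 1 + \<delta>)))"

context
  fixes A :: "real ^ 'n \<Rightarrow> real ^ 'n ^ 'n" and b :: "real ^ 'n \<Rightarrow> real ^ 'n"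
begin

definition gam :: "real ^ 'n \<Rightarrow> real" where
  "gam x = trace (A x) / ((norm (A x))\<^sup>2 + (norm (b x))\<^sup>2)"

definition At :: "real ^ 'n \<Rightarrow> real ^ 'n ^ 'n" where
  "At x = gam x *\<^sub>R A x"

definition bt :: "real ^ 'n \<Rightarrow> real ^ 'n" where
  "bt x = gam x *\<^sub>R b x"

definition B2 :: "(real ^ 'n \<Rightarrow> real ^ 'n) \<Rightarrow> (real ^ 'n \<Rightarrow> real ^ 'n) \<Rightarrow> real" where
  "B2 v w =
     cell_integral (\<lambda>x. weak_divergence v x * (At x \<bullet> weak_jacobian w x + bt x \<bullet> w x))
     + 1 / 2 * cell_integral (\<lambda>x. (weak_jacobian v x - transpose (weak_jacobian v x))
                                  \<bullet> (weak_jacobian w x - transpose (weak_jacobian w x)))"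

definition is_r_tilde :: "(real ^ 'n \<Rightarrow> real) \<Rightarrow> bool" where
  "is_r_tilde rt \<longleftrightarrow> rt \<in> L2_per \<and>
     (\<forall>\<phi>\<in>H2_per. cell_integral (\<lambda>x. rt x * (At x \<bullet> weak_hessian \<phi> x + bt x \<bullet> weak_grad \<phi> x)) = 0) \<and>
     cell_integral rt = 1"

text \<open>Applied to the solution in \<open>is_r_tilde\<close> this gives the density \<open>r\<close>, applied to \<open>1 - div \<rho>\<^sub>h\<close> it gives \<open>r\<^sub>h\<close>.\<close>

definition renormalize :: "(real ^ 'n \<Rightarrow> real) \<Rightarrow> real ^ 'n \<Rightarrow> real" where
  "renormalize rt x = 1 / cell_integral (\<lambda>y. gam y * rt y) * (gam x * rt x)"

definition is_corrector :: "'n \<Rightarrow> (real ^ 'n \<Rightarrow> real) \<Rightarrow> bool" where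
  "is_corrector j u \<longleftrightarrow> u \<in> H2_per0 \<and>
     (AE x in lebesgue. - (A x \<bullet> weak_hessian u x) - b x \<bullet> weak_grad u x = b x $ j)"

text \<open>With \<open>(r, D\<chi>)\<close> this is the effective matrix, with \<open>(r\<^sub>h, \<xi>\<^sub>h)\<close> its approximation.\<close>

definition effective_matrix ::
  "(real ^ 'n \<Rightarrow> real) \<Rightarrow> (real ^ 'n \<Rightarrow> real ^ 'n ^ 'n) \<Rightarrow> real ^ 'n ^ 'n" where
  "effective_matrix r X =
     cell_integral (\<lambda>x. r x *\<^sub>R ((mat 1 + X x) ** A x ** (mat 1 + transpose (X x))))"

definition is_xi_approx ::
  "(real ^ 'n \<Rightarrow> real ^ 'n) set \<Rightarrow> 'n \<Rightarrow> (real ^ 'n \<Rightarrow> real ^ 'n) \<Rightarrow> bool" where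
  "is_xi_approx P j \<xi> \<longleftrightarrow> \<xi> \<in> P \<and>
     (\<forall>w\<in>P. B2 w \<xi> = - cell_integral (\<lambda>x. bt x $ j * weak_divergence w x))"

definition is_rho_approx ::
  "(real ^ 'n \<Rightarrow> real ^ 'n) set \<Rightarrow> (real ^ 'n \<Rightarrow> real ^ 'n) \<Rightarrow> bool" where
  "is_rho_approx P \<rho> \<longleftrightarrow> \<rho> \<in> P \<and>
     (\<forall>w\<in>P. B2 \<rho> w = cell_integral (\<lambda>x. At x \<bullet> weak_jacobian w x + bt x \<bullet> w x))"

end

end

theory Submission
  imports Defs
begin

text \<open>The error \<open>r [I + D\<chi>] A [I + D\<chi>\<^sup>T] - r\<^sub>h [I + \<xi>\<^sub>h] A [I + \<xi>\<^sub>h\<^sup>T]\<close> is split into a part linear in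
  \<open>D\<chi> - \<xi>\<^sub>h\<close> and a part linear in \<open>r - r\<^sub>h\<close>, each a product of an \<open>L\<^sup>2\<close> function and two \<open>L\<^sup>4\<close> functions;
  for \<open>n \<le> 4\<close> the \<open>L\<^sup>4\<close> norms are bounded by \<open>H\<^sup>1\<close> norms. It remains to bound the \<open>L\<^sup>2\<close> norm of the very
  weak solution \<open>rt\<close> from above and the integral of \<open>\<gamma> rt\<close> from below in terms of \<open>(A, b)\<close>.

  Both bounds are obtained by duality. By the Cordes condition the operator \<open>At : D\<^sup>2 + bt \<bullet> \<nabla>\<close> is a
  contractive perturbation of the Laplacian, and this persists when the coefficients are convolved with a
  nonnegative trigonometric kernel. For such trigonometric polynomial coefficients a Neumann series, started from
  an explicit solution of Poisson's equation, solves the equation with right-hand side \<open>g - c\<close> up to a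
  uniformly small error, within trigonometric polynomials. The constant \<open>c\<close> is controlled by the \<open>L\<^sup>2\<close> norm
  of \<open>g\<close>, and from below by the maximum principle. Testing the very weak equation with these functions and
  passing to the limit shows that the integral of \<open>rt g\<close> obeys the same bounds as \<open>c\<close>.\<close>

subsection \<open>Integration over the periodicity cell\<close>

text \<open>The constant may depend on \<open>(A, b)\<close> and the dimension alone, whereas
  \<open>rt\<close> is given only as an element of \<open>L2_per\<close>, so its two bounds have to
  be produced a priori. Testing the very weak equation calls for functions in \<open>H2_per\<close>
  that solve a nondivergence equation with merely bounded coefficients. Trigonometric polynomials
  lie in \<open>H2_per\<close> by inspection; solving within them up to a small residual takes the
  place of an existence and regularity theory. The contraction has two sources. The function
  \<open>gam\<close> is the scaling that minimises
  \<open>\<bar>At - I\<bar>^2 + \<bar>bt\<bar>^2\<close>, and the Cordes condition bounds the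
  minimum by \<open>1 - \<delta>\<close>. On the torus, Hessian plus gradient energy is at most
  \<open>1 + 1 / (4 * pi^2)\<close> times the energy of the Laplacian, because nonzero frequencies
  have length at least 1. The lower bound on \<open>\<delta>\<close> makes the product of these two
  numbers less than 1, uniformly in the mollification. The restriction to dimension at most 4 is the
  condition that the Hoelder exponents in the proof of the \<open>L^4\<close> bound be
  nonnegative.\<close>

lemma translate_measurable_lebesgue [measurable]:
  "(\<lambda>x. x + s) \<in> lebesgue \<rightarrow>\<^sub>M (lebesgue :: (real ^ 'n) measure)"
  and distr_lebesgue_translate:
  "distr lebesgue lebesgue (\<lambda>x. x + s) = (lebesgue :: (real ^ 'n) measure)"
proof -
  have eq: "(\<lambda>x. s + (\<Sum>j\<in>Basis. (1 * (x \<bullet> j)) *\<^sub>R j)) = (\<lambda>x. x + s :: real ^ 'n)"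
    by (auto simp: euclidean_representation add.commute)
  show "(\<lambda>x. x + s) \<in> lebesgue \<rightarrow>\<^sub>M (lebesgue :: (real ^ 'n) measure)"
    using lebesgue_affine_measurable[of "\<lambda>_. 1" s] unfolding eq by simp
  show "distr lebesgue lebesgue (\<lambda>x. x + s) = (lebesgue :: (real ^ 'n) measure)"
    using lebesgue_affine_euclidean[of "\<lambda>_. 1" s] unfolding eq by (simp add: density_1)
qed

lemma lebesgue_measurable_translate:
  fixes f :: "real ^ 'n \<Rightarrow> 'b::topological_space"
  assumes "f \<in> borel_measurable lebesgue"
  shows "(\<lambda>x. f (x + s)) \<in> borel_measurable lebesgue"
  using measurable_compose[OF translate_measurable_lebesgue assms] .

lemma lebesgue_integral_translate:
  fixes f :: "real ^ 'n \<Rightarrow> 'b::{banach, second_countable_topology}"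
  assumes "f \<in> borel_measurable lebesgue"
  shows "integrable lebesgue (\<lambda>x. f (x + s)) \<longleftrightarrow> integrable lebesgue f"
    and "(LINT x|lebesgue. f (x + s)) = (LINT x|lebesgue. f x)"
  using integrable_distr_eq[OF translate_measurable_lebesgue assms, of s]
    integral_distr[OF translate_measurable_lebesgue assms, of s]
  by (simp_all add: distr_lebesgue_translate)

lemma AE_lebesgue_translate:
  assumes "AE x in (lebesgue :: (real ^ 'n) measure). P x"
  shows "AE x in lebesgue. P (x + s)"
proof -
  have "AE x in distr lebesgue lebesgue (\<lambda>x. x + s :: real ^ 'n). P x"
    unfolding distr_lebesgue_translate by (rule assms)
  from AE_distrD[OF translate_measurable_lebesgue this] show ?thesis .
qed

text \<open>The half-open cube differs from \<open>cell\<close> by a null set, but its shifts can be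
  cut and reassembled by exact identities between indicator functions, without exceptional
  hyperplanes.\<close>

definition hcell :: "(real ^ 'n) set" where
  "hcell = {x. \<forall>i. 0 \<le> x $ i \<and> x $ i < 1}"

lemma hcell_borel [measurable]: "(hcell :: (real ^ 'n) set) \<in> sets borel"
proof -
  have "hcell = (\<Inter>i. {x::real ^ 'n. 0 \<le> x $ i \<and> x $ i < 1})" by (auto simp: hcell_def)
  moreover have "{x::real ^ 'n. 0 \<le> x $ i \<and> x $ i < 1} \<in> sets borel" for i by measurable
  moreover have "(\<Inter>i. {x::real ^ 'n. 0 \<le> x $ i \<and> x $ i < 1}) \<in> sets borel"
    by (rule sets.countable_INT'') (use calculation in \<open>auto intro: countable_finite\<close>)
  ultimately show ?thesis by simp
qed

lemma cell_eq_box: "(cell :: (real ^ 'n) set) = box 0 1"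
  by (auto simp: cell_def mem_box_cart)

lemma cell_borel [measurable]: "(cell :: (real ^ 'n) set) \<in> sets borel"
  by (simp add: cell_eq_box)

lemma hcell_lebesgue [measurable]: "(hcell :: (real ^ 'n) set) \<in> sets lebesgue"
  by simp

lemma cell_lebesgue [measurable]: "(cell :: (real ^ 'n) set) \<in> sets lebesgue"
  by simp

lemma emeasure_cell [simp]: "emeasure lebesgue (cell :: (real ^ 'n) set) = 1"
proof -
  have "emeasure lborel (box (0::real ^ 'n) 1) = (\<Prod>b\<in>(Basis :: (real ^ 'n) set). (1 - 0) \<bullet> b)"
  proof -
    have "(0::real ^ 'n) \<bullet> b \<le> 1 \<bullet> b" if "b \<in> Basis" for b
      using that by (auto simp: Basis_vec_def inner_axis)
    from emeasure_lborel_box[OF this] show ?thesis by simp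
  qed
  also have "(\<Prod>b\<in>(Basis :: (real ^ 'n) set). (1 - 0) \<bullet> b) = (\<Prod>b\<in>(Basis :: (real ^ 'n) set). 1)"
    by (rule prod.cong) (auto simp: Basis_vec_def inner_axis)
  finally show ?thesis unfolding cell_eq_box by simp
qed

lemma AE_hcell_cell: "AE x in (lebesgue :: (real ^ 'n) measure). x \<in> hcell \<longleftrightarrow> x \<in> cell"
proof -
  have "negligible (\<Union>i. {x::real ^ 'n. x $ i = 0})"
    by (intro negligible_Union) (auto intro: negligible_standard_hyperplane_cart)
  then have "(\<Union>i. {x::real ^ 'n. x $ i = 0}) \<in> null_sets lebesgue"
    by (simp add: negligible_iff_null_sets)
  then have "AE x in (lebesgue :: (real ^ 'n) measure). x \<notin> (\<Union>i. {x. x $ i = 0})"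
    by (rule AE_not_in)
  then show ?thesis
  proof eventually_elim
    case (elim x)
    then have "x $ i \<noteq> 0" for i by blast
    then show ?case unfolding hcell_def cell_def mem_Collect_eq by (metis less_le)
  qed
qed

lemma integrable_cell_iff:
  fixes f :: "real ^ 'n \<Rightarrow> 'b::euclidean_space"
  shows "integrable (lebesgue_on cell) f \<longleftrightarrow> integrable lebesgue (\<lambda>x. indicator cell x *\<^sub>R f x)"
  by (simp add: integrable_restrict_space)

lemma cell_integral_indicator:
  fixes f :: "real ^ 'n \<Rightarrow> 'b::euclidean_space"
  shows "cell_integral f = (LINT x|lebesgue. indicator cell x *\<^sub>R f x)"
  unfolding cell_integral_def by (simp add: integral_restrict_space)

lemma integrable_hcell_iff:
  fixes f :: "real ^ 'n \<Rightarrow> 'b::euclidean_space"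
  assumes [measurable]: "f \<in> borel_measurable lebesgue"
  shows "integrable (lebesgue_on cell) f \<longleftrightarrow> integrable lebesgue (\<lambda>x. indicator hcell x *\<^sub>R f x)"
  unfolding integrable_cell_iff
proof (rule integrable_cong_AE)
  show "AE x in lebesgue. indicator cell x *\<^sub>R f x = indicator hcell x *\<^sub>R f x"
    using AE_hcell_cell by eventually_elim (auto split: split_indicator)
qed measurable

lemma cell_integral_hcell:
  fixes f :: "real ^ 'n \<Rightarrow> 'b::euclidean_space"
  assumes [measurable]: "f \<in> borel_measurable lebesgue"
  shows "cell_integral f = (LINT x|lebesgue. indicator hcell x *\<^sub>R f x)"
  unfolding cell_integral_indicator
proof (rule integral_cong_AE)
  show "AE x in lebesgue. indicator cell x *\<^sub>R f x = indicator hcell x *\<^sub>R f x"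
    using AE_hcell_cell by eventually_elim (auto split: split_indicator)
qed measurable

text \<open>Cut the half-open cube at height \<open>t\<close> in direction \<open>i\<close>. The
  translated cube consists of the upper slab \<open>A\<close> and of the lower slab \<open>B\<close>
  moved up by one period, and periodicity identifies the integral over the moved slab with the one
  over \<open>B\<close>.\<close>

lemma cell_integral_shift_axis:
  fixes f :: "real ^ 'n \<Rightarrow> 'b::euclidean_space"
  assumes f [measurable]: "f \<in> borel_measurable lebesgue" and per: "AE x in lebesgue. f (x + axis i 1) = f x"
    and int: "integrable (lebesgue_on cell) f" and t: "0 \<le> t" "t \<le> 1"
  shows "integrable (lebesgue_on cell) (\<lambda>x. f (x + axis i t))"
    and "cell_integral (\<lambda>x. f (x + axis i t)) = cell_integral f"
proof -
  define A where "A = {x::real ^ 'n. x \<in> hcell \<and> t \<le> x $ i}"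
  define B where "B = {x::real ^ 'n. x \<in> hcell \<and> x $ i < t}"
  have bb: "A \<in> sets borel" "B \<in> sets borel" unfolding A_def B_def by measurable
  then have AB [measurable]: "A \<in> sets lebesgue" "B \<in> sets lebesgue" "hcell \<in> sets (lebesgue :: (real ^ 'n) measure)"
    by simp_all
  have ft [measurable]: "(\<lambda>x. f (x + axis i s)) \<in> borel_measurable lebesgue" for s
    by (rule lebesgue_measurable_translate[OF f])
  have intH: "integrable lebesgue (\<lambda>x. indicator hcell x *\<^sub>R f x)"
    using int by (simp add: integrable_hcell_iff)
  have sub: "A \<subseteq> hcell" "B \<subseteq> hcell" by (auto simp: A_def B_def)
  have intA: "integrable lebesgue (\<lambda>x. indicator A x *\<^sub>R f x)"
    by (rule Bochner_Integration.integrable_bound[OF intH])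
      (measurable, use sub in \<open>auto split: split_indicator\<close>)
  have intB: "integrable lebesgue (\<lambda>x. indicator B x *\<^sub>R f x)"
    by (rule Bochner_Integration.integrable_bound[OF intH])
      (measurable, use sub in \<open>auto split: split_indicator\<close>)
  let ?B = "\<lambda>x. indicator B (x + axis i (-1)) *\<^sub>R f x"
  have mB: "?B \<in> borel_measurable lebesgue"
    using lebesgue_measurable_translate[of "indicator B :: _ \<Rightarrow> real" "axis i (-1)"] by measurable
  have ax: "x + axis i a + axis i (-a) = x" "x + axis i (-a) + axis i a = x" for x :: "real ^ 'n" and a :: real
    by (auto simp: vec_eq_iff axis_def)
  have Beq: "AE x in lebesgue. ?B (x + axis i 1) = indicator B x *\<^sub>R f x"
    using per by eventually_elim (simp add: ax)
  have mB': "(\<lambda>x. ?B (x + axis i 1)) \<in> borel_measurable lebesgue"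
    by (rule lebesgue_measurable_translate[OF mB])
  have mB2: "(\<lambda>x. indicator B x *\<^sub>R f x) \<in> borel_measurable lebesgue" by measurable
  have iB: "integrable lebesgue ?B" "(LINT x|lebesgue. ?B x) = (LINT x|lebesgue. indicator B x *\<^sub>R f x)"
    using intB lebesgue_integral_translate[OF mB, of "axis i 1"]
      integrable_cong_AE[OF mB' mB2 Beq] integral_cong_AE[OF mB' mB2 Beq] by auto
  let ?T = "\<lambda>x. indicator hcell (x + axis i (-t)) *\<^sub>R f x"
  have split: "?T x = indicator A x *\<^sub>R f x + ?B x" for x
  proof -
    have h1: "x + axis i (-t) \<in> hcell \<longleftrightarrow> (\<forall>j. j \<noteq> i \<longrightarrow> 0 \<le> x $ j \<and> x $ j < 1) \<and> t \<le> x $ i \<and> x $ i < 1 + t"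
      by (auto simp: hcell_def axis_def)
    have h2: "x + axis i (-1) \<in> B \<longleftrightarrow> (\<forall>j. j \<noteq> i \<longrightarrow> 0 \<le> x $ j \<and> x $ j < 1) \<and> 1 \<le> x $ i \<and> x $ i < 1 + t"
      using t by (auto simp: hcell_def B_def axis_def)
    have h3: "x \<in> A \<longleftrightarrow> (\<forall>j. j \<noteq> i \<longrightarrow> 0 \<le> x $ j \<and> x $ j < 1) \<and> t \<le> x $ i \<and> x $ i < 1"
    proof -
      have "0 \<le> x $ k \<and> x $ k < 1" if "\<forall>j. j \<noteq> i \<longrightarrow> 0 \<le> x $ j \<and> x $ j < 1" "t \<le> x $ i" "x $ i < 1" for k
        using that t by (cases "k = i") auto
      then show ?thesis unfolding hcell_def A_def by blast
    qed
    show ?thesis unfolding indicator_def h1 h2 h3 using t by auto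
  qed
  have mT: "?T \<in> borel_measurable lebesgue"
    using lebesgue_measurable_translate[of "indicator hcell :: _ \<Rightarrow> real" "axis i (-t)"] by measurable
  have AB_disj: "hcell = A \<union> B" "A \<inter> B = {}" by (auto simp: A_def B_def)
  have tot: "(LINT x|lebesgue. indicator hcell x *\<^sub>R f x) =
     (LINT x|lebesgue. indicator A x *\<^sub>R f x) + (LINT x|lebesgue. indicator B x *\<^sub>R f x)"
  proof -
    have "(\<lambda>x. indicator hcell x *\<^sub>R f x) = (\<lambda>x. indicator A x *\<^sub>R f x + indicator B x *\<^sub>R f x)"
      unfolding AB_disj(1) using AB_disj(2) by (auto simp: fun_eq_iff split: split_indicator)
    then show ?thesis using Bochner_Integration.integral_add[OF intA intB] by simp
  qed
  have iT: "integrable lebesgue ?T" "(LINT x|lebesgue. ?T x) = (LINT x|lebesgue. indicator hcell x *\<^sub>R f x)"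
    unfolding split using intA iB tot by auto
  have Teq: "(\<lambda>x. ?T (x + axis i t)) = (\<lambda>x. indicator hcell x *\<^sub>R f (x + axis i t))"
    by (simp add: ax)
  show "integrable (lebesgue_on cell) (\<lambda>x. f (x + axis i t))"
    using iT lebesgue_integral_translate(1)[OF mT, of "axis i t"] unfolding Teq integrable_hcell_iff[OF ft] by simp
  show "cell_integral (\<lambda>x. f (x + axis i t)) = cell_integral f"
    using iT lebesgue_integral_translate(2)[OF mT, of "axis i t"]
    unfolding Teq cell_integral_hcell[OF ft] cell_integral_hcell[OF f] by simp
qed

lemma periodic_translate:
  fixes f :: "real ^ 'n \<Rightarrow> 'b"
  assumes "periodic f" shows "periodic (\<lambda>x. f (x + s))"
  unfolding periodic_def
proof
  fix i
  have "AE x in lebesgue. f (x + axis i 1) = f x" using assms by (simp add: periodic_def)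
  from AE_lebesgue_translate[OF this, of s]
  show "AE x in lebesgue. f (x + axis i 1 + s) = f (x + s)" by (simp add: add_ac)
qed

lemma cell_integral_shift:
  fixes f :: "real ^ 'n \<Rightarrow> 'b::euclidean_space"
  assumes f: "f \<in> borel_measurable lebesgue" and per: "periodic f"
    and int: "integrable (lebesgue_on cell) f" and s: "\<And>i. \<bar>s $ i\<bar> \<le> 1"
  shows "integrable (lebesgue_on cell) (\<lambda>x. f (x + s))"
    and "cell_integral (\<lambda>x. f (x + s)) = cell_integral f"
proof -
  have step: "integrable (lebesgue_on cell) (\<lambda>x. g (x + axis i t)) \<and>
      cell_integral (\<lambda>x. g (x + axis i t)) = cell_integral g"
    if g: "g \<in> borel_measurable lebesgue" "periodic g" "integrable (lebesgue_on cell) g" "\<bar>t\<bar> \<le> 1"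
    for g :: "real ^ 'n \<Rightarrow> 'b" and i t
  proof (cases "0 \<le> t")
    case True
    then show ?thesis using cell_integral_shift_axis[of g i t] g by (auto simp: periodic_def)
  next
    case False
    \<comment> \<open>A negative shift by \<open>t\<close> is a full period back, which changes the
      function only on a null set, followed by the shift \<open>1 + t\<close>, which lies in
      \<open>[0, 1]\<close>.\<close>
    let ?g = "\<lambda>x. g (x + axis i (-1))"
    have ax: "x + axis i (-1) + axis i (1::real) = x" "x + axis i 1 + axis i (-1::real) = x"
        "x + axis i (1 + t) + axis i (-1) = x + axis i t" for x :: "real ^ 'n"
      by (auto simp: vec_eq_iff axis_def)
    have per': "AE x in lebesgue. g x = ?g x"
    proof -
      have "AE x in lebesgue. g (x + axis i 1) = g x" using g by (auto simp: periodic_def)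
      from AE_lebesgue_translate[OF this, of "axis i (-1)"] show ?thesis by (simp add: ax)
    qed
    have m: "?g \<in> borel_measurable lebesgue" by (rule lebesgue_measurable_translate[OF g(1)])
    have p: "periodic ?g" by (rule periodic_translate[OF g(2)])
    have per2: "AE x in lebesgue_on cell. g x = ?g x"
      using per' by (subst AE_restrict_space_iff) (auto elim: eventually_mono)
    have mm: "g \<in> borel_measurable (lebesgue_on cell)" "?g \<in> borel_measurable (lebesgue_on cell)"
      using g(1) m by (auto intro: measurable_restrict_space1)
    have i: "integrable (lebesgue_on cell) ?g" "cell_integral ?g = cell_integral g"
      unfolding cell_integral_def
      using integrable_cong_AE[OF mm per2] integral_cong_AE[OF mm per2] g by auto
    have "integrable (lebesgue_on cell) (\<lambda>x. ?g (x + axis i (1 + t)))"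
       "cell_integral (\<lambda>x. ?g (x + axis i (1 + t))) = cell_integral ?g"
      using cell_integral_shift_axis[of ?g i "1 + t"] p m i False g by (auto simp: periodic_def)
    then show ?thesis by (simp add: ax i)
  qed
  have "finite S \<Longrightarrow> integrable (lebesgue_on cell) (\<lambda>x. f (x + (\<Sum>i\<in>S. axis i (s $ i)))) \<and>
      cell_integral (\<lambda>x. f (x + (\<Sum>i\<in>S. axis i (s $ i)))) = cell_integral f" for S
  proof (induction S rule: finite_induct)
    case empty then show ?case using int by simp
  next
    case (insert i S)
    from step[of "\<lambda>x. f (x + (\<Sum>i\<in>S. axis i (s $ i)))" "s $ i" i] insert s
    show ?case
      using lebesgue_measurable_translate[OF f] periodic_translate[OF per] by (simp add: add_ac)
  qed
  moreover have "(\<Sum>i\<in>UNIV. axis i (s $ i)) = s"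
    by (simp add: vec_eq_iff axis_def)
  ultimately have "integrable (lebesgue_on cell) (\<lambda>x. f (x + s)) \<and>
      cell_integral (\<lambda>x. f (x + s)) = cell_integral f"
    by (metis finite_class.finite_UNIV)
  then show "integrable (lebesgue_on cell) (\<lambda>x. f (x + s))"
    and "cell_integral (\<lambda>x. f (x + s)) = cell_integral f" by auto
qed

lemma cell_finite_measure: "finite_measure (lebesgue_on (cell :: (real ^ 'n) set))"
  by (rule finite_measureI) (simp add: emeasure_restrict_space)

lemma measure_cell [simp]: "measure lebesgue (cell :: (real ^ 'n) set) = 1"
  by (simp add: measure_def)

lemma integrable_cell_continuous:
  fixes f :: "real ^ 'n \<Rightarrow> 'b::euclidean_space"
  assumes "continuous_on UNIV f"
  shows "integrable (lebesgue_on cell) f"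
proof -
  have "integrable (lebesgue_on (cbox 0 1)) f"
    by (rule continuous_imp_integrable) (use assms continuous_on_subset in blast)
  then have "f absolutely_integrable_on cbox 0 1"
    by (simp add: absolutely_integrable_on_def absolutely_integrable_imp_integrable
        integrable_restrict_space set_integrable_def)
  then have "f absolutely_integrable_on cell"
    unfolding cell_eq_box by (rule set_integrable_subset) (auto simp: box_subset_cbox)
  then show ?thesis
    unfolding integrable_cell_iff by (simp add: set_integrable_def)
qed

lemma cell_integral_const [simp]: "cell_integral (\<lambda>x :: real ^ 'n. c :: 'b::euclidean_space) = c"
  unfolding cell_integral_def by (simp add: measure_restrict_space)

lemma continuous_borel_lebesgue:
  fixes f :: "real ^ 'n \<Rightarrow> 'b::euclidean_space"
  assumes "continuous_on UNIV f"
  shows "f \<in> borel_measurable lebesgue"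
  using borel_measurable_continuous_onI[OF assms] by (simp add: measurable_completion)

lemma periodicI: "(\<And>i x. f (x + axis i 1) = f x) \<Longrightarrow> periodic f"
  by (simp add: periodic_def)

subsection \<open>Trigonometric polynomials\<close>

definition ee :: "int ^ 'n \<Rightarrow> real ^ 'n \<Rightarrow> complex" where
  "ee k x = cis (2 * pi * (\<Sum>i\<in>UNIV. of_int (k $ i) * x $ i))"

definition Box :: "nat \<Rightarrow> (int ^ 'n) set" where
  "Box d = {k. \<forall>i. \<bar>k $ i\<bar> \<le> int d}"

definition trig_poly :: "nat \<Rightarrow> (real ^ 'n \<Rightarrow> complex) set" where
  "trig_poly d = {f. \<exists>c. f = (\<lambda>x. \<Sum>k\<in>Box d. c k * ee k x)}"

definition real_trig_poly :: "nat \<Rightarrow> (real ^ 'n \<Rightarrow> real) set" where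
  "real_trig_poly d = {f. (\<lambda>x. complex_of_real (f x)) \<in> trig_poly d}"

lemma card_Box: "finite (Box d :: (int ^ 'n) set)" "card (Box d :: (int ^ 'n) set) \<le> (2 * d + 1) ^ CARD('n)"
proof -
  have sub: "vec_nth ` (Box d :: (int ^ 'n) set) \<subseteq> (\<Pi>\<^sub>E i\<in>(UNIV::'n set). {- int d .. int d})"
    by (auto simp: Box_def abs_le_iff minus_le_iff) 
  have fin: "finite (\<Pi>\<^sub>E i\<in>(UNIV::'n set). {- int d .. int d})" by (intro finite_PiE) auto
  have inj: "inj_on vec_nth (Box d :: (int ^ 'n) set)" by (auto simp: inj_on_def vec_eq_iff)
  show "finite (Box d :: (int ^ 'n) set)"
    using finite_subset[OF sub fin] inj by (rule finite_imageD)
  have "card (Box d :: (int ^ 'n) set) = card (vec_nth ` (Box d :: (int ^ 'n) set))"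
    by (simp add: card_image inj)
  also have "\<dots> \<le> card (\<Pi>\<^sub>E i\<in>(UNIV::'n set). {- int d .. int d})"
    by (rule card_mono[OF fin sub])
  also have "\<dots> = (2 * d + 1) ^ CARD('n)"
  proof -
    have "nat (1 + int d * 2) = Suc (2 * d)" by simp
    then show ?thesis by (simp add: card_PiE algebra_simps)
  qed
  finally show "card (Box d :: (int ^ 'n) set) \<le> (2 * d + 1) ^ CARD('n)" .
qed

lemma ee_simps [simp]:
  "ee 0 x = 1" "cnj (ee k x) = ee (- k) x" "cmod (ee k x) = 1"
  by (simp_all add: ee_def cis_cnj sum_negf)

lemma ee_add: "ee (k + l) x = ee k x * ee l x"
  by (simp add: ee_def cis_mult distrib_left sum.distrib distrib_right)

lemma ee_add_arg: "ee k (x + y) = ee k x * ee k y"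
  by (simp add: ee_def cis_mult distrib_left sum.distrib)

lemma ee_minus_arg: "ee k (- x) = ee (- k) x"
  by (simp add: ee_def sum_negf)

lemma ee_axis: "ee k (axis i t) = cis (2 * pi * (of_int (k $ i) * t))"
  by (simp add: ee_def axis_def if_distrib cong: if_cong)

lemma ee_periodic: "ee k (x + axis i 1) = ee k x"
  by (simp add: ee_add_arg ee_axis)

lemma continuous_ee [continuous_intros]:
  assumes "continuous_on S f" shows "continuous_on S (\<lambda>x. ee k (f x))"
  unfolding ee_def using assms by (intro continuous_intros)

text \<open>For \<open>k \<noteq> 0\<close> a shift by half a wavelength in a direction with
  \<open>k $ i \<noteq> 0\<close> changes the sign of \<open>ee k\<close>, whereas the integral over
  a period is invariant under shifts; so it equals its own negative.\<close>

lemma cell_integral_ee: "cell_integral (ee k :: real ^ 'n \<Rightarrow> complex) = (if k = 0 then 1 else 0)"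
proof (cases "k = 0")
  case False
  then obtain i where i: "k $ i \<noteq> 0" by (auto simp: vec_eq_iff)
  define t where "t = 1 / (2 * of_int (k $ i) :: real)"
  have c: "continuous_on UNIV (ee k :: real ^ 'n \<Rightarrow> complex)" by (intro continuous_intros)
  have "\<bar>of_int (k $ i) :: real\<bar> \<ge> 1" using i by (metis of_int_1_le_iff of_int_abs zero_less_abs_iff zless_imp_add1_zle add_0)
  then have t: "\<bar>t\<bar> \<le> 1" by (simp add: t_def abs_mult divide_simps)
  have p: "periodic (ee k :: real ^ 'n \<Rightarrow> complex)" by (intro periodicI ee_periodic)
  have "ee k (x + axis i t) = - ee k x" for x
    using i by (simp add: ee_add_arg ee_axis t_def)
  moreover have "cell_integral (\<lambda>x. ee k (x + axis i t)) = cell_integral (ee k)"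
    by (rule cell_integral_shift)
      (use t p in \<open>auto simp: continuous_borel_lebesgue[OF c] integrable_cell_continuous[OF c] axis_def\<close>)
  ultimately have "cell_integral (\<lambda>x. - ee k x) = cell_integral (ee k)" by simp
  then show ?thesis using False by (simp add: cell_integral_def)
next
  case True
  have "(ee 0 :: real ^ 'n \<Rightarrow> complex) = (\<lambda>x. 1)" by (simp add: fun_eq_iff)
  then show ?thesis using True by simp
qed

lemma continuous_trig_poly: "f \<in> trig_poly d \<Longrightarrow> continuous_on UNIV f"
  by (auto simp: trig_poly_def intro!: continuous_intros)

lemma periodic_trig_poly: "f \<in> trig_poly d \<Longrightarrow> f (x + axis i 1) = f x"
  by (auto simp: trig_poly_def ee_periodic)

lemma continuous_real_trig_poly: "f \<in> real_trig_poly d \<Longrightarrow> continuous_on UNIV f"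
  using continuous_trig_poly[of "\<lambda>x. complex_of_real (f x)" d] continuous_on_Re[of UNIV "\<lambda>x. complex_of_real (f x)"]
  by (simp add: real_trig_poly_def)

lemma periodic_real_trig_poly: "f \<in> real_trig_poly d \<Longrightarrow> f (x + axis i 1) = f x"
  using periodic_trig_poly[of "\<lambda>x. complex_of_real (f x)" d x i] by (simp add: real_trig_poly_def)

lemma trig_poly_I: "(\<And>x. f x = (\<Sum>k\<in>Box d. c k * ee k x)) \<Longrightarrow> f \<in> trig_poly d"
  by (auto simp: trig_poly_def)

lemma trig_poly_zero [simp]: "(\<lambda>x. 0) \<in> trig_poly d"
  by (rule trig_poly_I[where c="\<lambda>_. 0"]) simp

lemma trig_poly_add: "f \<in> trig_poly d \<Longrightarrow> g \<in> trig_poly d \<Longrightarrow> (\<lambda>x. f x + g x) \<in> trig_poly d"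
proof -
  assume "f \<in> trig_poly d" "g \<in> trig_poly d"
  then obtain a b where "f = (\<lambda>x. \<Sum>k\<in>Box d. a k * ee k x)" "g = (\<lambda>x. \<Sum>k\<in>Box d. b k * ee k x)"
    by (auto simp: trig_poly_def)
  then show ?thesis
    by (intro trig_poly_I[where c="\<lambda>k. a k + b k"]) (simp add: sum.distrib distrib_right)
qed

lemma trig_poly_cmult: "f \<in> trig_poly d \<Longrightarrow> (\<lambda>x. a * f x) \<in> trig_poly d"
proof -
  assume "f \<in> trig_poly d"
  then obtain c where "f = (\<lambda>x. \<Sum>k\<in>Box d. c k * ee k x)" by (auto simp: trig_poly_def)
  then show ?thesis by (intro trig_poly_I[where c="\<lambda>k. a * c k"]) (simp add: sum_distrib_left mult.assoc)
qed

lemma trig_poly_sum: "(\<And>i. i \<in> I \<Longrightarrow> f i \<in> trig_poly d) \<Longrightarrow> (\<lambda>x. \<Sum>i\<in>I. f i x) \<in> trig_poly d"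
  by (induction I rule: infinite_finite_induct) (auto intro: trig_poly_add)

lemma trig_poly_ee: "k \<in> Box d \<Longrightarrow> ee k \<in> trig_poly d"
  by (rule trig_poly_I[where c="\<lambda>l. if l = k then 1 else 0"])
    (simp add: if_distrib[where f="\<lambda>c. c * _"] sum.delta card_Box cong: if_cong)

lemma trig_poly_coeffs:
  "(\<lambda>x. \<Sum>k\<in>Box d. c k * ee k x) \<in> trig_poly d"
  by (auto simp: trig_poly_def)

lemma Box_mono: "d \<le> d' \<Longrightarrow> Box d \<subseteq> Box d'"
  unfolding Box_def by (auto intro: order_trans)

lemma trig_poly_mult:
  assumes "f \<in> trig_poly d" "g \<in> trig_poly d'" shows "(\<lambda>x. f x * g x) \<in> trig_poly (d + d')"
proof -
  obtain a b where f: "f = (\<lambda>x. \<Sum>k\<in>Box d. a k * ee k x)" and g: "g = (\<lambda>x. \<Sum>k\<in>Box d'. b k * ee k x)"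
    using assms by (auto simp: trig_poly_def)
  have "k + l \<in> Box (d + d')" if "k \<in> Box d" "l \<in> Box d'" for k l :: "int ^ 'a"
    unfolding Box_def
  proof safe
    fix i have "\<bar>k $ i\<bar> \<le> int d" "\<bar>l $ i\<bar> \<le> int d'" using that by (auto simp: Box_def)
    then show "\<bar>(k + l) $ i\<bar> \<le> int (d + d')" by simp
  qed
  then have "(\<lambda>x. \<Sum>k\<in>Box d. \<Sum>l\<in>Box d'. a k * b l * ee (k + l) x) \<in> trig_poly (d + d')"
    by (intro trig_poly_sum trig_poly_cmult trig_poly_ee) auto
  also have "(\<lambda>x. \<Sum>k\<in>Box d. \<Sum>l\<in>Box d'. a k * b l * ee (k + l) x) = (\<lambda>x. f x * g x)"
    by (simp add: f g sum_product ee_add mult_ac)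
  finally show ?thesis .
qed

lemma trig_poly_cnj: "f \<in> trig_poly d \<Longrightarrow> (\<lambda>x. cnj (f x)) \<in> trig_poly d"
proof -
  assume "f \<in> trig_poly d"
  then obtain c where f: "f = (\<lambda>x. \<Sum>k\<in>Box d. c k * ee k x)" by (auto simp: trig_poly_def)
  have "(\<lambda>x. \<Sum>k\<in>Box d. cnj (c k) * ee (- k) x) \<in> trig_poly d"
    by (intro trig_poly_sum trig_poly_cmult trig_poly_ee) (auto simp: Box_def)
  then show ?thesis by (simp add: f)
qed

lemma real_trig_poly_Re: "f \<in> trig_poly d \<Longrightarrow> (\<lambda>x. Re (f x)) \<in> real_trig_poly d"
proof -
  assume f: "f \<in> trig_poly d"
  have "(\<lambda>x. complex_of_real (Re (f x))) = (\<lambda>x. (1/2) * (f x + cnj (f x)))"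
    by (auto simp: complex_eq_iff)
  then show ?thesis using f by (simp only: real_trig_poly_def mem_Collect_eq) (intro trig_poly_cmult trig_poly_add trig_poly_cnj)
qed

lemma real_trig_poly_add: "f \<in> real_trig_poly d \<Longrightarrow> g \<in> real_trig_poly d \<Longrightarrow> (\<lambda>x. f x + g x) \<in> real_trig_poly d"
  by (simp add: real_trig_poly_def trig_poly_add)

lemma real_trig_poly_mult: "f \<in> real_trig_poly d \<Longrightarrow> g \<in> real_trig_poly d' \<Longrightarrow> (\<lambda>x. f x * g x) \<in> real_trig_poly (d + d')"
  by (simp add: real_trig_poly_def trig_poly_mult)

lemma real_trig_poly_cmult: "f \<in> real_trig_poly d \<Longrightarrow> (\<lambda>x. a * f x) \<in> real_trig_poly d"
  by (simp add: real_trig_poly_def trig_poly_cmult)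

lemma real_trig_poly_const: "(\<lambda>x. a) \<in> real_trig_poly d"
proof -
  have "(\<lambda>x. complex_of_real a * ee 0 x) \<in> trig_poly d" by (intro trig_poly_cmult trig_poly_ee) (simp add: Box_def)
  then show ?thesis by (simp add: real_trig_poly_def)
qed

lemma real_trig_poly_sum: "(\<And>i. i \<in> I \<Longrightarrow> f i \<in> real_trig_poly d) \<Longrightarrow> (\<lambda>x. \<Sum>i\<in>I. f i x) \<in> real_trig_poly d"
  by (simp add: real_trig_poly_def trig_poly_sum)

lemma real_trig_poly_diff: "f \<in> real_trig_poly d \<Longrightarrow> g \<in> real_trig_poly d \<Longrightarrow> (\<lambda>x. f x - g x) \<in> real_trig_poly d"
  using real_trig_poly_add[of f d "\<lambda>x. -1 * g x"] real_trig_poly_cmult[of g d "-1"] by simp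

lemma real_trig_poly_power: "f \<in> real_trig_poly d \<Longrightarrow> (\<lambda>x. f x ^ m) \<in> real_trig_poly (m * d)"
proof (induction m)
  case (Suc m) then show ?case using real_trig_poly_mult[of f d "\<lambda>x. f x ^ m"] by simp
qed (simp add: real_trig_poly_const)

lemma real_trig_poly_cos: "(\<lambda>x. cos (2 * pi * x $ i)) \<in> real_trig_poly 1"
proof -
  have "Re (ee (axis i 1) x) = cos (2 * pi * x $ i)" for x
    by (simp add: ee_def axis_def if_distrib[where f=of_int] if_distrib[where f="\<lambda>c. c * _"] cong: if_cong)
  moreover have "(\<lambda>x. Re (ee (axis i 1) x)) \<in> real_trig_poly 1"
    by (rule real_trig_poly_Re, rule trig_poly_ee) (auto simp: Box_def axis_def)
  ultimately show ?thesis by simp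
qed

lemma trig_poly_coeff:
  assumes "\<And>x. f x = (\<Sum>k\<in>Box d. c k * ee k x)" and "l \<in> Box d"
  shows "cell_integral (\<lambda>x. f x * cnj (ee l x)) = c l"
proof -
  have i: "integrable (lebesgue_on cell) (\<lambda>x. c k * ee (k - l) x)" for k
    by (intro integrable_cell_continuous continuous_intros)
  have "cell_integral (\<lambda>x. f x * cnj (ee l x)) = cell_integral (\<lambda>x. \<Sum>k\<in>Box d. c k * ee (k - l) x)"
    by (simp add: assms sum_distrib_right mult.assoc ee_add[symmetric])
  also have "\<dots> = (\<Sum>k\<in>Box d. c k * cell_integral (ee (k - l)))"
    unfolding cell_integral_def using i by (subst Bochner_Integration.integral_sum) auto
  also have "\<dots> = (\<Sum>k\<in>Box d. if k = l then c k else 0)"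
    by (simp add: cell_integral_ee if_distrib cong: if_cong)
  finally show ?thesis using assms(2) by (simp add: sum.delta card_Box)
qed

lemma cell_integral_complex_of_real:
  "cell_integral (\<lambda>x. complex_of_real (g x)) = complex_of_real (cell_integral g)"
  by (simp add: cell_integral_def)

lemma parseval:
  assumes "\<And>x. f x = (\<Sum>k\<in>Box d. c k * ee k x)"
  shows "cell_integral (\<lambda>x. (cmod (f x))\<^sup>2) = (\<Sum>k\<in>Box d. (cmod (c k))\<^sup>2)"
proof -
  have i: "integrable (lebesgue_on cell) (\<lambda>x. cnj (c l) * (f x * cnj (ee l x)))" for l
    unfolding assms by (intro integrable_cell_continuous continuous_intros)
  have "complex_of_real (cell_integral (\<lambda>x. (cmod (f x))\<^sup>2)) = cell_integral (\<lambda>x. f x * cnj (f x))"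
    by (simp add: cell_integral_complex_of_real[symmetric] complex_norm_square del: of_real_power)
  also have "\<dots> = cell_integral (\<lambda>x. \<Sum>l\<in>Box d. cnj (c l) * (f x * cnj (ee l x)))"
    by (subst (2) assms) (simp add: sum_distrib_left mult_ac)
  also have "\<dots> = (\<Sum>l\<in>Box d. cnj (c l) * cell_integral (\<lambda>x. f x * cnj (ee l x)))"
    unfolding cell_integral_def using i by (subst Bochner_Integration.integral_sum) auto
  also have "\<dots> = (\<Sum>l\<in>Box d. cnj (c l) * c l)"
    using trig_poly_coeff[of f, OF assms] by (intro sum.cong) auto
  also have "\<dots> = complex_of_real (\<Sum>k\<in>Box d. (cmod (c k))\<^sup>2)"
    by (simp add: complex_norm_square mult.commute del: of_real_power)
  finally show ?thesis using of_real_eq_iff by blast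
qed

subsection \<open>Approximation by continuous functions\<close>

text \<open>Radial projection onto the closed ball of radius \<open>M\<close>, written with
  \<open>max\<close> instead of a case distinction so that its continuity is immediate.\<close>

definition trunc :: "real \<Rightarrow> 'b::euclidean_space \<Rightarrow> 'b" where
  "trunc M v = (M / max M (norm v)) *\<^sub>R v"

lemma trunc_bound: "0 < M \<Longrightarrow> norm (trunc M v) \<le> M"
  by (auto simp: trunc_def divide_simps max_def mult_left_mono)

lemma trunc_le: "0 < M \<Longrightarrow> norm (trunc M v) \<le> norm v"
  by (auto simp: trunc_def divide_simps max_def mult_right_mono)

lemma trunc_eq: "0 < M \<Longrightarrow> norm v \<le> M \<Longrightarrow> trunc M v = v"
  by (simp add: trunc_def max_def)

lemma continuous_trunc [continuous_intros]:
  assumes "0 < M" "continuous_on S f" shows "continuous_on S (\<lambda>x. trunc M (f x))"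
  unfolding trunc_def using assms by (intro continuous_intros) (auto simp: max_def)

lemma measurable_trunc:
  assumes "0 < M" "f \<in> borel_measurable N" shows "(\<lambda>x. trunc M (f x)) \<in> borel_measurable N"
proof -
  have "(trunc M :: 'b \<Rightarrow> 'b) \<in> borel_measurable borel"
    by (intro borel_measurable_continuous_onI continuous_trunc assms continuous_intros)
  from measurable_compose[OF assms(2) this] show ?thesis .
qed

text \<open>Truncation at a high level \<open>M\<close> changes \<open>f\<close> little in the mean.
  A measurable function is an almost everywhere limit of continuous ones; truncating these as well
  keeps all differences below \<open>2 * M\<close>, which is integrable over the compact set, so
  dominated convergence applies.\<close>

lemma integrable_continuous_approx:
  fixes f :: "real ^ 'n \<Rightarrow> 'b::euclidean_space"
  assumes f: "f \<in> borel_measurable lebesgue" and int: "integrable (lebesgue_on K) f"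
    and K: "compact K" and e: "e > 0"
  obtains g where "continuous_on UNIV g" "(LINT x|lebesgue_on K. norm (f x - g x)) < e"
proof -
  have Ks: "K \<in> sets lebesgue" using K by (simp add: compact_imp_closed)
  interpret finite_measure "lebesgue_on K"
    using K by (intro finite_measure_lebesgue_on lmeasurable_compact)
  have fK: "f \<in> borel_measurable (lebesgue_on K)" using f by (rule measurable_restrict_space1)
  have tm: "(\<lambda>x. trunc (real (Suc m)) (f x)) \<in> borel_measurable (lebesgue_on K)" for m
    using fK by (intro measurable_trunc) auto
  have "(\<lambda>m. LINT x|lebesgue_on K. norm (f x - trunc (real (Suc m)) (f x))) \<longlonglongrightarrow> (LINT x|lebesgue_on K. 0)"
  proof (rule integral_dominated_convergence[where w="\<lambda>x. 2 * norm (f x)"])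
    show "AE x in lebesgue_on K. (\<lambda>m. norm (f x - trunc (real (Suc m)) (f x))) \<longlonglongrightarrow> 0"
    proof (rule AE_I2)
      fix x
      obtain m0 :: nat where m0: "norm (f x) \<le> m0" using real_arch_simple by blast
      have "\<forall>\<^sub>F m in sequentially. norm (f x - trunc (real (Suc m)) (f x)) = 0"
        unfolding eventually_sequentially
        by (intro exI[of _ m0] allI impI) (use m0 in \<open>subst trunc_eq; auto\<close>)
      then show "(\<lambda>m. norm (f x - trunc (real (Suc m)) (f x))) \<longlonglongrightarrow> 0" by (rule tendsto_eventually)
    qed
    show "AE x in lebesgue_on K. norm (norm (f x - trunc (real (Suc m)) (f x))) \<le> 2 * norm (f x)" for m
    proof (rule AE_I2)
      fix x
      have "norm (f x - trunc (real (Suc m)) (f x)) \<le> norm (f x) + norm (trunc (real (Suc m)) (f x))"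
        by (rule norm_triangle_ineq4)
      then show "norm (norm (f x - trunc (real (Suc m)) (f x))) \<le> 2 * norm (f x)"
        using trunc_le[of "real (Suc m)" "f x"] by simp
    qed
  qed (use fK int tm in \<open>auto intro!: borel_measurable_norm borel_measurable_diff simp del: of_nat_Suc\<close>)
  then have "(\<lambda>m. LINT x|lebesgue_on K. norm (f x - trunc (real (Suc m)) (f x))) \<longlonglongrightarrow> 0" by simp
  then have "\<forall>\<^sub>F m in sequentially. (LINT x|lebesgue_on K. norm (f x - trunc (real (Suc m)) (f x))) < e / 2"
    by (rule order_tendstoD) (use e in simp)
  then obtain m where m: "(LINT x|lebesgue_on K. norm (f x - trunc (real (Suc m)) (f x))) < e / 2"
    using eventually_happens'[OF sequentially_bot] by blast
  define M where "M = real (Suc m)"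
  have M: "M > 0" by (simp add: M_def)
  have "f measurable_on UNIV"
    by (rule lebesgue_measurable_imp_measurable_on) (use f in simp_all)
  then obtain N g where N: "negligible N" and g: "\<And>n. continuous_on UNIV (g n)"
    and lim: "\<And>x. x \<notin> N \<Longrightarrow> (\<lambda>n. g n x) \<longlonglongrightarrow> f x"
    unfolding measurable_on_def by auto
  have gt: "continuous_on UNIV (\<lambda>x. trunc M (g n x))" for n
    using g by (intro continuous_trunc M)
  then have gtm: "(\<lambda>x. trunc M (g n x)) \<in> borel_measurable (lebesgue_on K)" for n
    by (intro measurable_restrict_space1 continuous_borel_lebesgue)
  have ftm: "(\<lambda>x. trunc M (f x)) \<in> borel_measurable (lebesgue_on K)" by (intro measurable_trunc M fK)
  have b2: "norm (trunc M a - trunc M b) \<le> 2 * M" for a b :: 'b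
    using norm_triangle_ineq4[of "trunc M a" "trunc M b"] trunc_bound[OF M, of a] trunc_bound[OF M, of b] by linarith
  have "(\<lambda>n. LINT x|lebesgue_on K. norm (trunc M (f x) - trunc M (g n x))) \<longlonglongrightarrow> (LINT x|lebesgue_on K. 0)"
  proof (rule integral_dominated_convergence[where w="\<lambda>x. 2 * M"])
    have "AE x in lebesgue. x \<notin> N" using N by (simp add: negligible_iff_null_sets AE_not_in)
    then have "AE x in lebesgue_on K. x \<notin> N"
      by (subst AE_restrict_space_iff) (auto simp: Ks elim: eventually_mono)
    then show "AE x in lebesgue_on K. (\<lambda>n. norm (trunc M (f x) - trunc M (g n x))) \<longlonglongrightarrow> 0"
    proof eventually_elim
      case (elim x)
      have "isCont (trunc M :: 'b \<Rightarrow> 'b) (f x)"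
        using continuous_trunc[OF M continuous_on_id[of "UNIV :: 'b set"]] by (simp add: continuous_on_eq_continuous_at)
      from isCont_tendsto_compose[OF this lim[OF elim]]
      have "(\<lambda>n. trunc M (f x) - trunc M (g n x)) \<longlonglongrightarrow> trunc M (f x) - trunc M (f x)"
        by (intro tendsto_intros)
      then show ?case using tendsto_norm_zero by simp
    qed
  qed (use b2 gtm ftm in \<open>auto intro!: borel_measurable_norm borel_measurable_diff\<close>)
  then have "(\<lambda>n. LINT x|lebesgue_on K. norm (trunc M (f x) - trunc M (g n x))) \<longlonglongrightarrow> 0" by simp
  then have "\<forall>\<^sub>F n in sequentially. (LINT x|lebesgue_on K. norm (trunc M (f x) - trunc M (g n x))) < e / 2"
    by (rule order_tendstoD) (use e in simp)
  then obtain n where n: "(LINT x|lebesgue_on K. norm (trunc M (f x) - trunc M (g n x))) < e / 2"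
    using eventually_happens'[OF sequentially_bot] by blast
  have if1: "integrable (lebesgue_on K) (\<lambda>x. norm (f x - trunc M (f x)))"
  proof (rule Bochner_Integration.integrable_bound[of _ "\<lambda>x. 2 * norm (f x)"])
    show "AE x in lebesgue_on K. norm (norm (f x - trunc M (f x))) \<le> norm (2 * norm (f x))"
    proof (rule AE_I2)
      fix x
      have "norm (f x - trunc M (f x)) \<le> norm (f x) + norm (trunc M (f x))"
        by (rule norm_triangle_ineq4)
      then show "norm (norm (f x - trunc M (f x))) \<le> norm (2 * norm (f x))"
        using trunc_le[OF M, of "f x"] by simp
    qed
  qed (use int fK ftm in auto)
  have if2: "integrable (lebesgue_on K) (\<lambda>x. norm (trunc M (f x) - trunc M (g n x)))"
    by (rule integrable_const_bound[of _ "2 * M"]) (use b2 gtm ftm in auto)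
  show ?thesis
  proof
    show "continuous_on UNIV (\<lambda>x. trunc M (g n x))" by (rule gt)
    have "(LINT x|lebesgue_on K. norm (f x - trunc M (g n x)))
      \<le> (LINT x|lebesgue_on K. norm (f x - trunc M (f x)) + norm (trunc M (f x) - trunc M (g n x)))"
    proof (rule integral_mono')
      show "norm (f x - trunc M (g n x)) \<le> norm (f x - trunc M (f x)) + norm (trunc M (f x) - trunc M (g n x))" for x
        using norm_triangle_ineq[of "f x - trunc M (f x)" "trunc M (f x) - trunc M (g n x)"] by simp
    qed (use if1 if2 in auto)
    also have "\<dots> < e" using if1 if2 m n unfolding M_def[symmetric] by simp
    finally show "(LINT x|lebesgue_on K. norm (f x - trunc M (g n x))) < e" .
  qed
qed

abbreviation big :: "(real ^ 'n) set" where "big \<equiv> cbox (-1) 2"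

lemma cell_shift_subset_big:
  assumes "x \<in> cell" "\<And>i. \<bar>z $ i\<bar> \<le> 1" shows "x + z \<in> big"
proof -
  have "-1 \<le> x $ i + z $ i \<and> x $ i + z $ i \<le> 2" for i
    using assms(1) assms(2)[of i] unfolding cell_def by (auto simp: abs_le_iff) (smt (verit))+
  then show ?thesis by (auto simp: mem_box_cart)
qed

text \<open>The usual three-epsilon argument. The continuous approximation is made on
  \<open>big\<close> and not on \<open>cell\<close>, since translates of \<open>cell\<close> by
  vectors with components in \<open>[-1, 1]\<close> must remain inside the region of
  control.\<close>

lemma translation_continuous_L1:
  fixes f :: "real ^ 'n \<Rightarrow> 'b::euclidean_space"
  assumes f: "f \<in> borel_measurable lebesgue" and int: "integrable (lebesgue_on big) f" and e: "e > 0"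
  obtains d where "0 < d" "\<And>z. norm z < d \<Longrightarrow> cell_integral (\<lambda>x. norm (f (x + z) - f x)) \<le> e"
proof -
  obtain g where g: "continuous_on UNIV g" and ge: "(LINT x|lebesgue_on big. norm (f x - g x)) < e / 3"
    using integrable_continuous_approx[OF f int compact_cbox, of "e/3"] e by auto
  have "uniformly_continuous_on big g"
    using g by (intro compact_uniformly_continuous) (auto intro: continuous_on_subset)
  then obtain d0 where d0: "d0 > 0" and d: "\<And>x y. x \<in> big \<Longrightarrow> y \<in> big \<Longrightarrow> dist y x < d0 \<Longrightarrow> dist (g y) (g x) < e / 3"
    using e unfolding uniformly_continuous_on_def by (metis divide_pos_pos zero_less_numeral)
  define h where "h x = norm (f x - g x)" for x
  have hm [measurable]: "h \<in> borel_measurable lebesgue"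
    unfolding h_def using f continuous_borel_lebesgue[OF g] by measurable
  have sb: "big \<in> sets (lebesgue :: (real ^ 'n) measure)" by simp
  have hB: "integrable (lebesgue_on big) h"
    unfolding h_def using int g by (intro integrable_norm Bochner_Integration.integrable_diff)
       (auto intro!: continuous_imp_integrable intro: continuous_on_subset)
  then have hB': "integrable lebesgue (\<lambda>x. indicator big x *\<^sub>R h x)"
    by (simp add: integrable_restrict_space)
  have he: "(LINT x|lebesgue. indicator big x *\<^sub>R h x) < e / 3"
    using ge by (simp add: h_def integral_restrict_space)
  have hz: "integrable (lebesgue_on cell) (\<lambda>x. h (x + z))" "cell_integral (\<lambda>x. h (x + z)) < e / 3"
    if z: "\<And>i. \<bar>z $ i\<bar> \<le> 1" for z
  proof -
    have mI: "(\<lambda>x. indicator big x *\<^sub>R h x) \<in> borel_measurable lebesgue" using sb by measurable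
    have it: "integrable lebesgue (\<lambda>x. indicator big (x + z) *\<^sub>R h (x + z))"
      "(LINT x|lebesgue. indicator big (x + z) *\<^sub>R h (x + z)) = (LINT x|lebesgue. indicator big x *\<^sub>R h x)"
      using lebesgue_integral_translate[OF mI, of z] hB' by auto
    have hzm: "(\<lambda>x. h (x + z)) \<in> borel_measurable lebesgue" by (rule lebesgue_measurable_translate[OF hm])
    have le: "indicator cell x *\<^sub>R h (x + z) \<le> indicator big (x + z) *\<^sub>R h (x + z)" for x
      using cell_shift_subset_big[OF _ z, of x] by (auto simp: h_def split: split_indicator)
    have i2: "integrable lebesgue (\<lambda>x. indicator cell x *\<^sub>R h (x + z))"
    proof (rule Bochner_Integration.integrable_bound[OF it(1)])
      show "(\<lambda>x. indicator cell x *\<^sub>R h (x + z)) \<in> borel_measurable lebesgue" using hzm by measurable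
      have "norm (indicator cell x *\<^sub>R h (x + z)) \<le> norm (indicator big (x + z) *\<^sub>R h (x + z))" for x
        using cell_shift_subset_big[OF _ z, of x] by (auto simp: h_def split: split_indicator)
      then show "AE x in lebesgue. norm (indicator cell x *\<^sub>R h (x + z)) \<le> norm (indicator big (x + z) *\<^sub>R h (x + z))"
        by simp
    qed
    then show "integrable (lebesgue_on cell) (\<lambda>x. h (x + z))" by (simp add: integrable_cell_iff)
    have "cell_integral (\<lambda>x. h (x + z)) \<le> (LINT x|lebesgue. indicator big (x + z) *\<^sub>R h (x + z))"
      unfolding cell_integral_indicator by (rule integral_mono[OF i2 it(1) le])
    then show "cell_integral (\<lambda>x. h (x + z)) < e / 3" using he it(2) by simp
  qed
  show ?thesis
  proof
    show "0 < min d0 1" using d0 by simp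
    fix z :: "real ^ 'n" assume z: "norm z < min d0 1"
    then have z1: "\<bar>z $ i\<bar> \<le> 1" for i using component_le_norm_cart[of z i] by simp
    have le: "norm (f (x + z) - f x) \<le> h (x + z) + (e / 3 + h (x + 0))" if x: "x \<in> cell" for x
    proof -
      have "norm (g (x + z) - g x) < e / 3"
        using d[OF cell_shift_subset_big[OF x, of 0] cell_shift_subset_big[OF x z1]] z by (simp add: dist_norm)
      moreover have "norm (f (x + z) - f x) \<le> norm (f (x + z) - g (x + z)) + (norm (g (x + z) - g x) + norm (f x - g x))"
        by norm
      ultimately show ?thesis by (simp add: h_def)
    qed
    interpret finite_measure "lebesgue_on (cell :: (real ^ 'n) set)" by (rule cell_finite_measure)
    have h0: "0 \<le> h (x + z) + (e / 3 + h (x + 0))" for x using e by (simp add: h_def)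
    note hz0 = hz[of 0, simplified] note hzz = hz[OF z1]
    have i: "integrable (lebesgue_on cell) (\<lambda>x. h (x + z) + (e / 3 + h (x + 0)))"
      using hz0 hzz by (intro Bochner_Integration.integrable_add) auto
    have "cell_integral (\<lambda>x. norm (f (x + z) - f x)) \<le> cell_integral (\<lambda>x. h (x + z) + (e / 3 + h (x + 0)))"
      unfolding cell_integral_def
      by (rule integral_mono'[OF i]) (use le h0 in auto)
    also have "\<dots> = cell_integral (\<lambda>x. h (x + z)) + (e / 3 + cell_integral h)"
      using hz0 hzz e unfolding cell_integral_def by (simp add: measure_restrict_space)
    also have "\<dots> \<le> e" using hz0 hzz by simp
    finally show "cell_integral (\<lambda>x. norm (f (x + z) - f x)) \<le> e" .
  qed
qed

subsection \<open>Convolution with a nonnegative trigonometric kernel\<close>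

text \<open>Nonnegativity of the kernel makes convolution preserve pointwise convex constraints; the kernel itself is a
  normalised power of a polynomial with values in \<open>[0, 1]\<close> that equals \<open>1\<close> only at the integer lattice.\<close>

definition kern_base :: "real ^ 'n \<Rightarrow> real" where
  "kern_base x = (\<Sum>i\<in>UNIV. 1 + cos (2 * pi * x $ i)) / (2 * real CARD('n))"

definition kern :: "nat \<Rightarrow> real ^ 'n \<Rightarrow> real" where
  "kern N x = kern_base x ^ N / cell_integral (\<lambda>y :: real ^ 'n. kern_base y ^ N)"

lemma kern_base_real_trig_poly: "(kern_base :: real ^ 'n \<Rightarrow> real) \<in> real_trig_poly 1"
proof -
  have "(\<lambda>x. (1 / (2 * real CARD('n))) * (\<Sum>i\<in>UNIV. 1 + cos (2 * pi * x $ i))) \<in> real_trig_poly 1"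
    by (intro real_trig_poly_cmult real_trig_poly_sum real_trig_poly_add real_trig_poly_const real_trig_poly_cos)
  then show ?thesis by (simp add: kern_base_def[abs_def])
qed

lemma kern_base_bounds: "0 \<le> kern_base x" "kern_base (x :: real ^ 'n) \<le> 1"
proof -
  have "0 \<le> (1 + cos (2 * pi * x $ i))" for i using cos_ge_minus_one[of "2 * pi * x $ i"] by linarith
  then show "0 \<le> kern_base x" unfolding kern_base_def by (intro divide_nonneg_nonneg sum_nonneg) auto
  have "(\<Sum>i\<in>UNIV. 1 + cos (2 * pi * x $ i)) \<le> (\<Sum>i\<in>(UNIV :: 'n set). 2)"
    by (intro sum_mono) (simp add: cos_le_one)
  then show "kern_base x \<le> 1" by (simp add: kern_base_def divide_simps)
qed

lemma kern_base_less_1: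
  fixes x :: "real ^ 'n"
  assumes "x \<noteq> 0" "\<And>i. \<bar>x $ i\<bar> \<le> 1/2" shows "kern_base x < 1"
proof -
  obtain i where i: "x $ i \<noteq> 0" using assms(1) by (auto simp: vec_eq_iff)
  have "cos (2 * pi * \<bar>x $ i\<bar>) < cos 0"
    using assms(2)[of i] i by (intro cos_monotone_0_pi) (auto simp: field_simps)
  then have "cos (2 * pi * x $ i) < 1" using i by (cases "0 \<le> x $ i") auto
  then have "(\<Sum>i\<in>UNIV. 1 + cos (2 * pi * x $ i)) < (\<Sum>i\<in>(UNIV :: 'n set). 2)"
    by (intro sum_strict_mono_ex1) (auto simp: cos_le_one intro!: bexI[of _ i])
  then show ?thesis by (simp add: kern_base_def divide_simps)
qed

lemma kern_base_minus: "kern_base (- x) = kern_base x" by (simp add: kern_base_def)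

lemma continuous_qq [continuous_intros]:
  fixes f :: "'a::t2_space \<Rightarrow> real ^ 'n"
  shows "continuous_on S f \<Longrightarrow> continuous_on S (\<lambda>x. kern_base (f x))"
proof -
  assume f: "continuous_on S f"
  have "continuous_on S (\<lambda>x. cos (2 * pi * f x $ i))" for i
    by (rule continuous_on_cos) (intro continuous_on_mult continuous_on_const continuous_on_component f)
  then show ?thesis
    unfolding kern_base_def
    by (intro continuous_on_divide continuous_on_sum continuous_on_add continuous_on_const) auto
qed

text \<open>Normalising the \<open>N\<close>-th power costs at most a factor of order
  \<open>a ^ (- N)\<close>, for any \<open>a < 1\<close>. The set where \<open>kern_base\<close>
  exceeds \<open>a\<close> is an open neighbourhood of the origin; the origin lies only on the
  boundary of \<open>cell\<close>, but an open set meeting the closure of \<open>cell\<close> meets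
  \<open>cell\<close>, and there in a set of positive measure.\<close>

lemma kern_base_integral_lower:
  assumes "0 < a" "a < 1"
  obtains m where "0 < m" "\<And>N. a ^ N * m \<le> cell_integral (\<lambda>y :: real ^ 'n. kern_base y ^ N)"
proof -
  define U where "U = {x :: real ^ 'n. a < kern_base x} \<inter> cell"
  have o: "open U"
    unfolding U_def cell_eq_box by (intro open_Int open_box open_Collect_less continuous_intros)
  have oq: "open {x :: real ^ 'n. a < kern_base x}" by (intro open_Collect_less continuous_intros)
  have "kern_base (0::real ^ 'n) = 1" by (simp add: kern_base_def)
  then have "(0::real ^ 'n) \<in> {x. a < kern_base x}" using assms by simp
  moreover have "(0::real ^ 'n) \<in> closure cell"
  proof -
    have "(\<chi> i. 1/2) \<in> box 0 (1 :: real ^ 'n)" by (simp add: mem_box_cart)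
    then have "box 0 (1 :: real ^ 'n) \<noteq> {}" by blast
    then show ?thesis unfolding cell_eq_box by (simp add: mem_box_cart)
  qed
  ultimately have "U \<noteq> {}"
    unfolding U_def using oq open_Int_closure_eq_empty[OF oq, of cell] by blast
  then have "\<not> negligible U" using o open_not_negligible by blast
  have Us: "U \<in> sets borel" using o by simp
  have "emeasure lebesgue U \<le> emeasure lebesgue (cell :: (real ^ 'n) set)"
    by (rule emeasure_mono) (auto simp: U_def)
  then have Ul: "U \<in> lmeasurable" using Us by (auto simp: fmeasurable_def less_top[symmetric] top_unique)
  define m where "m = measure lebesgue U"
  have "m \<noteq> 0" unfolding m_def using \<open>\<not> negligible U\<close> Ul by (simp add: negligible_iff_measure)
  then have m: "0 < m" unfolding m_def using measure_nonneg[of lebesgue U] by linarith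
  show ?thesis
  proof
    fix N
    have i1: "integrable lebesgue (\<lambda>x :: real ^ 'n. indicator cell x *\<^sub>R (kern_base x ^ N))"
      using integrable_cell_continuous[of "\<lambda>x. kern_base x ^ N"] by (simp add: integrable_cell_iff continuous_intros)
    have i2: "integrable lebesgue (\<lambda>x. indicator U x *\<^sub>R (a ^ N))"
      using Ul by (intro integrable_scaleR_left integrable_real_indicator) (auto simp: fmeasurable_def)
    have "a ^ N * m = (LINT x|lebesgue. indicator U x *\<^sub>R (a ^ N))"
      using Ul unfolding m_def by (simp add: fmeasurable_def)
    also have "\<dots> \<le> (LINT x :: real ^ 'n|lebesgue. indicator cell x *\<^sub>R (kern_base x ^ N))"
    proof (rule integral_mono[OF i2 i1])
      fix x :: "real ^ 'n"
      show "indicator U x *\<^sub>R (a ^ N) \<le> indicator cell x *\<^sub>R (kern_base x ^ N)"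
        using assms kern_base_bounds[of x] by (auto simp: U_def intro!: power_mono split: split_indicator)
    qed
    finally show "a ^ N * m \<le> cell_integral (\<lambda>y :: real ^ 'n. kern_base y ^ N)"
      by (simp add: cell_integral_indicator)
  qed (rule m)
qed

lemma kern_base_integral_pos: "0 < cell_integral (\<lambda>y :: real ^ 'n. kern_base y ^ N)"
proof -
  obtain m where m: "0 < m" "\<And>N. (1/2) ^ N * m \<le> cell_integral (\<lambda>y :: real ^ 'n. kern_base y ^ N)"
    by (rule kern_base_integral_lower[of "1/2"]) auto
  have "0 < (1/2) ^ N * m" using m(1) by simp
  also note m(2)[of N]
  finally show ?thesis .
qed

lemma kern_nonneg: "0 \<le> kern N x"
  unfolding kern_def by (intro divide_nonneg_nonneg zero_le_power kern_base_bounds less_imp_le[OF kern_base_integral_pos])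

lemma kern_real_trig_poly: "(kern N :: real ^ 'n \<Rightarrow> real) \<in> real_trig_poly N"
proof -
  have "(\<lambda>x. (1 / cell_integral (\<lambda>y :: real ^ 'n. kern_base y ^ N)) * kern_base x ^ N) \<in> real_trig_poly N"
    using real_trig_poly_power[OF kern_base_real_trig_poly, of N] by (intro real_trig_poly_cmult) simp
  then show ?thesis by (simp add: kern_def[abs_def])
qed

lemma kern_minus: "kern N (- x) = kern N x" by (simp add: kern_def kern_base_minus)

lemma continuous_kern [continuous_intros]:
  fixes f :: "'a::t2_space \<Rightarrow> real ^ 'n"
  shows "continuous_on S f \<Longrightarrow> continuous_on S (\<lambda>x. kern N (f x))"
  unfolding kern_def using kern_base_integral_pos[where 'n='n, of N]
  by (intro continuous_on_divide continuous_on_power continuous_qq continuous_on_const) simp_all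

lemma kern_integral [simp]: "cell_integral (kern N :: real ^ 'n \<Rightarrow> real) = 1"
  using kern_base_integral_pos[where 'n='n, of N] unfolding kern_def cell_integral_def by simp

lemma kern_integral_shift:
  fixes x :: "real ^ 'n"
  assumes "\<And>i. \<bar>x $ i\<bar> \<le> 1"
  shows "cell_integral (\<lambda>y. kern N (x - y)) = 1"
proof -
  have c: "continuous_on UNIV (kern N :: real ^ 'n \<Rightarrow> real)" by (intro continuous_intros)
  have p: "periodic (kern N :: real ^ 'n \<Rightarrow> real)" by (rule periodicI) (rule periodic_real_trig_poly[OF kern_real_trig_poly])
  have "cell_integral (\<lambda>y. kern N (y + (- x))) = cell_integral (kern N :: real ^ 'n \<Rightarrow> real)"
    by (rule cell_integral_shift(2)[OF continuous_borel_lebesgue[OF c] p integrable_cell_continuous[OF c]])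
      (use assms in simp)
  then show ?thesis using kern_minus[of N "x - _"] by simp
qed

lemma kern_concentration:
  assumes "0 < d" "0 < e"
  shows "\<exists>N0. \<forall>N\<ge>N0. \<forall>z :: real ^ 'n. (\<forall>i. \<bar>z $ i\<bar> \<le> 1/2) \<longrightarrow> d \<le> norm z \<longrightarrow> kern N z \<le> e"
proof -
  define S where "S = {z :: real ^ 'n. (\<forall>i. \<bar>z $ i\<bar> \<le> 1/2) \<and> d \<le> norm z}"
  have "S = cbox (\<chi> i. -1/2) (\<chi> i. 1/2) \<inter> {z. d \<le> norm z}"
  proof -
    have "\<bar>t\<bar> \<le> 1/2 \<longleftrightarrow> -1/2 \<le> t \<and> t \<le> 1/2" for t :: real by auto
    then show ?thesis unfolding S_def by (simp only: mem_box_cart vec_lambda_beta set_eq_iff Int_iff mem_Collect_eq) blast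
  qed
  moreover have "closed {z :: real ^ 'n. d \<le> norm z}" by (intro closed_Collect_le continuous_intros)
  ultimately have "compact S" by (simp add: compact_Int_closed)
  have "\<exists>b<1. 0 < b \<and> (\<forall>z\<in>S. kern_base z \<le> b)"
  proof (cases "S = {}")
    case True then show ?thesis by (auto intro: exI[of _ "1/2"])
  next
    case False
    obtain z0 where z0: "z0 \<in> S" "\<And>z. z \<in> S \<Longrightarrow> kern_base z \<le> kern_base z0"
      using continuous_attains_sup[OF \<open>compact S\<close> False continuous_qq[OF continuous_on_id]] by auto
    have "kern_base z0 < 1" using z0(1) assms by (intro kern_base_less_1) (auto simp: S_def)
    then show ?thesis using z0 by (intro exI[of _ "max (kern_base z0) (1/2)"]) (auto simp: le_max_iff_disj)
  qed
  then obtain b where b: "b < 1" "0 < b" "\<And>z. z \<in> S \<Longrightarrow> kern_base z \<le> b" by auto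
  \<comment> \<open>Any number strictly between \<open>b\<close> and 1 would do: off the origin the
    numerator of the kernel is at most \<open>b ^ N\<close>, the denominator is at least
    \<open>a ^ N * m\<close>, and the quotient decays geometrically.\<close>
  define a where "a = (1 + b) / 2"
  have a: "0 < a" "a < 1" "b < a" using b by (auto simp: a_def)
  obtain m where m: "0 < m" "\<And>N. a ^ N * m \<le> cell_integral (\<lambda>y :: real ^ 'n. kern_base y ^ N)"
    using kern_base_integral_lower[OF a(1,2)] by metis
  have "(\<lambda>N. (b / a) ^ N / m) \<longlonglongrightarrow> 0 / m"
    by (intro tendsto_intros LIMSEQ_realpow_zero) (use a b m in auto)
  then have "\<forall>\<^sub>F N in sequentially. (b / a) ^ N / m < e"
    by (intro order_tendstoD) (use assms in auto)
  then obtain N0 where N0: "\<And>N. N \<ge> N0 \<Longrightarrow> (b / a) ^ N / m < e" by (auto simp: eventually_sequentially)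
  show ?thesis
  proof (intro exI[of _ N0] allI impI)
    fix N and z :: "real ^ 'n" assume N: "N \<ge> N0" and "\<forall>i. \<bar>z $ i\<bar> \<le> 1/2" "d \<le> norm z"
    then have z: "z \<in> S" by (simp add: S_def)
    have "kern N z \<le> b ^ N / (a ^ N * m)"
      unfolding kern_def by (intro frac_le power_mono m b kern_base_bounds z) (use a b m in auto)
    also have "\<dots> = (b / a) ^ N / m" by (simp add: power_divide)
    finally show "kern N z \<le> e" using N0[OF N] by simp
  qed
qed

section \<open>Convolution as a Fourier multiplier\<close>

definition conv :: "nat \<Rightarrow> (real ^ 'n \<Rightarrow> 'b::euclidean_space) \<Rightarrow> real ^ 'n \<Rightarrow> 'b" where
  "conv N f x = cell_integral (\<lambda>y. kern N (x - y) *\<^sub>R f y)"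

lemma kern_bounded: "\<exists>C. \<forall>x :: real ^ 'n. kern N x \<le> C"
proof (intro exI allI)
  fix x :: "real ^ 'n"
  show "kern N x \<le> 1 / cell_integral (\<lambda>y :: real ^ 'n. kern_base y ^ N)"
    unfolding kern_def
    by (intro divide_right_mono power_le_one kern_base_bounds less_imp_le[OF kern_base_integral_pos])
qed

lemma integrable_mult_bounded_cell:
  fixes f :: "real ^ 'n \<Rightarrow> 'b::euclidean_space"
  assumes "integrable (lebesgue_on cell) f" "g \<in> borel_measurable lebesgue" "\<And>x. \<bar>g x\<bar> \<le> C"
  shows "integrable (lebesgue_on cell) (\<lambda>x. g x *\<^sub>R f x)"
proof (rule Bochner_Integration.integrable_bound[of _ "\<lambda>x. C *\<^sub>R f x"])
  show "AE x in lebesgue_on cell. norm (g x *\<^sub>R f x) \<le> norm (C *\<^sub>R f x)"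
  proof (rule AE_I2)
    fix x
    have "\<bar>g x\<bar> \<le> \<bar>C\<bar>" using assms(3)[of x] by linarith
    then show "norm (g x *\<^sub>R f x) \<le> norm (C *\<^sub>R f x)" by (simp add: mult_right_mono)
  qed
qed (use assms(1) measurable_restrict_space1[OF assms(2)] in auto)

lemma integrable_kern_mult:
  fixes f :: "real ^ 'n \<Rightarrow> 'b::euclidean_space"
  assumes "integrable (lebesgue_on cell) f"
  shows "integrable (lebesgue_on cell) (\<lambda>y. kern N (x - y) *\<^sub>R f y)"
proof -
  obtain C where "\<And>x :: real ^ 'n. kern N x \<le> C" using kern_bounded by blast
  then have "\<bar>kern N (x - y)\<bar> \<le> C" for y using kern_nonneg[of N "x - y"] by simp
  moreover have "(\<lambda>y. kern N (x - y)) \<in> borel_measurable lebesgue"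
    by (intro continuous_borel_lebesgue continuous_intros)
  ultimately show ?thesis by (intro integrable_mult_bounded_cell[OF assms])
qed

lemma conv_inner:
  fixes f :: "real ^ 'n \<Rightarrow> 'b::euclidean_space"
  assumes "integrable (lebesgue_on cell) f"
  shows "conv N f x \<bullet> c = conv N (\<lambda>y. f y \<bullet> c) x"
  unfolding conv_def cell_integral_def
  by (subst integral_inner_left[symmetric]) (use integrable_kern_mult[OF assms] in auto)

text \<open>The Fourier coefficients of the kernel act as multipliers. They are bounded by 1 because
  the kernel is nonnegative with mean 1, which makes convolution a contraction in
  \<open>L^2\<close>. The family \<open>c\<close> is obtained before \<open>f\<close>: the same
  multipliers serve a function and its derivatives.\<close>

lemma conv_trig:
  obtains c :: "int ^ 'n \<Rightarrow> complex" where "\<And>k. cmod (c k) \<le> 1"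
    and "\<And>f x. integrable (lebesgue_on cell) f \<Longrightarrow> complex_of_real (conv N f x) =
        (\<Sum>k\<in>Box N. c k * cell_integral (\<lambda>y. f y * cnj (ee k y)) * ee k (x :: real ^ 'n))"
proof -
  have "(\<lambda>x. complex_of_real (kern N x)) \<in> trig_poly N" using kern_real_trig_poly by (auto simp: real_trig_poly_def)
  then obtain c0 where c0: "\<And>x. complex_of_real (kern N x) = (\<Sum>k\<in>Box N. c0 k * ee k (x :: real ^ 'n))"
    by (auto simp: trig_poly_def fun_eq_iff)
  \<comment> \<open>Coefficients outside the box are unconstrained by the expansion; the value 0
    makes the bound by 1 hold for every \<open>k\<close>.\<close>
  define c where "c k = (if k \<in> Box N then c0 k else 0)" for k
  have c: "complex_of_real (kern N x) = (\<Sum>k\<in>Box N. c k * ee k (x :: real ^ 'n))" for x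
    unfolding c0 by (intro sum.cong) (auto simp: c_def)
  show ?thesis
  proof
    fix k
    show "cmod (c k) \<le> 1"
    proof (cases "k \<in> Box N")
      case True
      have "c k = cell_integral (\<lambda>x. complex_of_real (kern N x) * cnj (ee k x))"
        using trig_poly_coeff[OF c True] by simp
      also have "cmod \<dots> \<le> cell_integral (\<lambda>x :: real ^ 'n. kern N x)"
        unfolding cell_integral_def
        by (rule order_trans[OF integral_norm_bound]) (simp add: norm_mult kern_nonneg)
      finally show ?thesis by simp
    qed (simp add: c_def)
  next
    fix f :: "real ^ 'n \<Rightarrow> real" and x assume f: "integrable (lebesgue_on cell) f"
    have i: "integrable (lebesgue_on cell) (\<lambda>y. complex_of_real (f y) * cnj (ee k y))" for k
    proof (rule Bochner_Integration.integrable_bound[OF f])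
      show "(\<lambda>y. complex_of_real (f y) * cnj (ee k y)) \<in> borel_measurable (lebesgue_on cell)"
      proof (rule borel_measurable_times)
        show "(\<lambda>y. complex_of_real (f y)) \<in> borel_measurable (lebesgue_on cell)"
          using borel_measurable_integrable[OF f] by measurable
        have "(\<lambda>y :: real ^ 'n. ee (- k) y) \<in> borel_measurable lebesgue"
          by (intro continuous_borel_lebesgue continuous_intros)
        then show "(\<lambda>y. cnj (ee k y)) \<in> borel_measurable (lebesgue_on cell)"
          by (simp add: measurable_restrict_space1)
      qed
    qed (simp add: norm_mult)
    have "complex_of_real (conv N f x) = cell_integral (\<lambda>y. complex_of_real (kern N (x - y)) * complex_of_real (f y))"
      unfolding conv_def by (simp flip: cell_integral_complex_of_real)
    also have "\<dots> = cell_integral (\<lambda>y. \<Sum>k\<in>Box N. c k * ee k x * (f y * cnj (ee k y)))"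
    proof -
      have "ee k (x - y) = ee k x * cnj (ee k y)" for k y
        using ee_add_arg[of k x "- y"] by (simp add: ee_minus_arg)
      then have "complex_of_real (kern N (x - y)) * complex_of_real (f y) =
          (\<Sum>k\<in>Box N. c k * ee k x * (f y * cnj (ee k y)))" for y
        unfolding c sum_distrib_right by (intro sum.cong) (simp_all del: ee_simps)
      then show ?thesis by simp
    qed
    also have "\<dots> = (\<Sum>k\<in>Box N. c k * ee k x * cell_integral (\<lambda>y. f y * cnj (ee k y)))"
      unfolding cell_integral_def using i by (subst Bochner_Integration.integral_sum) auto
    finally show "complex_of_real (conv N f x) =
        (\<Sum>k\<in>Box N. c k * cell_integral (\<lambda>y. f y * cnj (ee k y)) * ee k x)" by (simp add: mult_ac)
  qed
qed

lemma conv_real_trig_poly: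
  fixes f :: "real ^ 'n \<Rightarrow> real"
  assumes "integrable (lebesgue_on cell) f"
  shows "conv N f \<in> real_trig_poly N"
proof -
  obtain c where "complex_of_real (conv N f x) =
        (\<Sum>k\<in>Box N. c k * cell_integral (\<lambda>y. f y * cnj (ee k y)) * ee k x)" for x
    by (rule conv_trig) (use assms in blast)
  then show ?thesis by (simp add: real_trig_poly_def trig_poly_coeffs)
qed

lemma continuous_conv:
  fixes f :: "real ^ 'n \<Rightarrow> 'b::euclidean_space"
  assumes "integrable (lebesgue_on cell) f"
  shows "continuous_on UNIV (conv N f)"
proof -
  have "continuous_on UNIV (\<lambda>x. conv N f x \<bullet> c)" for c
    unfolding conv_inner[OF assms] using assms
    by (intro continuous_real_trig_poly[OF conv_real_trig_poly] integrable_inner_left) auto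
  then show ?thesis by (subst continuous_on_componentwise) auto
qed

section \<open>Convergence of the convolutions\<close>

lemma nn_integral_cell_lborel:
  "(\<integral>\<^sup>+x. f x \<partial>lebesgue_on (cell :: (real ^ 'n) set)) = (\<integral>\<^sup>+x. f x \<partial>restrict_space lborel cell)"
  by (simp add: nn_integral_restrict_space nn_integral_completion)

lemma borel_representative:
  fixes f :: "real ^ 'n \<Rightarrow> 'b::euclidean_space"
  assumes "f \<in> borel_measurable lebesgue"
  obtains g where "g \<in> borel_measurable borel" "AE x in lebesgue. f x = g x"
proof -
  have "\<exists>g\<in>borel_measurable lborel. AE x in lborel. f x \<bullet> b = g x" for b
    using assms by (intro completion_ex_borel_measurable_real borel_measurable_inner) auto
  then obtain g where g: "\<And>b. g b \<in> borel_measurable lborel" "\<And>b. AE x in lborel. f x \<bullet> b = g b x"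
    by metis
  show ?thesis
  proof
    show "(\<lambda>x. \<Sum>b\<in>Basis. g b x *\<^sub>R b) \<in> borel_measurable borel"
      using g(1) by (intro borel_measurable_sum borel_measurable_scaleR) simp_all
    have "AE x in lebesgue. \<forall>b\<in>Basis. f x \<bullet> b = g b x"
      using g(2) by (intro AE_finite_allI AE_completion) auto
    then show "AE x in lebesgue. f x = (\<Sum>b\<in>Basis. g b x *\<^sub>R b)"
      by eventually_elim (metis (no_types, lifting) euclidean_representation sum.cong)
  qed
qed

lemma measurable_cell_integral_bound:
  fixes f :: "real ^ 'n \<Rightarrow> real"
  assumes "f \<in> borel_measurable (lebesgue_on cell)" "\<And>x. x \<in> cell \<Longrightarrow> 0 \<le> f x" "0 \<le> c"
    and "(\<integral>\<^sup>+x. ennreal (f x) \<partial>lebesgue_on cell) \<le> ennreal c"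
  shows "cell_integral f \<le> c"
proof -
  have "cell_integral f = enn2real (\<integral>\<^sup>+x. ennreal (f x) \<partial>lebesgue_on cell)"
    unfolding cell_integral_def
    by (rule integral_eq_nn_integral) (use assms in \<open>auto intro!: AE_I2\<close>)
  also have "\<dots> \<le> enn2real (ennreal c)"
    by (rule enn2real_mono) (use assms in auto)
  finally show ?thesis using assms by simp
qed

text \<open>The error at \<open>x\<close> is at most the kernel average of
  \<open>norm (f (x + z) - f x)\<close> over shifts \<open>z\<close>. Exchanging the integrals turns
  this into the kernel average of the translation modulus \<open>om z\<close>, which is small for
  \<open>z\<close> near the origin and meets a small kernel elsewhere. The exchange needs joint
  measurability in both variables, hence a Borel function; \<open>conv_L1\<close> then passes to a
  Borel representative.\<close>

lemma conv_L1_borel: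
  fixes f :: "real ^ 'n \<Rightarrow> 'b::euclidean_space"
  assumes fb: "f \<in> borel_measurable borel" and per: "periodic f"
    and int: "integrable (lebesgue_on cell) f" and big: "integrable (lebesgue_on big) f"
  shows "(\<lambda>N. cell_integral (\<lambda>x. norm (conv N f x - f x))) \<longlonglongrightarrow> 0"
proof (rule LIMSEQ_I)
  fix r :: real assume r: "0 < r"
  \<comment> \<open>Centring at the midpoint lets \<open>z = y - hh\<close> range over the cube
    \<open>\<bar>z $ i\<bar> \<le> 1/2\<close>, in which the kernel peaks only at the origin. Over
    \<open>cell\<close> itself the mass would sit at all the corners.\<close>
  define hh :: "real ^ 'n" where "hh = (\<chi> i. 1/2)"
  define I where "I = cell_integral (\<lambda>x. norm (f x))"
  define om where "om z = cell_integral (\<lambda>x. norm (f (x + z) - f x))" for z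
  have I0: "0 \<le> I" unfolding I_def cell_integral_def by simp
  have f: "f \<in> borel_measurable lebesgue" using fb by (simp add: measurable_completion)
  obtain d where d: "0 < d" "\<And>z. norm z < d \<Longrightarrow> om z \<le> r / 4"
    using translation_continuous_L1[OF f big, of "r/4"] r unfolding om_def by auto
  \<comment> \<open>For \<open>norm z \<ge> d\<close> the modulus is at most \<open>2 * I\<close>,
    so this bound on the kernel makes the far part contribute at most \<open>r / 4\<close>. The
    added 1 covers the case \<open>I = 0\<close>.\<close>
  define e' where "e' = r / (4 * (2 * I + 1))"
  have e': "0 < e'" using r I0 by (simp add: e'_def)
  obtain N0 where N0: "\<And>N z. N \<ge> N0 \<Longrightarrow> (\<forall>i. \<bar>z $ i\<bar> \<le> 1/2) \<Longrightarrow> d \<le> norm z \<Longrightarrow> kern N (z :: real ^ 'n) \<le> e'"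
    using kern_concentration[OF d(1) e', where 'n='n] by blast
  have nf: "(\<lambda>x. norm (f x)) \<in> borel_measurable lebesgue" "periodic (\<lambda>x. norm (f x))"
    "integrable (lebesgue_on cell) (\<lambda>x. norm (f x))"
  proof -
    show "periodic (\<lambda>x. norm (f x))"
      unfolding periodic_def
    proof
      fix i
      have "AE x in lebesgue. f (x + axis i 1) = f x" using per by (simp add: periodic_def)
      then show "AE x in lebesgue. norm (f (x + axis i 1)) = norm (f x)" by eventually_elim simp
    qed
  qed (use f int in auto)
  have yh: "\<bar>(y - hh) $ i\<bar> \<le> 1/2" if "y \<in> cell" for y :: "real ^ 'n" and i
    using that unfolding cell_def hh_def by (auto simp: abs_le_iff less_imp_le) (smt (verit) field_sum_of_halves)+
  have om_le: "om z \<le> 2 * I" "integrable (lebesgue_on cell) (\<lambda>x. norm (f (x + z) - f x))"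
    if z: "\<And>i. \<bar>z $ i\<bar> \<le> 1" for z
  proof -
    have i2: "integrable (lebesgue_on cell) (\<lambda>x. f (x + z))" 
      by (rule cell_integral_shift(1)[OF f per int z])
    then show i3: "integrable (lebesgue_on cell) (\<lambda>x. norm (f (x + z) - f x))" using int by simp
    have "om z \<le> cell_integral (\<lambda>x. norm (f (x + z)) + norm (f x))"
      unfolding om_def cell_integral_def
      by (rule integral_mono[OF i3]) (use i2 int in \<open>auto intro: norm_triangle_ineq4\<close>)
    also have "\<dots> = cell_integral (\<lambda>x. norm (f (x + z))) + I"
      unfolding cell_integral_def I_def using i2 int by simp
    also have "cell_integral (\<lambda>x. norm (f (x + z))) = I"
      unfolding I_def by (rule cell_integral_shift(2)[OF nf z])
    finally show "om z \<le> 2 * I" by simp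
  qed
  have half1: "\<bar>t\<bar> \<le> 1/2 \<Longrightarrow> \<bar>t\<bar> \<le> 1" for t :: real by simp
  show "\<exists>no. \<forall>n\<ge>no. norm (cell_integral (\<lambda>x. norm (conv n f x - f x)) - 0) < r"
  proof (intro exI[of _ N0] allI impI)
    fix N assume N: "N \<ge> N0"
    define P where "P x y = kern N (hh - y) * norm (f (x + (y - hh)) - f x)" for x y :: "real ^ 'n"
    have P0: "0 \<le> P x y" for x y by (simp add: P_def kern_nonneg)
    have pt: "norm (conv N f x - f x) \<le> cell_integral (P x)" "integrable (lebesgue_on cell) (P x)"
      if x: "x \<in> cell" for x
    proof -
      have x1: "\<bar>x $ i\<bar> \<le> 1" for i using x by (auto simp: cell_def abs_le_iff less_imp_le)
      define G where "G y = kern N (x - y) * norm (f y - f x)" for y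
      interpret finite_measure "lebesgue_on (cell :: (real ^ 'n) set)" by (rule cell_finite_measure)
      have i1: "integrable (lebesgue_on cell) (\<lambda>y. f y - f x)" using int by simp
      have kc: "integrable (lebesgue_on cell) (\<lambda>y. kern N (x - y) *\<^sub>R f x)"
        by (intro integrable_cell_continuous continuous_intros)
      have "conv N f x - f x = cell_integral (\<lambda>y. kern N (x - y) *\<^sub>R (f y - f x))"
      proof -
        have "cell_integral (\<lambda>y. kern N (x - y) *\<^sub>R f x) = f x"
          using kern_integral_shift[OF x1, of N] unfolding cell_integral_def
          by (subst integral_scaleR_left) (auto intro!: integrable_cell_continuous continuous_intros)
        then show ?thesis
          unfolding conv_def cell_integral_def scaleR_diff_right
          using integrable_kern_mult[OF int, of N x] kc by simp
      qed
      also have "norm \<dots> \<le> cell_integral G"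
        unfolding cell_integral_def G_def by (rule order_trans[OF integral_norm_bound]) (simp add: kern_nonneg)
      finally have le: "norm (conv N f x - f x) \<le> cell_integral G" .
      have Gi: "integrable (lebesgue_on cell) G"
        using integrable_norm[OF integrable_kern_mult[OF i1, of N x]] by (simp add: G_def[abs_def] kern_nonneg)
      have Gm: "G \<in> borel_measurable lebesgue"
      proof -
        have "(\<lambda>y. kern N (x - y)) \<in> borel_measurable lebesgue"
          by (intro continuous_borel_lebesgue continuous_intros)
        then show ?thesis unfolding G_def[abs_def] using f by measurable
      qed
      have Gp: "periodic G"
        unfolding periodic_def
      proof
        fix i
        have k: "kern N (x - (y + axis i 1)) = kern N (x - y)" for y
          using periodic_real_trig_poly[OF kern_real_trig_poly, of N "x - (y + axis i 1)" i] by simp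
        have "AE y in lebesgue. f (y + axis i 1) = f y" using per by (simp add: periodic_def)
        then show "AE y in lebesgue. G (y + axis i 1) = G y"
          by eventually_elim (simp add: G_def k)
      qed
      have s: "\<bar>(x - hh) $ i\<bar> \<le> 1" for i by (rule half1) (rule yh[OF x])
      have GP: "G (y + (x - hh)) = P x y" for y by (simp add: G_def P_def algebra_simps)
      show "norm (conv N f x - f x) \<le> cell_integral (P x)"
        using cell_integral_shift(2)[OF Gm Gp Gi s] le by (simp add: GP)
      show "integrable (lebesgue_on cell) (P x)"
        using cell_integral_shift(1)[OF Gm Gp Gi s] by (simp add: GP)
    qed
    define C where "C = restrict_space lborel (cell :: (real ^ 'n) set)"
    have C: "space C = cell" by (simp add: C_def space_restrict_space)
    have fC: "finite_measure C"
    proof (rule finite_measureI)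
      have "emeasure lborel (cell :: (real ^ 'n) set) = emeasure lebesgue (cell :: (real ^ 'n) set)"
        by (simp del: emeasure_cell)
      then show "emeasure C (space C) \<noteq> \<infinity>"
        by (simp add: C) (simp add: C_def emeasure_restrict_space)
    qed
    then interpret pair_sigma_finite C C
      by (simp add: pair_sigma_finite_def finite_measure.axioms(1))
    have mP: "(\<lambda>(x, y). ennreal (P x y)) \<in> borel_measurable (C \<Otimes>\<^sub>M C)"
    proof -
      have "(\<lambda>z. P (fst z) (snd z)) \<in> borel_measurable (borel \<Otimes>\<^sub>M borel)"
      proof -
        have [measurable]: "(kern N :: real ^ 'n \<Rightarrow> real) \<in> borel_measurable borel"
          by (intro borel_measurable_continuous_onI continuous_intros)
        note fb[measurable]
        show ?thesis unfolding P_def by measurable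
      qed
      moreover have "(\<lambda>z. z) \<in> C \<Otimes>\<^sub>M C \<rightarrow>\<^sub>M borel \<Otimes>\<^sub>M (borel :: (real ^ 'n) measure)"
      proof -
        have "(\<lambda>x. x) \<in> C \<rightarrow>\<^sub>M borel" unfolding C_def by (intro measurable_restrict_space1) simp
        then show ?thesis
          using measurable_compose[OF measurable_fst, of "\<lambda>x. x" C borel C]
            measurable_compose[OF measurable_snd, of "\<lambda>x. x" C borel C]
          by (simp add: measurable_pair_iff comp_def)
      qed
      ultimately have "(\<lambda>z. P (fst z) (snd z)) \<in> borel_measurable (C \<Otimes>\<^sub>M C)"
        by (rule measurable_compose[rotated])
      then show ?thesis by (simp add: case_prod_unfold)
    qed
    have "(\<integral>\<^sup>+x. ennreal (norm (conv N f x - f x)) \<partial>lebesgue_on cell) \<le> (\<integral>\<^sup>+x. (\<integral>\<^sup>+y. ennreal (P x y) \<partial>C) \<partial>C)"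
      unfolding nn_integral_cell_lborel C_def[symmetric]
    proof (rule nn_integral_mono)
      fix x assume "x \<in> space C"
      then have x: "x \<in> cell" by (simp add: C)
      have "(\<integral>\<^sup>+y. ennreal (P x y) \<partial>C) = ennreal (cell_integral (P x))"
        using nn_integral_eq_integral[OF pt(2)[OF x]] P0 unfolding C_def cell_integral_def
        by (simp add: nn_integral_cell_lborel)
      then show "ennreal (norm (conv N f x - f x)) \<le> (\<integral>\<^sup>+y. ennreal (P x y) \<partial>C)"
        using pt(1)[OF x] by (simp add: ennreal_leI)
    qed
    also have "\<dots> = (\<integral>\<^sup>+y. (\<integral>\<^sup>+x. ennreal (P x y) \<partial>C) \<partial>C)"
      using Fubini'[OF mP] by simp
    also have "\<dots> \<le> (\<integral>\<^sup>+y. ennreal (kern N (hh - y) * (r / 4) + e' * (2 * I)) \<partial>C)"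
    proof (rule nn_integral_mono)
      fix y assume "y \<in> space C"
      then have y: "y \<in> cell" by (simp add: C)
      define z where "z = y - hh"
      have zi: "\<bar>z $ i\<bar> \<le> 1/2" for i unfolding z_def by (rule yh[OF y])
      then have z1: "\<bar>z $ i\<bar> \<le> 1" for i by (rule half1)
      have k: "kern N (hh - y) = kern N z" using kern_minus[of N z] by (simp add: z_def)
      have "(\<integral>\<^sup>+x. ennreal (P x y) \<partial>C) = ennreal (kern N z * om z)"
      proof -
        have "integrable (lebesgue_on cell) (\<lambda>x. P x y)"
          using om_le(2)[OF z1] by (simp add: P_def z_def[symmetric])
        from nn_integral_eq_integral[OF this] P0
        have "(\<integral>\<^sup>+x. ennreal (P x y) \<partial>lebesgue_on cell) = ennreal (integral\<^sup>L (lebesgue_on cell) (\<lambda>x. P x y))" by simp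
        also have "integral\<^sup>L (lebesgue_on cell) (\<lambda>x. P x y) = kern N z * om z"
          unfolding P_def om_def cell_integral_def k z_def[symmetric] by simp
        finally show ?thesis by (simp add: C_def nn_integral_cell_lborel)
      qed
      also have "kern N z * om z \<le> kern N (hh - y) * (r / 4) + e' * (2 * I)"
      proof (cases "norm z < d")
        case True
        then have "kern N z * om z \<le> kern N z * (r / 4)"
          by (intro mult_left_mono d kern_nonneg)
        moreover have "0 \<le> e' * (2 * I)" using e' I0 by simp
        ultimately show ?thesis unfolding k by linarith
      next
        case False
        then have "kern N z \<le> e'" using N0[OF N] zi by simp
        then have "kern N z * om z \<le> e' * (2 * I)"
          using om_le(1)[OF z1] e' kern_nonneg[of N z] by (intro mult_mono) (auto simp: om_def cell_integral_def)
        moreover have "0 \<le> kern N z * (r / 4)" using kern_nonneg[of N z] r by simp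
        ultimately show ?thesis unfolding k by linarith
      qed
      finally show "(\<integral>\<^sup>+x. ennreal (P x y) \<partial>C) \<le> ennreal (kern N (hh - y) * (r / 4) + e' * (2 * I))"
        by (simp add: ennreal_leI)
    qed
    also have "\<dots> = ennreal (cell_integral (\<lambda>y. kern N (hh - y) * (r / 4) + e' * (2 * I)))"
      unfolding C_def nn_integral_cell_lborel[symmetric] cell_integral_def
    proof (rule nn_integral_eq_integral)
      have "0 \<le> kern N (hh - y) * (r / 4) + e' * (2 * I)" for y
        using r e' I0 kern_nonneg[of N "hh - y"] by simp
      then show "AE y in lebesgue_on (cell :: (real ^ 'n) set). 0 \<le> kern N (hh - y) * (r / 4) + e' * (2 * I)" by simp
    qed (intro integrable_cell_continuous continuous_intros)
    also have "cell_integral (\<lambda>y. kern N (hh - y) * (r / 4) + e' * (2 * I)) = r / 4 + e' * (2 * I)"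
    proof -
      interpret finite_measure "lebesgue_on (cell :: (real ^ 'n) set)" by (rule cell_finite_measure)
      have "cell_integral (\<lambda>y. kern N (hh - y)) = 1" by (rule kern_integral_shift) (simp add: hh_def)
      moreover have "integrable (lebesgue_on cell) (\<lambda>y. kern N (hh - y))"
        by (intro integrable_cell_continuous continuous_intros)
      ultimately show ?thesis unfolding cell_integral_def by (simp add: measure_restrict_space)
    qed
    finally have "cell_integral (\<lambda>x. norm (conv N f x - f x)) \<le> r / 4 + e' * (2 * I)"
      using r e' I0 f continuous_borel_lebesgue[OF continuous_conv[OF int, of N]]
      by (intro measurable_cell_integral_bound)
        (auto intro!: borel_measurable_norm borel_measurable_diff measurable_restrict_space1)
    also have "\<dots> < r"
    proof -
      have "e' * (2 * I) \<le> r / 4" using I0 r by (simp add: e'_def divide_simps)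
      then show ?thesis using r by linarith
    qed
    finally show "norm (cell_integral (\<lambda>x. norm (conv N f x - f x)) - 0) < r"
      by (simp add: cell_integral_def)
  qed
qed

lemma AE_cell: "AE x in lebesgue. P x \<Longrightarrow> AE x in lebesgue_on (cell :: (real ^ 'n) set). P x"
  by (subst AE_restrict_space_iff) (auto elim: eventually_mono)

lemma cell_integral_cong_AE:
  fixes f g :: "real ^ 'n \<Rightarrow> 'b::euclidean_space"
  assumes "f \<in> borel_measurable lebesgue" "g \<in> borel_measurable lebesgue" "AE x in lebesgue. f x = g x"
  shows "cell_integral f = cell_integral g"
  unfolding cell_integral_def
  by (intro integral_cong_AE measurable_restrict_space1 AE_cell assms)

lemma periodic_cong_AE:
  fixes f g :: "real ^ 'n \<Rightarrow> 'b"
  assumes "periodic f" "AE x in lebesgue. f x = g x"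
  shows "periodic g"
  unfolding periodic_def
proof
  fix i
  have "AE x in lebesgue. f (x + axis i 1) = f x" using assms(1) by (simp add: periodic_def)
  with assms(2) AE_lebesgue_translate[OF assms(2), of "axis i 1"]
  show "AE x in lebesgue. g (x + axis i 1) = g x" by eventually_elim simp
qed

theorem conv_L1:
  fixes f :: "real ^ 'n \<Rightarrow> 'b::euclidean_space"
  assumes f: "f \<in> borel_measurable lebesgue" and per: "periodic f"
    and int: "integrable (lebesgue_on cell) f" and big: "integrable (lebesgue_on big) f"
  shows "(\<lambda>N. cell_integral (\<lambda>x. norm (conv N f x - f x))) \<longlonglongrightarrow> 0"
proof -
  obtain g where g: "g \<in> borel_measurable borel" and eq: "AE x in lebesgue. f x = g x"
    using borel_representative[OF f] by blast
  have gm: "g \<in> borel_measurable lebesgue" using g by (simp add: measurable_completion)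
  have on: "AE x in lebesgue_on S. f x = g x" if "S \<in> sets lebesgue" for S
    using eq that by (subst AE_restrict_space_iff) (auto elim: eventually_mono)
  have "integrable (lebesgue_on S) g" if "integrable (lebesgue_on S) f" "S \<in> sets lebesgue" for S
    using integrable_cong_AE[OF measurable_restrict_space1[OF f] measurable_restrict_space1[OF gm] on[OF that(2)]] that(1)
    by simp
  with int big have ig: "integrable (lebesgue_on cell) g" "integrable (lebesgue_on big) g" by auto
  have ce: "conv N f = conv N g" for N
  proof
    fix x :: "real ^ 'n"
    have "(\<lambda>y. kern N (x - y)) \<in> borel_measurable lebesgue"
      by (intro continuous_borel_lebesgue continuous_intros)
    then show "conv N f x = conv N g x"
      unfolding conv_def using f gm eq
      by (intro cell_integral_cong_AE) (auto elim: eventually_mono intro!: borel_measurable_scaleR)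
  qed
  have "cell_integral (\<lambda>x. norm (conv N f x - f x)) = cell_integral (\<lambda>x. norm (conv N g x - g x))" for N
    unfolding ce using f gm eq continuous_borel_lebesgue[OF continuous_conv[OF ig(1), of N]]
    by (intro cell_integral_cong_AE) (auto elim: eventually_mono intro!: borel_measurable_norm borel_measurable_diff)
  then show ?thesis
    using conv_L1_borel[OF g periodic_cong_AE[OF per eq] ig] by simp
qed

lemma conv_AE_subseq:
  fixes f :: "real ^ 'n \<Rightarrow> 'b::euclidean_space"
  assumes f: "f \<in> borel_measurable lebesgue" and per: "periodic f"
    and int: "integrable (lebesgue_on cell) f" and big: "integrable (lebesgue_on big) f"
  obtains r :: "nat \<Rightarrow> nat" where "strict_mono r" "AE x in lebesgue_on (cell :: (real ^ 'n) set). (\<lambda>k. conv (r k) f x) \<longlonglongrightarrow> f x"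
proof -
  have i: "integrable (lebesgue_on (cell :: (real ^ 'n) set)) (\<lambda>x. norm (conv N f x - f x))" for N
    using integrable_cell_continuous[OF continuous_conv[OF int]] int by simp
  have "\<exists>r::nat\<Rightarrow>nat. strict_mono r \<and> (AE x in lebesgue_on (cell :: (real ^ 'n) set). (\<lambda>k. norm (conv (r k) f x - f x)) \<longlonglongrightarrow> 0)"
    using conv_L1[OF assms] by (intro tendsto_L1_AE_subseq) (use i in \<open>auto simp: cell_integral_def\<close>)
  then obtain r :: "nat \<Rightarrow> nat" where r: "strict_mono r" "AE x in lebesgue_on (cell :: (real ^ 'n) set). (\<lambda>k. norm (conv (r k) f x - f x)) \<longlonglongrightarrow> 0"
    by blast
  from r(2) have "AE x in lebesgue_on (cell :: (real ^ 'n) set). (\<lambda>k. conv (r k) f x) \<longlonglongrightarrow> f x"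
    by eventually_elim (metis LIM_zero_cancel tendsto_norm_zero_cancel)
  with r(1) show ?thesis by (rule that)
qed

subsection \<open>Smooth bump functions\<close>

lemma Ck_mono1: "Ck (Suc k) f \<Longrightarrow> Ck k f"
proof (induction k arbitrary: f)
  case 0 then show ?case by (auto intro: differentiable_imp_continuous_on)
next
  case (Suc k) then show ?case by (subst Ck.simps) (auto simp del: Ck.simps simp: Ck.simps(2)[of "Suc k"])
qed

lemma Ck_continuous: "Ck k f \<Longrightarrow> continuous_on UNIV f"
  by (cases k) (auto intro: differentiable_imp_continuous_on)

lemma Ck_SucI:
  assumes "\<And>x. (f has_derivative f' x) (at x)" "\<And>i. Ck k (\<lambda>x. f' x (axis i 1))"
  shows "Ck (Suc k) f"
proof -
  have "frechet_derivative f (at x) = f' x" for x using assms(1) frechet_derivative_at by metis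
  moreover have "f differentiable_on UNIV"
    using assms(1) by (auto simp: differentiable_on_def differentiable_def)
  ultimately show ?thesis using assms(2) by simp
qed

lemma Ck_SucD:
  assumes "Ck (Suc k) f"
  shows "(f has_derivative frechet_derivative f (at x)) (at x)" "Ck k (\<lambda>x. frechet_derivative f (at x) (axis i 1))"
  using assms by (auto simp: differentiable_on_def frechet_derivative_works)

lemma Ck_const: "Ck k (\<lambda>x. c)"
proof (induction k arbitrary: c)
  case (Suc k)
  show ?case by (rule Ck_SucI[where f'="\<lambda>x h. 0"]) (auto intro: Suc)
qed simp

lemma Ck_add: "Ck k f \<Longrightarrow> Ck k g \<Longrightarrow> Ck k (\<lambda>x. f x + g x)"
proof (induction k arbitrary: f g)
  case 0 then show ?case by (auto intro: continuous_on_add)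
next
  case (Suc k)
  show ?case
    by (rule Ck_SucI[where f'="\<lambda>x h. frechet_derivative f (at x) h + frechet_derivative g (at x) h"])
      (auto intro!: has_derivative_add Suc.IH Ck_SucD[OF Suc.prems(1)] Ck_SucD[OF Suc.prems(2)])
qed

lemma Ck_mult: "Ck k f \<Longrightarrow> Ck k g \<Longrightarrow> Ck k (\<lambda>x. f x * g x)"
proof (induction k arbitrary: f g)
  case 0 then show ?case by (auto intro: continuous_on_mult)
next
  case (Suc k)
  show ?case
    by (rule Ck_SucI[where f'="\<lambda>x h. f x * frechet_derivative g (at x) h + frechet_derivative f (at x) h * g x"])
      (auto intro!: has_derivative_mult Ck_add Suc.IH Ck_SucD[OF Suc.prems(1)] Ck_SucD[OF Suc.prems(2)]
        Ck_mono1[OF Suc.prems(1)] Ck_mono1[OF Suc.prems(2)])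
qed

lemma Ck_prod: "(\<And>i. i \<in> I \<Longrightarrow> Ck k (f i)) \<Longrightarrow> Ck k (\<lambda>x. \<Prod>i\<in>I. f i x)"
  by (induction I rule: infinite_finite_induct) (auto intro: Ck_mult Ck_const)

text \<open>The family \<open>t\<^sup>-\<^sup>j exp (- 1/t)\<close>, extended by \<open>0\<close> to \<open>t \<le> 0\<close>, is closed under differentiation.\<close>

definition flat :: "nat \<Rightarrow> real \<Rightarrow> real" where
  "flat j t = (if 0 < t then (1 / t) ^ j * exp (- (1 / t)) else 0)"

lemma flat_bounds: "0 \<le> flat 0 t" "flat 0 t \<le> 1" "t \<le> 0 \<Longrightarrow> flat j t = 0"
  by (auto simp: flat_def)

text \<open>A single term of the series of \<open>exp (1 / t)\<close> already dominates
  \<open>(1 / t) ^ (j + 2)\<close> up to a factorial. Two powers beyond \<open>j\<close> are taken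
  so that \<open>flat j\<close> is of order \<open>t^2\<close> at the origin, and its difference
  quotient there tends to 0.\<close>

lemma flat_le: "0 < t \<Longrightarrow> flat j t \<le> fact (Suc (Suc j)) * t ^ 2"
proof -
  assume t: "0 < t"
  have "(1 / t) ^ (Suc (Suc j)) / fact (Suc (Suc j)) \<le> exp (1 / t)"
  proof -
    have s: "summable (\<lambda>n. (1 / t) ^ n /\<^sub>R fact n)" by (rule summable_exp_generic)
    have "sum (\<lambda>n. (1 / t) ^ n /\<^sub>R fact n) {Suc (Suc j)} \<le> suminf (\<lambda>n. (1 / t) ^ n /\<^sub>R fact n)"
      by (rule sum_le_suminf[OF s]) (use t in auto)
    then show ?thesis by (simp add: exp_def divide_inverse mult.commute)
  qed
  then have "(1 / t) ^ (Suc (Suc j)) \<le> fact (Suc (Suc j)) * exp (1 / t)"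
    by (simp add: pos_divide_le_eq mult.commute del: fact_Suc power_Suc)
  then have "(1 / t) ^ (Suc (Suc j)) * (exp (- (1 / t)) * t ^ 2) \<le> fact (Suc (Suc j)) * exp (1 / t) * (exp (- (1 / t)) * t ^ 2)"
    using t by (intro mult_right_mono) auto
  also have "\<dots> = fact (Suc (Suc j)) * t ^ 2 * (exp (1 / t) * exp (- (1 / t)))" by simp
  also have "exp (1 / t) * exp (- (1 / t)) = 1" by (simp flip: exp_add)
  also have "(1 / t) ^ (Suc (Suc j)) * (exp (- (1 / t)) * t ^ 2) = flat j t"
    using t by (simp add: flat_def power_divide field_simps power2_eq_square)
  finally show ?thesis by simp
qed

lemma flat_deriv: "(flat j has_real_derivative (flat (Suc (Suc j)) t - real j * flat (Suc j) t)) (at t)"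
proof -
  consider "t < 0" | "t = 0" | "0 < t" by linarith
  then show ?thesis
  proof cases
    case 1
    have "((\<lambda>t. 0) has_real_derivative 0) (at t)" by simp
    then have "(flat j has_real_derivative 0) (at t)"
      by (rule has_field_derivative_transform_within_open[of _ _ _ "{..<0}"]) (use 1 in \<open>auto simp: flat_def\<close>)
    then show ?thesis using 1 by (simp add: flat_def)
  next
    case 3
    have "((\<lambda>t. (1 / t) ^ j * exp (- (1 / t))) has_real_derivative
        (1 / t) ^ j * (exp (- (1 / t)) * (1 / t ^ 2)) + real j * (1 / t) ^ (j - 1) * (- (1 / t ^ 2)) * exp (- (1 / t))) (at t)"
      using 3 by (auto intro!: derivative_eq_intros simp: power2_eq_square)
    also have "(1 / t) ^ j * (exp (- (1 / t)) * (1 / t ^ 2)) + real j * (1 / t) ^ (j - 1) * (- (1 / t ^ 2)) * exp (- (1 / t))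
        = flat (Suc (Suc j)) t - real j * flat (Suc j) t"
      using 3 by (cases j) (auto simp: flat_def power_divide field_simps power2_eq_square)
    finally show ?thesis
      by (rule has_field_derivative_transform_within_open[of _ _ _ "{0<..}"]) (use 3 in \<open>auto simp: flat_def\<close>)
  next
    case 2
    have "(\<lambda>h. (flat j h - flat j 0) / h) \<midarrow>0\<rightarrow> 0"
    proof (rule Lim_null_comparison)
      have "norm ((flat j h - flat j 0) / h) \<le> fact (Suc (Suc j)) * \<bar>h\<bar>" for h
      proof (cases "0 < h")
        case True
        have "0 \<le> flat j h" using True by (simp add: flat_def)
        then have "norm ((flat j h - flat j 0) / h) = flat j h / h" using True by (simp add: flat_def)
        also have "\<dots> \<le> fact (Suc (Suc j)) * h ^ 2 / h" using flat_le[OF True, of j] True by (intro divide_right_mono) auto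
        finally show ?thesis using True by (simp add: power2_eq_square)
      next
        case False
        then have e: "(flat j h - flat j 0) / h = 0" by (simp add: flat_def)
        show ?thesis unfolding e by (simp del: fact_Suc)
      qed
      then show "\<forall>\<^sub>F h in at 0. norm ((flat j h - flat j 0) / h) \<le> fact (Suc (Suc j)) * \<bar>h\<bar>" by simp
      show "(\<lambda>h. fact (Suc (Suc j)) * \<bar>h\<bar>) \<midarrow>0\<rightarrow> (0::real)"
        by (rule tendsto_eq_intros refl | simp)+
    qed
    then have "(flat j has_real_derivative 0) (at 0)" by (simp add: DERIV_def)
    then show ?thesis using 2 by (simp add: flat_def)
  qed
qed

lemma Ck_flat: "Ck k (\<lambda>x :: real ^ 'n. flat j (a * x $ i + b))"
proof (induction k arbitrary: j)
  case 0
  have "continuous_on UNIV (flat j)"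
    using flat_deriv by (meson DERIV_isCont continuous_at_imp_continuous_on)
  then have "continuous_on UNIV (\<lambda>x :: real ^ 'n. flat j (a * x $ i + b))"
    by (rule continuous_on_compose2) (auto intro!: continuous_intros)
  then show ?case by simp
next
  case (Suc k)
  let ?D = "\<lambda>x :: real ^ 'n. flat (Suc (Suc j)) (a * x $ i + b) + (- real j) * flat (Suc j) (a * x $ i + b)"
  show ?case
  proof (rule Ck_SucI[where f'="\<lambda>x h. ?D x * (a * h $ i)"])
    fix x :: "real ^ 'n"
    have 1: "((\<lambda>x :: real ^ 'n. a * x $ i + b) has_derivative (\<lambda>h. a * h $ i)) (at x)"
      by (auto intro!: derivative_eq_intros bounded_linear.has_derivative[OF bounded_linear_vec_nth])
    have 2: "(flat j has_derivative (\<lambda>h. ?D x * h)) (at (a * x $ i + b))"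
      using flat_deriv[of j "a * x $ i + b"] by (simp add: has_field_derivative_def)
    show "((\<lambda>x. flat j (a * x $ i + b)) has_derivative (\<lambda>h. ?D x * (a * h $ i))) (at x)"
      using has_derivative_compose[OF 1 2] by simp
  next
    fix l
    show "Ck k (\<lambda>x. ?D x * (a * axis l 1 $ i))"
      by (intro Ck_mult Ck_add Suc Ck_const)
  qed
qed

lemma ee_has_derivative:
  "(ee l has_derivative (\<lambda>h. (2 * pi * (\<Sum>i\<in>UNIV. of_int (l $ i) * h $ i)) *\<^sub>R (\<i> * ee l x))) (at x)"
proof -
  have "((\<lambda>x. 2 * pi * (\<Sum>i\<in>UNIV. of_int (l $ i) * x $ i)) has_derivative
      (\<lambda>h. 2 * pi * (\<Sum>i\<in>UNIV. of_int (l $ i) * h $ i))) (at x)"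
    by (intro bounded_linear.has_derivative[OF bounded_linear_mult_right] has_derivative_sum
        bounded_linear.has_derivative[OF bounded_linear_vec_nth] has_derivative_ident)
  from has_derivative_cis[OF this] show ?thesis by (simp add: ee_def[abs_def])
qed

lemma Ck_trig: "Ck k (\<lambda>x. Re (c * ee l x))"
proof (induction k arbitrary: c)
  case 0 then show ?case by (auto intro!: continuous_intros)
next
  case (Suc k)
  note d = bounded_linear.has_derivative[OF bounded_linear_Re
      bounded_linear.has_derivative[OF bounded_linear_mult_right ee_has_derivative[of l]]]
  show ?case
  proof (rule Ck_SucI[OF d])
    fix i
    have "Re (c * (2 * pi * (\<Sum>j\<in>UNIV. of_int (l $ j) * axis i 1 $ j)) *\<^sub>R (\<i> * ee l x)) = Re ((c * (2 * pi * l $ i) * \<i>) * ee l x)" for x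
      by (simp add: axis_def if_distrib algebra_simps cong: if_cong)
    then show "Ck k (\<lambda>x. Re (c * (2 * pi * (\<Sum>j\<in>UNIV. of_int (l $ j) * axis i 1 $ j)) *\<^sub>R (\<i> * ee l x)))"
      using Suc[of "c * (2 * pi * l $ i) * \<i>"] by simp
  qed
qed

section \<open>Test functions in boxes and the fundamental lemma of the calculus of
  variations\<close>

definition bump :: "nat \<Rightarrow> real ^ 'n \<Rightarrow> real ^ 'n \<Rightarrow> real ^ 'n \<Rightarrow> real" where
  "bump m a b x = (\<Prod>i\<in>UNIV. flat 0 (real m * (x $ i - a $ i)) * flat 0 (real m * (b $ i - x $ i)))"

lemma Ck_bump: "Ck k (bump m a (b :: real ^ 'n))"
proof -
  have "Ck k (\<lambda>x :: real ^ 'n. flat 0 (real m * x $ i + - (real m * a $ i)) * flat 0 (- real m * x $ i + real m * b $ i))" for i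
    by (intro Ck_mult Ck_flat)
  then have "Ck k (\<lambda>x :: real ^ 'n. \<Prod>i\<in>UNIV. flat 0 (real m * x $ i + - (real m * a $ i)) * flat 0 (- real m * x $ i + real m * b $ i))"
    by (intro Ck_prod)
  then show ?thesis by (simp add: bump_def[abs_def] right_diff_distrib)
qed

lemma bump_bounds: "0 \<le> bump m a b x" "bump m a b x \<le> 1"
proof -
  have "0 \<le> flat 0 s * flat 0 t \<and> flat 0 s * flat 0 t \<le> 1" for s t
    using mult_mono[OF flat_bounds(2)[of s] flat_bounds(2)[of t]] flat_bounds(1)[of s] flat_bounds(1)[of t] by simp
  then show "0 \<le> bump m a b x" "bump m a b x \<le> 1"
    unfolding bump_def by (auto intro!: prod_nonneg prod_le_1)
qed

lemma bump_support: "x \<notin> box a b \<Longrightarrow> bump m a b x = 0"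
proof -
  assume "x \<notin> box a b"
  then obtain i where "x $ i \<le> a $ i \<or> b $ i \<le> x $ i" by (auto simp: mem_box_cart not_less)
  then have "flat 0 (real m * (x $ i - a $ i)) * flat 0 (real m * (b $ i - x $ i)) = 0"
    by (auto simp: flat_bounds(3) mult_nonneg_nonpos)
  then show ?thesis unfolding bump_def by (intro prod_zero) auto
qed

lemma bump_pos: "x \<in> box a b \<Longrightarrow> 0 < m \<Longrightarrow> 0 < bump m a b x"
  unfolding bump_def by (intro prod_pos) (auto simp: flat_def mem_box_cart)

lemma bump_tendsto: "(\<lambda>m. bump m a b x) \<longlonglongrightarrow> indicator (box a b) x"
proof (cases "x \<in> box a b")
  case True
  have "(\<lambda>m. flat 0 (real m * t)) \<longlonglongrightarrow> 1" if "0 < t" for t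
  proof -
    have "(\<lambda>m. exp (- ((1 / t) * (1 / real m)))) \<longlonglongrightarrow> exp (- ((1 / t) * 0))"
      by (intro tendsto_intros lim_1_over_n)
    moreover have "\<forall>\<^sub>F m in sequentially. exp (- ((1 / t) * (1 / real m))) = flat 0 (real m * t)"
      using eventually_gt_at_top[of 0] by eventually_elim (use that in \<open>simp add: flat_def mult.commute\<close>)
    ultimately show ?thesis by (simp add: tendsto_cong)
  qed
  then have "(\<lambda>m. bump m a b x) \<longlonglongrightarrow> (\<Prod>i\<in>(UNIV :: 'a set). 1 * 1)"
    unfolding bump_def using True by (intro tendsto_intros) (auto simp: mem_box_cart)
  then show ?thesis using True by simp
qed (simp add: bump_support)

lemma test_functionI:
  assumes "\<And>k. Ck k \<phi>" "\<And>x. x \<notin> cbox a b \<Longrightarrow> \<phi> x = 0"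
  shows "test_function \<phi>"
proof -
  have "bounded {x. \<phi> x \<noteq> 0}" by (rule bounded_subset[OF bounded_cbox[of a b]]) (use assms(2) in auto)
  then show ?thesis unfolding test_function_def using assms(1) by auto
qed

lemma test_bump_mult: "(\<And>k. Ck k \<psi>) \<Longrightarrow> test_function (\<lambda>x. \<psi> x * bump m a b x)"
proof (rule test_functionI[where a=a and b=b])
  fix x assume "x \<notin> cbox a b"
  then have "x \<notin> box a b" using box_subset_cbox[of a b] by blast
  then show "\<psi> x * bump m a b x = 0" by (simp add: bump_support)
qed (intro Ck_mult Ck_bump)

lemma test_bump: "test_function (bump m a b)"
  using test_bump_mult[of "\<lambda>x. 1"] by (simp add: Ck_const)

text \<open>Integrals over boxes determine an integrable function, since boxes are an intersection-stable
  generator of the Borel sets.\<close>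

lemma AE_zero_if_box_integrals:
  fixes w :: "real ^ 'n \<Rightarrow> real"
  assumes w: "integrable lborel w" and box: "\<And>a b. (LINT x|lborel. indicator (box a b) x * w x) = 0"
  shows "AE x in lborel. w x = 0"
proof -
  have wm [measurable]: "w \<in> borel_measurable borel" using w by (simp add: borel_measurable_integrable[simplified])
  have i: "integrable lborel (\<lambda>x. indicator A x * w x)" if "A \<in> sets borel" for A
    using integrable_real_mult_indicator[OF _ w, of A] that by (simp add: mult.commute)
  \<comment> \<open>The integral over the whole space is what the induction over Borel sets needs
    for complements; it is obtained by exhausting the space with boxes.\<close>
  have tot: "(LINT x|lborel. w x) = 0"
  proof -
    have "(\<lambda>m. LINT x|lborel. indicator (box (\<chi> i. - real m) (\<chi> i. real m)) x * w x) \<longlonglongrightarrow> (LINT x|lborel. w x)"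
    proof (rule integral_dominated_convergence[where w="\<lambda>x. norm (w x)"])
      show "AE x in lborel. (\<lambda>m. indicator (box (\<chi> i. - real m) (\<chi> i. real m)) x * w x) \<longlonglongrightarrow> w x"
      proof (rule AE_I2)
        fix x :: "real ^ 'n"
        obtain m0 :: nat where m0: "norm x < m0" using reals_Archimedean2 by blast
        have "\<forall>\<^sub>F m in sequentially. indicator (box (\<chi> i. - real m) (\<chi> i. real m)) x * w x = w x"
          unfolding eventually_sequentially
        proof (intro exI[of _ m0] allI impI)
          fix m assume "m0 \<le> m"
          then have "\<bar>x $ i\<bar> < real m" for i using component_le_norm_cart[of x i] m0 by linarith
          then have "x \<in> box (\<chi> i. - real m) (\<chi> i. real m)" by (auto simp: mem_box_cart abs_less_iff minus_less_iff)
          then show "indicator (box (\<chi> i. - real m) (\<chi> i. real m)) x * w x = w x" by simp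
        qed
        then show "(\<lambda>m. indicator (box (\<chi> i. - real m) (\<chi> i. real m)) x * w x) \<longlonglongrightarrow> w x"
          by (rule tendsto_eventually)
      qed
    qed (use w in \<open>auto split: split_indicator\<close>)
    then show ?thesis by (simp add: box LIMSEQ_const_iff)
  qed
  have all: "(LINT x|lborel. indicator A x * w x) = 0" if "A \<in> sets borel" for A
  proof -
    have A: "A \<in> sigma_sets UNIV (range (\<lambda>(a, b). box a b :: (real ^ 'n) set))"
      using that by (simp add: borel_eq_box)
    have st: "Int_stable (range (\<lambda>(a, b). box a b :: (real ^ 'n) set))"
      by (auto simp: Int_stable_def box_Int_box intro!: image_eqI)
    have "range (\<lambda>(a, b). box a b :: (real ^ 'n) set) \<subseteq> Pow UNIV" by simp
    from st this A show ?thesis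
    proof (induction rule: sigma_sets_induct_disjoint)
      case (basic A) then show ?case using box by auto
    next
      case empty then show ?case by simp
    next
      case (compl A)
      then have A: "A \<in> sets borel" by (simp add: borel_eq_box)
      have "(LINT x|lborel. indicator (UNIV - A) x * w x) = (LINT x|lborel. w x - indicator A x * w x)"
        by (intro Bochner_Integration.integral_cong) (auto split: split_indicator)
      then show ?case using w i[OF A] compl tot by simp
    next
      case (union A)
      then have A: "A j \<in> sets borel" for j by (auto simp: borel_eq_box)
      have "(LINT x:(\<Union>j. A j)|lborel. w x) = (\<Sum>j. (LINT x:A j|lborel. w x))"
        using union(1) A i[of "\<Union>j. A j"]
        by (intro lebesgue_integral_countable_add) (auto simp: disjoint_family_on_def set_integrable_def)
      then show ?case using union(3) by (simp add: set_lebesgue_integral_def)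
    qed
  qed
  have "AE x in lborel. w x = (\<lambda>_. 0) x"
    by (rule density_unique_real) (use w all in \<open>auto simp: set_lebesgue_integral_def\<close>)
  then show ?thesis by simp
qed

lemma locally_integrable_lborel_rep:
  assumes "locally_integrable u"
  shows "u \<in> borel_measurable lebesgue"
proof -
  have "(\<lambda>x. indicator (cball 0 (real m)) x *\<^sub>R u x) \<in> borel_measurable lebesgue" for m :: nat
  proof -
    have "integrable (lebesgue_on (cball 0 (real m))) u" using assms by (simp add: locally_integrable_def)
    then have "integrable lebesgue (\<lambda>x. indicator (cball 0 (real m)) x *\<^sub>R u x)"
      by (subst (asm) integrable_restrict_space) auto
    then show ?thesis by (rule borel_measurable_integrable)
  qed
  then show ?thesis
  proof (rule borel_measurable_LIMSEQ_metric)
    fix x :: "real ^ 'a"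
    obtain m0 :: nat where m0: "norm x < m0" using reals_Archimedean2 by blast
    have "\<forall>\<^sub>F m in sequentially. indicator (cball 0 (real m)) x *\<^sub>R u x = u x"
      unfolding eventually_sequentially by (intro exI[of _ m0] allI impI) (use m0 in auto)
    then show "(\<lambda>m. indicator (cball 0 (real m)) x *\<^sub>R u x) \<longlonglongrightarrow> u x" by (rule tendsto_eventually)
  qed
qed

text \<open>Bump functions of increasing steepness stay between 0 and 1, are supported in a fixed
  box and tend to its indicator, so the integrals of \<open>w\<close> over boxes vanish. Since
  \<open>w\<close> is only locally integrable, a Borel representative is cut off to large cubes;
  intersections of boxes with these cubes are again boxes, and the cubes exhaust the space.\<close>

lemma du_Bois_Reymond:
  fixes w :: "real ^ 'n \<Rightarrow> real"
  assumes w: "locally_integrable w" and z: "\<And>\<phi>. test_function \<phi> \<Longrightarrow> (LINT x|lebesgue. w x * \<phi> x) = 0"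
  shows "AE x in lebesgue. w x = 0"
proof -
  have wm [measurable]: "w \<in> borel_measurable lebesgue" by (rule locally_integrable_lborel_rep[OF w])
  have iK: "integrable lebesgue (\<lambda>x. indicator K x *\<^sub>R w x)" if "compact K" for K
    using w that by (subst integrable_restrict_space[symmetric]) (auto simp: locally_integrable_def compact_imp_closed)
  have bz: "(LINT x|lebesgue. indicator (box a b) x * w x) = 0" for a b
  proof -
    have "(\<lambda>m. LINT x|lebesgue. w x * bump m a b x) \<longlonglongrightarrow> (LINT x|lebesgue. w x * indicator (box a b) x)"
    proof (rule integral_dominated_convergence[where w="\<lambda>x. norm (indicator (cbox a b) x *\<^sub>R w x)"])
      show "integrable lebesgue (\<lambda>x. norm (indicator (cbox a b) x *\<^sub>R w x))"
        by (rule integrable_norm[OF iK]) simp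
      show "AE x in lebesgue. (\<lambda>m. w x * bump m a b x) \<longlonglongrightarrow> w x * indicator (box a b) x"
        by (intro AE_I2 tendsto_intros bump_tendsto)
      have "norm (w x * bump m a b x) \<le> norm (indicator (cbox a b) x *\<^sub>R w x)" for m x
        using bump_bounds[of m a b x] bump_support[of x a b m] box_subset_cbox[of a b]
        by (cases "x \<in> box a b") (auto simp: abs_mult mult_left_le)
      then show "AE x in lebesgue. norm (w x * bump m a b x) \<le> norm (indicator (cbox a b) x *\<^sub>R w x)" for m by simp
      have "bump m a b \<in> borel_measurable lebesgue" for m
        using continuous_borel_lebesgue[OF Ck_continuous[OF Ck_bump]] .
      then show "(\<lambda>x. w x * bump m a b x) \<in> borel_measurable lebesgue" for m by measurable
      have "(\<lambda>x. w x * indicator (box a b) x) \<in> borel_measurable lebesgue"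
        by (intro borel_measurable_times borel_measurable_indicator wm) simp
      then show "(\<lambda>x. w x * indicator (box a b) x) \<in> borel_measurable lebesgue" .
    qed
    then show ?thesis by (simp add: z[OF test_bump] LIMSEQ_const_iff mult.commute)
  qed
  obtain g where g: "g \<in> borel_measurable borel" and eq: "AE x in lebesgue. w x = g x"
    using borel_representative[OF wm] by blast
  have "AE x in lborel. indicator (box (\<chi> i. - real m) (\<chi> i. real m)) x * g x = 0" for m
  proof (rule AE_zero_if_box_integrals)
    let ?B = "box (\<chi> i. - real m) (\<chi> i. real m) :: (real ^ 'n) set"
    have gm: "g \<in> borel_measurable lebesgue" using g by (simp add: measurable_completion)
    have "integrable lebesgue (\<lambda>x. indicator (cbox (\<chi> i. - real m) (\<chi> i. real m)) x *\<^sub>R w x)"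
      by (rule iK) simp
    then have "integrable lebesgue (\<lambda>x. indicator ?B x * g x)"
    proof (rule Bochner_Integration.integrable_bound)
      show "AE x in lebesgue. norm (indicator ?B x * g x)
          \<le> norm (indicator (cbox (\<chi> i. - real m) (\<chi> i. real m)) x *\<^sub>R w x)"
        using eq by eventually_elim (auto split: split_indicator dest: box_subset_cbox[THEN subsetD])
      show "(\<lambda>x. indicator ?B x * g x) \<in> borel_measurable lebesgue"
        by (intro borel_measurable_times borel_measurable_indicator gm) simp
    qed
    then show "integrable lborel (\<lambda>x. indicator ?B x * g x)"
      using g by (subst (asm) integrable_completion) auto
    fix a b
    have "(LINT x|lborel. indicator (box a b) x * (indicator ?B x * g x))
       = (LINT x|lebesgue. indicator (box a b) x * (indicator ?B x * g x))"
      using g by (subst integral_completion) auto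
    also have "\<dots> = (LINT x|lebesgue. indicator (box a b \<inter> ?B) x * w x)"
    proof (rule integral_cong_AE)
      show "AE x in lebesgue. indicator (box a b) x * (indicator ?B x * g x) = indicator (box a b \<inter> ?B) x * w x"
        using eq by eventually_elim (auto split: split_indicator)
    qed (intro borel_measurable_times borel_measurable_indicator gm wm; simp)+
    also have "\<dots> = 0" unfolding Int_interval box_Int_box by (rule bz)
    finally show "(LINT x|lborel. indicator (box a b) x * (indicator ?B x * g x)) = 0" .
  qed
  then have "AE x in lebesgue. \<forall>m. indicator (box (\<chi> i. - real m) (\<chi> i. real m)) x * g x = 0"
    by (intro AE_all_countable[THEN iffD2] allI AE_completion)
  with eq show ?thesis
  proof eventually_elim
    case (elim x)
    obtain m :: nat where m: "norm x < m" using reals_Archimedean2 by blast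
    then have "\<bar>x $ i\<bar> < real m" for i using component_le_norm_cart[of x i] by linarith
    then have "x \<in> box (\<chi> i. - real m) (\<chi> i. real m)" by (auto simp: mem_box_cart abs_less_iff minus_less_iff)
    then show ?case using elim by (metis indicator_simps(1) mult_1)
  qed
qed

subsection \<open>Weak derivatives of periodic functions\<close>

lemma test_function_bounds:
  fixes \<phi> :: "real ^ 'n \<Rightarrow> real"
  assumes "test_function \<phi>"
  obtains R where "0 < R" "\<And>x. norm x \<ge> R \<Longrightarrow> \<phi> x = 0"
    "\<And>x i. norm x \<ge> R \<Longrightarrow> frechet_derivative \<phi> (at x) (axis i 1) = 0"
proof -
  have "bounded (closure {x. \<phi> x \<noteq> 0})" using assms by (auto simp: test_function_def compact_imp_bounded)
  then obtain R where R: "0 < R" "\<And>x. x \<in> closure {x. \<phi> x \<noteq> 0} \<Longrightarrow> norm x \<le> R" by (auto simp: bounded_pos)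
  have z: "\<phi> x = 0" if "norm x > R" for x using R(2)[of x] that closure_subset[of "{x. \<phi> x \<noteq> 0}"] by force
  show ?thesis
  proof
    \<comment> \<open>The extra 1 puts every \<open>x\<close> with \<open>norm x \<ge> R + 1\<close>
      into an open set on which \<open>\<phi>\<close> vanishes, so that its derivative vanishes
      there too.\<close>
    show "0 < R + 1" using R by simp
    show "norm x \<ge> R + 1 \<Longrightarrow> \<phi> x = 0" for x using z[of x] by simp
    fix x :: "real ^ 'n" and i assume x: "norm x \<ge> R + 1"
    have "((\<lambda>x. 0) has_derivative (\<lambda>h. 0 :: real)) (at x)" by simp
    then have "(\<phi> has_derivative (\<lambda>h. 0)) (at x)"
      by (rule has_derivative_transform_within_open[where s="{x. R < norm x}"])
        (use x z in \<open>auto intro!: open_Collect_less continuous_intros\<close>)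
    then show "frechet_derivative \<phi> (at x) (axis i 1) = 0"
      by (simp add: frechet_derivative_at[symmetric])
  qed
qed

lemma test_function_Ck: "test_function \<phi> \<Longrightarrow> Ck k \<phi>"
  by (simp add: test_function_def)

lemma test_function_mult: "test_function \<phi> \<Longrightarrow> (\<And>k. Ck k \<psi>) \<Longrightarrow> test_function (\<lambda>x. \<psi> x * \<phi> x)"
proof -
  assume a: "test_function \<phi>" "\<And>k. Ck k \<psi>"
  have "bounded {x. \<phi> x \<noteq> 0}" using a(1) by (simp add: test_function_def)
  then have "bounded {x. \<psi> x * \<phi> x \<noteq> 0}" by (rule bounded_subset) auto
  then show ?thesis using a by (simp add: test_function_def Ck_mult)
qed

lemma locally_integrable_mult_compact:
  assumes g: "locally_integrable g" and k: "continuous_on UNIV k" and z: "\<And>x. norm x \<ge> R \<Longrightarrow> k x = 0"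
  shows "integrable lebesgue (\<lambda>x. g x * k x)"
proof -
  have "compact (k ` cball 0 R)" by (intro compact_continuous_image continuous_on_subset[OF k]) auto
  then obtain B where B: "\<And>x. x \<in> cball 0 R \<Longrightarrow> norm (k x) \<le> B"
    using compact_imp_bounded bounded_iff by (metis imageI)
  have "integrable (lebesgue_on (cball 0 R)) g" using g by (simp add: locally_integrable_def)
  then have i: "integrable lebesgue (\<lambda>x. indicator (cball 0 R) x *\<^sub>R g x)"
    by (subst (asm) integrable_restrict_space) auto
  show ?thesis
  proof (rule Bochner_Integration.integrable_bound[of _ "\<lambda>x. B *\<^sub>R (indicator (cball 0 R) x *\<^sub>R g x)"])
    show "(\<lambda>x. g x * k x) \<in> borel_measurable lebesgue"
      by (intro borel_measurable_times locally_integrable_lborel_rep[OF g] continuous_borel_lebesgue[OF k])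
    have "norm (g x * k x) \<le> norm (B *\<^sub>R (indicator (cball 0 R) x *\<^sub>R g x))" for x
    proof (cases "norm x \<le> R")
      case True
      then have "\<bar>k x\<bar> \<le> \<bar>B\<bar>" using B[of x] by auto
      then have "\<bar>k x\<bar> * \<bar>g x\<bar> \<le> \<bar>B\<bar> * \<bar>g x\<bar>" by (intro mult_right_mono) auto
      then show ?thesis using True by (simp add: abs_mult mult.commute)
    qed (simp add: z)
    then show "AE x in lebesgue. norm (g x * k x) \<le> norm (B *\<^sub>R (indicator (cball 0 R) x *\<^sub>R g x))" by simp
  qed (use i in auto)
qed

lemma integrable_test_mult:
  assumes "locally_integrable g" "test_function \<phi>"
  shows "integrable lebesgue (\<lambda>x. g x * \<phi> x)"
    and "integrable lebesgue (\<lambda>x. g x * frechet_derivative \<phi> (at x) (axis i 1))"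
proof -
  obtain R where "0 < R" and R: "\<And>x. norm x \<ge> R \<Longrightarrow> \<phi> x = 0"
    "\<And>x i. norm x \<ge> R \<Longrightarrow> frechet_derivative \<phi> (at x) (axis i 1) = 0"
    using test_function_bounds[OF assms(2)] by metis
  have c: "continuous_on UNIV \<phi>" "continuous_on UNIV (\<lambda>x. frechet_derivative \<phi> (at x) (axis i 1))"
    using Ck_continuous[OF test_function_Ck[OF assms(2), of 0]]
      Ck_continuous[OF Ck_SucD(2)[OF test_function_Ck[OF assms(2), of 1, simplified One_nat_def]]] by auto
  show "integrable lebesgue (\<lambda>x. g x * \<phi> x)"
    by (rule locally_integrable_mult_compact[OF assms(1) c(1) R(1)])
  show "integrable lebesgue (\<lambda>x. g x * frechet_derivative \<phi> (at x) (axis i 1))"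
    by (rule locally_integrable_mult_compact[OF assms(1) c(2) R(2)])
qed

lemma locally_integrable_add: "locally_integrable u \<Longrightarrow> locally_integrable v \<Longrightarrow> locally_integrable (\<lambda>x. u x + v x)"
  by (simp add: locally_integrable_def)

lemma locally_integrable_cmult: "locally_integrable u \<Longrightarrow> locally_integrable (\<lambda>x. c * u x)"
  by (simp add: locally_integrable_def)

lemma has_weak_partial_add:
  assumes "has_weak_partial i u g" "has_weak_partial i v h"
  shows "has_weak_partial i (\<lambda>x. u x + v x) (\<lambda>x. g x + h x)"
proof -
  have l: "locally_integrable u" "locally_integrable g" "locally_integrable v" "locally_integrable h"
    using assms by (auto simp: has_weak_partial_def)
  have "(LINT x|lebesgue. (u x + v x) * frechet_derivative \<phi> (at x) (axis i 1)) = - (LINT x|lebesgue. (g x + h x) * \<phi> x)"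
    if \<phi>: "test_function \<phi>" for \<phi>
    using assms \<phi> l by (simp add: has_weak_partial_def distrib_right integrable_test_mult)
  with l show ?thesis by (simp add: has_weak_partial_def locally_integrable_add)
qed

lemma has_weak_partial_cmult:
  assumes "has_weak_partial i u g"
  shows "has_weak_partial i (\<lambda>x. c * u x) (\<lambda>x. c * g x)"
  using assms by (simp add: has_weak_partial_def locally_integrable_cmult mult.assoc)

lemma has_weak_partial_diff:
  assumes "has_weak_partial i u g" "has_weak_partial i v h"
  shows "has_weak_partial i (\<lambda>x. u x - v x) (\<lambda>x. g x - h x)"
  using has_weak_partial_add[OF assms(1) has_weak_partial_cmult[OF assms(2), of "-1"]] by simp

lemma has_weak_partial_unique:
  assumes "has_weak_partial i u g" "has_weak_partial i u h"
  shows "AE x in lebesgue. g x = h x"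
proof -
  have l: "locally_integrable g" "locally_integrable h"
    using assms by (auto simp: has_weak_partial_def)
  have "AE x in lebesgue. g x + (-1) * h x = 0"
  proof (rule du_Bois_Reymond)
    show "locally_integrable (\<lambda>x. g x + (-1) * h x)" using l by (intro locally_integrable_add locally_integrable_cmult)
    fix \<phi> :: "real ^ 'a \<Rightarrow> real" assume \<phi>: "test_function \<phi>"
    have "(LINT x|lebesgue. u x * frechet_derivative \<phi> (at x) (axis i 1)) = - (LINT x|lebesgue. g x * \<phi> x)"
      "(LINT x|lebesgue. u x * frechet_derivative \<phi> (at x) (axis i 1)) = - (LINT x|lebesgue. h x * \<phi> x)"
      using assms \<phi> by (simp_all add: has_weak_partial_def)
    then have "(LINT x|lebesgue. g x * \<phi> x) = (LINT x|lebesgue. h x * \<phi> x)" by simp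
    then show "(LINT x|lebesgue. (g x + (-1) * h x) * \<phi> x) = 0"
      using l \<phi> by (simp add: left_diff_distrib integrable_test_mult)
  qed
  then show ?thesis by eventually_elim simp
qed

lemma weak_partial_works:
  assumes "has_weak_partial i u g"
  shows "has_weak_partial i u (weak_partial i u)" "AE x in lebesgue. weak_partial i u x = g x"
proof -
  show "has_weak_partial i u (weak_partial i u)"
    unfolding weak_partial_def by (rule someI[of "has_weak_partial i u", OF assms])
  then show "AE x in lebesgue. weak_partial i u x = g x" using assms by (rule has_weak_partial_unique)
qed

lemma measurable_cong_AE_lebesgue:
  fixes f g :: "real ^ 'n \<Rightarrow> 'b::euclidean_space"
  assumes "f \<in> borel_measurable lebesgue" "AE x in lebesgue. f x = g x"
  shows "g \<in> borel_measurable lebesgue"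
  using borel_measurable_AE[OF assms] .

lemma AE_lebesgue_on: "S \<in> sets lebesgue \<Longrightarrow> AE x in lebesgue. P x \<Longrightarrow> AE x in lebesgue_on S. P (x :: real ^ 'n)"
  by (subst AE_restrict_space_iff) (auto elim: eventually_mono)

lemma locally_integrable_cong_AE:
  assumes "locally_integrable f" "AE x in lebesgue. f x = g x"
  shows "locally_integrable g"
proof -
  have m: "f \<in> borel_measurable lebesgue" by (rule locally_integrable_lborel_rep[OF assms(1)])
  have "integrable (lebesgue_on K) g" if "compact K" for K
    using integrable_cong_AE[OF measurable_restrict_space1[OF m] measurable_restrict_space1[OF measurable_cong_AE_lebesgue[OF m assms(2)]]
        AE_lebesgue_on[OF _ assms(2)], of K] assms(1) that
    by (simp add: locally_integrable_def compact_imp_closed)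
  then show ?thesis by (simp add: locally_integrable_def)
qed

lemma has_weak_partial_cong_AE:
  assumes "has_weak_partial i u g" "AE x in lebesgue. u x = v x" "AE x in lebesgue. g x = h x"
  shows "has_weak_partial i v h"
proof -
  have l: "locally_integrable u" "locally_integrable g" using assms by (auto simp: has_weak_partial_def)
  have l': "locally_integrable v" "locally_integrable h"
    using locally_integrable_cong_AE[OF l(1) assms(2)] locally_integrable_cong_AE[OF l(2) assms(3)] .
  have "(LINT x|lebesgue. v x * frechet_derivative \<phi> (at x) (axis i 1)) = - (LINT x|lebesgue. h x * \<phi> x)"
    if \<phi>: "test_function \<phi>" for \<phi>
  proof -
    have "(LINT x|lebesgue. v x * frechet_derivative \<phi> (at x) (axis i 1)) = (LINT x|lebesgue. u x * frechet_derivative \<phi> (at x) (axis i 1))"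
      by (rule integral_cong_AE)
        (use integrable_test_mult[OF l(1) \<phi>] integrable_test_mult[OF l'(1) \<phi>] assms(2) in \<open>auto elim: eventually_mono\<close>)
    moreover have "(LINT x|lebesgue. h x * \<phi> x) = (LINT x|lebesgue. g x * \<phi> x)"
      by (rule integral_cong_AE)
        (use integrable_test_mult[OF l(2) \<phi>] integrable_test_mult[OF l'(2) \<phi>] assms(3) in \<open>auto elim: eventually_mono\<close>)
    ultimately show ?thesis using assms(1) \<phi> by (simp add: has_weak_partial_def)
  qed
  with l' show ?thesis by (simp add: has_weak_partial_def)
qed

lemma axis_add: "axis i (a + b :: real) = axis i a + axis i b"
  by (simp add: axis_def vec_eq_iff)

lemma axis_scale: "axis i (a :: real) = a *\<^sub>R axis i 1"
  by (simp add: axis_def vec_eq_iff)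

lemma has_derivative_axis:
  fixes f :: "real ^ 'n \<Rightarrow> real"
  assumes "(f has_derivative f') (at (x + axis i t))"
  shows "((\<lambda>t. f (x + axis i t)) has_real_derivative f' (axis i 1)) (at t)"
proof -
  have 1: "((\<lambda>t. x + axis i t) has_derivative (\<lambda>h. h *\<^sub>R axis i 1)) (at t)"
    unfolding axis_scale[of i t] by (subst axis_scale) (auto intro!: derivative_eq_intros)
  have l: "linear f'" using assms by (rule has_derivative_linear)
  from has_derivative_compose[OF 1 assms]
  have "((\<lambda>t. f (x + axis i t)) has_derivative (\<lambda>h. h * f' (axis i 1))) (at t)"
    by (simp add: linear_cmul[OF l])
  then show ?thesis by (simp add: has_field_derivative_def mult.commute[of _ "f' (axis i 1)"])
qed

lemma locally_integrable_continuous: "continuous_on UNIV f \<Longrightarrow> locally_integrable f"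
proof -
  assume f: "continuous_on UNIV f"
  have "integrable (lebesgue_on K) f" if K: "compact K" for K
  proof -
    interpret finite_measure "lebesgue_on K"
      using K by (intro finite_measure_lebesgue_on lmeasurable_compact)
    have "compact (f ` K)" using K f by (intro compact_continuous_image) (auto intro: continuous_on_subset)
    then obtain B where "\<And>x. x \<in> K \<Longrightarrow> norm (f x) \<le> B"
      using compact_imp_bounded bounded_iff by (metis imageI)
    then show ?thesis
      by (intro integrable_const_bound[of _ B] AE_I2 measurable_restrict_space1 continuous_borel_lebesgue f) auto
  qed
  then show ?thesis by (simp add: locally_integrable_def)
qed

text \<open>Difference quotients in direction \<open>i\<close> have integral 0 by translation
  invariance. They converge pointwise to the derivative and, by the mean value theorem, are
  dominated by a multiple of the indicator of a ball whose radius allows for shifts of length at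
  most 1.\<close>

lemma test_function_integral_partial:
  fixes f :: "real ^ 'n \<Rightarrow> real"
  assumes f: "test_function f"
  shows "(LINT x|lebesgue. frechet_derivative f (at x) (axis i 1)) = 0"
proof -
  define D where "D x = frechet_derivative f (at x) (axis i 1)" for x
  obtain R where R0: "0 < R" and R: "\<And>x. norm x \<ge> R \<Longrightarrow> f x = 0" "\<And>x. norm x \<ge> R \<Longrightarrow> D x = 0"
    using test_function_bounds[OF f] unfolding D_def by metis
  have C1: "Ck (Suc 0) f" by (rule test_function_Ck[OF f])
  have cD: "continuous_on UNIV D" unfolding D_def using Ck_SucD(2)[OF C1] by simp
  have cf: "continuous_on UNIV f" by (rule Ck_continuous[OF C1])
  have der: "((\<lambda>t. f (x + axis i t)) has_real_derivative D (x + axis i t)) (at t)" for x t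
    unfolding D_def by (rule has_derivative_axis[OF Ck_SucD(1)[OF C1]])
  have "compact (D ` cball 0 R)" by (intro compact_continuous_image continuous_on_subset[OF cD]) auto
  then obtain B where B: "\<And>x. x \<in> cball 0 R \<Longrightarrow> norm (D x) \<le> B"
    using compact_imp_bounded bounded_iff by (metis imageI)
  have B0: "0 \<le> B" using B[of 0] R0 norm_ge_zero[of "D 0"] by (simp del: norm_ge_zero)
  have BD: "\<bar>D x\<bar> \<le> B" for x using B[of x] R(2)[of x] B0 by (cases "norm x \<le> R") auto
  let ?h = "\<lambda>m x. real (Suc m) * (f (x + axis i (1 / real (Suc m))) - f x)"
  have fi: "integrable lebesgue f"
  proof -
    have "locally_integrable (\<lambda>x :: real ^ 'n. 1)"
      by (intro locally_integrable_continuous continuous_intros)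
    from integrable_test_mult(1)[OF this f] show ?thesis by simp
  qed
  have fm: "f \<in> borel_measurable lebesgue" using fi by (rule borel_measurable_integrable)
  have h0: "(LINT x|lebesgue. ?h m x) = 0" for m
    using fi lebesgue_integral_translate[OF fm, of "axis i (1 / real (Suc m))"] by (simp del: of_nat_Suc)
  have "(\<lambda>m. LINT x|lebesgue. ?h m x) \<longlonglongrightarrow> (LINT x|lebesgue. D x)"
  proof (rule integral_dominated_convergence[where w="\<lambda>x. B * indicator (cball 0 (R + 1)) x"])
    show "integrable lebesgue (\<lambda>x :: real ^ 'n. B * indicator (cball 0 (R + 1)) x)"
      by (intro integrable_mult_right integrable_real_indicator)
        (use lmeasurable_cball[of "0 :: real ^ 'n" "R + 1"] in \<open>auto simp: fmeasurable_def\<close>)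
    show "AE x in lebesgue. (\<lambda>m. ?h m x) \<longlonglongrightarrow> D x"
    proof (rule AE_I2)
      fix x
      have "(\<lambda>h. (f (x + axis i (0 + h)) - f (x + axis i 0)) / h) \<midarrow>0\<rightarrow> D (x + axis i 0)"
        using der[of x 0] by (simp only: DERIV_def)
      then have lim: "(\<lambda>h. (f (x + axis i h) - f x) / h) \<midarrow>0\<rightarrow> D x" by (simp add: axis_scale[of i 0])
      have "filterlim (\<lambda>m. 1 / real (Suc m)) (at 0) sequentially"
        unfolding filterlim_at using LIMSEQ_inverse_real_of_nat by (simp add: inverse_eq_divide)
      from filterlim_compose[OF lim this] show "(\<lambda>m. ?h m x) \<longlonglongrightarrow> D x" by (simp add: field_simps)
    qed
    show "AE x in lebesgue. norm (?h m x) \<le> B * indicator (cball 0 (R + 1)) x" for m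
    proof (rule AE_I2)
      fix x :: "real ^ 'n"
      define s where "s = 1 / real (Suc m)"
      have s: "0 < s" "s \<le> 1" by (auto simp: s_def)
      have ns: "norm (axis i s) \<le> 1" using s by (simp add: axis_scale[of i s] norm_axis_1)
      show "norm (?h m x) \<le> B * indicator (cball 0 (R + 1)) x"
      proof (cases "norm x \<le> R + 1")
        case False
        have "norm x \<le> norm (x + axis i s) + norm (axis i s)"
          using norm_triangle_ineq4[of "x + axis i s" "axis i s"] by simp
        then have "norm (x + axis i s) \<ge> R" using False ns by linarith
        then have "f (x + axis i s) = 0" "f x = 0" using R(1) False by auto
        then show ?thesis using False by (simp add: s_def[symmetric] del: of_nat_Suc)
      next
        case True
        obtain z where z: "f (x + axis i s) - f (x + axis i 0) = (s - 0) * D (x + axis i z)"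
          using MVT2[OF s(1), of "\<lambda>t. f (x + axis i t)" "\<lambda>t. D (x + axis i t)"] der by blast
        have "?h m x = D (x + axis i z)"
          using z unfolding s_def[symmetric] by (simp add: axis_scale[of i 0]) (simp add: s_def)
        then show ?thesis using True BD by simp
      qed
    qed
    show "D \<in> borel_measurable lebesgue" by (rule continuous_borel_lebesgue[OF cD])
    show "?h m \<in> borel_measurable lebesgue" for m
      using lebesgue_measurable_translate[OF fm] fm by measurable
  qed
  then show ?thesis unfolding h0 D_def by (simp add: LIMSEQ_const_iff)
qed

lemma frechet_derivative_product:
  assumes "\<And>k. Ck k \<psi>" "\<And>k. Ck k \<phi>"
  shows "frechet_derivative (\<lambda>x. \<psi> x * \<phi> x) (at x) h = \<psi> x * frechet_derivative \<phi> (at x) h + frechet_derivative \<psi> (at x) h * \<phi> x"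
proof -
  have "((\<lambda>x. \<psi> x * \<phi> x) has_derivative (\<lambda>h. \<psi> x * frechet_derivative \<phi> (at x) h + frechet_derivative \<psi> (at x) h * \<phi> x)) (at x)"
    using assms by (intro has_derivative_mult Ck_SucD(1)) auto
  from frechet_derivative_at[OF this, symmetric] show ?thesis by simp
qed

lemma has_weak_partial_smooth:
  assumes "\<And>k. Ck k \<psi>"
  shows "has_weak_partial i \<psi> (\<lambda>x. frechet_derivative \<psi> (at x) (axis i 1))"
proof -
  have c: "continuous_on UNIV \<psi>" "continuous_on UNIV (\<lambda>x. frechet_derivative \<psi> (at x) (axis i 1))"
    using Ck_continuous[OF assms[of 0]] Ck_continuous[OF Ck_SucD(2)[OF assms[of "Suc 0"]]] by auto
  have l: "locally_integrable \<psi>" "locally_integrable (\<lambda>x. frechet_derivative \<psi> (at x) (axis i 1))"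
    using c by (auto intro: locally_integrable_continuous)
  have "(LINT x|lebesgue. \<psi> x * frechet_derivative \<phi> (at x) (axis i 1))
      = - (LINT x|lebesgue. frechet_derivative \<psi> (at x) (axis i 1) * \<phi> x)" if \<phi>: "test_function \<phi>" for \<phi>
    using test_function_integral_partial[OF test_function_mult[OF \<phi> assms], of i]
      integrable_test_mult[OF l(1) \<phi>] integrable_test_mult[OF l(2) \<phi>]
    by (simp add: frechet_derivative_product[OF assms test_function_Ck[OF \<phi>]])
  with l show ?thesis by (simp add: has_weak_partial_def)
qed

lemma integrable_cell_locally_integrable: "locally_integrable f \<Longrightarrow> integrable (lebesgue_on cell) f"
  for f :: "real ^ 'n \<Rightarrow> real"
proof -
  assume l: "locally_integrable f"
  then have "integrable (lebesgue_on (cbox 0 1)) f" by (simp add: locally_integrable_def)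
  then have i: "integrable lebesgue (\<lambda>x. indicator (cbox 0 1) x *\<^sub>R f x)"
    by (subst (asm) integrable_restrict_space) auto
  have "integrable lebesgue (\<lambda>x. indicator cell x *\<^sub>R f x)"
  proof (rule Bochner_Integration.integrable_bound[OF i])
    show "(\<lambda>x. indicator cell x *\<^sub>R f x) \<in> borel_measurable lebesgue"
      by (intro borel_measurable_scaleR borel_measurable_indicator locally_integrable_lborel_rep[OF l]) simp
    show "AE x in lebesgue. norm (indicator cell x *\<^sub>R f x) \<le> norm (indicator (cbox 0 1) x *\<^sub>R f x)"
      using box_subset_cbox[of "0 :: real ^ 'n" 1] by (intro AE_I2) (auto simp: cell_eq_box split: split_indicator)
  qed
  then show ?thesis by (simp add: integrable_cell_iff)
qed

text \<open>Averaging over all translates \<open>y\<close> decouples the two factors: by Fubini's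
  theorem the integral over \<open>y\<close> is taken first, and periodicity makes it independent of
  \<open>x\<close>. A Borel representative of \<open>H\<close> supplies the joint
  measurability.\<close>

lemma cell_convolution_integral:
  fixes H k :: "real ^ 'n \<Rightarrow> real"
  assumes H: "H \<in> borel_measurable lebesgue" and per: "periodic H"
    and int: "integrable (lebesgue_on cell) H" and k: "continuous_on UNIV k"
  shows "cell_integral (\<lambda>y. cell_integral (\<lambda>x. H (x + y) * k x)) = cell_integral k * cell_integral H"
    and "integrable (lebesgue_on cell) (\<lambda>y. cell_integral (\<lambda>x. H (x + y) * k x))"
proof -
  obtain g where gb: "g \<in> borel_measurable borel" and eq: "AE x in lebesgue. H x = g x"
    using borel_representative[OF H] by blast
  have g: "g \<in> borel_measurable lebesgue" using gb by (simp add: measurable_completion)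
  have gp: "periodic g" by (rule periodic_cong_AE[OF per eq])
  have gi: "integrable (lebesgue_on cell) g"
    using integrable_cong_AE[OF measurable_restrict_space1[OF H] measurable_restrict_space1[OF g] AE_cell[OF eq]] int by simp
  have km: "k \<in> borel_measurable lebesgue" by (rule continuous_borel_lebesgue[OF k])
  have inner: "cell_integral (\<lambda>x. H (x + y) * k x) = cell_integral (\<lambda>x. g (x + y) * k x)" for y
    using AE_lebesgue_translate[OF eq, of y] lebesgue_measurable_translate[OF H, of y] lebesgue_measurable_translate[OF g, of y] km
    by (intro cell_integral_cong_AE) (auto elim: eventually_mono)
  define C where "C = restrict_space lborel (cell :: (real ^ 'n) set)"
  have C: "space C = cell" by (simp add: C_def space_restrict_space)
  have CL: "cell_integral f = integral\<^sup>L C f" if "f \<in> borel_measurable borel" for f :: "real ^ 'n \<Rightarrow> real"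
    unfolding cell_integral_indicator C_def using that
    by (subst integral_restrict_space) (auto simp: integral_completion)
  have CI: "integrable (lebesgue_on cell) f \<longleftrightarrow> integrable C f" if "f \<in> borel_measurable borel" for f :: "real ^ 'n \<Rightarrow> real"
    unfolding integrable_cell_iff C_def using that
    by (simp add: integrable_restrict_space integrable_completion)
  have fC: "finite_measure C"
  proof (rule finite_measureI)
    have "emeasure lborel (cell :: (real ^ 'n) set) = emeasure lebesgue (cell :: (real ^ 'n) set)"
      by (simp del: emeasure_cell)
    then show "emeasure C (space C) \<noteq> \<infinity>"
      by (simp add: C) (simp add: C_def emeasure_restrict_space)
  qed
  then interpret pair_sigma_finite C C
    by (simp add: pair_sigma_finite_def finite_measure.axioms(1))
  have kb [measurable]: "k \<in> borel_measurable borel" by (rule borel_measurable_continuous_onI[OF k])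
  note gb [measurable]
  have mP: "(\<lambda>(x, y). g (x + y) * k x) \<in> borel_measurable (C \<Otimes>\<^sub>M C)"
  proof -
    have "(\<lambda>z. g (fst z + snd z) * k (fst z)) \<in> borel_measurable (borel \<Otimes>\<^sub>M borel)" by measurable
    moreover have "(\<lambda>z. z) \<in> C \<Otimes>\<^sub>M C \<rightarrow>\<^sub>M borel \<Otimes>\<^sub>M (borel :: (real ^ 'n) measure)"
    proof -
      have "(\<lambda>x. x) \<in> C \<rightarrow>\<^sub>M borel" unfolding C_def by (intro measurable_restrict_space1) simp
      then show ?thesis
        using measurable_compose[OF measurable_fst, of "\<lambda>x. x" C borel C]
          measurable_compose[OF measurable_snd, of "\<lambda>x. x" C borel C]
        by (simp add: measurable_pair_iff comp_def)
    qed
    ultimately have "(\<lambda>z. g (fst z + snd z) * k (fst z)) \<in> borel_measurable (C \<Otimes>\<^sub>M C)"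
      by (rule measurable_compose[rotated])
    then show ?thesis by (simp add: case_prod_unfold)
  qed
  have x1: "\<bar>x $ i\<bar> \<le> 1" if "x \<in> cell" for x :: "real ^ 'n" and i
    using that by (auto simp: cell_def abs_le_iff less_imp_le)
  have sh: "integrable (lebesgue_on cell) (\<lambda>y. f (x + y))" "cell_integral (\<lambda>y. f (x + y)) = cell_integral f"
    if "x \<in> cell" "f \<in> borel_measurable borel" "periodic f" "integrable (lebesgue_on cell) f"
    for f :: "real ^ 'n \<Rightarrow> real" and x
    using cell_integral_shift[of f x] that x1[OF that(1)] by (auto simp: add.commute measurable_completion)
  define ng where "ng x = norm (g x)" for x
  have ng: "ng \<in> borel_measurable borel" "periodic ng" "integrable (lebesgue_on cell) ng"
    "\<And>x. norm (g x) = ng x"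
  proof -
    show "periodic ng"
      unfolding periodic_def ng_def
    proof
      fix i
      have "AE x in lebesgue. g (x + axis i 1) = g x" using gp by (simp add: periodic_def)
      then show "AE x in lebesgue. norm (g (x + axis i 1)) = norm (g x)" by eventually_elim simp
    qed
  qed (use gb gi in \<open>auto simp: ng_def[abs_def]\<close>)
  have sC: "integrable C (\<lambda>y. f (x + y))" "(LINT y|C. f (x + y)) = cell_integral f"
    if "x \<in> cell" and f: "f \<in> borel_measurable borel" "periodic f" "integrable (lebesgue_on cell) f"
    for f :: "real ^ 'n \<Rightarrow> real" and x
  proof -
    have "(\<lambda>y. f (x + y)) \<in> borel_measurable borel" using f(1) by measurable
    then show "integrable C (\<lambda>y. f (x + y))" "(LINT y|C. f (x + y)) = cell_integral f"
      using sh[OF that] CI CL by auto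
  qed
  have iP: "integrable (C \<Otimes>\<^sub>M C) (\<lambda>(x, y). g (x + y) * k x)"
  proof (rule Fubini_integrable[OF mP])
    have "integrable C (\<lambda>x. \<bar>k x\<bar> * cell_integral ng)"
      using k by (subst CI[symmetric]) (auto intro!: integrable_cell_continuous continuous_intros)
    moreover have "(LINT y|C. norm (case (x, y) of (x, y) \<Rightarrow> g (x + y) * k x)) = \<bar>k x\<bar> * cell_integral ng" if "x \<in> space C" for x
      using sC(2)[of x ng] that ng by (simp add: abs_mult C mult.commute)
    ultimately show "integrable C (\<lambda>x. LINT y|C. norm (case (x, y) of (x, y) \<Rightarrow> g (x + y) * k x))"
      by (simp cong: Bochner_Integration.integrable_cong)
    show "AE x in C. integrable C (\<lambda>y. case (x, y) of (x, y) \<Rightarrow> g (x + y) * k x)"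
      using sC(1)[of _ g] gb gp gi by (intro AE_I2) (simp add: C)
  qed
  have mI: "(\<lambda>y. LINT x|C. g (x + y) * k x) \<in> borel_measurable borel"
  proof -
    have "(\<lambda>(y, x). g (x + y) * k x) \<in> borel_measurable (borel \<Otimes>\<^sub>M C)"
    proof -
      have "(\<lambda>z. g (snd z + fst z) * k (snd z)) \<in> borel_measurable (borel \<Otimes>\<^sub>M borel)" by measurable
      moreover have "(\<lambda>z. z) \<in> borel \<Otimes>\<^sub>M C \<rightarrow>\<^sub>M borel \<Otimes>\<^sub>M (borel :: (real ^ 'n) measure)"
      proof -
        have "(\<lambda>x. x) \<in> C \<rightarrow>\<^sub>M borel" unfolding C_def by (intro measurable_restrict_space1) simp
        then show ?thesis
          using measurable_compose[OF measurable_snd, of "\<lambda>x. x" C borel borel]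
          by (simp add: measurable_pair_iff comp_def)
      qed
      ultimately have "(\<lambda>z. g (snd z + fst z) * k (snd z)) \<in> borel_measurable (borel \<Otimes>\<^sub>M C)"
        by (rule measurable_compose[rotated])
      then show ?thesis by (simp add: case_prod_unfold)
    qed
    from sigma_finite_measure.borel_measurable_lebesgue_integral[OF finite_measure.axioms(1)[OF fC] this]
    show ?thesis by simp
  qed
  have inn: "cell_integral (\<lambda>x. g (x + y) * k x) = (LINT x|C. g (x + y) * k x)" for y
    by (rule CL) measurable
  have "integrable C (\<lambda>y. LINT x|C. g (x + y) * k x)"
    using integrable_snd[OF iP] by simp
  then show "integrable (lebesgue_on cell) (\<lambda>y. cell_integral (\<lambda>x. H (x + y) * k x))"
    unfolding inner inn using CI[OF mI] by simp
  have "cell_integral (\<lambda>y. cell_integral (\<lambda>x. H (x + y) * k x)) = (LINT y|C. LINT x|C. g (x + y) * k x)"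
    unfolding inner inn by (rule CL[OF mI])
  also have "\<dots> = (LINT x|C. LINT y|C. g (x + y) * k x)"
    using Fubini_integral[OF iP] by simp
  also have "\<dots> = (LINT x|C. k x * cell_integral g)"
    using sC(2)[of _ g] gb gp gi by (intro Bochner_Integration.integral_cong) (auto simp: C mult.commute)
  also have "\<dots> = cell_integral k * cell_integral g"
    by (simp add: CL[OF kb])
  also have "cell_integral g = cell_integral H"
    by (rule cell_integral_cong_AE[OF g H]) (use eq in \<open>auto elim: eventually_mono\<close>)
  finally show "cell_integral (\<lambda>y. cell_integral (\<lambda>x. H (x + y) * k x)) = cell_integral k * cell_integral H" .
qed

lemma bump_translate: "bump m (a + y) (b + y) x = bump m a b (x - y)"
  by (simp add: bump_def algebra_simps)

lemma frechet_derivative_translate: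
  fixes f :: "real ^ 'n \<Rightarrow> real"
  assumes "f differentiable (at (x - y))"
  shows "frechet_derivative (\<lambda>x. f (x - y)) (at x) = frechet_derivative f (at (x - y))"
proof -
  have "((\<lambda>x. f (x - y)) has_derivative frechet_derivative f (at (x - y))) (at x)"
  proof -
    have "((\<lambda>x. x - y) has_derivative (\<lambda>h. h)) (at x)" by (auto intro!: derivative_eq_intros)
    from has_derivative_compose[OF this] assms show ?thesis by (auto simp: frechet_derivative_works)
  qed
  then show ?thesis by (metis frechet_derivative_at)
qed

lemma cell_integral_support:
  fixes f :: "real ^ 'n \<Rightarrow> real"
  assumes "\<And>x. x \<notin> cell \<Longrightarrow> f x = 0"
  shows "(LINT x|lebesgue. f x) = cell_integral f"
  unfolding cell_integral_indicator
  by (rule Bochner_Integration.integral_cong) (use assms in \<open>auto split: split_indicator\<close>)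

text \<open>Testing with \<open>\<psi>\<close> times a translated bump function and averaging over all translations turns the
  compactly supported test functions into the periodic test function \<open>\<psi>\<close>.\<close>

lemma periodic_weak_partial:
  fixes u :: "real ^ 'n \<Rightarrow> real"
  assumes wp: "has_weak_partial i u g" and pu: "periodic u" and pg: "periodic g"
    and psi: "\<And>k. Ck k \<psi>" "periodic \<psi>" "periodic (\<lambda>x. frechet_derivative \<psi> (at x) (axis i 1))"
  shows "cell_integral (\<lambda>x. u x * frechet_derivative \<psi> (at x) (axis i 1)) = - cell_integral (\<lambda>x. g x * \<psi> x)"
proof -
  define th :: "real ^ 'n \<Rightarrow> real" where "th = bump 1 0 1"
  define D where "D x = frechet_derivative th (at x) (axis i 1)" for x
  define dp where "dp x = frechet_derivative \<psi> (at x) (axis i 1)" for x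
  have l: "locally_integrable u" "locally_integrable g" using wp by (auto simp: has_weak_partial_def)
  have Cth: "Ck k th" for k unfolding th_def by (rule Ck_bump)
  have cth: "continuous_on UNIV th" "continuous_on UNIV D" "continuous_on UNIV \<psi>" "continuous_on UNIV dp"
    unfolding D_def dp_def using Ck_continuous[OF Cth[of 0]] Ck_continuous[OF Ck_SucD(2)[OF Cth[of "Suc 0"]]]
      Ck_continuous[OF psi(1)[of 0]] Ck_continuous[OF Ck_SucD(2)[OF psi(1)[of "Suc 0"]]] by auto
  have th0: "th x = 0" if "x \<notin> cell" for x using that bump_support[of x 0 1 1] by (simp add: th_def cell_eq_box)
  have th_nn: "0 \<le> th x" for x by (simp add: th_def bump_bounds)
  \<comment> \<open>The function \<open>th\<close> is nonnegative everywhere and zero off the open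
    cell, so each point off the cell, including its boundary, is a minimum of \<open>th\<close>
    along the line in direction \<open>i\<close>.\<close>
  have D0: "D x = 0" if "x \<notin> cell" for x
  proof -
    have "((\<lambda>t. th (x + axis i t)) has_real_derivative D x) (at 0)"
      using has_derivative_axis[OF Ck_SucD(1)[OF Cth[of "Suc 0"]], of x i 0] by (simp add: D_def axis_scale[of i 0])
    moreover have "th (x + axis i 0) \<le> th (x + axis i t)" for t
      using th0[OF that] th_nn by (simp add: axis_scale[of i 0])
    ultimately show ?thesis by (intro DERIV_local_min[of "\<lambda>t. th (x + axis i t)" "D x" 0 1]) auto
  qed
  define H1 where "H1 x = u x * \<psi> x" for x
  define H2 where "H2 x = u x * dp x + g x * \<psi> x" for x
  have lm: "locally_integrable (\<lambda>x. f x * k x)" if f: "locally_integrable f" and k: "continuous_on UNIV k" for f k :: "real ^ 'n \<Rightarrow> real"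
  proof -
    have "integrable (lebesgue_on K) (\<lambda>x. f x * k x)" if K: "compact K" for K
    proof -
      have "compact (k ` K)" using K k by (intro compact_continuous_image) (auto intro: continuous_on_subset)
      then obtain B where B: "\<And>x. x \<in> K \<Longrightarrow> norm (k x) \<le> B"
        using compact_imp_bounded bounded_iff by (metis imageI)
      have "integrable (lebesgue_on K) f" using f K by (simp add: locally_integrable_def)
      then show ?thesis
      proof (rule Bochner_Integration.integrable_bound[OF integrable_mult_right[where c=B]])
        show "(\<lambda>x. f x * k x) \<in> borel_measurable (lebesgue_on K)"
          by (intro measurable_restrict_space1 borel_measurable_times locally_integrable_lborel_rep[OF f] continuous_borel_lebesgue[OF k])
        show "AE x in lebesgue_on K. norm (f x * k x) \<le> norm (B * f x)"
        proof (rule AE_I2)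
          fix x assume "x \<in> space (lebesgue_on K)"
          then have "\<bar>k x\<bar> * \<bar>f x\<bar> \<le> \<bar>B\<bar> * \<bar>f x\<bar>" using B[of x] by (intro mult_right_mono) auto
          then show "norm (f x * k x) \<le> norm (B * f x)" by (simp add: abs_mult mult.commute)
        qed
      qed
    qed
    then show ?thesis by (simp add: locally_integrable_def)
  qed
  have lH: "locally_integrable H1" "locally_integrable H2"
    unfolding H1_def[abs_def] H2_def[abs_def] using lm l cth by (auto intro!: locally_integrable_add)
  have pH: "periodic H1" "periodic H2"
  proof -
    have p: "AE x in lebesgue. u (x + axis j 1) = u x" "AE x in lebesgue. g (x + axis j 1) = g x"
      "AE x in lebesgue. \<psi> (x + axis j 1) = \<psi> x" "AE x in lebesgue. dp (x + axis j 1) = dp x" for j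
      using pu pg psi(2,3) by (auto simp: periodic_def dp_def)
    show "periodic H1" unfolding periodic_def
    proof
      fix j show "AE x in lebesgue. H1 (x + axis j 1) = H1 x"
        using p(1)[of j] p(3)[of j] by eventually_elim (simp add: H1_def)
    qed
    show "periodic H2" unfolding periodic_def
    proof
      fix j show "AE x in lebesgue. H2 (x + axis j 1) = H2 x"
        using p(1)[of j] p(2)[of j] p(3)[of j] p(4)[of j] by eventually_elim (simp add: H2_def)
    qed
  qed
  have mH: "H1 \<in> borel_measurable lebesgue" "H2 \<in> borel_measurable lebesgue"
    using lH by (auto intro: locally_integrable_lborel_rep)
  have iH: "integrable (lebesgue_on cell) H1" "integrable (lebesgue_on cell) H2"
    using lH by (auto intro: integrable_cell_locally_integrable)
  have key: "cell_integral (\<lambda>x. H1 (x + y) * D x) + cell_integral (\<lambda>x. H2 (x + y) * th x) = 0" for y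
  proof -
    define ty where "ty x = th (x - y)" for x
    have ty_b: "ty = bump 1 (0 + y) (1 + y)" unfolding ty_def th_def bump_translate[symmetric] ..
    have tf: "test_function (\<lambda>x. \<psi> x * ty x)" unfolding ty_b by (rule test_bump_mult[OF psi(1)])
    have Cty: "Ck k ty" for k unfolding ty_b by (rule Ck_bump)
    have tft: "test_function ty" unfolding ty_b by (rule test_bump)
    have dty: "frechet_derivative ty (at x) (axis i 1) = D (x - y)" for x
      unfolding ty_def D_def using frechet_derivative_translate[of th x y] Ck_SucD(1)[OF Cth[of "Suc 0"]]
      by (simp add: differentiable_def) metis
    have i1: "integrable lebesgue (\<lambda>x. H1 x * D (x - y))" using integrable_test_mult(2)[OF lH(1) tft, of i] by (simp add: dty)
    have i2: "integrable lebesgue (\<lambda>x. H2 x * th (x - y))" using integrable_test_mult(1)[OF lH(2) tft] by (simp add: ty_def)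
    have ig: "integrable lebesgue (\<lambda>x. g x * (\<psi> x * ty x))" by (rule integrable_test_mult(1)[OF l(2) tf])
    have iu: "integrable lebesgue (\<lambda>x. u x * frechet_derivative (\<lambda>x. \<psi> x * ty x) (at x) (axis i 1))"
      by (rule integrable_test_mult(2)[OF l(1) tf])
    have "(LINT x|lebesgue. u x * frechet_derivative (\<lambda>x. \<psi> x * ty x) (at x) (axis i 1)) = - (LINT x|lebesgue. g x * (\<psi> x * ty x))"
      using wp tf by (simp add: has_weak_partial_def)
    then have "0 = (LINT x|lebesgue. u x * frechet_derivative (\<lambda>x. \<psi> x * ty x) (at x) (axis i 1) + g x * (\<psi> x * ty x))"
      using ig iu by simp
    also have "\<dots> = (LINT x|lebesgue. H1 x * D (x - y) + H2 x * th (x - y))"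
      unfolding frechet_derivative_product[OF psi(1) Cty] dty
      by (simp add: H1_def H2_def dp_def[symmetric] ty_def algebra_simps)
    also have "\<dots> = (LINT x|lebesgue. H1 x * D (x - y)) + (LINT x|lebesgue. H2 x * th (x - y))"
      using i1 i2 by simp
    also have "(LINT x|lebesgue. H1 x * D (x - y)) = (LINT x|lebesgue. H1 (x + y) * D x)"
      using lebesgue_integral_translate(2)[OF borel_measurable_integrable[OF i1], of y] by simp
    also have "(LINT x|lebesgue. H2 x * th (x - y)) = (LINT x|lebesgue. H2 (x + y) * th x)"
      using lebesgue_integral_translate(2)[OF borel_measurable_integrable[OF i2], of y] by simp
    also have "(LINT x|lebesgue. H1 (x + y) * D x) = cell_integral (\<lambda>x. H1 (x + y) * D x)"
      by (rule cell_integral_support) (simp add: D0)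
    also have "(LINT x|lebesgue. H2 (x + y) * th x) = cell_integral (\<lambda>x. H2 (x + y) * th x)"
      by (rule cell_integral_support) (simp add: th0)
    finally show ?thesis by simp
  qed
  note c1 = cell_convolution_integral[OF mH(1) pH(1) iH(1) cth(2)]
  note c2 = cell_convolution_integral[OF mH(2) pH(2) iH(2) cth(1)]
  have "cell_integral D * cell_integral H1 + cell_integral th * cell_integral H2
      = cell_integral (\<lambda>y. cell_integral (\<lambda>x. H1 (x + y) * D x) + cell_integral (\<lambda>x. H2 (x + y) * th x))"
    unfolding c1(1)[symmetric] c2(1)[symmetric] using c1(2) c2(2) by (simp add: cell_integral_def)
  also have "\<dots> = 0" by (simp add: key)
  finally have e: "cell_integral D * cell_integral H1 + cell_integral th * cell_integral H2 = 0" .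
  \<comment> \<open>The term with \<open>H1\<close> drops out since a derivative of a compactly
    supported function has integral 0; the remaining factor, the integral of \<open>th\<close>, is
    positive and can be cancelled.\<close>
  have "cell_integral D = 0"
  proof -
    have "(LINT x|lebesgue. D x) = 0"
      unfolding D_def th_def by (rule test_function_integral_partial[OF test_bump])
    then show ?thesis using cell_integral_support[of D] D0 by simp
  qed
  moreover have "cell_integral th \<noteq> 0"
  proof
    assume "cell_integral th = 0"
    then have "AE x in lebesgue_on cell. th x = 0"
      unfolding cell_integral_def using th_nn integrable_cell_continuous[OF cth(1)]
      by (subst (asm) integral_nonneg_eq_0_iff_AE) auto
    then have "AE x in lebesgue_on (cell :: (real ^ 'n) set). False"
    proof (rule AE_mp)
      have "th x \<noteq> 0" if "x \<in> cell" for x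
        using bump_pos[of x 0 1 1] that by (simp add: th_def cell_eq_box)
      then show "AE x in lebesgue_on (cell :: (real ^ 'n) set). th x = 0 \<longrightarrow> False"
        by (intro AE_I2) auto
    qed
    then have "AE x in lebesgue_on (cell :: (real ^ 'n) set). 1 = (0 :: real)"
      by (rule AE_mp) simp
    then have "cell_integral (\<lambda>x :: real ^ 'n. 1 :: real) = cell_integral (\<lambda>x :: real ^ 'n. 0)"
      unfolding cell_integral_def by (intro integral_cong_AE) auto
    then show False by simp
  qed
  ultimately have "cell_integral H2 = 0" using e by simp
  then show ?thesis
    unfolding H2_def[abs_def] using integrable_cell_locally_integrable[OF lm[OF l(1) cth(4)]]
      integrable_cell_locally_integrable[OF lm[OF l(2) cth(3)]]
    by (simp add: cell_integral_def dp_def[symmetric])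
qed

section \<open>Fourier coefficients and convolutions of weak derivatives\<close>

lemma frechet_derivative_trig:
  "frechet_derivative (\<lambda>x. Re (c * ee l x)) (at x) (axis i 1) = Re ((c * (2 * pi * l $ i) * \<i>) * ee l x)"
proof -
  note d = bounded_linear.has_derivative[OF bounded_linear_Re
      bounded_linear.has_derivative[OF bounded_linear_mult_right ee_has_derivative[of l x]]]
  have "Re (c * (2 * pi * (\<Sum>j\<in>UNIV. of_int (l $ j) * axis i 1 $ j)) *\<^sub>R (\<i> * ee l x)) = Re ((c * (2 * pi * l $ i) * \<i>) * ee l x)"
    by (simp add: axis_def if_distrib algebra_simps cong: if_cong)
  then show ?thesis unfolding frechet_derivative_at[OF d, symmetric] .
qed

lemma integrable_mult_cnj_ee:
  fixes f :: "real ^ 'n \<Rightarrow> real"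
  assumes "integrable (lebesgue_on cell) f"
  shows "integrable (lebesgue_on cell) (\<lambda>x. complex_of_real (f x) * cnj (ee l x))"
proof (rule Bochner_Integration.integrable_bound[OF assms])
  show "(\<lambda>y. complex_of_real (f y) * cnj (ee l y)) \<in> borel_measurable (lebesgue_on cell)"
  proof (rule borel_measurable_times)
    show "(\<lambda>y. complex_of_real (f y)) \<in> borel_measurable (lebesgue_on cell)"
      using borel_measurable_integrable[OF assms] by measurable
    have "(\<lambda>y :: real ^ 'n. ee (- l) y) \<in> borel_measurable lebesgue"
      by (intro continuous_borel_lebesgue continuous_intros)
    then show "(\<lambda>y. cnj (ee l y)) \<in> borel_measurable (lebesgue_on cell)"
      by (simp add: measurable_restrict_space1)
  qed
qed (simp add: norm_mult)

lemma Re_cell_integral: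
  fixes f :: "real ^ 'n \<Rightarrow> real"
  assumes "integrable (lebesgue_on cell) f"
  shows "Re (c * cell_integral (\<lambda>x. complex_of_real (f x) * cnj (ee l x))) = cell_integral (\<lambda>x. f x * Re (c * ee (- l) x))"
proof -
  note i = integrable_mult_cnj_ee[OF assms, of l]
  have "c * cell_integral (\<lambda>x. complex_of_real (f x) * cnj (ee l x)) = cell_integral (\<lambda>x. c * (complex_of_real (f x) * cnj (ee l x)))"
    unfolding cell_integral_def using i by simp
  also have "Re \<dots> = cell_integral (\<lambda>x. Re (c * (complex_of_real (f x) * cnj (ee l x))))"
    unfolding cell_integral_def using i by (subst integral_Re) auto
  also have "\<dots> = cell_integral (\<lambda>x. f x * Re (c * ee (- l) x))"
  proof -
    have "Re (c * (complex_of_real (f x) * cnj (ee l x))) = f x * Re (c * ee (- l) x)" for x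
      unfolding ee_simps(2) by (simp add: algebra_simps)
    then show ?thesis by simp
  qed
  finally show ?thesis .
qed

lemma weak_partial_fourier:
  fixes u :: "real ^ 'n \<Rightarrow> real"
  assumes wp: "has_weak_partial i u g" and pu: "periodic u" and pg: "periodic g"
  shows "cell_integral (\<lambda>x. complex_of_real (g x) * cnj (ee l x))
      = (2 * pi * l $ i) * \<i> * cell_integral (\<lambda>x. complex_of_real (u x) * cnj (ee l x))" (is "?G = _ * ?U")
proof -
  have iu: "integrable (lebesgue_on cell) u" and ig: "integrable (lebesgue_on cell) g"
    using wp by (auto simp: has_weak_partial_def intro: integrable_cell_locally_integrable)
  have "Re (c * ?G) = Re (c * ((2 * pi * l $ i) * \<i> * ?U))" for c
  proof -
    define \<psi> where "\<psi> x = Re (c * ee (- l) x)" for x :: "real ^ 'n"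
    have d: "frechet_derivative \<psi> (at x) (axis i 1) = Re ((c * (2 * pi * (- l) $ i) * \<i>) * ee (- l) x)" for x
      unfolding \<psi>_def[abs_def] by (rule frechet_derivative_trig)
    have "cell_integral (\<lambda>x. u x * frechet_derivative \<psi> (at x) (axis i 1)) = - cell_integral (\<lambda>x. g x * \<psi> x)"
    proof (rule periodic_weak_partial[OF wp pu pg])
      show "Ck k \<psi>" for k unfolding \<psi>_def[abs_def] by (rule Ck_trig)
      show "periodic \<psi>" unfolding \<psi>_def by (intro periodicI) (simp add: ee_periodic)
      show "periodic (\<lambda>x. frechet_derivative \<psi> (at x) (axis i 1))" unfolding d by (intro periodicI) (simp add: ee_periodic)
    qed
    then have "Re ((c * (2 * pi * (- l) $ i) * \<i>) * ?U) = - Re (c * ?G)"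
      unfolding d Re_cell_integral[OF iu] Re_cell_integral[OF ig] \<psi>_def by simp
    then show ?thesis by (simp add: algebra_simps)
  qed
  \<comment> \<open>The choices \<open>c = 1\<close> and \<open>c = - \<i>\<close> recover the real
    and the imaginary part.\<close>
  from this[of 1] this[of "- \<i>"] show ?thesis by (simp add: complex_eq_iff)
qed

text \<open>Convolution and weak differentiation both multiply Fourier coefficients, hence commute.
  The convolution is a finite trigonometric sum, so the resulting derivative is classical and can be
  used along coordinate lines.\<close>

lemma conv_has_derivative:
  fixes u :: "real ^ 'n \<Rightarrow> real"
  assumes wp: "has_weak_partial i u g" and pu: "periodic u" and pg: "periodic g"
  shows "((\<lambda>t. conv N u (x + axis i t)) has_real_derivative conv N g (x + axis i t)) (at t)"
proof -
  have iu: "integrable (lebesgue_on cell) u" and ig: "integrable (lebesgue_on cell) g"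
    using wp by (auto simp: has_weak_partial_def intro: integrable_cell_locally_integrable)
  obtain c where c: "\<And>f x. integrable (lebesgue_on cell) f \<Longrightarrow> complex_of_real (conv N f x) =
        (\<Sum>k\<in>Box N. c k * cell_integral (\<lambda>y. f y * cnj (ee k y)) * ee k (x :: real ^ 'n))"
    by (rule conv_trig[of N]) blast
  define U where "U k = cell_integral (\<lambda>y. complex_of_real (u y) * cnj (ee k y))" for k
  have cu: "conv N u = (\<lambda>x. \<Sum>k\<in>Box N. Re (c k * U k * ee k x))"
  proof
    fix x show "conv N u x = (\<Sum>k\<in>Box N. Re (c k * U k * ee k x))"
      using arg_cong[where f=Re, OF c[OF iu, of x]] by (simp add: U_def Re_sum del: times_complex.sel)
  qed
  have cg: "conv N g x = (\<Sum>k\<in>Box N. Re ((c k * U k * (2 * pi * k $ i) * \<i>) * ee k x))" for x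
    using arg_cong[where f=Re, OF c[OF ig, of x]]
    unfolding weak_partial_fourier[OF wp pu pg] U_def[symmetric] by (simp add: mult_ac Re_sum del: times_complex.sel)
  have "Ck (Suc 0) (\<lambda>x. Re (c k * U k * ee k x))" for k by (rule Ck_trig)
  from has_derivative_axis[OF Ck_SucD(1)[OF this]]
  have "((\<lambda>t. Re (c k * U k * ee k (x + axis i t))) has_real_derivative Re ((c k * U k * (2 * pi * k $ i) * \<i>) * ee k (x + axis i t))) (at t)" for k
    unfolding frechet_derivative_trig .
  then show ?thesis unfolding cu cg by (intro DERIV_sum)
qed

lemma periodic_conv:
  fixes u :: "real ^ 'n \<Rightarrow> real"
  assumes "integrable (lebesgue_on cell) u" shows "conv N u (x + axis i 1) = conv N u x"
  by (rule periodic_real_trig_poly[OF conv_real_trig_poly[OF assms]])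

lemma square_integrable_imp_integrable:
  fixes f :: "real ^ 'n \<Rightarrow> 'b::euclidean_space"
  assumes "f \<in> borel_measurable lebesgue" "integrable (lebesgue_on cell) (\<lambda>x. (norm (f x))\<^sup>2)"
  shows "integrable (lebesgue_on cell) f"
proof -
  interpret finite_measure "lebesgue_on (cell :: (real ^ 'n) set)" by (rule cell_finite_measure)
  have "integrable (lebesgue_on cell) (\<lambda>x. 1 + (norm (f x))\<^sup>2)" using assms(2) by simp
  then show ?thesis
  proof (rule Bochner_Integration.integrable_bound)
    have "norm (f x) \<le> norm (1 + (norm (f x))\<^sup>2)" for x
      using zero_le_power2[of "norm (f x) - 1"] norm_ge_zero[of "f x"]
      by (simp add: power2_diff add_nonneg_nonneg) (smt (verit) norm_ge_zero)
    then show "AE x in lebesgue_on cell. norm (f x) \<le> norm (1 + (norm (f x))\<^sup>2)" by simp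
  qed (use assms(1) in \<open>auto intro: measurable_restrict_space1\<close>)
qed

text \<open>Expand the nonnegative integral of \<open>\<bar>f - p\<bar>^2\<close>, where
  \<open>p\<close> is the partial Fourier sum. As \<open>p\<close> is complex and \<open>f\<close>
  real, the square is written as \<open>(f - Re p)^2 + (Im p)^2\<close>, so that only real integrals
  occur.\<close>

lemma bessel:
  fixes f :: "real ^ 'n \<Rightarrow> real"
  assumes m: "f \<in> borel_measurable lebesgue" and i2: "integrable (lebesgue_on cell) (\<lambda>x. (f x)\<^sup>2)"
  shows "(\<Sum>k\<in>Box d. (cmod (cell_integral (\<lambda>x. complex_of_real (f x) * cnj (ee k x))))\<^sup>2) \<le> cell_integral (\<lambda>x. (f x)\<^sup>2)"
proof -
  define a where "a k = cell_integral (\<lambda>x. complex_of_real (f x) * cnj (ee k x))" for k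
  define p where "p x = (\<Sum>k\<in>Box d. a k * ee k x)" for x :: "real ^ 'n"
  have i1: "integrable (lebesgue_on cell) f" using square_integrable_imp_integrable[OF m] i2 by simp
  have ip: "integrable (lebesgue_on cell) (\<lambda>x. (cmod (p x))\<^sup>2)"
    unfolding p_def by (intro integrable_cell_continuous continuous_intros)
  have ifp: "integrable (lebesgue_on cell) (\<lambda>x. complex_of_real (f x) * cnj (p x))"
    unfolding p_def using integrable_mult_cnj_ee[OF i1]
    by (simp add: sum_distrib_left mult.left_commute del: ee_simps) 
  have "cell_integral (\<lambda>x. complex_of_real (f x) * cnj (p x)) = (\<Sum>k\<in>Box d. cnj (a k) * a k)"
  proof -
    have "cell_integral (\<lambda>x. complex_of_real (f x) * cnj (p x)) = cell_integral (\<lambda>x. \<Sum>k\<in>Box d. cnj (a k) * (complex_of_real (f x) * cnj (ee k x)))"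
      unfolding p_def by (simp add: sum_distrib_left mult_ac)
    also have "\<dots> = (\<Sum>k\<in>Box d. cnj (a k) * a k)"
      unfolding cell_integral_def a_def using integrable_mult_cnj_ee[OF i1]
      by (subst Bochner_Integration.integral_sum) auto
    finally show ?thesis .
  qed
  also have "\<dots> = complex_of_real (\<Sum>k\<in>Box d. (cmod (a k))\<^sup>2)"
    by (simp add: complex_norm_square mult.commute del: of_real_power)
  finally have e: "Re (cell_integral (\<lambda>x. complex_of_real (f x) * cnj (p x))) = (\<Sum>k\<in>Box d. (cmod (a k))\<^sup>2)" by simp
  have e': "Re (cell_integral (\<lambda>x. complex_of_real (f x) * cnj (p x))) = cell_integral (\<lambda>x. f x * Re (p x))"
  proof -
    have "Re (cell_integral (\<lambda>x. complex_of_real (f x) * cnj (p x))) = cell_integral (\<lambda>x. Re (complex_of_real (f x) * cnj (p x)))"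
      unfolding cell_integral_def using ifp by (subst integral_Re) auto
    then show ?thesis by simp
  qed
  have ir: "integrable (lebesgue_on cell) (\<lambda>x. f x * Re (p x))"
    using integrable_Re[OF ifp] by simp
  have "0 \<le> cell_integral (\<lambda>x. (f x)\<^sup>2 - 2 * (f x * Re (p x)) + (cmod (p x))\<^sup>2)"
  proof -
    have "(f x)\<^sup>2 - 2 * (f x * Re (p x)) + (cmod (p x))\<^sup>2 = (f x - Re (p x))\<^sup>2 + (Im (p x))\<^sup>2" for x
      by (simp add: cmod_power2 power2_diff)
    then show ?thesis by (simp add: cell_integral_def)
  qed
  also have "\<dots> = cell_integral (\<lambda>x. (f x)\<^sup>2) - 2 * cell_integral (\<lambda>x. f x * Re (p x)) + cell_integral (\<lambda>x. (cmod (p x))\<^sup>2)"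
    unfolding cell_integral_def using i2 ir ip by simp
  also have "cell_integral (\<lambda>x. (cmod (p x))\<^sup>2) = (\<Sum>k\<in>Box d. (cmod (a k))\<^sup>2)"
    by (rule parseval) (simp add: p_def)
  finally show ?thesis using e e' unfolding a_def by simp
qed

text \<open>The multipliers have modulus at most 1; Parseval's identity applies to the convolution
  and Bessel's inequality to \<open>f\<close>.\<close>

lemma conv_L2_le:
  fixes f :: "real ^ 'n \<Rightarrow> real"
  assumes m: "f \<in> borel_measurable lebesgue" and i2: "integrable (lebesgue_on cell) (\<lambda>x. (f x)\<^sup>2)"
  shows "cell_integral (\<lambda>x. (conv N f x)\<^sup>2) \<le> cell_integral (\<lambda>x. (f x)\<^sup>2)"
proof -
  have i1: "integrable (lebesgue_on cell) f" using square_integrable_imp_integrable[OF m] i2 by simp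
  define a where "a k = cell_integral (\<lambda>x. complex_of_real (f x) * cnj (ee k x))" for k
  obtain c where c1: "\<And>k. cmod (c k) \<le> 1" and c: "\<And>f x. integrable (lebesgue_on cell) f \<Longrightarrow> complex_of_real (conv N f x) =
        (\<Sum>k\<in>Box N. c k * cell_integral (\<lambda>y. f y * cnj (ee k y)) * ee k (x :: real ^ 'n))"
    by (rule conv_trig[of N]) blast
  have "cell_integral (\<lambda>x. (conv N f x)\<^sup>2) = cell_integral (\<lambda>x. (cmod (complex_of_real (conv N f x)))\<^sup>2)" by simp
  also have "\<dots> = (\<Sum>k\<in>Box N. (cmod (c k * a k))\<^sup>2)"
    by (rule parseval) (use c[OF i1] in \<open>simp add: a_def\<close>)
  also have "\<dots> \<le> (\<Sum>k\<in>Box N. (cmod (a k))\<^sup>2)"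
    by (intro sum_mono power_mono) (auto simp: norm_mult intro: mult_left_le_one_le c1)
  also have "\<dots> \<le> cell_integral (\<lambda>x. (f x)\<^sup>2)"
    unfolding a_def by (rule bessel[OF m i2])
  finally show ?thesis .
qed

subsection \<open>The Sobolev inequality on the torus\<close>

text \<open>Continuity together with periodicity at every point, not merely almost everywhere, makes
  averages along single coordinate lines meaningful. The class is preserved by
  \<open>coord_mean\<close>, so that averages can be iterated.\<close>

definition cont_per :: "(real ^ 'n \<Rightarrow> real) set" where
  "cont_per = {f. continuous_on UNIV f \<and> (\<forall>i x. f (x + axis i 1) = f x)}"

definition coord_mean :: "'n \<Rightarrow> (real ^ 'n \<Rightarrow> real) \<Rightarrow> real ^ 'n \<Rightarrow> real" where
  "coord_mean i f x = integral {0..1} (\<lambda>t. f (x + axis i t))"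

lemma cont_per_continuous: "f \<in> cont_per \<Longrightarrow> continuous_on S f"
  by (auto simp: cont_per_def intro: continuous_on_subset)

lemma cont_per_periodic: "f \<in> cont_per \<Longrightarrow> f (x + axis i 1) = f x"
  by (auto simp: cont_per_def)

lemma continuous_on_axis [continuous_intros]:
  fixes g :: "'a::t2_space \<Rightarrow> real"
  shows "continuous_on S g \<Longrightarrow> continuous_on S (\<lambda>x. axis i (g x))"
  by (subst axis_scale) (intro continuous_on_scaleR continuous_on_const)

lemma cont_per_compose: "f \<in> cont_per \<Longrightarrow> continuous_on S g \<Longrightarrow> continuous_on S (\<lambda>x. f (g x))"
  using continuous_on_compose2[OF cont_per_continuous[of f UNIV]] by auto

lemma cont_per_line_integrable: "f \<in> cont_per \<Longrightarrow> (\<lambda>t. f (x + axis i t)) integrable_on {a..b}"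
  by (intro integrable_continuous_real cont_per_compose[of f] continuous_intros)

lemma cont_per_coord_mean: "f \<in> cont_per \<Longrightarrow> coord_mean i f \<in> cont_per"
proof -
  assume f: "f \<in> cont_per"
  have "continuous_on UNIV (\<lambda>x. integral (cbox 0 1) (\<lambda>t. f (x + axis i t)))"
    by (rule integral_continuous_on_param) (auto simp: split_beta intro!: cont_per_compose[OF f] continuous_intros)
  moreover have "f (x + axis j 1 + axis i t) = f (x + axis i t)" for x j t
    using cont_per_periodic[OF f, of "x + axis i t" j] by (simp add: add_ac)
  ultimately show ?thesis by (auto simp: cont_per_def coord_mean_def[abs_def])
qed

lemma coord_mean_shift:
  assumes f: "f \<in> cont_per" and s: "0 \<le> s" "s \<le> 1"
  shows "coord_mean i f (x + axis i s) = coord_mean i f x"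
proof -
  define h where "h t = f (x + axis i t)" for t
  have hi: "h integrable_on {a..b}" for a b unfolding h_def by (rule cont_per_line_integrable[OF f])
  have hp: "h (t + 1) = h t" for t
    using cont_per_periodic[OF f, of "x + axis i t" i] by (simp add: h_def axis_add add_ac)
  have "coord_mean i f (x + axis i s) = integral {0..1} (\<lambda>t. h (t + s))"
    by (simp add: coord_mean_def h_def axis_add add_ac)
  also have "\<dots> = integral {s..1 + s} h"
    using integral_shift_real_ivl[of s s "1 + s" h] by simp
  also have "\<dots> = integral {s..1} h + integral {1..1 + s} h"
    using s hi by (subst Henstock_Kurzweil_Integration.integral_combine) auto
  also have "integral {1..1 + s} h = integral {0..s} h"
    using integral_shift_real_ivl[of 1 1 "1 + s" h] by (simp add: hp)
  also have "integral {s..1} h + integral {0..s} h = integral {0..1} h"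
    using Henstock_Kurzweil_Integration.integral_combine[of 0 s 1 h] s hi by simp
  finally show ?thesis unfolding coord_mean_def[of i f x] h_def .
qed

lemma coord_mean_commute: "f \<in> cont_per \<Longrightarrow> coord_mean i (coord_mean j f) x = coord_mean j (coord_mean i f) x"
proof -
  assume f: "f \<in> cont_per"
  have "integral (cbox 0 1) (\<lambda>s. integral (cbox 0 1) (\<lambda>t. f (x + axis i s + axis j t)))
     = integral (cbox 0 1) (\<lambda>t. integral (cbox 0 1) (\<lambda>s. f (x + axis i s + axis j (t :: real))))"
    by (rule integral_swap_continuous) (auto simp: split_beta intro!: cont_per_compose[OF f] continuous_intros)
  then show ?thesis by (simp add: coord_mean_def add_ac)
qed

lemma coord_mean_mono: "f \<in> cont_per \<Longrightarrow> g \<in> cont_per \<Longrightarrow> (\<And>x. f x \<le> g x) \<Longrightarrow> coord_mean i f x \<le> coord_mean i g x"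
  unfolding coord_mean_def by (intro integral_le cont_per_line_integrable) auto

lemma cont_per_cell_integral: "f \<in> cont_per \<Longrightarrow> cell_integral f = integral (cbox 0 1) f"
proof -
  assume f: "f \<in> cont_per"
  have "integrable (lebesgue_on cell) f" by (intro integrable_cell_continuous cont_per_continuous f)
  then have "cell_integral f = integral cell f"
    unfolding cell_integral_def by (rule lebesgue_integral_eq_integral) simp
  then show ?thesis by (simp add: cell_eq_box integral_open_interval)
qed

lemma cell_integral_coord_mean: "f \<in> cont_per \<Longrightarrow> cell_integral (coord_mean i f) = cell_integral f" for f :: "real ^ 'n \<Rightarrow> real"
proof -
  assume f: "f \<in> cont_per"
  have sh: "integral (cbox 0 1) (\<lambda>x. f (x + axis i t)) = cell_integral f" if t: "t \<in> cbox 0 1" for t :: real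
  proof -
    have ft: "(\<lambda>x. f (x + axis i t)) \<in> cont_per"
      using f cont_per_periodic[OF f, of "_ + axis i t"] by (auto simp: cont_per_def add_ac intro!: cont_per_compose[OF f] continuous_intros)
    have "cell_integral (\<lambda>x. f (x + axis i t)) = cell_integral f"
      by (rule cell_integral_shift(2))
        (use t cont_per_continuous[OF f, of UNIV] cont_per_periodic[OF f] in
          \<open>auto intro: continuous_borel_lebesgue integrable_cell_continuous periodicI simp: axis_def\<close>)
    then show ?thesis by (simp add: cont_per_cell_integral[OF ft])
  qed
  have "cell_integral (coord_mean i f) = integral (cbox 0 1) (\<lambda>x. integral (cbox 0 1) (\<lambda>t. f (x + axis i t)))"
    unfolding cont_per_cell_integral[OF cont_per_coord_mean[OF f]] by (simp add: coord_mean_def[abs_def])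
  also have "\<dots> = integral (cbox 0 1) (\<lambda>t :: real. integral (cbox 0 1) (\<lambda>x. f (x + axis i t)))"
    by (rule integral_swap_continuous) (auto simp: split_beta intro!: cont_per_compose[OF f] continuous_intros)
  also have "\<dots> = integral (cbox 0 1) (\<lambda>t :: real. cell_integral f)"
    by (rule Henstock_Kurzweil_Integration.integral_cong) (rule sh)
  finally show ?thesis by simp
qed

lemma cont_per_add: "f \<in> cont_per \<Longrightarrow> g \<in> cont_per \<Longrightarrow> (\<lambda>x. f x + g x) \<in> cont_per"
  by (auto simp: cont_per_def intro: continuous_intros)
lemma cont_per_mult: "f \<in> cont_per \<Longrightarrow> g \<in> cont_per \<Longrightarrow> (\<lambda>x. f x * g x) \<in> cont_per"
  by (auto simp: cont_per_def intro: continuous_intros)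
lemma cont_per_const: "(\<lambda>x. c) \<in> cont_per"
  by (auto simp: cont_per_def)
lemma cont_per_sum: "(\<And>i. i \<in> I \<Longrightarrow> f i \<in> cont_per) \<Longrightarrow> (\<lambda>x. \<Sum>i\<in>I. f i x) \<in> cont_per"
  by (induction I rule: infinite_finite_induct) (auto intro: cont_per_add cont_per_const)
lemma cont_per_prod: "(\<And>i. i \<in> I \<Longrightarrow> f i \<in> cont_per) \<Longrightarrow> (\<lambda>x. \<Prod>i\<in>I. f i x) \<in> cont_per"
  by (induction I rule: infinite_finite_induct) (auto intro: cont_per_mult cont_per_const)
lemma cont_per_powr: "f \<in> cont_per \<Longrightarrow> (\<And>x. 0 < f x) \<Longrightarrow> (\<lambda>x. f x powr a) \<in> cont_per"
  by (auto simp: cont_per_def intro!: continuous_intros) (metis less_irrefl)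
lemma cont_per_abs: "f \<in> cont_per \<Longrightarrow> (\<lambda>x. \<bar>f x\<bar>) \<in> cont_per"
  by (auto simp: cont_per_def intro: continuous_intros)
lemma cont_per_power: "f \<in> cont_per \<Longrightarrow> (\<lambda>x. f x ^ m) \<in> cont_per"
  by (auto simp: cont_per_def intro: continuous_intros)

lemma coord_mean_pos:
  assumes "f \<in> cont_per" "\<And>x. 0 < f x" shows "0 < coord_mean i f x"
proof -
  have c: "continuous_on {0..1} (\<lambda>t. f (x + axis i t))" by (intro cont_per_compose[OF assms(1)] continuous_intros)
  obtain t0 where t0: "t0 \<in> {0..1}" "\<And>t. t \<in> {0..1} \<Longrightarrow> f (x + axis i t0) \<le> f (x + axis i t)"
    using continuous_attains_inf[OF _ _ c] by auto
  have "f (x + axis i t0) = integral {0..1} (\<lambda>t::real. f (x + axis i t0))" by simp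
  also have "\<dots> \<le> coord_mean i f x"
    unfolding coord_mean_def by (rule integral_le) (use t0 cont_per_line_integrable[OF assms(1)] in auto)
  finally show ?thesis using assms(2)[of "x + axis i t0"] by simp
qed

lemma weighted_am_gm:
  fixes a p :: "'k \<Rightarrow> real"
  assumes "finite K" "\<And>k. k \<in> K \<Longrightarrow> 0 < a k" "\<And>k. k \<in> K \<Longrightarrow> 0 \<le> p k" "(\<Sum>k\<in>K. p k) = 1"
  shows "(\<Prod>k\<in>K. a k powr p k) \<le> (\<Sum>k\<in>K. p k * a k)"
proof -
  have ne: "K \<noteq> {}" using assms(4) by auto
  have a0: "a k \<noteq> 0" if "k \<in> K" for k using assms(2)[OF that] by simp
  have "exp (\<Sum>k\<in>K. p k *\<^sub>R ln (a k)) \<le> (\<Sum>k\<in>K. p k * exp (ln (a k)))"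
    by (rule convex_on_sum[OF assms(1) ne exp_convex assms(4)]) (use assms in auto)
  moreover have "(\<Sum>k\<in>K. p k * exp (ln (a k))) = (\<Sum>k\<in>K. p k * a k)"
    by (intro sum.cong) (use assms(2) in auto)
  moreover have "exp (\<Sum>k\<in>K. p k *\<^sub>R ln (a k)) = (\<Prod>k\<in>K. a k powr p k)"
    unfolding exp_sum[OF assms(1)] by (intro prod.cong) (auto simp: powr_def a0)
  ultimately show ?thesis by simp
qed

text \<open>Divide each factor by its mean \<open>m k\<close> and apply the weighted inequality of
  arithmetic and geometric means pointwise; every normalised factor then averages to 1, and the
  weights add up to 1.\<close>

lemma coord_mean_Hoelder:
  fixes f :: "'k \<Rightarrow> real ^ 'n \<Rightarrow> real"
  assumes K: "finite K" and f: "\<And>k. k \<in> K \<Longrightarrow> f k \<in> cont_per" "\<And>k x. k \<in> K \<Longrightarrow> 0 < f k x"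
    and p: "\<And>k. k \<in> K \<Longrightarrow> 0 \<le> p k" "(\<Sum>k\<in>K. p k) = 1"
  shows "coord_mean i (\<lambda>x. \<Prod>k\<in>K. f k x powr p k) x \<le> (\<Prod>k\<in>K. coord_mean i (f k) x powr p k)"
proof -
  define m where "m k = coord_mean i (f k) x" for k
  have m: "0 < m k" if "k \<in> K" for k unfolding m_def using f that by (intro coord_mean_pos) auto
  have P: "0 < (\<Prod>k\<in>K. m k powr p k)" using m by (intro prod_pos) (auto simp: less_imp_neq[symmetric])
  have le: "(\<Prod>k\<in>K. f k y powr p k) \<le> (\<Prod>k\<in>K. m k powr p k) * (\<Sum>k\<in>K. p k / m k * f k y)" for y
  proof -
    have "(\<Prod>k\<in>K. (f k y / m k) powr p k) \<le> (\<Sum>k\<in>K. p k * (f k y / m k))"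
      by (rule weighted_am_gm[OF K _ p]) (use f m in auto)
    moreover have "(\<Prod>k\<in>K. (f k y / m k) powr p k) = (\<Prod>k\<in>K. f k y powr p k) / (\<Prod>k\<in>K. m k powr p k)"
      unfolding prod_dividef[symmetric] using f(2) m by (intro prod.cong) (auto simp: powr_divide less_imp_le)
    ultimately show ?thesis using P by (simp add: divide_simps mult.commute)
  qed
  have cs: "(\<lambda>y. \<Sum>k\<in>K. p k / m k * f k y) \<in> cont_per" using f by (intro cont_per_sum cont_per_mult cont_per_const)
  have "coord_mean i (\<lambda>x. \<Prod>k\<in>K. f k x powr p k) x \<le> coord_mean i (\<lambda>y. (\<Prod>k\<in>K. m k powr p k) * (\<Sum>k\<in>K. p k / m k * f k y)) x"
    using f by (intro coord_mean_mono le cont_per_prod cont_per_powr cont_per_mult cont_per_const cs) auto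
  also have "\<dots> = (\<Prod>k\<in>K. m k powr p k) * integral {0..1} (\<lambda>t. \<Sum>k\<in>K. p k / m k * f k (x + axis i t))"
    by (simp add: coord_mean_def)
  also have "integral {0..1} (\<lambda>t. \<Sum>k\<in>K. p k / m k * f k (x + axis i t)) = (\<Sum>k\<in>K. p k / m k * m k)"
  proof -
    have c: "integral {0..1} (\<lambda>t. c * f k (x + axis i t)) = c * m k" for c k by (simp add: m_def coord_mean_def)
    have "(\<lambda>t. p k / m k * f k (x + axis i t)) integrable_on {0..1}" if "k \<in> K" for k
      using cont_per_line_integrable[OF cont_per_mult[OF cont_per_const f(1)[OF that]]] .
    from Henstock_Kurzweil_Integration.integral_sum[OF K this] show ?thesis unfolding c .
  qed
  also have "(\<Sum>k\<in>K. p k / m k * m k) = 1"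
  proof -
    have "p k / m k * m k = p k" if "k \<in> K" for k using m[OF that] by simp
    then show ?thesis using p(2) by simp
  qed
  finally show ?thesis by (simp add: m_def)
qed

primrec coord_means :: "'n list \<Rightarrow> (real ^ 'n \<Rightarrow> real) \<Rightarrow> real ^ 'n \<Rightarrow> real" where
  "coord_means [] f = f"
| "coord_means (i # L) f = coord_means L (coord_mean i f)"

lemma coord_means_mono: "f \<in> cont_per \<Longrightarrow> g \<in> cont_per \<Longrightarrow> (\<And>x. f x \<le> g x) \<Longrightarrow> coord_means L f x \<le> coord_means L g x"
  by (induction L arbitrary: f g) (auto intro: cont_per_coord_mean coord_mean_mono)

lemma cell_integral_coord_means: "f \<in> cont_per \<Longrightarrow> cell_integral (coord_means L f) = cell_integral f"
  by (induction L arbitrary: f) (auto simp: cont_per_coord_mean cell_integral_coord_mean)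

lemma coord_means_invariant: "f \<in> cont_per \<Longrightarrow> (\<And>x. f (x + v) = f x) \<Longrightarrow> coord_means L f (y + v) = coord_means L f y"
proof (induction L arbitrary: f)
  case (Cons i L)
  have "coord_mean i f (x + v) = coord_mean i f x" for x
    using Cons.prems(2)[of "x + axis i _"] by (simp add: coord_mean_def add_ac)
  then show ?case using Cons.IH[OF cont_per_coord_mean[OF Cons.prems(1)]] by simp
qed simp

lemma coord_means_shift: "f \<in> cont_per \<Longrightarrow> i \<in> set L \<Longrightarrow> 0 \<le> s \<Longrightarrow> s \<le> 1 \<Longrightarrow> coord_means L f (y + axis i s) = coord_means L f y"
proof (induction L arbitrary: f)
  case (Cons j L)
  show ?case
  proof (cases "i = j")
    case True
    then show ?thesis
      using coord_means_invariant[OF cont_per_coord_mean[OF Cons.prems(1)], where v="axis i s"] coord_mean_shift[OF Cons.prems(1,3,4)] by simp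
  next
    case False
    then show ?thesis using Cons.IH[OF cont_per_coord_mean[OF Cons.prems(1)]] Cons.prems by simp
  qed
qed simp

lemma coord_means_UNIV:
  fixes f :: "real ^ 'n \<Rightarrow> real"
  assumes f: "f \<in> cont_per" and U: "set L = UNIV" and x: "x \<in> cell"
  shows "coord_means L f x = coord_means L f 0"
proof -
  have "finite S \<Longrightarrow> coord_means L f (\<Sum>i\<in>S. axis i (x $ i)) = coord_means L f 0" for S
  proof (induction S rule: finite_induct)
    case (insert i S)
    have "0 \<le> x $ i" "x $ i \<le> 1" using x by (auto simp: cell_def less_imp_le)
    from coord_means_shift[OF f _ this, where L=L and y="\<Sum>i\<in>S. axis i (x $ i)"] insert U show ?case by (simp add: add_ac)
  qed simp
  from this[of UNIV] have "coord_means L f (\<Sum>i\<in>UNIV. axis i (x $ i)) = coord_means L f 0" by simp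
  moreover have "(\<Sum>i\<in>UNIV. axis i (x $ i)) = x" by (simp add: vec_eq_iff axis_def)
  ultimately show ?thesis by simp
qed

lemma coord_means_eq_cell_integral:
  fixes f :: "real ^ 'n \<Rightarrow> real"
  assumes f: "f \<in> cont_per" and U: "set L = UNIV"
  shows "coord_means L f 0 = cell_integral f"
proof -
  have "cell_integral f = cell_integral (coord_means L f)" by (simp add: cell_integral_coord_means[OF f])
  also have "\<dots> = cell_integral (\<lambda>x :: real ^ 'n. coord_means L f 0)"
    unfolding cell_integral_def by (rule Bochner_Integration.integral_cong) (auto simp: coord_means_UNIV[OF f U])
  finally show ?thesis by simp
qed

text \<open>The Loomis-Whitney type inequality behind the Gagliardo-Nirenberg-Sobolev inequality, in a form
  that allows induction on the number of coordinates: integrating out one coordinate \<open>i\<close> by Hoelder's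
  inequality replaces \<open>f\<close> by \<open>coord_mean i f\<close>.\<close>

lemma grid_lines:
  fixes p :: real
  assumes p: "0 \<le> p"
  shows "distinct L \<Longrightarrow> (real (length L) - 1) * p \<le> 1 \<Longrightarrow> f \<in> cont_per \<Longrightarrow> (\<And>x. 0 < f x) \<Longrightarrow>
    coord_means L (\<lambda>x. f x powr (1 - (real (length L) - 1) * p) * (\<Prod>i\<in>set L. coord_mean i f x powr p)) y \<le> coord_means L f y powr (1 + p)"
proof (induction L arbitrary: f)
  case Nil
  then show ?case by (simp add: algebra_simps)
next
  case (Cons i L)
  note f = Cons.prems(3,4)
  define n where "n = real (length L)"
  define g where "g = coord_mean i f"
  have g: "g \<in> cont_per" "\<And>x. 0 < g x" unfolding g_def using f by (auto intro: cont_per_coord_mean coord_mean_pos)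
  have np: "n * p \<le> 1" using Cons.prems(2) by (simp add: n_def)
  have mj: "coord_mean j f \<in> cont_per" "\<And>x. 0 < coord_mean j f x" for j using f by (auto intro: cont_per_coord_mean coord_mean_pos)
  \<comment> \<open>The Hoelder factors for averaging over coordinate \<open>i\<close>:
    \<open>None\<close> stands for \<open>f\<close> with exponent \<open>1 - n * p\<close>, and
    \<open>Some j\<close> for the mean in a remaining direction \<open>j\<close> with exponent
    \<open>p\<close>. Since \<open>n\<close> is the length of the tail \<open>L\<close>, the
    exponents sum to 1; the mean in direction \<open>i\<close> itself is kept out.\<close>
  define F where "F k = (case k of None \<Rightarrow> f | Some j \<Rightarrow> coord_mean j f)" for k
  define q where "q k = (case k of None \<Rightarrow> 1 - n * p | Some (j :: 'a) \<Rightarrow> p)" for k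
  let ?K = "insert None (Some ` set L)"
  have card: "card (set L) = length L" using Cons.prems(1) distinct_card by auto
  have Fp: "F k \<in> cont_per" "0 < F k x" for k x using f mj by (auto simp: F_def split: option.splits)
  have q: "0 \<le> q k" for k using p np by (auto simp: q_def split: option.splits)
  have qs: "(\<Sum>k\<in>?K. q k) = 1"
    by (simp add: sum.reindex q_def card n_def)
  have prodK: "(\<Prod>k\<in>?K. G k) = G None * (\<Prod>j\<in>set L. G (Some j))" for G :: "_ \<Rightarrow> real"
    by (simp add: prod.reindex)
  define H where "H x = f x powr (1 - n * p) * (\<Prod>j\<in>set L. coord_mean j f x powr p)" for x
  have HCP: "H \<in> cont_per" unfolding H_def using f mj by (intro cont_per_mult cont_per_prod cont_per_powr) auto
  have H: "coord_mean i H x \<le> g x powr (1 - n * p) * (\<Prod>j\<in>set L. coord_mean j g x powr p)" for x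
  proof -
    have "coord_mean i (\<lambda>x. \<Prod>k\<in>?K. F k x powr q k) x \<le> (\<Prod>k\<in>?K. coord_mean i (F k) x powr q k)"
      by (rule coord_mean_Hoelder) (use Fp q qs in auto)
    then show ?thesis
      unfolding prodK by (simp add: F_def q_def H_def[abs_def] g_def coord_mean_commute[OF f(1)] cong: prod.cong)
  qed
  \<comment> \<open>The mean \<open>g\<close> is constant in direction \<open>i\<close>, so its
    power leaves the average. Combined with the Hoelder bound, its exponent becomes
    \<open>p + (1 - n * p)\<close>, exactly the one in the induction hypothesis for the shorter
    list.\<close>
  have eq: "coord_mean i (\<lambda>x. g x powr p * H x) x = g x powr p * coord_mean i H x" for x
  proof -
    have "g (x + axis i t) powr p * H (x + axis i t) = g x powr p * H (x + axis i t)" if "t \<in> {0..1}" for t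
      using coord_mean_shift[OF f(1), of t i x] that by (simp add: g_def)
    then have "integral {0..1} (\<lambda>t. g (x + axis i t) powr p * H (x + axis i t)) = integral {0..1} (\<lambda>t. g x powr p * H (x + axis i t))"
      by (rule Henstock_Kurzweil_Integration.integral_cong)
    then show ?thesis unfolding coord_mean_def[of i "\<lambda>x. g x powr p * H x"] coord_mean_def[of i H] by simp
  qed
  have int_eq: "(\<lambda>x. f x powr (1 - (real (length (i # L)) - 1) * p) * (\<Prod>j\<in>set (i # L). coord_mean j f x powr p)) = (\<lambda>x. g x powr p * H x)"
    using Cons.prems(1) by (auto simp: H_def g_def n_def mult_ac)
  have "coord_means (i # L) (\<lambda>x. g x powr p * H x) y = coord_means L (\<lambda>x. g x powr p * coord_mean i H x) y"
    by (simp add: eq[abs_def])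
  also have "\<dots> \<le> coord_means L (\<lambda>x. g x powr (1 - (n - 1) * p) * (\<Prod>j\<in>set L. coord_mean j g x powr p)) y"
  proof (rule coord_means_mono)
    show "(\<lambda>x. g x powr p * coord_mean i H x) \<in> cont_per" using g HCP by (intro cont_per_mult cont_per_powr cont_per_coord_mean) auto
    show "(\<lambda>x. g x powr (1 - (n - 1) * p) * (\<Prod>j\<in>set L. coord_mean j g x powr p)) \<in> cont_per"
      using g by (intro cont_per_mult cont_per_powr cont_per_prod cont_per_coord_mean coord_mean_pos) auto
    fix x
    have "g x powr p * coord_mean i H x \<le> g x powr p * (g x powr (1 - n * p) * (\<Prod>j\<in>set L. coord_mean j g x powr p))"
      by (intro mult_left_mono H) auto
    also have "\<dots> = g x powr (1 - (n - 1) * p) * (\<Prod>j\<in>set L. coord_mean j g x powr p)"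
      by (simp add: mult.assoc[symmetric] powr_add[symmetric] algebra_simps)
    finally show "g x powr p * coord_mean i H x \<le> g x powr (1 - (n - 1) * p) * (\<Prod>j\<in>set L. coord_mean j g x powr p)" .
  qed
  also have "\<dots> \<le> coord_means L g y powr (1 + p)"
    unfolding n_def
  proof (rule Cons.IH[OF _ _ g])
    show "distinct L" using Cons.prems(1) by simp
    show "(real (length L) - 1) * p \<le> 1" using np p by (simp add: n_def algebra_simps)
  qed
  finally show ?case unfolding int_eq by (simp add: g_def)
qed

section \<open>The Sobolev embedding into L^4\<close>

text \<open>Young's inequality, weighted by the two norms enlarged by \<open>e\<close>; the
  enlargement avoids a division by a vanishing norm and disappears in the limit.\<close>

lemma cauchy_schwarz_cell:
  fixes f g :: "real ^ 'n \<Rightarrow> real"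
  assumes m: "f \<in> borel_measurable lebesgue" "g \<in> borel_measurable lebesgue"
    and f: "integrable (lebesgue_on cell) (\<lambda>x. (f x)\<^sup>2)" and g: "integrable (lebesgue_on cell) (\<lambda>x. (g x)\<^sup>2)"
  shows "integrable (lebesgue_on cell) (\<lambda>x. f x * g x)"
    and "cell_integral (\<lambda>x. \<bar>f x * g x\<bar>) \<le> sqrt (cell_integral (\<lambda>x. (f x)\<^sup>2)) * sqrt (cell_integral (\<lambda>x. (g x)\<^sup>2))"
proof -
  have pt: "\<bar>a * b\<bar> \<le> (a / s)\<^sup>2 * (s * t / 2) + (b / t)\<^sup>2 * (s * t / 2)" if "0 < s" "0 < t" for a b s t :: real
  proof -
    have "0 \<le> (\<bar>a\<bar> / s - \<bar>b\<bar> / t)\<^sup>2" by simp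
    then have "2 * ((\<bar>a\<bar> / s) * (\<bar>b\<bar> / t)) \<le> (a / s)\<^sup>2 + (b / t)\<^sup>2"
      by (simp add: power2_diff power_divide mult_ac)
    then have "2 * ((\<bar>a\<bar> / s) * (\<bar>b\<bar> / t)) * (s * t / 2) \<le> ((a / s)\<^sup>2 + (b / t)\<^sup>2) * (s * t / 2)"
      by (rule mult_right_mono) (use that in simp)
    moreover have "2 * ((\<bar>a\<bar> / s) * (\<bar>b\<bar> / t)) * (s * t / 2) = \<bar>a * b\<bar>" using that by (simp add: abs_mult)
    ultimately show ?thesis by (simp add: distrib_right)
  qed
  have m': "f \<in> borel_measurable (lebesgue_on cell)" "g \<in> borel_measurable (lebesgue_on cell)"
    using m by (auto intro: measurable_restrict_space1)
  have ib: "integrable (lebesgue_on cell) (\<lambda>x. (f x / s)\<^sup>2 * (s * t / 2) + (g x / t)\<^sup>2 * (s * t / 2))" for s t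
    using f g by (auto simp: power_divide)
  show i: "integrable (lebesgue_on cell) (\<lambda>x. f x * g x)"
  proof (rule Bochner_Integration.integrable_bound[OF ib[of 1 1]])
    have "norm (f x * g x) \<le> norm ((f x / 1)\<^sup>2 * (1 * 1 / 2) + (g x / 1)\<^sup>2 * (1 * 1 / 2))" for x
      using pt[of 1 1 "f x" "g x"] by simp
    then show "AE x in lebesgue_on cell. norm (f x * g x) \<le> norm ((f x / 1)\<^sup>2 * (1 * 1 / 2) + (g x / 1)\<^sup>2 * (1 * 1 / 2))" by simp
  qed (use m' in auto)
  define a b where "a = sqrt (cell_integral (\<lambda>x. (f x)\<^sup>2))" and "b = sqrt (cell_integral (\<lambda>x. (g x)\<^sup>2))"
  have ab: "0 \<le> a" "0 \<le> b" "a\<^sup>2 = cell_integral (\<lambda>x. (f x)\<^sup>2)" "b\<^sup>2 = cell_integral (\<lambda>x. (g x)\<^sup>2)"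
    by (auto simp: a_def b_def cell_integral_def)
  have "cell_integral (\<lambda>x. \<bar>f x * g x\<bar>) \<le> (a + e) * (b + e)" if e: "0 < e" for e
  proof -
    have st: "0 < a + e" "0 < b + e" using ab e by auto
    have "cell_integral (\<lambda>x. \<bar>f x * g x\<bar>) \<le>
        cell_integral (\<lambda>x. (f x / (a + e))\<^sup>2 * ((a + e) * (b + e) / 2) + (g x / (b + e))\<^sup>2 * ((a + e) * (b + e) / 2))"
      unfolding cell_integral_def by (rule integral_mono[OF _ ib]) (use i pt[OF st] in auto)
    also have "\<dots> = (a\<^sup>2 / (a + e)\<^sup>2 + b\<^sup>2 / (b + e)\<^sup>2) * ((a + e) * (b + e) / 2)"
    proof -
      have "cell_integral (\<lambda>x. (f x / s)\<^sup>2 * c + (g x / t)\<^sup>2 * c)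
          = (cell_integral (\<lambda>x. (f x)\<^sup>2) / s\<^sup>2 + cell_integral (\<lambda>x. (g x)\<^sup>2) / t\<^sup>2) * c" for s t c
        using f g by (simp add: cell_integral_def power_divide distrib_right)
      then show ?thesis unfolding ab .
    qed
    also have "\<dots> \<le> (1 + 1) * ((a + e) * (b + e) / 2)"
    proof -
      have "a\<^sup>2 \<le> (a + e)\<^sup>2" "b\<^sup>2 \<le> (b + e)\<^sup>2" using ab(1,2) e by (auto intro!: power_mono)
      then have "a\<^sup>2 / (a + e)\<^sup>2 \<le> 1" "b\<^sup>2 / (b + e)\<^sup>2 \<le> 1" using st by simp_all
      then show ?thesis using st by (intro mult_right_mono add_mono) auto
    qed
    finally show ?thesis by simp
  qed
  then have le: "\<forall>\<^sub>F e in at_right 0. cell_integral (\<lambda>x. \<bar>f x * g x\<bar>) \<le> (a + e) * (b + e)"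
    by (auto simp: eventually_at_filter)
  have "((\<lambda>e. (a + e) * (b + e)) \<longlongrightarrow> (a + 0) * (b + 0)) (at_right 0)" by (intro tendsto_intros)
  from tendsto_lowerbound[OF this le] show "cell_integral (\<lambda>x. \<bar>f x * g x\<bar>) \<le>
      sqrt (cell_integral (\<lambda>x. (f x)\<^sup>2)) * sqrt (cell_integral (\<lambda>x. (g x)\<^sup>2))" by (simp add: a_def b_def)
qed

lemma cont_per_integrable: "f \<in> cont_per \<Longrightarrow> integrable (lebesgue_on cell) f"
  by (intro integrable_cell_continuous cont_per_continuous)

lemma cont_per_measurable: "f \<in> cont_per \<Longrightarrow> f \<in> borel_measurable lebesgue"
  by (intro continuous_borel_lebesgue cont_per_continuous)

lemma cell_integral_cont_per_mono: "f \<in> cont_per \<Longrightarrow> g \<in> cont_per \<Longrightarrow> (\<And>x. f x \<le> g x) \<Longrightarrow> cell_integral f \<le> cell_integral g"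
  unfolding cell_integral_def by (intro integral_mono cont_per_integrable) auto

text \<open>Along a line, the values of \<open>u^3\<close> at two points of one period differ by at
  most the integral of \<open>3 * u^2 * \<bar>g\<bar>\<close>. Averaging over the second point
  leaves the mean of \<open>\<bar>u\<bar>^3\<close>, which plays the part that compact support plays
  on the whole space. The cube is chosen because its power \<open>4/3\<close> is the desired
  \<open>u^4\<close>.\<close>

lemma line_bound:
  fixes u g :: "real ^ 'n \<Rightarrow> real"
  assumes u: "u \<in> cont_per" and g: "g \<in> cont_per" and d: "\<And>x t. ((\<lambda>t. u (x + axis i t)) has_real_derivative g (x + axis i t)) (at t)"
  shows "\<bar>u x\<bar> ^ 3 \<le> coord_mean i (\<lambda>x. \<bar>u x\<bar> ^ 3 + 3 * ((u x)\<^sup>2 * \<bar>g x\<bar>)) x"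
proof -
  define w where "w t = (u (x + axis i t)) ^ 3" for t
  define w' where "w' t = 3 * ((u (x + axis i t))\<^sup>2 * g (x + axis i t))" for t
  have dw: "(w has_real_derivative w' t) (at t)" for t
    unfolding w_def w'_def using DERIV_power[OF d[of x t], of 3] by (simp add: mult_ac)
  have cw': "(\<lambda>x. 3 * ((u x)\<^sup>2 * g x)) \<in> cont_per" "(\<lambda>x. 3 * ((u x)\<^sup>2 * \<bar>g x\<bar>)) \<in> cont_per"
    using u g by (auto intro!: cont_per_mult cont_per_const cont_per_power cont_per_abs)
  have iw': "w' integrable_on {a..b}" "(\<lambda>t. \<bar>w' t\<bar>) integrable_on {a..b}" for a b
    unfolding w'_def using cont_per_line_integrable[OF cw'(1)] cont_per_line_integrable[OF cont_per_abs[OF cw'(1)]] by auto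
  define J where "J = integral {0..1} (\<lambda>t. \<bar>w' t\<bar>)"
  have "\<bar>w 0\<bar> - J \<le> \<bar>w t\<bar>" if t: "t \<in> {0..1}" for t
  proof -
    have "(w' has_integral (w t - w 0)) {0..t}"
      using t dw by (intro fundamental_theorem_of_calculus)
        (auto simp: has_real_derivative_iff_has_vector_derivative[symmetric] intro: has_field_derivative_at_within)
    then have "w t - w 0 = integral {0..t} w'" by (simp add: integral_unique)
    then have "\<bar>w t - w 0\<bar> \<le> integral {0..t} (\<lambda>t. \<bar>w' t\<bar>)"
      using integral_norm_bound_integral[OF iw'(1) iw'(2), of 0 t] by simp
    also have "\<dots> \<le> J"
      unfolding J_def using t iw'(2) by (intro integral_subset_le) auto
    finally show ?thesis by linarith
  qed
  then have "integral {0..1} (\<lambda>t::real. \<bar>w 0\<bar> - J) \<le> integral {0..1} (\<lambda>t. \<bar>w t\<bar>)"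
    using cont_per_line_integrable[OF cont_per_abs[OF cont_per_power[OF u, of 3]]] by (intro integral_le) (auto simp: w_def)
  then have "\<bar>w 0\<bar> \<le> integral {0..1} (\<lambda>t. \<bar>w t\<bar>) + J" by simp
  also have "\<dots> = coord_mean i (\<lambda>x. \<bar>u x\<bar> ^ 3 + 3 * ((u x)\<^sup>2 * \<bar>g x\<bar>)) x"
    unfolding coord_mean_def J_def
    using cont_per_line_integrable[OF cont_per_power[OF cont_per_abs[OF u], of 3]] cont_per_line_integrable[OF cw'(2)]
    by (subst Henstock_Kurzweil_Integration.integral_add) (auto simp: w_def w'_def power_abs abs_mult)
  finally show ?thesis by (simp add: w_def power_abs axis_scale[of i 0])
qed

text \<open>The inequality for iterated means bounds \<open>Q\<close> by
  \<open>A powr (4/3)\<close>. Every summand of \<open>A\<close> contains the factor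
  \<open>u^2\<close>, so Cauchy-Schwarz returns \<open>A \<le> sqrt Q * H\<close>. As
  \<open>Q\<close> is finite for continuous \<open>u\<close>, the two estimates can be solved for
  \<open>Q\<close>, which gives \<open>Q \<le> H ^ 4\<close>.\<close>

lemma sobolev_smooth:
  fixes u :: "real ^ 'n \<Rightarrow> real" and g :: "'n \<Rightarrow> real ^ 'n \<Rightarrow> real"
  assumes card: "CARD('n) \<le> 4"
    and u: "u \<in> cont_per" and g: "\<And>i. g i \<in> cont_per"
    and d: "\<And>i x t. ((\<lambda>t. u (x + axis i t)) has_real_derivative g i (x + axis i t)) (at t)"
  shows "cell_integral (\<lambda>x. u x ^ 4) \<le>
    (sqrt (cell_integral (\<lambda>x. (u x)\<^sup>2)) + 3 * (\<Sum>i\<in>UNIV. sqrt (cell_integral (\<lambda>x. (g i x)\<^sup>2)))) ^ 4"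
proof -
  \<comment> \<open>With \<open>v = \<bar>u\<bar>^3\<close> one has
    \<open>u^4 = v powr (1 + p)\<close>. The requirement \<open>(CARD('n) - 1) * p \<le> 1\<close>
    of \<open>grid_lines\<close> then reads \<open>CARD('n) \<le> 4\<close>.\<close>
  define p :: real where "p = 1 / 3"
  define Q where "Q = cell_integral (\<lambda>x. u x ^ 4)"
  define H where "H = sqrt (cell_integral (\<lambda>x. (u x)\<^sup>2)) + 3 * (\<Sum>i\<in>UNIV. sqrt (cell_integral (\<lambda>x. (g i x)\<^sup>2)))"
  have Q0: "0 \<le> Q" by (simp add: Q_def cell_integral_def)
  have H0: "0 \<le> H" unfolding H_def by (intro add_nonneg_nonneg mult_nonneg_nonneg sum_nonneg) (auto simp: cell_integral_def)
  \<comment> \<open>One function that dominates \<open>\<bar>u\<bar>^3\<close> and whose mean in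
    every direction does so as well. The summand \<open>e > 0\<close> makes it strictly positive, as
    Hoelder's inequality with real powers requires, and is removed by letting \<open>e\<close> tend
    to 0.\<close>
  define F where "F e x = \<bar>u x\<bar> ^ 3 + 3 * (\<Sum>i\<in>UNIV. (u x)\<^sup>2 * \<bar>g i x\<bar>) + e" for e x
  define A where "A = cell_integral (\<lambda>x. F 0 x)"
  have FCP: "F e \<in> cont_per" for e
    unfolding F_def[abs_def] using u g by (intro cont_per_add cont_per_mult cont_per_sum cont_per_const cont_per_power cont_per_abs)
  have cpu: "(\<lambda>x. u x ^ 4) \<in> cont_per" "(\<lambda>x. \<bar>u x\<bar> ^ 3) \<in> cont_per" using u by (auto intro: cont_per_power cont_per_abs)
  obtain L :: "'n list" where L: "set L = UNIV" "distinct L"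
    using finite_distinct_list[OF finite_class.finite_UNIV] by blast
  have len: "length L = CARD('n)" using distinct_card[OF L(2)] L(1) by simp
  have a0: "0 \<le> 1 - (real (CARD('n)) - 1) * p" using card by (simp add: p_def)
  have Ae: "cell_integral (F e) = A + e" for e
  proof -
    have "F e = (\<lambda>x. F 0 x + e)" by (simp add: F_def fun_eq_iff)
    then have "cell_integral (F e) = cell_integral (\<lambda>x. F 0 x + e)" by simp
    also have "\<dots> = cell_integral (F 0) + cell_integral (\<lambda>x :: real ^ 'n. e)"
      unfolding cell_integral_def by (rule Bochner_Integration.integral_add) (auto intro: cont_per_integrable FCP cont_per_const)
    finally show ?thesis by (simp add: A_def)
  qed
  have "Q \<le> (A + e) powr (1 + p)" if e: "0 < e" for e
  proof -
    have Fp: "0 < F e x" for x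
      unfolding F_def using e by (intro add_nonneg_pos add_nonneg_nonneg mult_nonneg_nonneg sum_nonneg) auto
    have v1: "\<bar>u x\<bar> ^ 3 \<le> F e x" for x
      unfolding F_def using e by (auto intro!: add_increasing2 sum_nonneg)
    have v2: "\<bar>u x\<bar> ^ 3 \<le> coord_mean i (F e) x" for i x
    proof -
      have "\<bar>u x\<bar> ^ 3 \<le> coord_mean i (\<lambda>x. \<bar>u x\<bar> ^ 3 + 3 * ((u x)\<^sup>2 * \<bar>g i x\<bar>)) x"
        by (rule line_bound[OF u g d])
      also have "\<dots> \<le> coord_mean i (F e) x"
      proof (rule coord_mean_mono)
        show "(\<lambda>x. \<bar>u x\<bar> ^ 3 + 3 * ((u x)\<^sup>2 * \<bar>g i x\<bar>)) \<in> cont_per"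
          using u g by (intro cont_per_add cont_per_mult cont_per_const cont_per_power cont_per_abs)
        fix x
        have "(u x)\<^sup>2 * \<bar>g i x\<bar> \<le> (\<Sum>i\<in>UNIV. (u x)\<^sup>2 * \<bar>g i x\<bar>)"
          by (rule member_le_sum) auto
        then show "\<bar>u x\<bar> ^ 3 + 3 * ((u x)\<^sup>2 * \<bar>g i x\<bar>) \<le> F e x" using e by (simp add: F_def)
      qed (rule FCP)
      finally show ?thesis .
    qed
    define G where "G x = F e x powr (1 - (real (length L) - 1) * p) * (\<Prod>i\<in>set L. coord_mean i (F e) x powr p)" for x
    have GCP: "G \<in> cont_per" unfolding G_def using FCP Fp by (intro cont_per_mult cont_per_powr cont_per_prod cont_per_coord_mean coord_mean_pos) auto
    have uG: "u x ^ 4 \<le> G x" for x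
    proof (cases "u x = 0")
      case True then show ?thesis by (auto simp: G_def intro!: mult_nonneg_nonneg prod_nonneg)
    next
      case False
      define v where "v = \<bar>u x\<bar> ^ 3"
      have v: "0 < v" using False by (simp add: v_def)
      have "u x ^ 4 = \<bar>u x\<bar> powr 4" using False by (simp add: powr_numeral)
      also have "\<dots> = v powr (1 + p)"
      proof -
        have "v = \<bar>u x\<bar> powr 3" using False by (simp add: v_def powr_numeral)
        then have "v powr (1 + p) = \<bar>u x\<bar> powr (3 * (1 + p))" by (simp only: powr_powr)
        then show ?thesis by (simp add: p_def)
      qed
      also have "\<dots> = v powr (1 - (real (length L) - 1) * p) * (\<Prod>i\<in>set L. v powr p)"
      proof -
        have "(\<Prod>i\<in>set L. v powr p) = (v powr p) ^ CARD('n)" by (simp add: L)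
        also have "\<dots> = (v powr p) powr real (CARD('n))" using v by (intro powr_realpow[symmetric]) simp
        also have "\<dots> = v powr (p * real (CARD('n)))" by (simp only: powr_powr)
        finally have e1: "(\<Prod>i\<in>set L. v powr p) = v powr (p * real (CARD('n)))" .
        have e2: "1 + p = (1 - (real (length L) - 1) * p) + p * real (CARD('n))"
          unfolding len by (simp add: algebra_simps)
        show ?thesis unfolding e1 by (subst e2) (rule powr_add)
      qed
      also have "\<dots> \<le> G x"
        unfolding G_def v_def using a0 len
        by (intro mult_mono powr_mono2 prod_mono v1 v2 conjI prod_nonneg) (auto simp: p_def)
      finally show ?thesis .
    qed
    have "Q \<le> cell_integral G" unfolding Q_def by (rule cell_integral_cont_per_mono[OF cpu(1) GCP uG])
    also have "\<dots> = coord_means L G 0" by (rule coord_means_eq_cell_integral[OF GCP L(1), symmetric])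
    also have "\<dots> \<le> coord_means L (F e) 0 powr (1 + p)"
      unfolding G_def by (rule grid_lines) (use L len card FCP Fp in \<open>auto simp: p_def\<close>)
    also have "coord_means L (F e) 0 = A + e" by (simp add: coord_means_eq_cell_integral[OF FCP L(1)] Ae)
    finally show ?thesis .
  qed
  then have le: "\<forall>\<^sub>F e in at_right 0. Q \<le> (A + e) powr (1 + p)" by (auto simp: eventually_at_filter)
  have A0: "0 \<le> A" unfolding A_def cell_integral_def F_def
    by (intro Bochner_Integration.integral_nonneg) (auto intro!: add_nonneg_nonneg mult_nonneg_nonneg sum_nonneg)
  have "((\<lambda>e. (A + e) powr (1 + p)) \<longlongrightarrow> (A + 0) powr (1 + p)) (at_right 0)"
    using A0 by (intro tendsto_powr' tendsto_intros) (auto simp: p_def eventually_at_filter)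
  from tendsto_lowerbound[OF this le] have QA: "Q \<le> A powr (4 / 3)" by (simp add: p_def)
  have cs: "cell_integral (\<lambda>x. (u x)\<^sup>2 * \<bar>h x\<bar>) \<le> sqrt Q * sqrt (cell_integral (\<lambda>x. (h x)\<^sup>2))" if h: "h \<in> cont_per" for h
  proof -
    have "(\<lambda>x. ((u x)\<^sup>2)\<^sup>2) = (\<lambda>x. u x ^ 4)" by (simp add: power_mult[symmetric])
    then show ?thesis
      using cauchy_schwarz_cell(2)[of "\<lambda>x. (u x)\<^sup>2" h] cont_per_measurable[OF cont_per_power[OF u, of 2]] cont_per_measurable[OF h]
        cont_per_integrable[OF cpu(1)] cont_per_integrable[OF cont_per_power[OF h, of 2]] by (simp add: abs_mult Q_def)
  qed
  have "A = cell_integral (\<lambda>x. (u x)\<^sup>2 * \<bar>u x\<bar>) + 3 * (\<Sum>i\<in>UNIV. cell_integral (\<lambda>x. (u x)\<^sup>2 * \<bar>g i x\<bar>))"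
  proof -
    have i: "integrable (lebesgue_on cell) (\<lambda>x. (u x)\<^sup>2 * \<bar>h x\<bar>)" if "h \<in> cont_per" for h
      using that u by (intro cont_per_integrable cont_per_mult cont_per_power cont_per_abs)
    have "F 0 = (\<lambda>x. (u x)\<^sup>2 * \<bar>u x\<bar> + 3 * (\<Sum>i\<in>UNIV. (u x)\<^sup>2 * \<bar>g i x\<bar>))"
      by (auto simp: F_def fun_eq_iff power3_eq_cube power2_eq_square abs_mult_self_eq mult.assoc[symmetric])
    then show ?thesis unfolding A_def cell_integral_def using i[OF u] i[OF g] by simp
  qed
  also have "\<dots> \<le> sqrt Q * sqrt (cell_integral (\<lambda>x. (u x)\<^sup>2)) + 3 * (\<Sum>i\<in>UNIV. sqrt Q * sqrt (cell_integral (\<lambda>x. (g i x)\<^sup>2)))"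
    by (intro add_mono mult_left_mono sum_mono cs u g) auto
  also have "\<dots> = sqrt Q * H" by (simp add: H_def sum_distrib_left distrib_left mult_ac)
  finally have AH: "A \<le> sqrt Q * H" .
  have "Q \<le> H ^ 4"
  proof (cases "Q = 0")
    case False
    then have Qp: "0 < Q" using Q0 by simp
    have "Q powr (3 / 4) \<le> (A powr (4 / 3)) powr (3 / 4)" using QA Qp by (intro powr_mono2) auto
    also have "\<dots> = A" using A0 by (simp add: powr_powr)
    also have "\<dots> \<le> Q powr (1/2) * H" using AH Qp by (simp add: powr_half_sqrt)
    finally have "Q powr (1/2) * Q powr (1/4) \<le> Q powr (1/2) * H" by (simp add: powr_add[symmetric])
    then have "Q powr (1/4) \<le> H" using Qp by simp
    then have "(Q powr (1/4)) ^ 4 \<le> H ^ 4" by (intro power_mono) auto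
    moreover have "(Q powr (1/4)) ^ 4 = Q"
    proof -
      have "(Q powr (1/4)) ^ 4 = (Q powr (1/4)) powr 4" by (rule powr_numeral[symmetric]) simp
      also have "\<dots> = Q powr ((1/4) * 4)" by (simp only: powr_powr)
      finally show ?thesis using Qp by simp
    qed
    ultimately show ?thesis by simp
  qed simp
  then show ?thesis by (simp add: Q_def H_def)
qed

section \<open>Periodic Sobolev functions\<close>

lemma L2_per_D:
  fixes f :: "real ^ 'n \<Rightarrow> 'b::euclidean_space"
  assumes "f \<in> L2_per"
  shows "f \<in> borel_measurable lebesgue" "periodic f" "integrable (lebesgue_on cell) (\<lambda>x. (norm (f x))\<^sup>2)"
    "integrable (lebesgue_on cell) f"
  using assms square_integrable_imp_integrable by (auto simp: L2_per_def)

lemma integrable_cell_cong_AE: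
  fixes f g :: "real ^ 'n \<Rightarrow> 'b::euclidean_space"
  assumes "f \<in> borel_measurable lebesgue" "AE x in lebesgue. f x = g x" "integrable (lebesgue_on cell) f"
  shows "integrable (lebesgue_on cell) g"
  using integrable_cong_AE[OF measurable_restrict_space1[OF assms(1)]
      measurable_restrict_space1[OF measurable_cong_AE_lebesgue[OF assms(1,2)]] AE_cell[OF assms(2)]] assms(3) by simp

lemma L2_per_cong_AE:
  fixes f g :: "real ^ 'n \<Rightarrow> 'b::euclidean_space"
  assumes "f \<in> L2_per" "AE x in lebesgue. f x = g x"
  shows "g \<in> L2_per"
proof -
  note f = L2_per_D[OF assms(1)]
  have "integrable (lebesgue_on cell) (\<lambda>x. (norm (g x))\<^sup>2)"
    by (rule integrable_cell_cong_AE[OF _ _ f(3)]) (use f(1) assms(2) in \<open>auto elim: eventually_mono\<close>)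
  then show ?thesis
    using measurable_cong_AE_lebesgue[OF f(1) assms(2)] periodic_cong_AE[OF f(2) assms(2)] by (simp add: L2_per_def)
qed

lemma H1_per_cong_AE:
  assumes "u \<in> H1_per" "AE x in lebesgue. u x = v x"
  shows "v \<in> H1_per"
proof -
  have "\<exists>g\<in>L2_per. has_weak_partial i v g" for i
  proof -
    obtain g where g: "g \<in> L2_per" "has_weak_partial i u g" using assms(1) by (auto simp: H1_per_def)
    have "has_weak_partial i v g" by (rule has_weak_partial_cong_AE[OF g(2) assms(2)]) simp
    with g(1) show ?thesis by blast
  qed
  moreover have "v \<in> L2_per" using L2_per_cong_AE[OF _ assms(2)] assms(1) by (simp add: H1_per_def)
  ultimately show ?thesis by (simp add: H1_per_def)
qed

lemma H1_per_weak_partial: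
  assumes "u \<in> H1_per"
  shows "has_weak_partial i u (weak_partial i u)" "weak_partial i u \<in> L2_per"
proof -
  obtain g where g: "g \<in> L2_per" "has_weak_partial i u g" using assms by (auto simp: H1_per_def)
  show "has_weak_partial i u (weak_partial i u)" using weak_partial_works[OF g(2)] by simp
  have "AE x in lebesgue. g x = weak_partial i u x"
    using weak_partial_works(2)[OF g(2)] by (auto elim: eventually_mono)
  then show "weak_partial i u \<in> L2_per" by (rule L2_per_cong_AE[OF g(1)])
qed

lemma H1_perI:
  assumes "u \<in> L2_per" "\<And>i. g i \<in> L2_per" "\<And>i. has_weak_partial i u (g i)"
  shows "u \<in> H1_per"
  using assms by (auto simp: H1_per_def)

lemma L2_per_diff:
  fixes f g :: "real ^ 'n \<Rightarrow> 'b::euclidean_space"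
  assumes "f \<in> L2_per" "g \<in> L2_per" shows "(\<lambda>x. f x - g x) \<in> L2_per"
proof -
  note f = L2_per_D[OF assms(1)] note g = L2_per_D[OF assms(2)]
  have m: "(\<lambda>x. f x - g x) \<in> borel_measurable lebesgue" using f(1) g(1) by simp
  have "periodic (\<lambda>x. f x - g x)" unfolding periodic_def
  proof
    fix i
    have "AE x in lebesgue. f (x + axis i 1) = f x" "AE x in lebesgue. g (x + axis i 1) = g x"
      using f(2) g(2) by (auto simp: periodic_def)
    then show "AE x in lebesgue. f (x + axis i 1) - g (x + axis i 1) = f x - g x" by eventually_elim simp
  qed
  moreover have "integrable (lebesgue_on cell) (\<lambda>x. (norm (f x - g x))\<^sup>2)"
  proof (rule Bochner_Integration.integrable_bound)
    show "integrable (lebesgue_on cell) (\<lambda>x. 2 * (norm (f x))\<^sup>2 + 2 * (norm (g x))\<^sup>2)" using f(3) g(3) by simp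
    have "norm ((norm (f x - g x))\<^sup>2) \<le> norm (2 * (norm (f x))\<^sup>2 + 2 * (norm (g x))\<^sup>2)" for x
    proof -
      have "(norm (f x - g x))\<^sup>2 \<le> (norm (f x) + norm (g x))\<^sup>2"
        by (intro power_mono norm_triangle_ineq4) auto
      also have "\<dots> \<le> 2 * (norm (f x))\<^sup>2 + 2 * (norm (g x))\<^sup>2"
        using zero_le_power2[of "norm (f x) - norm (g x)"] by (simp add: power2_sum power2_diff)
      finally show ?thesis by simp
    qed
    then show "AE x in lebesgue_on cell. norm ((norm (f x - g x))\<^sup>2) \<le> norm (2 * (norm (f x))\<^sup>2 + 2 * (norm (g x))\<^sup>2)" by simp
  qed (use m in \<open>auto intro!: measurable_restrict_space1\<close>)
  ultimately show ?thesis using m by (simp add: L2_per_def)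
qed

lemma H1_per_L2: "u \<in> H1_per \<Longrightarrow> u \<in> L2_per"
  by (simp add: H1_per_def)

lemma H1_per_diff:
  assumes "u \<in> H1_per" "v \<in> H1_per" shows "(\<lambda>x. u x - v x) \<in> H1_per"
proof (rule H1_perI)
  show "(\<lambda>x. u x - v x) \<in> L2_per" by (intro L2_per_diff H1_per_L2 assms)
  show "(\<lambda>x. weak_partial i u x - weak_partial i v x) \<in> L2_per" for i
    by (intro L2_per_diff H1_per_weak_partial assms)
  show "has_weak_partial i (\<lambda>x. u x - v x) (\<lambda>x. weak_partial i u x - weak_partial i v x)" for i
    by (intro has_weak_partial_diff H1_per_weak_partial assms)
qed

text \<open>The convolutions are smooth and their derivatives are the convolutions of the weak
  derivatives, so neither \<open>L^2\<close> norm on the right-hand side grows. Fatou's lemma along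
  an almost everywhere convergent subsequence yields integrability of the fourth power and the bound
  at once.\<close>

theorem sobolev_H1_per:
  fixes u :: "real ^ 'n \<Rightarrow> real"
  assumes card: "CARD('n) \<le> 4" and u: "u \<in> H1_per"
  defines "H \<equiv> sqrt (cell_integral (\<lambda>x. (u x)\<^sup>2)) + 3 * (\<Sum>i\<in>UNIV. sqrt (cell_integral (\<lambda>x. (weak_partial i u x)\<^sup>2)))"
  shows "integrable (lebesgue_on cell) (\<lambda>x. u x ^ 4)" "cell_integral (\<lambda>x. u x ^ 4) \<le> H ^ 4"
proof -
  define g where "g i = weak_partial i u" for i
  have wp: "has_weak_partial i u (g i)" and gL: "g i \<in> L2_per" for i
    using H1_per_weak_partial[OF u] by (auto simp: g_def)
  note uL = L2_per_D[OF H1_per_L2[OF u]] note gD = L2_per_D[OF gL]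
  have big: "integrable (lebesgue_on big) u" using wp by (auto simp: has_weak_partial_def locally_integrable_def)
  have H0: "0 \<le> H" unfolding H_def by (intro add_nonneg_nonneg mult_nonneg_nonneg sum_nonneg) (auto simp: cell_integral_def)
  have cCP: "conv N f \<in> cont_per" if "integrable (lebesgue_on cell) f" for N and f :: "real ^ 'n \<Rightarrow> real"
    using continuous_conv[OF that] periodic_conv[OF that] by (auto simp: cont_per_def)
  have Nle: "cell_integral (\<lambda>x. conv N u x ^ 4) \<le> H ^ 4" for N
  proof -
    have "cell_integral (\<lambda>x. conv N u x ^ 4) \<le> (sqrt (cell_integral (\<lambda>x. (conv N u x)\<^sup>2)) + 3 * (\<Sum>i\<in>UNIV. sqrt (cell_integral (\<lambda>x. (conv N (g i) x)\<^sup>2)))) ^ 4"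
      by (rule sobolev_smooth[OF card cCP cCP conv_has_derivative[OF wp]]) (use uL gD in auto)
    also have "\<dots> \<le> H ^ 4"
      unfolding H_def
    proof (intro power_mono add_mono mult_left_mono sum_mono real_sqrt_le_mono)
      show "cell_integral (\<lambda>x. (conv N u x)\<^sup>2) \<le> cell_integral (\<lambda>x. (u x)\<^sup>2)"
        by (rule conv_L2_le) (use uL in auto)
      show "cell_integral (\<lambda>x. (conv N (g i) x)\<^sup>2) \<le> cell_integral (\<lambda>x. (weak_partial i u x)\<^sup>2)" for i
        unfolding g_def[symmetric] by (rule conv_L2_le) (use gD in auto)
    qed (auto intro!: add_nonneg_nonneg mult_nonneg_nonneg sum_nonneg simp: cell_integral_def)
    finally show ?thesis .
  qed
  obtain r :: "nat \<Rightarrow> nat" where r: "AE x in lebesgue_on (cell :: (real ^ 'n) set). (\<lambda>k. conv (r k) u x) \<longlonglongrightarrow> u x"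
    using conv_AE_subseq[OF uL(1,2,4) big] by blast
  have cm: "(\<lambda>x. conv N u x ^ 4) \<in> borel_measurable (lebesgue_on cell)" for N
    using continuous_borel_lebesgue[OF continuous_conv[OF uL(4), of N]] by (intro measurable_restrict_space1) measurable
  have um: "(\<lambda>x. u x ^ 4) \<in> borel_measurable (lebesgue_on cell)"
    using uL(1) by (intro measurable_restrict_space1) measurable
  have "(\<integral>\<^sup>+x. ennreal (u x ^ 4) \<partial>lebesgue_on cell) = (\<integral>\<^sup>+x. liminf (\<lambda>k. ennreal (conv (r k) u x ^ 4)) \<partial>lebesgue_on cell)"
  proof (rule nn_integral_cong_AE)
    show "AE x in lebesgue_on cell. ennreal (u x ^ 4) = liminf (\<lambda>k. ennreal (conv (r k) u x ^ 4))"
      using r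
    proof eventually_elim
      case (elim x)
      have "(\<lambda>k. ennreal (conv (r k) u x ^ 4)) \<longlonglongrightarrow> ennreal (u x ^ 4)"
        using elim by (intro tendsto_ennrealI tendsto_intros)
      from lim_imp_Liminf[OF sequentially_bot this] show ?case by (rule sym)
    qed
  qed
  also have "\<dots> \<le> liminf (\<lambda>k. \<integral>\<^sup>+x. ennreal (conv (r k) u x ^ 4) \<partial>lebesgue_on cell)"
    by (rule nn_integral_liminf) (use cm in measurable)
  also have "\<dots> \<le> liminf (\<lambda>k :: nat. ennreal (H ^ 4))"
  proof (rule Liminf_mono, rule always_eventually, rule allI)
    fix k
    have "(\<lambda>x. conv (r k) u x ^ 4) \<in> cont_per" by (intro cont_per_power cCP uL)
    from nn_integral_eq_integral[OF cont_per_integrable[OF this]]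
    show "(\<integral>\<^sup>+x. ennreal (conv (r k) u x ^ 4) \<partial>lebesgue_on cell) \<le> ennreal (H ^ 4)"
      using Nle[of "r k"] by (simp add: cell_integral_def ennreal_leI)
  qed
  also have "\<dots> = ennreal (H ^ 4)" by (simp add: Liminf_const)
  finally have le: "(\<integral>\<^sup>+x. ennreal (u x ^ 4) \<partial>lebesgue_on cell) \<le> ennreal (H ^ 4)" .
  show "integrable (lebesgue_on cell) (\<lambda>x. u x ^ 4)"
    by (rule integrableI_nonneg) (use um le in \<open>auto simp: less_top[symmetric] top_unique\<close>)
  show "cell_integral (\<lambda>x. u x ^ 4) \<le> H ^ 4"
    by (rule measurable_cell_integral_bound[OF um _ _ le]) (use H0 in auto)
qed

subsection \<open>Strong solutions with trigonometric polynomial coefficients\<close>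

text \<open>\<open>p\<close> is a family of Fourier coefficients; \<open>tgrad p\<close> and \<open>thess p\<close> are the gradient and the Hessian of the
  real part of \<open>trig p\<close>, and \<open>lapnorm p\<close> is the \<open>L\<^sup>2\<close> norm of the Laplacian of \<open>trig p\<close> by Parseval's identity.\<close>

definition supp :: "(int ^ 'n \<Rightarrow> complex) \<Rightarrow> (int ^ 'n) set" where
  "supp p = {k. p k \<noteq> 0}"

definition trig :: "(int ^ 'n \<Rightarrow> complex) \<Rightarrow> real ^ 'n \<Rightarrow> complex" where
  "trig p x = (\<Sum>k\<in>supp p. p k * ee k x)"

definition dcoeff :: "'n \<Rightarrow> (int ^ 'n \<Rightarrow> complex) \<Rightarrow> int ^ 'n \<Rightarrow> complex" where
  "dcoeff i p k = p k * (2 * pi * k $ i) * \<i>"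

definition tgrad :: "(int ^ 'n \<Rightarrow> complex) \<Rightarrow> real ^ 'n \<Rightarrow> real ^ 'n" where
  "tgrad p x = (\<chi> i. Re (trig (dcoeff i p) x))"

definition thess :: "(int ^ 'n \<Rightarrow> complex) \<Rightarrow> real ^ 'n \<Rightarrow> real ^ 'n ^ 'n" where
  "thess p x = (\<chi> i j. Re (trig (dcoeff i (dcoeff j p)) x))"

definition sq :: "int ^ 'n \<Rightarrow> real" where
  "sq k = (\<Sum>i\<in>UNIV. (real_of_int (k $ i))\<^sup>2)"

definition lapnorm :: "(int ^ 'n \<Rightarrow> complex) \<Rightarrow> real" where
  "lapnorm p = L2_set (\<lambda>k. 4 * pi\<^sup>2 * sq k * cmod (p k)) (supp p)"

lemma trig_eq: "finite K \<Longrightarrow> supp p \<subseteq> K \<Longrightarrow> trig p x = (\<Sum>k\<in>K. p k * ee k x)"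
  unfolding trig_def by (rule sum.mono_neutral_left) (auto simp: supp_def)

lemma lapnorm_eq: "finite K \<Longrightarrow> supp p \<subseteq> K \<Longrightarrow> lapnorm p = L2_set (\<lambda>k. 4 * pi\<^sup>2 * sq k * cmod (p k)) K"
  unfolding lapnorm_def L2_set_def by (intro arg_cong[where f=sqrt] sum.mono_neutral_left) (auto simp: supp_def)

lemma supp_dcoeff: "supp (dcoeff i p) \<subseteq> supp p"
  by (auto simp: supp_def dcoeff_def)

lemma supp_add: "supp (\<lambda>k. p k + q k) \<subseteq> supp p \<union> supp q"
  by (auto simp: supp_def)

lemma dcoeff_add: "dcoeff i (\<lambda>k. p k + q k) = (\<lambda>k. dcoeff i p k + dcoeff i q k)"
  by (simp add: dcoeff_def fun_eq_iff algebra_simps)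

lemma dcoeff_commute: "dcoeff i (dcoeff j p) = dcoeff j (dcoeff i p)"
  by (simp add: dcoeff_def fun_eq_iff mult_ac)

lemma trig_add:
  assumes "finite (supp p)" "finite (supp q)"
  shows "trig (\<lambda>k. p k + q k) x = trig p x + trig q x"
proof -
  let ?K = "supp p \<union> supp q"
  have f: "finite ?K" using assms by simp
  show ?thesis
    using trig_eq[OF f supp_add, of x] trig_eq[OF f, of p x] trig_eq[OF f, of q x]
    by (simp add: sum.distrib distrib_right)
qed

lemma finite_supp_dcoeff: "finite (supp p) \<Longrightarrow> finite (supp (dcoeff i p))"
  using supp_dcoeff by (rule finite_subset)

lemma tgrad_add: "finite (supp p) \<Longrightarrow> finite (supp q) \<Longrightarrow> tgrad (\<lambda>k. p k + q k) x = tgrad p x + tgrad q x"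
  by (simp add: tgrad_def vec_eq_iff dcoeff_add trig_add finite_supp_dcoeff)

lemma thess_add: "finite (supp p) \<Longrightarrow> finite (supp q) \<Longrightarrow> thess (\<lambda>k. p k + q k) x = thess p x + thess q x"
  by (simp add: thess_def vec_eq_iff dcoeff_add trig_add finite_supp_dcoeff)

lemma lapnorm_add:
  assumes "finite (supp p)" "finite (supp q)"
  shows "lapnorm (\<lambda>k. p k + q k) \<le> lapnorm p + lapnorm q"
proof -
  let ?K = "supp p \<union> supp q"
  have f: "finite ?K" using assms by simp
  have sq: "0 \<le> sq k" for k :: "int ^ 'a" by (simp add: sq_def sum_nonneg)
  have "lapnorm (\<lambda>k. p k + q k) = L2_set (\<lambda>k. 4 * pi\<^sup>2 * sq k * cmod (p k + q k)) ?K"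
    by (rule lapnorm_eq[OF f supp_add])
  also have "\<dots> \<le> L2_set (\<lambda>k. 4 * pi\<^sup>2 * sq k * cmod (p k) + 4 * pi\<^sup>2 * sq k * cmod (q k)) ?K"
    unfolding distrib_left[symmetric] by (intro L2_set_mono mult_left_mono norm_triangle_ineq) (auto simp: sq)
  also have "\<dots> \<le> L2_set (\<lambda>k. 4 * pi\<^sup>2 * sq k * cmod (p k)) ?K + L2_set (\<lambda>k. 4 * pi\<^sup>2 * sq k * cmod (q k)) ?K"
    by (rule L2_set_triangle_ineq)
  also have "\<dots> = lapnorm p + lapnorm q"
    using lapnorm_eq[OF f, of p] lapnorm_eq[OF f, of q] by simp
  finally show ?thesis .
qed

lemma lapnorm_nonneg: "0 \<le> lapnorm p"
  by (simp add: lapnorm_def)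

lemma trig_trig_poly: "supp p \<subseteq> Box d \<Longrightarrow> trig p \<in> trig_poly d"
  using trig_eq[OF card_Box(1), of p d] by (intro trig_poly_I[where c=p]) auto

lemma real_trig_poly_tgrad: "supp p \<subseteq> Box d \<Longrightarrow> (\<lambda>x. tgrad p x $ i) \<in> real_trig_poly d"
  unfolding tgrad_def using trig_trig_poly[of "dcoeff i p" d] supp_dcoeff[of i p] by (simp add: real_trig_poly_Re)

lemma real_trig_poly_thess: "supp p \<subseteq> Box d \<Longrightarrow> (\<lambda>x. thess p x $ i $ j) \<in> real_trig_poly d"
  unfolding thess_def using trig_trig_poly[of "dcoeff i (dcoeff j p)" d] supp_dcoeff[of i "dcoeff j p"] supp_dcoeff[of j p]
  by (simp add: real_trig_poly_Re)

lemma finite_supp_Box: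
  assumes "finite (supp (p :: int ^ 'n \<Rightarrow> complex))" obtains d where "supp p \<subseteq> Box d"
proof -
  have "\<exists>d. k \<in> Box d" for k :: "int ^ 'n"
  proof -
    have "\<bar>k $ i\<bar> \<le> int (nat (\<Sum>j\<in>UNIV. \<bar>k $ j\<bar>))" for i
      using member_le_sum[of i UNIV "\<lambda>j. \<bar>k $ j\<bar>"] by (simp add: sum_nonneg)
    then show ?thesis unfolding Box_def by blast
  qed
  then obtain D where D: "\<And>k :: int ^ 'n. k \<in> Box (D k)" by metis
  have "k \<in> Box (\<Sum>l\<in>supp p. D l)" if "k \<in> supp p" for k
    using D[of k] Box_mono[of "D k" "\<Sum>l\<in>supp p. D l"] member_le_sum[of k "supp p" D] assms that by auto
  then show ?thesis using that by blast
qed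

lemma integral_Re_trig_le:
  assumes "supp p \<subseteq> Box d"
  shows "cell_integral (\<lambda>x. (Re (trig p x))\<^sup>2) \<le> (\<Sum>k\<in>Box d. (cmod (p k))\<^sup>2)"
proof -
  have c: "continuous_on UNIV (trig p)" by (rule continuous_trig_poly[OF trig_trig_poly[OF assms]])
  have "cell_integral (\<lambda>x. (Re (trig p x))\<^sup>2) \<le> cell_integral (\<lambda>x. (cmod (trig p x))\<^sup>2)"
    unfolding cell_integral_def
    by (intro integral_mono integrable_cell_continuous continuous_intros c) (simp add: cmod_power2)
  also have "\<dots> = (\<Sum>k\<in>Box d. (cmod (p k))\<^sup>2)"
    by (rule parseval) (rule trig_eq[OF card_Box(1) assms])
  finally show ?thesis .
qed

lemma norm_sq_vec: "(norm (v :: real ^ 'n))\<^sup>2 = (\<Sum>i\<in>UNIV. (v $ i)\<^sup>2)"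
  by (simp add: norm_vec_def L2_set_def sum_nonneg)

lemma norm_sq_mat: "(norm (M :: real ^ 'n ^ 'n))\<^sup>2 = (\<Sum>i\<in>UNIV. \<Sum>j\<in>UNIV. (M $ i $ j)\<^sup>2)"
  by (simp add: norm_vec_def[of M] L2_set_def sum_nonneg norm_sq_vec)

lemma sq_ge_1: "k \<noteq> 0 \<Longrightarrow> 1 \<le> sq k"
proof -
  assume "k \<noteq> 0"
  then obtain i where "k $ i \<noteq> 0" by (auto simp: vec_eq_iff)
  then have "1 \<le> \<bar>k $ i\<bar>" by simp
  then have "1 \<le> \<bar>real_of_int (k $ i)\<bar>" by linarith
  then have "1 \<le> (real_of_int (k $ i))\<^sup>2" by (metis one_le_power power2_abs)
  also have "\<dots> \<le> sq k" unfolding sq_def by (rule member_le_sum) auto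
  finally show ?thesis .
qed

text \<open>In Fourier space the Hessian of \<open>trig p\<close> has the same energy as its
  Laplacian, both carrying the weight \<open>(4 * pi^2 * sq k)^2\<close>. The gradient has weight
  \<open>4 * pi^2 * sq k\<close>, and \<open>sq k \<le> (sq k)^2\<close> for integer frequencies
  bounds its energy by \<open>1 / (4 * pi^2)\<close> times that of the Laplacian. Passing to real
  parts turns equality into an inequality.\<close>

lemma hessian_gradient_energy_le:
  fixes p :: "int ^ 'n \<Rightarrow> complex"
  assumes "finite (supp p)"
  shows "cell_integral (\<lambda>x. (norm (thess p x))\<^sup>2 + (norm (tgrad p x))\<^sup>2) \<le> (1 + 1 / (4 * pi\<^sup>2)) * (lapnorm p)\<^sup>2"
proof -
  obtain d where d: "supp p \<subseteq> Box d" using finite_supp_Box[OF assms] by blast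
  have s1: "supp (dcoeff i p) \<subseteq> Box d" for i using supp_dcoeff d by blast
  have s2: "supp (dcoeff i (dcoeff j p)) \<subseteq> Box d" for i j using supp_dcoeff s1 by blast
  have c: "continuous_on UNIV (trig q)" if "supp q \<subseteq> Box d" for q by (rule continuous_trig_poly[OF trig_trig_poly[OF that]])
  have i: "integrable (lebesgue_on cell) (\<lambda>x. (Re (trig q x))\<^sup>2)" if "supp q \<subseteq> Box d" for q
    by (intro integrable_cell_continuous continuous_intros c that)
  have "cell_integral (\<lambda>x. (norm (thess p x))\<^sup>2 + (norm (tgrad p x))\<^sup>2)
     = (\<Sum>i\<in>UNIV. \<Sum>j\<in>UNIV. cell_integral (\<lambda>x. (Re (trig (dcoeff i (dcoeff j p)) x))\<^sup>2))
       + (\<Sum>i\<in>UNIV. cell_integral (\<lambda>x. (Re (trig (dcoeff i p) x))\<^sup>2))"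
    unfolding norm_sq_vec norm_sq_mat thess_def tgrad_def cell_integral_def using i[OF s1] i[OF s2] by simp
  also have "\<dots> \<le> (\<Sum>i\<in>UNIV. \<Sum>j\<in>UNIV. \<Sum>k\<in>Box d. (cmod (dcoeff i (dcoeff j p) k))\<^sup>2)
       + (\<Sum>i\<in>UNIV. \<Sum>k\<in>Box d. (cmod (dcoeff i p k))\<^sup>2)"
    by (intro add_mono sum_mono integral_Re_trig_le s1 s2)
  also have "\<dots> = (\<Sum>k\<in>Box d. (cmod (p k))\<^sup>2 * (2 * pi) ^ 4 * (sq k)\<^sup>2 + (cmod (p k))\<^sup>2 * (2 * pi)\<^sup>2 * sq k)"
  proof -
    have "(\<Sum>i\<in>UNIV. \<Sum>k\<in>Box d. (cmod (dcoeff i p k))\<^sup>2) = (\<Sum>k\<in>Box d. \<Sum>i\<in>UNIV. (cmod (dcoeff i p k))\<^sup>2)"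
      by (rule sum.swap)
    also have "\<dots> = (\<Sum>k\<in>Box d. (cmod (p k))\<^sup>2 * (2 * pi)\<^sup>2 * sq k)"
      by (simp add: dcoeff_def norm_mult power_mult_distrib sq_def sum_distrib_left mult_ac)
    finally have a: "(\<Sum>i\<in>UNIV. \<Sum>k\<in>Box d. (cmod (dcoeff i p k))\<^sup>2) = (\<Sum>k\<in>Box d. (cmod (p k))\<^sup>2 * (2 * pi)\<^sup>2 * sq k)" .
    have "(\<Sum>i\<in>UNIV. \<Sum>j\<in>UNIV. \<Sum>k\<in>Box d. (cmod (dcoeff i (dcoeff j p) k))\<^sup>2)
        = (\<Sum>i\<in>UNIV. \<Sum>k\<in>Box d. \<Sum>j\<in>UNIV. (cmod (dcoeff i (dcoeff j p) k))\<^sup>2)"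
      by (intro sum.cong refl sum.swap)
    also have "\<dots> = (\<Sum>k\<in>Box d. \<Sum>i\<in>UNIV. \<Sum>j\<in>UNIV. (cmod (dcoeff i (dcoeff j p) k))\<^sup>2)"
      by (rule sum.swap)
    also have "\<dots> = (\<Sum>k\<in>Box d. (cmod (p k))\<^sup>2 * (2 * pi) ^ 4 * (sq k)\<^sup>2)"
    proof (rule sum.cong)
      fix k :: "int ^ 'n"
      have "(cmod (dcoeff i (dcoeff j p) k))\<^sup>2 = (cmod (p k))\<^sup>2 * (2 * pi) ^ 4 * ((real_of_int (k $ i))\<^sup>2 * (real_of_int (k $ j))\<^sup>2)" for i j
        by (simp add: dcoeff_def norm_mult power_mult_distrib power4_eq_xxxx power2_eq_square mult_ac)
      then show "(\<Sum>i\<in>UNIV. \<Sum>j\<in>UNIV. (cmod (dcoeff i (dcoeff j p) k))\<^sup>2) = (cmod (p k))\<^sup>2 * (2 * pi) ^ 4 * (sq k)\<^sup>2"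
        by (simp add: sum_distrib_left[symmetric] sq_def power2_eq_square[of "sum _ _"] sum_product)
    qed simp
    finally show ?thesis using a by (simp add: sum.distrib)
  qed
  also have "\<dots> \<le> (\<Sum>k\<in>Box d. (1 + 1 / (4 * pi\<^sup>2)) * (4 * pi\<^sup>2 * sq k * cmod (p k))\<^sup>2)"
  proof (rule sum_mono)
    fix k :: "int ^ 'n"
    have "sq k \<le> (sq k)\<^sup>2"
    proof (cases "k = 0")
      case False then show ?thesis using sq_ge_1[OF False] by (simp add: power2_eq_square)
    qed (simp add: sq_def)
    then have "(cmod (p k))\<^sup>2 * (2 * pi)\<^sup>2 * sq k \<le> (cmod (p k))\<^sup>2 * (2 * pi)\<^sup>2 * (sq k)\<^sup>2"
      by (intro mult_left_mono) auto
    moreover have "(1 + 1 / (4 * pi\<^sup>2)) * (4 * pi\<^sup>2 * sq k * cmod (p k))\<^sup>2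
        = (cmod (p k))\<^sup>2 * (2 * pi) ^ 4 * (sq k)\<^sup>2 + (cmod (p k))\<^sup>2 * (2 * pi)\<^sup>2 * (sq k)\<^sup>2"
      by (simp add: power_mult_distrib power4_eq_xxxx power2_eq_square distrib_right distrib_left field_simps)
    ultimately show "(cmod (p k))\<^sup>2 * (2 * pi) ^ 4 * (sq k)\<^sup>2 + (cmod (p k))\<^sup>2 * (2 * pi)\<^sup>2 * sq k
        \<le> (1 + 1 / (4 * pi\<^sup>2)) * (4 * pi\<^sup>2 * sq k * cmod (p k))\<^sup>2" by linarith
  qed
  also have "\<dots> = (1 + 1 / (4 * pi\<^sup>2)) * (lapnorm p)\<^sup>2"
    unfolding lapnorm_eq[OF card_Box(1) d] L2_set_def by (simp add: sum_nonneg sum_distrib_left)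
  finally show ?thesis .
qed

lemma trig_poisson_solution:
  fixes f :: "real ^ 'n \<Rightarrow> real"
  assumes f: "f \<in> real_trig_poly d" and mean: "cell_integral f = 0"
  obtains p where "supp p \<subseteq> Box d" "\<And>x. (\<Sum>i\<in>UNIV. thess p x $ i $ i) = f x"
    "lapnorm p = sqrt (cell_integral (\<lambda>x. (f x)\<^sup>2))"
proof -
  obtain c where c: "\<And>x. complex_of_real (f x) = (\<Sum>k\<in>Box d. c k * ee k x)"
    using f by (auto simp: real_trig_poly_def trig_poly_def fun_eq_iff)
  have z: "(0 :: int ^ 'n) \<in> Box d" by (simp add: Box_def)
  have c0: "c 0 = 0"
    using trig_poly_coeff[OF c z] mean by (simp add: cell_integral_complex_of_real)
  \<comment> \<open>The Laplacian multiplies the coefficient at \<open>k\<close> by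
    \<open>- 4 * pi^2 * sq k\<close>. The constant mode cannot be divided out; it is set to 0,
    consistently with \<open>c 0 = 0\<close>, which is the mean value condition.\<close>
  define p where "p k = (if k \<in> Box d \<and> k \<noteq> 0 then - c k / complex_of_real (4 * pi\<^sup>2 * sq k) else 0)" for k
  have sp: "supp p \<subseteq> Box d" by (auto simp: supp_def p_def)
  have pc: "p k * complex_of_real (4 * pi\<^sup>2 * sq k) = - c k" if "k \<in> Box d" for k
  proof (cases "k = 0")
    case False then show ?thesis using sq_ge_1[OF False] that by (simp add: p_def)
  qed (simp add: p_def c0)
  have s2: "supp (dcoeff i (dcoeff j p)) \<subseteq> Box d" for i j using supp_dcoeff sp by blast
  show ?thesis
  proof
    show "supp p \<subseteq> Box d" by (rule sp)
    fix x
    have "(\<Sum>i\<in>UNIV. thess p x $ i $ i) = Re (\<Sum>i\<in>UNIV. \<Sum>k\<in>Box d. dcoeff i (dcoeff i p) k * ee k x)"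
      by (simp add: thess_def trig_eq[OF card_Box(1) s2] Re_sum del: times_complex.sel)
    also have "(\<Sum>i\<in>UNIV. \<Sum>k\<in>Box d. dcoeff i (dcoeff i p) k * ee k x) = (\<Sum>k\<in>Box d. (\<Sum>i\<in>UNIV. dcoeff i (dcoeff i p) k) * ee k x)"
      by (subst sum.swap) (simp add: sum_distrib_right)
    also have "\<dots> = (\<Sum>k\<in>Box d. c k * ee k x)"
    proof (rule sum.cong)
      fix k assume k: "k \<in> (Box d :: (int ^ 'n) set)"
      have "(\<Sum>i\<in>UNIV. dcoeff i (dcoeff i p) k) = (\<Sum>i\<in>UNIV. - (p k * complex_of_real (4 * pi\<^sup>2 * (real_of_int (k $ i))\<^sup>2)))"
        by (intro sum.cong) (simp_all add: dcoeff_def power2_eq_square mult_ac)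
      also have "\<dots> = - (p k * complex_of_real (4 * pi\<^sup>2 * sq k))"
        by (simp add: sum_negf sum_distrib_left sq_def mult_ac)
      also have "\<dots> = c k" using pc[OF k] by simp
      finally show "(\<Sum>i\<in>UNIV. dcoeff i (dcoeff i p) k) * ee k x = c k * ee k x" by simp
    qed simp
    finally show "(\<Sum>i\<in>UNIV. thess p x $ i $ i) = f x" by (simp flip: c)
  next
    have "lapnorm p = sqrt (\<Sum>k\<in>Box d. (cmod (p k * complex_of_real (4 * pi\<^sup>2 * sq k)))\<^sup>2)"
      unfolding lapnorm_eq[OF card_Box(1) sp] L2_set_def norm_mult norm_of_real
      by (simp add: power_mult_distrib mult_ac)
    also have "\<dots> = sqrt (\<Sum>k\<in>Box d. (cmod (c k))\<^sup>2)"
      using pc by (intro arg_cong[where f=sqrt] sum.cong) auto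
    also have "\<dots> = sqrt (cell_integral (\<lambda>x. (f x)\<^sup>2))"
      using parseval[OF c] by simp
    finally show "lapnorm p = sqrt (cell_integral (\<lambda>x. (f x)\<^sup>2))" .
  qed
qed

section \<open>The maximum principle for trigonometric polynomials\<close>

text \<open>Elimination of one index at a time in place of a spectral decomposition. If
  \<open>\<beta> = B k k\<close> is positive, \<open>B\<close> is the Schur complement
  \<open>B'\<close>, whose row and column \<open>k\<close> vanish, plus a rank-one matrix, and the
  latter pairs with \<open>a\<close> to a value of the quadratic form of \<open>a\<close>. If
  \<open>\<beta> = 0\<close>, semidefiniteness forces row and column \<open>k\<close> of
  \<open>B\<close> to vanish.\<close>

lemma psd_inner_nonneg:
  fixes a B :: "'n \<Rightarrow> 'n \<Rightarrow> real"
  assumes "finite S"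
    and "\<And>v. 0 \<le> (\<Sum>i\<in>S. \<Sum>j\<in>S. a i j * v i * v j)"
    and "\<And>i j. B i j = B j i"
    and "\<And>v. 0 \<le> (\<Sum>i\<in>S. \<Sum>j\<in>S. B i j * v i * v j)"
  shows "0 \<le> (\<Sum>i\<in>S. \<Sum>j\<in>S. a i j * B i j)"
  using assms
proof (induction S arbitrary: B rule: finite_induct)
  case empty then show ?case by simp
next
  case (insert k S)
  note sym = insert.prems(2) and Bpsd = insert.prems(3)
  have exp: "(\<Sum>i\<in>insert k S. \<Sum>j\<in>insert k S. F i j)
      = F k k + (\<Sum>j\<in>S. F k j) + (\<Sum>i\<in>S. F i k) + (\<Sum>i\<in>S. \<Sum>j\<in>S. F i j)" for F :: "'n \<Rightarrow> 'n \<Rightarrow> real"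
    using insert.hyps by (simp add: sum.distrib)
  have aS: "0 \<le> (\<Sum>i\<in>S. \<Sum>j\<in>S. a i j * v i * v j)" for v
  proof -
    have "(\<Sum>i\<in>insert k S. \<Sum>j\<in>insert k S. a i j * (v(k := 0)) i * (v(k := 0)) j) = (\<Sum>i\<in>S. \<Sum>j\<in>S. a i j * v i * v j)"
      unfolding exp using insert.hyps by (simp add: sum.neutral) (intro sum.cong refl; auto)
    then show ?thesis using insert.prems(1)[of "v(k := 0)"] by simp
  qed
  define \<beta> where "\<beta> = B k k"
  have quad: "0 \<le> \<beta> * s * s + 2 * s * (\<Sum>i\<in>S. B i k * v i) + (\<Sum>i\<in>S. \<Sum>j\<in>S. B i j * v i * v j)" for s v
  proof -
    let ?w = "v(k := s)"
    have w: "?w i = v i" if "i \<in> S" for i using that insert.hyps by auto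
    have "0 \<le> (\<Sum>i\<in>insert k S. \<Sum>j\<in>insert k S. B i j * ?w i * ?w j)" by (rule Bpsd)
    also have "\<dots> = \<beta> * s * s + (\<Sum>j\<in>S. B k j * s * v j) + (\<Sum>i\<in>S. B i k * v i * s) + (\<Sum>i\<in>S. \<Sum>j\<in>S. B i j * v i * v j)"
      unfolding exp using w by (simp add: \<beta>_def cong: sum.cong)
    also have "(\<Sum>j\<in>S. B k j * s * v j) = s * (\<Sum>i\<in>S. B i k * v i)"
      by (simp add: sum_distrib_left sym[of k] mult_ac)
    also have "(\<Sum>i\<in>S. B i k * v i * s) = s * (\<Sum>i\<in>S. B i k * v i)"
      by (simp add: sum_distrib_left mult_ac)
    finally show ?thesis by simp
  qed
  have b0: "0 \<le> \<beta>" using quad[of 1 "\<lambda>_. 0"] by simp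
  show ?case
  proof (cases "\<beta> = 0")
    case True
    have Bk: "B i k = 0" if i: "i \<in> S" for i
    proof (rule ccontr)
      assume ne: "B i k \<noteq> 0"
      let ?v = "\<lambda>j. if j = i then 1 else 0 :: real"
      have e1: "(\<Sum>j\<in>S. B j k * ?v j) = B i k" using i insert.hyps by (simp add: if_distrib cong: if_cong)
      define Q where "Q = (\<Sum>i\<in>S. \<Sum>j\<in>S. B i j * ?v i * ?v j)"
      \<comment> \<open>For \<open>\<beta> = 0\<close> the expression in \<open>quad\<close> is
        affine in \<open>s\<close>; this choice of \<open>s\<close> gives it the value
        \<open>-1\<close>.\<close>
      have "0 \<le> 2 * (- (Q + 1) / (2 * B i k)) * B i k + Q"
        using quad[of "- (Q + 1) / (2 * B i k)" ?v] True unfolding e1 Q_def by simp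
      moreover have "2 * (- (Q + 1) / (2 * B i k)) * B i k = - (Q + 1)" using ne by simp
      ultimately show False by linarith
    qed
    have "0 \<le> (\<Sum>i\<in>S. \<Sum>j\<in>S. a i j * B i j)"
      using insert.IH[of B] aS sym quad[of 0] by simp
    moreover have "B k i = 0" if "i \<in> S" for i using Bk[OF that] sym[of k i] by simp
    ultimately show ?thesis unfolding exp using True Bk by (simp add: \<beta>_def)
  next
    case False
    then have bp: "0 < \<beta>" using b0 by simp
    define B' where "B' i j = B i j - B i k * B j k / \<beta>" for i j
    have "0 \<le> (\<Sum>i\<in>S. \<Sum>j\<in>S. B' i j * v i * v j)" for v
    proof -
      define T where "T = (\<Sum>i\<in>S. B i k * v i)"
      have "(\<Sum>i\<in>S. \<Sum>j\<in>S. B' i j * v i * v j) = (\<Sum>i\<in>S. \<Sum>j\<in>S. B i j * v i * v j) - (\<Sum>i\<in>S. \<Sum>j\<in>S. (B i k * v i) * (B j k * v j)) / \<beta>"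
        unfolding sum_divide_distrib sum_subtractf[symmetric]
        by (intro sum.cong refl) (simp add: B'_def algebra_simps)
      also have "(\<Sum>i\<in>S. \<Sum>j\<in>S. (B i k * v i) * (B j k * v j)) = T * T"
        by (simp add: T_def sum_product)
      finally have eqX: "(\<Sum>i\<in>S. \<Sum>j\<in>S. B' i j * v i * v j) = (\<Sum>i\<in>S. \<Sum>j\<in>S. B i j * v i * v j) - T * T / \<beta>" .
      \<comment> \<open>The point \<open>s = - T / \<beta>\<close> minimises the expression in
        \<open>quad\<close>, and the minimum is the quadratic form of \<open>B'\<close>.\<close>
      have "\<beta> * (- T / \<beta>) * (- T / \<beta>) + 2 * (- T / \<beta>) * T = - (T * T / \<beta>)" using bp by (simp add: field_simps)
      then show ?thesis unfolding eqX using quad[of "- T / \<beta>" v] unfolding T_def[symmetric] by linarith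
    qed
    then have "0 \<le> (\<Sum>i\<in>S. \<Sum>j\<in>S. a i j * B' i j)"
      using insert.IH[of B'] aS sym by (simp add: B'_def mult.commute)
    moreover have "B' k j = 0" "B' j k = 0" for j using bp sym[of k j] by (simp_all add: B'_def \<beta>_def)
    ultimately have 1: "0 \<le> (\<Sum>i\<in>insert k S. \<Sum>j\<in>insert k S. a i j * B' i j)" unfolding exp by simp
    have 2: "0 \<le> (\<Sum>i\<in>insert k S. \<Sum>j\<in>insert k S. a i j * B i k * B j k) / \<beta>"
      using insert.prems(1)[of "\<lambda>i. B i k"] bp by simp
    have "(\<Sum>i\<in>insert k S. \<Sum>j\<in>insert k S. a i j * B i j)
        = (\<Sum>i\<in>insert k S. \<Sum>j\<in>insert k S. a i j * B' i j) + (\<Sum>i\<in>insert k S. \<Sum>j\<in>insert k S. a i j * B i k * B j k) / \<beta>"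
      unfolding sum_divide_distrib sum.distrib[symmetric] by (intro sum.cong refl) (simp add: B'_def algebra_simps)
    then show ?thesis using 1 2 by simp
  qed
qed

lemma trig_has_derivative:
  fixes p :: "int ^ 'n \<Rightarrow> complex"
  assumes "finite (supp p)"
  shows "((\<lambda>x. Re (trig p x)) has_derivative (\<lambda>h. \<Sum>i\<in>UNIV. Re (trig (dcoeff i p) x) * h $ i)) (at x)"
proof -
  have "((\<lambda>x. \<Sum>k\<in>supp p. p k * ee k x) has_derivative
      (\<lambda>h. \<Sum>k\<in>supp p. p k * (2 * pi * (\<Sum>i\<in>UNIV. of_int (k $ i) * h $ i)) *\<^sub>R (\<i> * ee k x))) (at x)"
    by (intro has_derivative_sum bounded_linear.has_derivative[OF bounded_linear_mult_right ee_has_derivative])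
  from bounded_linear.has_derivative[OF bounded_linear_Re this]
  have "((\<lambda>x. Re (trig p x)) has_derivative
      (\<lambda>h. Re (\<Sum>k\<in>supp p. p k * (2 * pi * (\<Sum>i\<in>UNIV. of_int (k $ i) * h $ i)) *\<^sub>R (\<i> * ee k x)))) (at x)"
    by (simp add: trig_def[abs_def])
  moreover have "Re (\<Sum>k\<in>supp p. p k * (2 * pi * (\<Sum>i\<in>UNIV. of_int (k $ i) * h $ i)) *\<^sub>R (\<i> * ee k x))
      = (\<Sum>i\<in>UNIV. Re (trig (dcoeff i p) x) * h $ i)" for h
  proof -
    have "p k * (2 * pi * (\<Sum>i\<in>UNIV. of_int (k $ i) * h $ i)) *\<^sub>R (\<i> * ee k x) = (\<Sum>i\<in>UNIV. complex_of_real (h $ i) * (dcoeff i p k * ee k x))" for k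
      by (simp add: dcoeff_def scaleR_conv_of_real sum_distrib_left sum_distrib_right mult_ac)
    then have "(\<Sum>k\<in>supp p. p k * (2 * pi * (\<Sum>i\<in>UNIV. of_int (k $ i) * h $ i)) *\<^sub>R (\<i> * ee k x))
        = (\<Sum>i\<in>UNIV. \<Sum>k\<in>supp p. complex_of_real (h $ i) * (dcoeff i p k * ee k x))"
      by (simp add: sum.swap[of _ _ "supp p"])
    also have "\<dots> = (\<Sum>i\<in>UNIV. complex_of_real (h $ i) * trig (dcoeff i p) x)"
      by (simp add: trig_eq[OF assms supp_dcoeff] sum_distrib_left)
    finally show ?thesis by (simp add: mult.commute)
  qed
  ultimately show ?thesis by simp
qed

lemma ee_int_vector: "ee k (\<chi> i. real_of_int (l i)) = 1"
proof -
  have "(\<Sum>i\<in>UNIV. real_of_int (k $ i) * real_of_int (l i)) \<in> \<int>" by (intro Ints_sum Ints_mult) auto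
  then show ?thesis by (simp add: ee_def cis_multiple_2pi)
qed

lemma trig_attains_max:
  fixes p :: "int ^ 'n \<Rightarrow> complex"
  assumes "finite (supp p)"
  obtains x0 where "\<And>x. Re (trig p x) \<le> Re (trig p x0)"
proof -
  have c: "continuous_on (cbox 0 1) (\<lambda>x :: real ^ 'n. Re (trig p x))"
    unfolding trig_def by (intro continuous_intros)
  have "(0 :: real ^ 'n) \<in> cbox 0 1" by (simp add: mem_box_cart)
  then obtain x0 where x0: "\<And>x. x \<in> cbox 0 1 \<Longrightarrow> Re (trig p x) \<le> Re (trig p x0)"
    using continuous_attains_sup[OF compact_cbox _ c] by blast
  have "Re (trig p x) \<le> Re (trig p x0)" for x
  proof -
    define z where "z = (\<chi> i. frac (x $ i))"
    have xz: "x = z + (\<chi> i. real_of_int \<lfloor>x $ i\<rfloor>)" by (simp add: vec_eq_iff z_def frac_def)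
    have "ee k x = ee k z" for k by (subst xz) (simp add: ee_add_arg ee_int_vector)
    then have "trig p x = trig p z" by (simp add: trig_def)
    moreover have "z \<in> cbox 0 1" by (simp add: z_def mem_box_cart frac_lt_1 less_imp_le)
    ultimately show ?thesis using x0 by simp
  qed
  then show ?thesis by (rule that)
qed

text \<open>At a global maximum the gradient vanishes and the Hessian is negative semidefinite, so
  its pairing with a positive semidefinite \<open>a\<close> is nonpositive. A single such point is
  enough to bound the constant in the approximate equation from below.\<close>

lemma trig_max_principle:
  fixes p :: "int ^ 'n \<Rightarrow> complex" and a :: "real ^ 'n \<Rightarrow> real ^ 'n ^ 'n" and b :: "real ^ 'n \<Rightarrow> real ^ 'n"
  assumes fin: "finite (supp p)" and psd: "\<And>x v. 0 \<le> v \<bullet> (a x *v v)"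
  obtains x0 where "a x0 \<bullet> thess p x0 + b x0 \<bullet> tgrad p x0 \<le> 0"
proof -
  obtain x0 where x0: "\<And>x. Re (trig p x) \<le> Re (trig p x0)" using trig_attains_max[OF fin] by blast
  define D where "D v x = (\<Sum>i\<in>UNIV. Re (trig (dcoeff i p) x) * v $ i)" for v x
  define D2 where "D2 v x = (\<Sum>i\<in>UNIV. (\<Sum>j\<in>UNIV. Re (trig (dcoeff j (dcoeff i p)) x) * v $ j) * v $ i)" for v x
  have line: "((\<lambda>t. x0 + t *\<^sub>R v) has_derivative (\<lambda>h. h *\<^sub>R v)) (at t)" for v t
    by (auto intro!: derivative_eq_intros)
  have d1: "((\<lambda>t. Re (trig p (x0 + t *\<^sub>R v))) has_real_derivative D v (x0 + t *\<^sub>R v)) (at t)" for v t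
    unfolding has_field_derivative_def
    by (rule has_derivative_eq_rhs[OF has_derivative_compose[OF line trig_has_derivative[OF fin]]])
      (auto simp: fun_eq_iff D_def sum_distrib_left sum_distrib_right mult_ac)
  have dd: "((\<lambda>t. Re (trig q (x0 + t *\<^sub>R v))) has_real_derivative (\<Sum>j\<in>UNIV. Re (trig (dcoeff j q) (x0 + t *\<^sub>R v)) * v $ j)) (at t)"
    if "finite (supp q)" for q v t
    unfolding has_field_derivative_def
    by (rule has_derivative_eq_rhs[OF has_derivative_compose[OF line trig_has_derivative[OF that]]])
      (auto simp: fun_eq_iff sum_distrib_left sum_distrib_right mult_ac)
  have d2: "((\<lambda>t. D v (x0 + t *\<^sub>R v)) has_real_derivative D2 v (x0 + t *\<^sub>R v)) (at t)" for v t
    unfolding D_def D2_def by (intro DERIV_sum DERIV_cmult_right dd finite_supp_dcoeff fin)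
  have D0: "D v x0 = 0" for v
    using DERIV_local_max[OF d1[of v 0], of 1] x0 by simp
  \<comment> \<open>A positive second derivative at the critical point would make the first
    derivative positive just to the right of it, and the function would exceed its maximum.\<close>
  have neg: "D2 v x0 \<le> 0" for v
  proof (rule ccontr)
    assume "\<not> D2 v x0 \<le> 0"
    then have "0 < D2 v (x0 + 0 *\<^sub>R v)" by simp
    from DERIV_pos_inc_right[OF d2[of v 0] this] obtain e where e: "0 < e" "\<And>h. 0 < h \<Longrightarrow> h < e \<Longrightarrow> 0 < D v (x0 + h *\<^sub>R v)"
      using D0[of v] by auto
    have "Re (trig p (x0 + 0 *\<^sub>R v)) < Re (trig p (x0 + (e / 2) *\<^sub>R v))"
    proof (rule DERIV_pos_imp_increasing_open[of 0 "e / 2" "\<lambda>t. Re (trig p (x0 + t *\<^sub>R v))"])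
      show "0 < e / 2" using e by simp
      show "\<exists>y. ((\<lambda>t. Re (trig p (x0 + t *\<^sub>R v))) has_real_derivative y) (at t) \<and> 0 < y" if "0 < t" "t < e / 2" for t
        using d1[of v t] e(2)[of t] that by auto
      show "continuous_on {0..e / 2} (\<lambda>t. Re (trig p (x0 + t *\<^sub>R v)))"
        using d1 by (meson DERIV_isCont continuous_at_imp_continuous_on)
    qed
    then show False using x0[of "x0 + (e / 2) *\<^sub>R v"] by simp
  qed
  have g0: "tgrad p x0 = 0"
  proof -
    have "Re (trig (dcoeff i p) x0) = 0" for i
      using D0[of "axis i 1"] by (simp add: D_def axis_def if_distrib cong: if_cong)
    then show ?thesis by (simp add: tgrad_def vec_eq_iff)
  qed
  define B where "B i j = - (thess p x0 $ i $ j)" for i j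
  have "0 \<le> (\<Sum>i\<in>UNIV. \<Sum>j\<in>UNIV. a x0 $ i $ j * B i j)"
  proof (rule psd_inner_nonneg)
    fix v :: "'n \<Rightarrow> real"
    show "0 \<le> (\<Sum>i\<in>UNIV. \<Sum>j\<in>UNIV. a x0 $ i $ j * v i * v j)"
      using psd[of "\<chi> i. v i" x0] by (simp add: inner_vec_def matrix_vector_mult_def sum_distrib_left mult_ac)
    show "0 \<le> (\<Sum>i\<in>UNIV. \<Sum>j\<in>UNIV. B i j * v i * v j)"
      using neg[of "\<chi> i. v i"]
      by (simp add: D2_def B_def thess_def sum_distrib_right sum_distrib_left sum_negf mult_ac dcoeff_commute)
  next
    show "B i j = B j i" for i j by (simp add: B_def thess_def dcoeff_commute[of i j])
  qed simp
  then have "a x0 \<bullet> thess p x0 \<le> 0" by (simp add: frobenius_inner B_def sum_negf)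
  then show ?thesis using that[of x0] g0 by simp
qed

section \<open>Neumann series within trigonometric polynomials\<close>

text \<open>Cauchy-Schwarz over the at most \<open>(2 * d + 1) ^ CARD('n)\<close> frequencies. The
  square root of their number is replaced by the number itself; only polynomial growth in the degree
  matters.\<close>

lemma real_trig_poly_sup_bound:
  fixes f :: "real ^ 'n \<Rightarrow> real"
  assumes "f \<in> real_trig_poly d"
  shows "\<bar>f x\<bar> \<le> real ((2 * d + 1) ^ CARD('n)) * sqrt (cell_integral (\<lambda>x. (f x)\<^sup>2))"
proof -
  obtain c where c: "\<And>x. complex_of_real (f x) = (\<Sum>k\<in>Box d. c k * ee k x)"
    using assms by (auto simp: real_trig_poly_def trig_poly_def fun_eq_iff)
  define K where "K = real ((2 * d + 1) ^ CARD('n))"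
  have "(1 :: nat) \<le> (2 * d + 1) ^ CARD('n)" by (rule one_le_power) simp
  from of_nat_mono[OF this, where 'a=real] have K1: "1 \<le> K" unfolding K_def by (simp only: of_nat_1)
  have cK: "real (card (Box d :: (int ^ 'n) set)) \<le> K" unfolding K_def by (rule of_nat_mono[OF card_Box(2)])
  have "\<bar>f x\<bar> = cmod (complex_of_real (f x))" by simp
  also have "\<dots> \<le> (\<Sum>k\<in>Box d. \<bar>1\<bar> * \<bar>cmod (c k)\<bar>)"
    unfolding c by (rule order_trans[OF norm_sum]) (simp add: norm_mult)
  also have "\<dots> \<le> L2_set (\<lambda>_. 1) (Box d :: (int ^ 'n) set) * L2_set (\<lambda>k. cmod (c k)) (Box d)"
    by (rule L2_set_mult_ineq)
  also have "L2_set (\<lambda>k. cmod (c k)) (Box d) = sqrt (cell_integral (\<lambda>x. (f x)\<^sup>2))"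
    using parseval[OF c] by (simp add: L2_set_def)
  also have "L2_set (\<lambda>_. 1) (Box d :: (int ^ 'n) set) * sqrt (cell_integral (\<lambda>x. (f x)\<^sup>2)) \<le> K * sqrt (cell_integral (\<lambda>x. (f x)\<^sup>2))"
  proof (rule mult_right_mono)
    have "L2_set (\<lambda>_. 1) (Box d :: (int ^ 'n) set) \<le> sqrt K"
      unfolding L2_set_def using cK by simp
    also have "\<dots> \<le> K" using K1 by (intro real_le_lsqrt) (auto simp: power2_eq_square)
    finally show "L2_set (\<lambda>_. 1) (Box d :: (int ^ 'n) set) \<le> K" .
  qed (simp add: cell_integral_def)
  finally show ?thesis by (simp add: K_def)
qed

text \<open>Solve Poisson's equation with right-hand side \<open>f\<close>; what is left is
  \<open>K\<close>, the operator with coefficients \<open>(a - I, b)\<close> applied to the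
  solution. Cauchy-Schwarz for the pair of coefficients against the pair of Hessian and gradient,
  with the energy bound, gives \<open>L^2\<close> norm at most \<open>\<kappa>\<close> times that of
  \<open>f\<close>. Removing the mean is an orthogonal projection, so \<open>R\<close> and
  \<open>c\<close> both inherit this bound.\<close>

lemma neumann_step:
  fixes a :: "real ^ 'n \<Rightarrow> real ^ 'n ^ 'n" and b :: "real ^ 'n \<Rightarrow> real ^ 'n"
  assumes a: "\<And>i j. (\<lambda>x. a x $ i $ j) \<in> real_trig_poly N" and b: "\<And>i. (\<lambda>x. b x $ i) \<in> real_trig_poly N"
    and s: "\<And>x. (norm (a x - mat 1))\<^sup>2 + (norm (b x))\<^sup>2 \<le> s" and k: "s * (1 + 1 / (4 * pi\<^sup>2)) \<le> \<kappa>\<^sup>2" "0 \<le> \<kappa>"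
    and f: "f \<in> real_trig_poly d" "cell_integral f = 0"
  obtains p c R where "finite (supp p)" "R \<in> real_trig_poly (d + N)" "cell_integral R = 0"
    "sqrt (cell_integral (\<lambda>x. (R x)\<^sup>2)) \<le> \<kappa> * sqrt (cell_integral (\<lambda>x. (f x)\<^sup>2))"
    "\<And>x. a x \<bullet> thess p x + b x \<bullet> tgrad p x = f x - c - R x"
    "lapnorm p = sqrt (cell_integral (\<lambda>x. (f x)\<^sup>2))"
    "\<bar>c\<bar> \<le> \<kappa> * sqrt (cell_integral (\<lambda>x. (f x)\<^sup>2))"
proof -
  define F where "F = sqrt (cell_integral (\<lambda>x. (f x)\<^sup>2))"
  have F0: "0 \<le> F" by (simp add: F_def cell_integral_def)
  obtain p where p: "supp p \<subseteq> Box d" "\<And>x. (\<Sum>i\<in>UNIV. thess p x $ i $ i) = f x" "lapnorm p = F"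
    using trig_poisson_solution[OF f] unfolding F_def by blast
  have fin: "finite (supp p)" using p(1) card_Box(1) by (rule finite_subset)
  define K where "K x = (a x - mat 1) \<bullet> thess p x + b x \<bullet> tgrad p x" for x
  \<comment> \<open>The mean of \<open>K\<close> is moved into the constant so that \<open>R\<close>
    has mean zero and can be the right-hand side of Poisson's equation in the next step.\<close>
  define c where "c = - cell_integral K"
  define R where "R x = - c - K x" for x
  have tr: "mat 1 \<bullet> thess p x = f x" for x
    unfolding p(2)[symmetric] by (simp add: frobenius_inner mat_def if_distrib[where f="\<lambda>c. c * _"] cong: if_cong)
  have KR: "K \<in> real_trig_poly (d + N)"
  proof -
    have "(\<lambda>x. (\<Sum>i\<in>UNIV. \<Sum>j\<in>UNIV. thess p x $ i $ j * (a x $ i $ j - mat 1 $ i $ j)) + (\<Sum>i\<in>UNIV. tgrad p x $ i * b x $ i)) \<in> real_trig_poly (d + N)"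
      by (intro real_trig_poly_add real_trig_poly_sum real_trig_poly_mult real_trig_poly_thess real_trig_poly_tgrad real_trig_poly_diff a b real_trig_poly_const p)
    then show ?thesis by (simp add: K_def[abs_def] frobenius_inner inner_vec_def mult.commute)
  qed
  have Kc: "continuous_on UNIV K" by (rule continuous_real_trig_poly[OF KR])
  have Ki: "integrable (lebesgue_on cell) K" "integrable (lebesgue_on cell) (\<lambda>x. (K x)\<^sup>2)"
    by (intro integrable_cell_continuous continuous_intros Kc)+
  have RR: "R \<in> real_trig_poly (d + N)" unfolding R_def[abs_def] by (intro real_trig_poly_diff real_trig_poly_const KR)
  have Rm: "cell_integral R = 0"
  proof -
    interpret finite_measure "lebesgue_on (cell :: (real ^ 'n) set)" by (rule cell_finite_measure)
    show ?thesis
      unfolding R_def[abs_def] c_def using Ki by (simp add: cell_integral_def measure_restrict_space)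
  qed
  have ct: "continuous_on UNIV (\<lambda>x. thess p x $ i $ j)" "continuous_on UNIV (\<lambda>x. tgrad p x $ i)" for i j
    by (rule continuous_real_trig_poly[OF real_trig_poly_thess[OF p(1)]], rule continuous_real_trig_poly[OF real_trig_poly_tgrad[OF p(1)]])
  have Kpt: "(K x)\<^sup>2 \<le> s * ((norm (thess p x))\<^sup>2 + (norm (tgrad p x))\<^sup>2)" for x
  proof -
    have "(K x)\<^sup>2 = ((a x - mat 1, b x) \<bullet> (thess p x, tgrad p x))\<^sup>2" by (simp add: K_def)
    also have "\<dots> \<le> ((a x - mat 1, b x) \<bullet> (a x - mat 1, b x)) * ((thess p x, tgrad p x) \<bullet> (thess p x, tgrad p x))"
      by (rule Cauchy_Schwarz_ineq)
    also have "\<dots> = ((norm (a x - mat 1))\<^sup>2 + (norm (b x))\<^sup>2) * ((norm (thess p x))\<^sup>2 + (norm (tgrad p x))\<^sup>2)"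
      by (simp add: power2_norm_eq_inner)
    also have "\<dots> \<le> s * ((norm (thess p x))\<^sup>2 + (norm (tgrad p x))\<^sup>2)"
      by (rule mult_right_mono[OF s]) simp
    finally show ?thesis .
  qed
  have s0: "0 \<le> s" using s[of 0] by (meson add_nonneg_nonneg order_trans zero_le_power2)
  have ei: "integrable (lebesgue_on cell) (\<lambda>x. (norm (thess p x))\<^sup>2 + (norm (tgrad p x))\<^sup>2)"
    unfolding norm_sq_vec norm_sq_mat by (intro integrable_cell_continuous continuous_intros ct)
  have "cell_integral (\<lambda>x. (K x)\<^sup>2) \<le> cell_integral (\<lambda>x. s * ((norm (thess p x))\<^sup>2 + (norm (tgrad p x))\<^sup>2))"
    unfolding cell_integral_def by (intro integral_mono Ki integrable_mult_right ei Kpt)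
  also have "\<dots> = s * cell_integral (\<lambda>x. (norm (thess p x))\<^sup>2 + (norm (tgrad p x))\<^sup>2)"
    unfolding cell_integral_def by simp
  also have "\<dots> \<le> s * ((1 + 1 / (4 * pi\<^sup>2)) * (lapnorm p)\<^sup>2)"
    by (intro mult_left_mono hessian_gradient_energy_le fin s0)
  also have "\<dots> \<le> \<kappa>\<^sup>2 * F\<^sup>2"
    unfolding p(3) mult.assoc[symmetric] by (intro mult_right_mono k) simp
  finally have KF: "cell_integral (\<lambda>x. (K x)\<^sup>2) \<le> (\<kappa> * F)\<^sup>2" by (simp add: power_mult_distrib)
  have RK: "cell_integral (\<lambda>x. (R x)\<^sup>2) = cell_integral (\<lambda>x. (K x)\<^sup>2) - c\<^sup>2"
  proof -
    interpret finite_measure "lebesgue_on (cell :: (real ^ 'n) set)" by (rule cell_finite_measure)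
    have "cell_integral (\<lambda>x. (R x)\<^sup>2) = cell_integral (\<lambda>x. (K x)\<^sup>2 + 2 * c * K x + c\<^sup>2)"
      by (intro arg_cong[where f=cell_integral]) (simp add: R_def fun_eq_iff power2_eq_square algebra_simps)
    also have "\<dots> = cell_integral (\<lambda>x. (K x)\<^sup>2) + 2 * c * cell_integral K + c\<^sup>2"
      using Ki by (simp add: cell_integral_def measure_restrict_space)
    finally show ?thesis by (simp add: c_def power2_eq_square)
  qed
  have R0: "0 \<le> cell_integral (\<lambda>x. (R x)\<^sup>2)" by (simp add: cell_integral_def)
  show ?thesis
  proof (rule that[where p=p and c=c and R=R, OF fin RR Rm])
    have "cell_integral (\<lambda>x. (R x)\<^sup>2) \<le> (\<kappa> * F)\<^sup>2"
    proof -
      have "cell_integral (\<lambda>x. (R x)\<^sup>2) \<le> cell_integral (\<lambda>x. (K x)\<^sup>2)" unfolding RK by simp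
      also note KF
      finally show ?thesis .
    qed
    then have "sqrt (cell_integral (\<lambda>x. (R x)\<^sup>2)) \<le> sqrt ((\<kappa> * F)\<^sup>2)" by (rule real_sqrt_le_mono)
    then show "sqrt (cell_integral (\<lambda>x. (R x)\<^sup>2)) \<le> \<kappa> * sqrt (cell_integral (\<lambda>x. (f x)\<^sup>2))"
      using k F0 by (simp add: F_def[symmetric])
    have "c\<^sup>2 \<le> (\<kappa> * F)\<^sup>2" using RK KF R0 by simp
    then show "\<bar>c\<bar> \<le> \<kappa> * sqrt (cell_integral (\<lambda>x. (f x)\<^sup>2))"
      unfolding F_def[symmetric] using abs_le_square_iff[of c "\<kappa> * F"] k F0 by simp
    show "lapnorm p = sqrt (cell_integral (\<lambda>x. (f x)\<^sup>2))" using p(3) by (simp add: F_def)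
    show "a x \<bullet> thess p x + b x \<bullet> tgrad p x = f x - c - R x" for x
      by (simp add: R_def K_def inner_diff_left tr)
  qed
qed

text \<open>Each step is applied to the residual of the preceding one. Its degree rises by
  \<open>N\<close>, the degree of the coefficients, while the corrections to \<open>p\<close> and
  \<open>c\<close> shrink geometrically.\<close>

lemma neumann_series:
  fixes a :: "real ^ 'n \<Rightarrow> real ^ 'n ^ 'n" and b :: "real ^ 'n \<Rightarrow> real ^ 'n"
  assumes a: "\<And>i j. (\<lambda>x. a x $ i $ j) \<in> real_trig_poly N" and b: "\<And>i. (\<lambda>x. b x $ i) \<in> real_trig_poly N"
    and s: "\<And>x. (norm (a x - mat 1))\<^sup>2 + (norm (b x))\<^sup>2 \<le> s" and k: "s * (1 + 1 / (4 * pi\<^sup>2)) \<le> \<kappa>\<^sup>2" "0 \<le> \<kappa>"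
    and f: "f \<in> real_trig_poly d" "cell_integral f = 0"
  defines "F \<equiv> sqrt (cell_integral (\<lambda>x. (f x)\<^sup>2))"
  shows "\<exists>p c R. finite (supp p) \<and> R \<in> real_trig_poly (d + m * N) \<and> cell_integral R = 0 \<and>
    sqrt (cell_integral (\<lambda>x. (R x)\<^sup>2)) \<le> \<kappa> ^ m * F \<and>
    (\<forall>x. a x \<bullet> thess p x + b x \<bullet> tgrad p x = f x - c - R x) \<and>
    lapnorm p \<le> F * (\<Sum>j<m. \<kappa> ^ j) \<and> \<bar>c\<bar> \<le> \<kappa> * F * (\<Sum>j<m. \<kappa> ^ j)"
proof (induction m)
  case 0
  have s0: "supp (\<lambda>k :: int ^ 'n. 0) = {}" by (simp add: supp_def)
  have z: "trig (\<lambda>k. 0) x = 0" "dcoeff i (\<lambda>k. 0) = (\<lambda>k. 0)" for x :: "real ^ 'n" and i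
    by (simp_all add: trig_def s0 dcoeff_def fun_eq_iff)
  have "thess (\<lambda>k. 0) x = 0" "tgrad (\<lambda>k. 0) x = 0" for x :: "real ^ 'n"
    by (simp_all add: thess_def tgrad_def z vec_eq_iff)
  then show ?case
    by (intro exI[of _ "\<lambda>k. 0"] exI[of _ 0] exI[of _ f]) (use f in \<open>simp add: s0 lapnorm_def F_def\<close>)
next
  case (Suc m)
  then obtain p c R where IH: "finite (supp p)" "R \<in> real_trig_poly (d + m * N)" "cell_integral R = 0"
    "sqrt (cell_integral (\<lambda>x. (R x)\<^sup>2)) \<le> \<kappa> ^ m * F"
    "\<And>x. a x \<bullet> thess p x + b x \<bullet> tgrad p x = f x - c - R x"
    "lapnorm p \<le> F * (\<Sum>j<m. \<kappa> ^ j)" "\<bar>c\<bar> \<le> \<kappa> * F * (\<Sum>j<m. \<kappa> ^ j)" by blast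
  obtain p' c' R' where st: "finite (supp p')" "R' \<in> real_trig_poly (d + m * N + N)" "cell_integral R' = 0"
    "sqrt (cell_integral (\<lambda>x. (R' x)\<^sup>2)) \<le> \<kappa> * sqrt (cell_integral (\<lambda>x. (R x)\<^sup>2))"
    "\<And>x. a x \<bullet> thess p' x + b x \<bullet> tgrad p' x = R x - c' - R' x"
    "lapnorm p' = sqrt (cell_integral (\<lambda>x. (R x)\<^sup>2))"
    "\<bar>c'\<bar> \<le> \<kappa> * sqrt (cell_integral (\<lambda>x. (R x)\<^sup>2))"
    by (rule neumann_step[OF a b s k IH(2,3)]) blast
  have kR: "\<kappa> * sqrt (cell_integral (\<lambda>x. (R x)\<^sup>2)) \<le> \<kappa> * (\<kappa> ^ m * F)" by (rule mult_left_mono[OF IH(4) k(2)])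
  show ?case
  proof (intro exI conjI allI)
    let ?p = "\<lambda>k. p k + p' k"
    show "finite (supp ?p)" using supp_add[of p p'] IH(1) st(1) by (meson finite_UnI finite_subset)
    show "R' \<in> real_trig_poly (d + Suc m * N)" using st(2) by (simp add: algebra_simps)
    show "cell_integral R' = 0" by (rule st)
    show "sqrt (cell_integral (\<lambda>x. (R' x)\<^sup>2)) \<le> \<kappa> ^ Suc m * F" using st(4) kR by (simp add: mult.assoc)
    show "a x \<bullet> thess ?p x + b x \<bullet> tgrad ?p x = f x - (c + c') - R' x" for x
      using IH(5)[of x] st(5)[of x] by (simp add: thess_add tgrad_add IH(1) st(1) inner_add_right)
    have "lapnorm ?p \<le> lapnorm p + lapnorm p'" by (rule lapnorm_add[OF IH(1) st(1)])
    also have "\<dots> \<le> F * (\<Sum>j<m. \<kappa> ^ j) + \<kappa> ^ m * F" using IH(6) IH(4) st(6) by simp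
    finally show "lapnorm ?p \<le> F * (\<Sum>j<Suc m. \<kappa> ^ j)" by (simp add: algebra_simps)
    have "\<bar>c + c'\<bar> \<le> \<kappa> * F * (\<Sum>j<m. \<kappa> ^ j) + \<kappa> * (\<kappa> ^ m * F)"
      using IH(7) st(7) kR abs_triangle_ineq[of c c'] by linarith
    then show "\<bar>c + c'\<bar> \<le> \<kappa> * F * (\<Sum>j<Suc m. \<kappa> ^ j)" by (simp add: algebra_simps)
  qed
qed

text \<open>The expression is an \<open>n\<close>-th power; with \<open>\<theta>\<close> the
  \<open>n\<close>-th root of \<open>\<kappa>\<close>, it reduces to \<open>\<theta> ^ m\<close> and
  \<open>m * \<theta> ^ m\<close> tending to 0.\<close>

lemma poly_geometric_limit:
  fixes \<kappa> :: real
  assumes k: "0 < \<kappa>" "\<kappa> < 1" and n: "0 < n"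
  shows "(\<lambda>m. real ((2 * (d + m * N) + 1) ^ n) * \<kappa> ^ m) \<longlonglongrightarrow> 0"
proof -
  define \<theta> where "\<theta> = root n \<kappa>"
  have th: "0 < \<theta>" "\<theta> < 1" "\<theta> ^ n = \<kappa>" using k n by (auto simp: \<theta>_def)
  have "(\<lambda>m. (real (2 * d + 1) * \<theta> ^ m + real (2 * N) * (real m * \<theta> ^ m)) ^ n) \<longlonglongrightarrow> (real (2 * d + 1) * 0 + real (2 * N) * 0) ^ n"
    by (intro tendsto_intros LIMSEQ_realpow_zero powser_times_n_limit_0) (use th in auto)
  moreover have "(real (2 * d + 1) * \<theta> ^ m + real (2 * N) * (real m * \<theta> ^ m)) ^ n = real ((2 * (d + m * N) + 1) ^ n) * \<kappa> ^ m" for m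
  proof -
    have "real (2 * d + 1) * \<theta> ^ m + real (2 * N) * (real m * \<theta> ^ m) = real (2 * (d + m * N) + 1) * \<theta> ^ m"
      by (simp add: algebra_simps)
    then show ?thesis by (simp add: power_mult_distrib power_mult[symmetric] mult.commute[of m n] flip: th(3))
  qed
  moreover have "(real (2 * d + 1) * 0 + real (2 * N) * 0) ^ n = 0" using n by simp
  ultimately show ?thesis by (simp only:)
qed

text \<open>The residual of the \<open>m\<close>-th partial Neumann sum has \<open>L\<^sup>2\<close> norm \<open>O(\<kappa>\<^sup>m)\<close> and degree \<open>O(m)\<close>, so it
  tends to \<open>0\<close> even uniformly.\<close>

lemma approximate_solution:
  fixes a :: "real ^ 'n \<Rightarrow> real ^ 'n ^ 'n" and b :: "real ^ 'n \<Rightarrow> real ^ 'n"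
  assumes a: "\<And>i j. (\<lambda>x. a x $ i $ j) \<in> real_trig_poly N" and b: "\<And>i. (\<lambda>x. b x $ i) \<in> real_trig_poly N"
    and s: "\<And>x. (norm (a x - mat 1))\<^sup>2 + (norm (b x))\<^sup>2 \<le> s" and k: "s * (1 + 1 / (4 * pi\<^sup>2)) \<le> \<kappa>\<^sup>2" "0 < \<kappa>" "\<kappa> < 1"
    and psd: "\<And>x v. 0 \<le> v \<bullet> (a x *v v)"
    and f: "f \<in> real_trig_poly d" "cell_integral f = 0" and e: "0 < e"
  defines "F \<equiv> sqrt (cell_integral (\<lambda>x. (f x)\<^sup>2))"
  obtains p c R where "finite (supp p)" "continuous_on UNIV R" "\<And>x. \<bar>R x\<bar> \<le> e"
    "\<And>x. a x \<bullet> thess p x + b x \<bullet> tgrad p x = f x - c - R x"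
    "lapnorm p \<le> F / (1 - \<kappa>)" "\<bar>c\<bar> \<le> F / (1 - \<kappa>)" "\<And>\<mu>. (\<And>x. \<mu> \<le> f x) \<Longrightarrow> \<mu> - e \<le> c"
proof -
  have F0: "0 \<le> F" by (simp add: F_def cell_integral_def)
  have "(\<lambda>m. real ((2 * (d + m * N) + 1) ^ CARD('n)) * \<kappa> ^ m * F) \<longlonglongrightarrow> 0 * F"
    by (intro tendsto_mult poly_geometric_limit k tendsto_const) simp
  then have "\<forall>\<^sub>F m in sequentially. real ((2 * (d + m * N) + 1) ^ CARD('n)) * \<kappa> ^ m * F < e"
    using e by (intro order_tendstoD) auto
  then obtain m where m: "real ((2 * (d + m * N) + 1) ^ CARD('n)) * \<kappa> ^ m * F < e"
    using eventually_happens'[OF sequentially_bot] by blast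
  obtain p c R where P: "finite (supp p)" "R \<in> real_trig_poly (d + m * N)" "cell_integral R = 0"
    "sqrt (cell_integral (\<lambda>x. (R x)\<^sup>2)) \<le> \<kappa> ^ m * F"
    "\<And>x. a x \<bullet> thess p x + b x \<bullet> tgrad p x = f x - c - R x"
    "lapnorm p \<le> F * (\<Sum>j<m. \<kappa> ^ j)" "\<bar>c\<bar> \<le> \<kappa> * F * (\<Sum>j<m. \<kappa> ^ j)"
    using neumann_series[OF a b s k(1) less_imp_le[OF k(2)] f, of m] unfolding F_def by blast
  have geo: "(\<Sum>j<m. \<kappa> ^ j) \<le> 1 / (1 - \<kappa>)"
  proof -
    have "(\<Sum>j<m. \<kappa> ^ j) = (1 - \<kappa> ^ m) / (1 - \<kappa>)" using k by (simp add: sum_gp_strict)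
    also have "\<dots> \<le> 1 / (1 - \<kappa>)" using k by (intro divide_right_mono) auto
    finally show ?thesis .
  qed
  have Re: "\<bar>R x\<bar> \<le> e" for x
  proof -
    have "\<bar>R x\<bar> \<le> real ((2 * (d + m * N) + 1) ^ CARD('n)) * sqrt (cell_integral (\<lambda>x. (R x)\<^sup>2))"
      by (rule real_trig_poly_sup_bound[OF P(2)])
    also have "\<dots> \<le> real ((2 * (d + m * N) + 1) ^ CARD('n)) * (\<kappa> ^ m * F)"
      by (intro mult_left_mono P) simp
    finally show ?thesis using m by (simp add: mult.assoc)
  qed
  have gF: "F * (\<Sum>j<m. \<kappa> ^ j) \<le> F / (1 - \<kappa>)" using mult_left_mono[OF geo F0] by simp
  show ?thesis
  proof (rule that[where p=p and c=c and R=R, OF P(1) continuous_real_trig_poly[OF P(2)] Re P(5)])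
    show "lapnorm p \<le> F / (1 - \<kappa>)" using P(6) gF by simp
    have "\<kappa> * F * (\<Sum>j<m. \<kappa> ^ j) \<le> 1 * (F * (\<Sum>j<m. \<kappa> ^ j))"
      unfolding mult.assoc using k F0 by (intro mult_right_mono mult_nonneg_nonneg sum_nonneg) auto
    then show "\<bar>c\<bar> \<le> F / (1 - \<kappa>)" using P(7) gF by simp
    fix \<mu> assume mu: "\<And>x. \<mu> \<le> f x"
    \<comment> \<open>At this point the equation reads \<open>f x0 - c - R x0 \<le> 0\<close>, so
      \<open>c\<close> is at least the lower bound of \<open>f\<close> minus the size of the
      residual.\<close>
    obtain x0 where "a x0 \<bullet> thess p x0 + b x0 \<bullet> tgrad p x0 \<le> 0" by (rule trig_max_principle[OF P(1) psd])
    then show "\<mu> - e \<le> c" using P(5)[of x0] mu[of x0] Re[of x0] by simp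
  qed
qed

text \<open>Since \<open>weak_partial\<close> picks an arbitrary representative, second derivatives
  are computed by first exchanging the inner derivative for its smooth representative, which is
  harmless because weak derivatives depend only on classes modulo null sets.\<close>

lemma trig_H2:
  fixes p :: "int ^ 'n \<Rightarrow> complex"
  assumes fin: "finite (supp p)"
  shows "(\<lambda>x. Re (trig p x)) \<in> H2_per"
    and "AE x in lebesgue. weak_grad (\<lambda>x. Re (trig p x)) x = tgrad p x"
    and "AE x in lebesgue. weak_hessian (\<lambda>x. Re (trig p x)) x = thess p x"
proof -
  have Ck: "Ck k (\<lambda>x. Re (trig q x))" for q :: "int ^ 'n \<Rightarrow> complex" and k
  proof -
    have "Ck k (\<lambda>x. \<Sum>l\<in>S. Re (q l * ee l x))" for S
      by (induction S rule: infinite_finite_induct) (auto intro: Ck_add Ck_trig Ck_const simp del: times_complex.sel)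
    then show ?thesis by (simp add: trig_def Re_sum del: times_complex.sel)
  qed
  have wp: "has_weak_partial i (\<lambda>x. Re (trig q x)) (\<lambda>x. Re (trig (dcoeff i q) x))" if "finite (supp q)" for i and q :: "int ^ 'n \<Rightarrow> complex"
  proof -
    have "frechet_derivative (\<lambda>x. Re (trig q x)) (at x) (axis i 1) = Re (trig (dcoeff i q) x)" for x
      unfolding frechet_derivative_at[OF trig_has_derivative[OF that], symmetric]
      by (simp add: axis_def if_distrib cong: if_cong)
    then show ?thesis using has_weak_partial_smooth[OF Ck[of _ q], of i] by simp
  qed
  have L2: "(\<lambda>x. Re (trig q x)) \<in> L2_per" for q :: "int ^ 'n \<Rightarrow> complex"
  proof -
    have c: "continuous_on UNIV (\<lambda>x. Re (trig q x))" unfolding trig_def by (intro continuous_intros)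
    have "periodic (\<lambda>x. Re (trig q x))" by (intro periodicI) (simp add: trig_def ee_periodic)
    then show ?thesis
      unfolding L2_per_def using continuous_borel_lebesgue[OF c]
      by (auto intro!: integrable_cell_continuous continuous_intros c)
  qed
  have H1: "(\<lambda>x. Re (trig q x)) \<in> H1_per" if "finite (supp q)" for q :: "int ^ 'n \<Rightarrow> complex"
    by (rule H1_perI[OF L2 L2 wp[OF that]])
  show "(\<lambda>x. Re (trig p x)) \<in> H2_per"
    unfolding H2_per_def using L2 H1[OF finite_supp_dcoeff[OF fin]] wp[OF fin] by blast
  have w1: "AE x in lebesgue. \<forall>i. weak_partial i (\<lambda>x. Re (trig p x)) x = Re (trig (dcoeff i p) x)"
    using weak_partial_works(2)[OF wp[OF fin]] by (simp add: AE_all_countable)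
  then show "AE x in lebesgue. weak_grad (\<lambda>x. Re (trig p x)) x = tgrad p x"
    by eventually_elim (simp add: weak_grad_def tgrad_def)
  have "AE x in lebesgue. weak_partial i (weak_partial j (\<lambda>x. Re (trig p x))) x = Re (trig (dcoeff i (dcoeff j p)) x)" for i j
  proof -
    have "AE x in lebesgue. Re (trig (dcoeff j p) x) = weak_partial j (\<lambda>x. Re (trig p x)) x"
      using w1 by eventually_elim simp
    from has_weak_partial_cong_AE[OF wp[OF finite_supp_dcoeff[OF fin], of i j] this, of "\<lambda>x. Re (trig (dcoeff i (dcoeff j p)) x)"]
    show ?thesis using weak_partial_works(2) by simp
  qed
  then have "AE x in lebesgue. \<forall>i j. weak_partial i (weak_partial j (\<lambda>x. Re (trig p x))) x = Re (trig (dcoeff i (dcoeff j p)) x)"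
    by (simp add: AE_all_countable)
  then show "AE x in lebesgue. weak_hessian (\<lambda>x. Re (trig p x)) x = thess p x"
    by eventually_elim (simp add: weak_hessian_def thess_def)
qed

subsection \<open>Bounds for very weak solutions\<close>

lemma real_trig_poly_int_shift:
  assumes "f \<in> real_trig_poly d" shows "f (x + (\<chi> i. real_of_int (l i))) = f x"
proof -
  obtain c where c: "\<And>x. complex_of_real (f x) = (\<Sum>k\<in>Box d. c k * ee k x)"
    using assms by (auto simp: real_trig_poly_def trig_poly_def fun_eq_iff)
  have "complex_of_real (f (x + (\<chi> i. real_of_int (l i)))) = complex_of_real (f x)"
    unfolding c by (simp add: ee_add_arg ee_int_vector)
  then show ?thesis by simp
qed

text \<open>Reduction to the fractional part of \<open>x\<close>. The bounds on mollified
  coefficients must hold at every point and not only in the cell, since the maximum principle is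
  applied at a point that is not under control.\<close>

lemma kern_integral_eq_1: "cell_integral (\<lambda>y. kern N (x - y)) = 1" for x :: "real ^ 'n"
proof -
  define z where "z = (\<chi> i. frac (x $ i))"
  have xz: "x = z + (\<chi> i. real_of_int \<lfloor>x $ i\<rfloor>)" by (simp add: vec_eq_iff z_def frac_def)
  have "kern N (x - y) = kern N (z - y)" for y
    using real_trig_poly_int_shift[OF kern_real_trig_poly, of N "z - y" "\<lambda>i. \<lfloor>x $ i\<rfloor>"] by (subst xz) (simp add: algebra_simps)
  then show ?thesis using kern_integral_shift[of z N] by (simp add: z_def frac_lt_1 less_imp_le)
qed

lemma conv_const: "conv N (\<lambda>y. c) x = c" for x :: "real ^ 'n" and c :: "'b::euclidean_space"
  using kern_integral_eq_1[of N x] unfolding conv_def cell_integral_def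
  by (subst integral_scaleR_left) (auto intro!: integrable_cell_continuous continuous_intros)

lemma conv_mono_AE:
  fixes f g :: "real ^ 'n \<Rightarrow> real"
  assumes "integrable (lebesgue_on cell) f" "integrable (lebesgue_on cell) g" "AE x in lebesgue. f x \<le> g x"
  shows "conv N f x \<le> conv N g x"
  unfolding conv_def cell_integral_def
proof (rule integral_mono_AE)
  show "AE y in lebesgue_on cell. kern N (x - y) *\<^sub>R f y \<le> kern N (x - y) *\<^sub>R g y"
    using AE_cell[OF assms(3)] by eventually_elim (auto intro: mult_left_mono kern_nonneg)
qed (intro integrable_kern_mult assms)+

lemma norm_conv_le:
  fixes f :: "real ^ 'n \<Rightarrow> 'b::euclidean_space"
  assumes "integrable (lebesgue_on cell) f" "AE x in lebesgue. norm (f x) \<le> C"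
  shows "norm (conv N f x) \<le> C"
proof -
  have "norm (conv N f x) \<le> conv N (\<lambda>y. norm (f y)) x"
    unfolding conv_def cell_integral_def
    by (rule order_trans[OF integral_norm_bound]) (simp add: kern_nonneg)
  also have "\<dots> \<le> conv N (\<lambda>y. C) x"
    by (rule conv_mono_AE) (use assms in \<open>auto intro!: integrable_cell_continuous\<close>)
  finally show ?thesis by (simp add: conv_const)
qed

lemma integrable_cell_bounded:
  fixes f :: "real ^ 'n \<Rightarrow> 'b::euclidean_space"
  assumes "f \<in> borel_measurable lebesgue" "AE x in lebesgue. norm (f x) \<le> C"
  shows "integrable (lebesgue_on cell) f" "integrable (lebesgue_on big) f"
proof -
  interpret finite_measure "lebesgue_on (cell :: (real ^ 'n) set)" by (rule cell_finite_measure)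
  show "integrable (lebesgue_on cell) f"
    by (rule integrable_const_bound[OF AE_cell[OF assms(2)]]) (rule measurable_restrict_space1[OF assms(1)])
next
  interpret finite_measure "lebesgue_on (big :: (real ^ 'n) set)"
    by (intro finite_measure_lebesgue_on lmeasurable_cbox)
  show "integrable (lebesgue_on big) f"
    by (rule integrable_const_bound[OF AE_lebesgue_on[OF _ assms(2)]]) (auto intro: measurable_restrict_space1[OF assms(1)])
qed

lemma integrable_L2_mult:
  fixes f g :: "real ^ 'n \<Rightarrow> real"
  assumes "f \<in> L2_per" "g \<in> borel_measurable lebesgue" "integrable (lebesgue_on cell) (\<lambda>x. (g x)\<^sup>2)"
  shows "integrable (lebesgue_on cell) (\<lambda>x. f x * g x)"
  by (rule cauchy_schwarz_cell(1)) (use L2_per_D[OF assms(1)] assms(2,3) in auto)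

lemma cell_integral_abs_le:
  fixes f :: "real ^ 'n \<Rightarrow> real"
  shows "\<bar>cell_integral f\<bar> \<le> cell_integral (\<lambda>x. \<bar>f x\<bar>)"
  unfolding cell_integral_def using integral_norm_bound[of "lebesgue_on cell" f] by simp

text \<open>Pairing the approximate solutions of the mollified equation with \<open>rt\<close> shows that the constants
  \<open>c\<close> in the approximate solutions converge to the integral of \<open>rt\<close> times the right-hand side.\<close>

lemma very_weak_solution_trig:
  fixes At :: "real ^ 'n \<Rightarrow> real ^ 'n ^ 'n" and bt :: "real ^ 'n \<Rightarrow> real ^ 'n" and rt :: "real ^ 'n \<Rightarrow> real"
  assumes m: "At \<in> borel_measurable lebesgue" "bt \<in> borel_measurable lebesgue" and per: "periodic At" "periodic bt"
    and s: "AE x in lebesgue. (norm (At x - mat 1))\<^sup>2 + (norm (bt x))\<^sup>2 \<le> s"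
    and psd: "AE x in lebesgue. \<forall>v. 0 \<le> v \<bullet> (At x *v v)"
    and k: "s * (1 + 1 / (4 * pi\<^sup>2)) \<le> \<kappa>\<^sup>2" "0 < \<kappa>" "\<kappa> < 1" and s0: "0 \<le> s"
    and rt: "rt \<in> L2_per" "cell_integral rt = 1"
    and sol: "\<And>\<phi>. \<phi> \<in> H2_per \<Longrightarrow> cell_integral (\<lambda>x. rt x * (At x \<bullet> weak_hessian \<phi> x + bt x \<bullet> weak_grad \<phi> x)) = 0"
    and f: "f \<in> real_trig_poly d"
  shows "\<bar>cell_integral (\<lambda>x. rt x * f x)\<bar> \<le> (1 + 1 / (1 - \<kappa>)) * sqrt (cell_integral (\<lambda>x. (f x)\<^sup>2))"
    and "\<And>\<mu>. (\<And>x. \<mu> \<le> f x) \<Longrightarrow> \<mu> \<le> cell_integral (\<lambda>x. rt x * f x)"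
proof -
  interpret finite_measure "lebesgue_on (cell :: (real ^ 'n) set)" by (rule cell_finite_measure)
  note rtD = L2_per_D[OF rt(1)]
  \<comment> \<open>Bundling the coefficients turns the Cordes bound into a bound on a single norm,
    which convolution respects, and lets one subsequence serve \<open>At\<close> and
    \<open>bt\<close> simultaneously.\<close>
  define Z where "Z x = (At x - mat 1, bt x)" for x
  define S where "S = sqrt s"
  have Zm: "Z \<in> borel_measurable lebesgue" unfolding Z_def[abs_def] using m by (intro borel_measurable_Pair borel_measurable_diff) auto
  have ZS: "AE x in lebesgue. norm (Z x) \<le> S"
    using s by eventually_elim (simp add: Z_def norm_Pair S_def)
  have Zp: "periodic Z" unfolding periodic_def
  proof
    fix i
    have "AE x in lebesgue. At (x + axis i 1) = At x" "AE x in lebesgue. bt (x + axis i 1) = bt x"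
      using per by (auto simp: periodic_def)
    then show "AE x in lebesgue. Z (x + axis i 1) = Z x" by eventually_elim (simp add: Z_def)
  qed
  note Zi = integrable_cell_bounded[OF Zm ZS]
  obtain r :: "nat \<Rightarrow> nat" where r: "AE x in lebesgue_on (cell :: (real ^ 'n) set). (\<lambda>k. conv (r k) Z x) \<longlonglongrightarrow> Z x"
    using conv_AE_subseq[OF Zm Zp Zi] by blast
  define mf where "mf = cell_integral f"
  \<comment> \<open>Poisson's equation is solvable only for mean-zero data. The mean
    \<open>mf\<close> comes back at the end with factor 1, the integral of
    \<open>rt\<close>.\<close>
  define f0 where "f0 x = f x - mf" for x
  have f0R: "f0 \<in> real_trig_poly d" unfolding f0_def[abs_def] by (intro real_trig_poly_diff real_trig_poly_const f)
  have cf: "continuous_on UNIV f" "continuous_on UNIV f0" using continuous_real_trig_poly f f0R by blast+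
  have fi: "integrable (lebesgue_on cell) f" "integrable (lebesgue_on cell) (\<lambda>x. (f x)\<^sup>2)"
    by (intro integrable_cell_continuous continuous_intros cf)+
  have f0m: "cell_integral f0 = 0"
    unfolding f0_def[abs_def] mf_def using fi by (simp add: cell_integral_def measure_restrict_space)
  define F where "F = sqrt (cell_integral (\<lambda>x. (f0 x)\<^sup>2))"
  define F1 where "F1 = sqrt (cell_integral (\<lambda>x. (f x)\<^sup>2))"
  have F0: "0 \<le> F" by (simp add: F_def cell_integral_def)
  have f0f: "cell_integral (\<lambda>x. (f0 x)\<^sup>2) = cell_integral (\<lambda>x. (f x)\<^sup>2) - mf\<^sup>2"
  proof -
    have "cell_integral (\<lambda>x. (f0 x)\<^sup>2) = cell_integral (\<lambda>x. (f x)\<^sup>2 - 2 * mf * f x + mf\<^sup>2)"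
      by (intro arg_cong[where f=cell_integral]) (simp add: f0_def fun_eq_iff power2_eq_square algebra_simps)
    also have "\<dots> = cell_integral (\<lambda>x. (f x)\<^sup>2) - 2 * mf * cell_integral f + mf\<^sup>2"
      using fi by (simp add: cell_integral_def measure_restrict_space)
    finally show ?thesis by (simp add: mf_def power2_eq_square)
  qed
  have FF1: "F \<le> F1" unfolding F_def F1_def by (intro real_sqrt_le_mono) (simp add: f0f)
  have mF1: "\<bar>mf\<bar> \<le> F1"
  proof -
    have "0 \<le> cell_integral (\<lambda>x. (f0 x)\<^sup>2)" by (simp add: cell_integral_def)
    then show ?thesis unfolding F1_def using f0f by (intro real_le_rsqrt) simp
  qed
  define a where "a N x = fst (conv N Z x) + mat 1" for N x
  define b where "b N x = snd (conv N Z x)" for N x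
  have comp: "conv N Z x \<bullet> c = conv N (\<lambda>y. Z y \<bullet> c) x" for N x c by (rule conv_inner[OF Zi(1)])
  have Zci: "integrable (lebesgue_on cell) (\<lambda>y. Z y \<bullet> c)" for c using Zi(1) by simp
  have aR: "(\<lambda>x. a N x $ i $ j) \<in> real_trig_poly N" for N i j
  proof -
    have "a N x $ i $ j = conv N (\<lambda>y. Z y \<bullet> (axis i (axis j 1), 0)) x + mat 1 $ i $ j" for x
      unfolding comp[symmetric] by (simp add: a_def inner_prod_def inner_axis)
    then show ?thesis by (simp only:) (intro real_trig_poly_add real_trig_poly_const conv_real_trig_poly Zci)
  qed
  have bR: "(\<lambda>x. b N x $ i) \<in> real_trig_poly N" for N i
  proof -
    have "b N x $ i = conv N (\<lambda>y. Z y \<bullet> (0, axis i 1)) x" for x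
      unfolding comp[symmetric] by (simp add: b_def inner_prod_def inner_axis)
    then show ?thesis by (simp only:) (intro conv_real_trig_poly Zci)
  qed
  have sN: "(norm (a N x - mat 1))\<^sup>2 + (norm (b N x))\<^sup>2 \<le> s" for N x
  proof -
    have "norm (conv N Z x) \<le> S" by (rule norm_conv_le[OF Zi(1) ZS])
    then have "(norm (conv N Z x))\<^sup>2 \<le> S\<^sup>2" by (intro power_mono) auto
    then show ?thesis using s0 by (simp add: a_def b_def S_def norm_prod_def)
  qed
  have psdN: "0 \<le> v \<bullet> (a N x *v v)" for N x v
  proof -
    \<comment> \<open>Paired with the rank-one matrix \<open>V\<close>, the quadratic form at
      \<open>v\<close> becomes a linear functional of the matrix, so its sign survives averaging.
      The identity subtracted in \<open>Z\<close> accounts for the bound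
      \<open>- (v \<bullet> v)\<close>.\<close>
    define V :: "real ^ 'n ^ 'n" where "V = (\<chi> i j. v $ i * v $ j)"
    have Vv: "M \<bullet> V = v \<bullet> (M *v v)" for M :: "real ^ 'n ^ 'n"
      by (simp add: V_def frobenius_inner inner_vec_def matrix_vector_mult_def sum_distrib_left mult_ac)
    have "- (v \<bullet> v) = conv N (\<lambda>y. - (v \<bullet> v)) x" by (simp add: conv_const)
    also have "\<dots> \<le> conv N (\<lambda>y. Z y \<bullet> (V, 0)) x"
    proof (rule conv_mono_AE[OF _ Zci])
      show "AE y in lebesgue. - (v \<bullet> v) \<le> Z y \<bullet> (V, 0)"
        using psd
      proof eventually_elim
        case (elim y)
        then have "0 \<le> v \<bullet> (At y *v v)" by blast
        then show ?case by (simp add: Z_def Vv matrix_vector_mult_diff_rdistrib inner_diff_right)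
      qed
    qed simp
    also have "\<dots> = fst (conv N Z x) \<bullet> V" unfolding comp[symmetric] by (simp add: inner_prod_def)
    finally show ?thesis unfolding a_def by (simp add: Vv matrix_vector_mult_add_rdistrib inner_add_right)
  qed
  have ex: "\<exists>p c R. finite (supp p) \<and> continuous_on UNIV R \<and> (\<forall>x. \<bar>R x\<bar> \<le> 1 / real (Suc k)) \<and>
    (\<forall>x. a (r k) x \<bullet> thess p x + b (r k) x \<bullet> tgrad p x = f0 x - c - R x) \<and>
    lapnorm p \<le> F / (1 - \<kappa>) \<and> \<bar>c\<bar> \<le> F / (1 - \<kappa>) \<and> (\<forall>\<mu>. (\<forall>x. \<mu> \<le> f0 x) \<longrightarrow> \<mu> - 1 / real (Suc k) \<le> c)" for k
    by (rule approximate_solution[OF aR bR sN k psdN f0R f0m, of "1 / real (Suc k)" "r k"]) (auto simp: F_def)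
  then obtain p c R where P: "\<And>k. finite (supp (p k))" "\<And>k. continuous_on UNIV (R k)" "\<And>k x. \<bar>R k x\<bar> \<le> 1 / real (Suc k)"
    "\<And>k x. a (r k) x \<bullet> thess (p k) x + b (r k) x \<bullet> tgrad (p k) x = f0 x - c k - R k x"
    "\<And>k. lapnorm (p k) \<le> F / (1 - \<kappa>)" "\<And>k. \<bar>c k\<bar> \<le> F / (1 - \<kappa>)"
    "\<And>k \<mu>. (\<And>x. \<mu> \<le> f0 x) \<Longrightarrow> \<mu> - 1 / real (Suc k) \<le> c k"
    by metis
  \<comment> \<open>The coefficient error is grouped with \<open>rt\<close> rather than with the
    derivatives of \<open>p k\<close>: these are bounded only in \<open>L^2\<close>, uniformly in
    \<open>k\<close>, whereas \<open>rt * dev k\<close> tends to 0 in \<open>L^2\<close>, being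
    dominated by \<open>2 * S * \<bar>rt\<bar>\<close> and converging pointwise almost
    everywhere.\<close>
  define dev where "dev k x = norm (conv (r k) Z x - Z x)" for k x
  define en where "en k x = norm (thess (p k) x, tgrad (p k) x)" for k x
  have devm: "dev k \<in> borel_measurable lebesgue" for k
    unfolding dev_def[abs_def] using continuous_borel_lebesgue[OF continuous_conv[OF Zi(1)]] Zm by measurable
  have rdm: "(\<lambda>x. rt x * dev k x) \<in> borel_measurable lebesgue" for k using devm rtD(1) by measurable
  have dev2S: "AE x in lebesgue. dev k x \<le> 2 * S" for k
    using ZS
  proof eventually_elim
    case (elim x)
    then show ?case
      using norm_triangle_ineq4[of "conv (r k) Z x" "Z x"] norm_conv_le[OF Zi(1) ZS, of "r k" x] by (simp add: dev_def)
  qed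
  have rdsq: "AE x in lebesgue. norm ((rt x * dev k x)\<^sup>2) \<le> 4 * S\<^sup>2 * (rt x)\<^sup>2" for k
    using dev2S[of k]
  proof eventually_elim
    case (elim x)
    have "(dev k x)\<^sup>2 \<le> (2 * S)\<^sup>2" using elim by (intro power_mono) (auto simp: dev_def)
    then have "(rt x)\<^sup>2 * (dev k x)\<^sup>2 \<le> (rt x)\<^sup>2 * (2 * S)\<^sup>2" by (rule mult_left_mono) simp
    then show ?case by (simp add: power_mult_distrib mult_ac)
  qed
  have rt2: "integrable (lebesgue_on cell) (\<lambda>x. (rt x)\<^sup>2)" using rtD(3) by simp
  have rdi: "integrable (lebesgue_on cell) (\<lambda>x. (rt x * dev k x)\<^sup>2)" for k
  proof (rule Bochner_Integration.integrable_bound)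
    show "integrable (lebesgue_on cell) (\<lambda>x. 4 * S\<^sup>2 * (rt x)\<^sup>2)" using rt2 by simp
    show "AE x in lebesgue_on cell. norm ((rt x * dev k x)\<^sup>2) \<le> norm (4 * S\<^sup>2 * (rt x)\<^sup>2)"
      using AE_cell[OF rdsq[of k]] by eventually_elim auto
    show "(\<lambda>x. (rt x * dev k x)\<^sup>2) \<in> borel_measurable (lebesgue_on cell)"
      by (intro measurable_restrict_space1 borel_measurable_power rdm)
  qed
  have rd0: "(\<lambda>k. cell_integral (\<lambda>x. (rt x * dev k x)\<^sup>2)) \<longlonglongrightarrow> cell_integral (\<lambda>x :: real ^ 'n. 0)"
    unfolding cell_integral_def
  proof (rule integral_dominated_convergence[where w="\<lambda>x. 4 * S\<^sup>2 * (rt x)\<^sup>2"])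
    show "AE x in lebesgue_on cell. (\<lambda>k. (rt x * dev k x)\<^sup>2) \<longlonglongrightarrow> 0"
      using r
    proof eventually_elim
      case (elim x)
      have "(\<lambda>k. (rt x * norm (conv (r k) Z x - Z x))\<^sup>2) \<longlonglongrightarrow> (rt x * norm (Z x - Z x))\<^sup>2"
        by (intro tendsto_intros elim)
      then show ?case by (simp add: dev_def)
    qed
    show "AE x in lebesgue_on cell. norm ((rt x * dev k x)\<^sup>2) \<le> 4 * S\<^sup>2 * (rt x)\<^sup>2" for k
      by (rule AE_cell[OF rdsq])
    show "(\<lambda>x. (rt x * dev k x)\<^sup>2) \<in> borel_measurable (lebesgue_on cell)" for k
      by (intro measurable_restrict_space1 borel_measurable_power rdm)
  qed (use rt2 in auto)
  have en_sq: "(en k x)\<^sup>2 = (norm (thess (p k) x))\<^sup>2 + (norm (tgrad (p k) x))\<^sup>2" for k x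
    by (simp add: en_def norm_prod_def)
  have cth: "continuous_on UNIV (\<lambda>x. thess (p k) x $ i $ j)" "continuous_on UNIV (\<lambda>x. tgrad (p k) x $ i)" for k i j
    unfolding thess_def tgrad_def trig_def by (auto intro!: continuous_intros)
  have cth2: "continuous_on UNIV (thess (p k))" "continuous_on UNIV (tgrad (p k))" for k
    unfolding thess_def[abs_def] tgrad_def[abs_def] trig_def by (auto intro!: continuous_on_vec_lambda continuous_intros)
  have enm: "en k \<in> borel_measurable lebesgue" for k
    unfolding en_def[abs_def] by (intro continuous_borel_lebesgue continuous_intros cth2)
  have eni: "integrable (lebesgue_on cell) (\<lambda>x. (en k x)\<^sup>2)" for k
    unfolding en_sq by (intro integrable_cell_continuous continuous_intros cth2)
  define I0 where "I0 = cell_integral (\<lambda>x. rt x * f0 x)"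
  define W where "W k x = (conv (r k) Z x - Z x) \<bullet> (thess (p k) x, tgrad (p k) x)" for k x
  have Wm: "W k \<in> borel_measurable lebesgue" for k
    unfolding W_def[abs_def] using continuous_borel_lebesgue[OF continuous_conv[OF Zi(1)]] Zm
    by (intro borel_measurable_inner borel_measurable_diff continuous_borel_lebesgue[OF continuous_on_Pair[OF cth2]]) auto
  have Wle: "\<bar>rt x * W k x\<bar> \<le> \<bar>(rt x * dev k x) * en k x\<bar>" for k x
  proof -
    have "\<bar>W k x\<bar> \<le> dev k x * en k x" unfolding W_def dev_def en_def by (rule Cauchy_Schwarz_ineq2)
    then have "\<bar>rt x\<bar> * \<bar>W k x\<bar> \<le> \<bar>rt x\<bar> * (dev k x * en k x)" by (rule mult_left_mono) simp
    then show ?thesis by (simp add: abs_mult dev_def en_def mult_ac)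
  qed
  note cs = cauchy_schwarz_cell[OF rdm enm rdi eni]
  have Wi: "integrable (lebesgue_on cell) (\<lambda>x. rt x * W k x)" for k
  proof (rule Bochner_Integration.integrable_bound[OF cs(1)[of k k]])
    show "(\<lambda>x. rt x * W k x) \<in> borel_measurable (lebesgue_on cell)"
      by (intro measurable_restrict_space1 borel_measurable_times rtD Wm)
    show "AE x in lebesgue_on cell. norm (rt x * W k x) \<le> norm (rt x * dev k x * en k x)" using Wle by simp
  qed
  have Ci: "integrable (lebesgue_on cell) (\<lambda>x. rt x * g x)" if "continuous_on UNIV g" for g :: "real ^ 'n \<Rightarrow> real"
    by (intro integrable_L2_mult rt continuous_borel_lebesgue integrable_cell_continuous continuous_intros that)
  \<comment> \<open>The very weak equation is tested with the real part of
    \<open>trig (p k)\<close>. The given operator is the mollified one minus the error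
    \<open>W k\<close>, and the constant \<open>c k\<close> is multiplied by the integral of
    \<open>rt\<close>, which is 1.\<close>
  have id: "I0 - c k = cell_integral (\<lambda>x. rt x * R k x) + cell_integral (\<lambda>x. rt x * W k x)" for k
  proof -
    define \<phi> where "\<phi> x = Re (trig (p k) x)" for x
    note T = trig_H2[OF P(1)[of k], folded \<phi>_def]
    have rhsm: "(\<lambda>x. rt x * (At x \<bullet> thess (p k) x + bt x \<bullet> tgrad (p k) x)) \<in> borel_measurable lebesgue"
      by (intro borel_measurable_times borel_measurable_add borel_measurable_inner rtD m continuous_borel_lebesgue cth2)
    have ae: "AE x in lebesgue. rt x * (At x \<bullet> thess (p k) x + bt x \<bullet> tgrad (p k) x) = rt x * (At x \<bullet> weak_hessian \<phi> x + bt x \<bullet> weak_grad \<phi> x)"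
      using T(2) T(3) by eventually_elim simp
    have "0 = cell_integral (\<lambda>x. rt x * (At x \<bullet> weak_hessian \<phi> x + bt x \<bullet> weak_grad \<phi> x))" using sol[OF T(1)] by simp
    also have "\<dots> = cell_integral (\<lambda>x. rt x * (At x \<bullet> thess (p k) x + bt x \<bullet> tgrad (p k) x))"
      by (rule cell_integral_cong_AE[symmetric, OF rhsm measurable_cong_AE_lebesgue[OF rhsm ae] ae])
    also have "\<dots> = cell_integral (\<lambda>x. rt x * f0 x - c k * rt x - rt x * R k x - rt x * W k x)"
    proof -
      have "At x \<bullet> thess (p k) x + bt x \<bullet> tgrad (p k) x = f0 x - c k - R k x - W k x" for x
      proof -
        have "W k x = (a (r k) x \<bullet> thess (p k) x + b (r k) x \<bullet> tgrad (p k) x) - (At x \<bullet> thess (p k) x + bt x \<bullet> tgrad (p k) x)"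
          by (simp add: W_def a_def b_def Z_def inner_prod_def inner_diff_left inner_add_left)
        then show ?thesis using P(4)[of k x] by simp
      qed
      then have "rt x * (At x \<bullet> thess (p k) x + bt x \<bullet> tgrad (p k) x) = rt x * f0 x - c k * rt x - rt x * R k x - rt x * W k x" for x
        by (simp only: right_diff_distrib mult.commute)
      then show ?thesis by (simp only:)
    qed
    also have "\<dots> = I0 - c k * cell_integral rt - cell_integral (\<lambda>x. rt x * R k x) - cell_integral (\<lambda>x. rt x * W k x)"
      unfolding I0_def cell_integral_def using Wi Ci[OF cf(2)] Ci[OF P(2)] rtD(4) by simp
    finally show ?thesis using rt(2) by simp
  qed
  have b1: "\<bar>cell_integral (\<lambda>x. rt x * R k x)\<bar> \<le> (1 / real (Suc k)) * cell_integral (\<lambda>x. \<bar>rt x\<bar>)" for k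
  proof -
    have "\<bar>cell_integral (\<lambda>x. rt x * R k x)\<bar> \<le> cell_integral (\<lambda>x. \<bar>rt x * R k x\<bar>)" by (rule cell_integral_abs_le)
    also have "\<dots> \<le> cell_integral (\<lambda>x. (1 / real (Suc k)) * \<bar>rt x\<bar>)"
      unfolding cell_integral_def
    proof (rule integral_mono)
      fix x
      have "\<bar>R k x\<bar> * \<bar>rt x\<bar> \<le> (1 / real (Suc k)) * \<bar>rt x\<bar>" by (rule mult_right_mono[OF P(3)]) simp
      then show "\<bar>rt x * R k x\<bar> \<le> (1 / real (Suc k)) * \<bar>rt x\<bar>" by (simp only: abs_mult mult.commute)
    qed (use Ci[OF P(2)[of k]] rtD(4) in auto)
    finally show ?thesis by (simp add: cell_integral_def)
  qed
  have b2: "\<bar>cell_integral (\<lambda>x. rt x * W k x)\<bar> \<le> sqrt (cell_integral (\<lambda>x. (rt x * dev k x)\<^sup>2)) * (2 * (F / (1 - \<kappa>)))" for k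
  proof -
    have "\<bar>cell_integral (\<lambda>x. rt x * W k x)\<bar> \<le> cell_integral (\<lambda>x. \<bar>rt x * W k x\<bar>)" by (rule cell_integral_abs_le)
    also have "\<dots> \<le> cell_integral (\<lambda>x. \<bar>(rt x * dev k x) * en k x\<bar>)"
      unfolding cell_integral_def by (rule integral_mono) (use Wi cs(1) Wle in auto)
    also have "\<dots> \<le> sqrt (cell_integral (\<lambda>x. (rt x * dev k x)\<^sup>2)) * sqrt (cell_integral (\<lambda>x. (en k x)\<^sup>2))"
      by (rule cs(2))
    also have "\<dots> \<le> sqrt (cell_integral (\<lambda>x. (rt x * dev k x)\<^sup>2)) * (2 * (F / (1 - \<kappa>)))"
    proof (rule mult_left_mono)
      have "1 \<le> pi\<^sup>2" using pi_ge_two by (intro one_le_power) simp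
      then have c4: "1 + 1 / (4 * pi\<^sup>2) \<le> (2 :: real)\<^sup>2" by (simp add: divide_simps)
      have "cell_integral (\<lambda>x. (en k x)\<^sup>2) \<le> (1 + 1 / (4 * pi\<^sup>2)) * (lapnorm (p k))\<^sup>2"
        unfolding en_sq by (rule hessian_gradient_energy_le[OF P(1)])
      also have "\<dots> \<le> 2\<^sup>2 * (F / (1 - \<kappa>))\<^sup>2"
        using c4 by (intro mult_mono power_mono P(5)) (auto simp: lapnorm_nonneg)
      finally have "sqrt (cell_integral (\<lambda>x. (en k x)\<^sup>2)) \<le> sqrt ((2 * (F / (1 - \<kappa>)))\<^sup>2)"
        by (intro real_sqrt_le_mono) (simp only: power_mult_distrib)
      then show "sqrt (cell_integral (\<lambda>x. (en k x)\<^sup>2)) \<le> 2 * (F / (1 - \<kappa>))" using F0 k by simp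
    qed (simp add: cell_integral_def)
    finally show ?thesis .
  qed
  have clim: "c \<longlonglongrightarrow> I0"
  proof -
    have "(\<lambda>k. I0 - c k) \<longlonglongrightarrow> 0"
    proof (rule Lim_null_comparison)
      show "\<forall>\<^sub>F k in sequentially. norm (I0 - c k) \<le> (1 / real (Suc k)) * cell_integral (\<lambda>x. \<bar>rt x\<bar>)
          + sqrt (cell_integral (\<lambda>x. (rt x * dev k x)\<^sup>2)) * (2 * (F / (1 - \<kappa>)))"
      proof (intro always_eventually allI)
        fix k show "norm (I0 - c k) \<le> (1 / real (Suc k)) * cell_integral (\<lambda>x. \<bar>rt x\<bar>)
          + sqrt (cell_integral (\<lambda>x. (rt x * dev k x)\<^sup>2)) * (2 * (F / (1 - \<kappa>)))"
          unfolding id[of k] real_norm_def by (rule order_trans[OF abs_triangle_ineq add_mono[OF b1 b2]])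
      qed
      have "(\<lambda>k. (1 / real (Suc k)) * cell_integral (\<lambda>x. \<bar>rt x\<bar>)
          + sqrt (cell_integral (\<lambda>x. (rt x * dev k x)\<^sup>2)) * (2 * (F / (1 - \<kappa>))))
          \<longlonglongrightarrow> 0 * cell_integral (\<lambda>x. \<bar>rt x\<bar>) + sqrt (cell_integral (\<lambda>x :: real ^ 'n. 0)) * (2 * (F / (1 - \<kappa>)))"
        using LIMSEQ_inverse_real_of_nat by (intro tendsto_intros rd0) (simp add: inverse_eq_divide)
      then show "(\<lambda>k. (1 / real (Suc k)) * cell_integral (\<lambda>x. \<bar>rt x\<bar>)
          + sqrt (cell_integral (\<lambda>x. (rt x * dev k x)\<^sup>2)) * (2 * (F / (1 - \<kappa>)))) \<longlonglongrightarrow> 0" by simp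
    qed
    from tendsto_diff[OF tendsto_const[of I0] this] show ?thesis by simp
  qed
  have tot: "cell_integral (\<lambda>x. rt x * f x) = I0 + mf"
  proof -
    have "cell_integral (\<lambda>x. rt x * f x) = cell_integral (\<lambda>x. rt x * f0 x + mf * rt x)"
      by (simp add: f0_def algebra_simps)
    also have "\<dots> = I0 + mf * cell_integral rt"
      unfolding I0_def cell_integral_def using Ci[OF cf(2)] rtD(4) by simp
    finally show ?thesis by (simp add: rt(2))
  qed
  show "\<bar>cell_integral (\<lambda>x. rt x * f x)\<bar> \<le> (1 + 1 / (1 - \<kappa>)) * sqrt (cell_integral (\<lambda>x. (f x)\<^sup>2))"
  proof -
    have "\<bar>I0\<bar> \<le> F / (1 - \<kappa>)"
      by (rule LIMSEQ_le_const2[OF tendsto_rabs[OF clim]]) (use P(6) in auto)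
    also have "\<dots> \<le> F1 / (1 - \<kappa>)" using FF1 k by (intro divide_right_mono) auto
    finally have "\<bar>I0 + mf\<bar> \<le> F1 / (1 - \<kappa>) + F1" using mF1 by linarith
    then show ?thesis unfolding tot F1_def[symmetric] by (simp add: algebra_simps)
  qed
  fix \<mu> assume mu: "\<And>x. \<mu> \<le> f x"
  have "\<mu> - mf - 1 / real (Suc k) \<le> c k" for k
    by (rule P(7)) (use mu in \<open>simp add: f0_def\<close>)
  moreover have "(\<lambda>k. \<mu> - mf - 1 / real (Suc k)) \<longlonglongrightarrow> \<mu> - mf - 0"
    using LIMSEQ_inverse_real_of_nat by (intro tendsto_intros) (simp add: inverse_eq_divide)
  ultimately have "\<mu> - mf - 0 \<le> I0"
    by (intro LIMSEQ_le[OF _ clim]) auto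
  then show "\<mu> \<le> cell_integral (\<lambda>x. rt x * f x)" unfolding tot by simp
qed

text \<open>Convolution turns \<open>g\<close> into a trigonometric polynomial without increasing
  its \<open>L^2\<close> norm and without lowering an essential lower bound. Boundedness of
  \<open>g\<close> supplies the majorant \<open>C * \<bar>rt\<bar>\<close> for the passage to the
  limit.\<close>

lemma very_weak_solution_bounded:
  fixes At :: "real ^ 'n \<Rightarrow> real ^ 'n ^ 'n" and bt :: "real ^ 'n \<Rightarrow> real ^ 'n" and rt g :: "real ^ 'n \<Rightarrow> real"
  assumes m: "At \<in> borel_measurable lebesgue" "bt \<in> borel_measurable lebesgue" and per: "periodic At" "periodic bt"
    and s: "AE x in lebesgue. (norm (At x - mat 1))\<^sup>2 + (norm (bt x))\<^sup>2 \<le> s"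
    and psd: "AE x in lebesgue. \<forall>v. 0 \<le> v \<bullet> (At x *v v)"
    and k: "s * (1 + 1 / (4 * pi\<^sup>2)) \<le> \<kappa>\<^sup>2" "0 < \<kappa>" "\<kappa> < 1" and s0: "0 \<le> s"
    and rt: "rt \<in> L2_per" "cell_integral rt = 1"
    and sol: "\<And>\<phi>. \<phi> \<in> H2_per \<Longrightarrow> cell_integral (\<lambda>x. rt x * (At x \<bullet> weak_hessian \<phi> x + bt x \<bullet> weak_grad \<phi> x)) = 0"
    and g: "g \<in> borel_measurable lebesgue" "periodic g" "AE x in lebesgue. norm (g x) \<le> C"
  shows "\<bar>cell_integral (\<lambda>x. rt x * g x)\<bar> \<le> (1 + 1 / (1 - \<kappa>)) * sqrt (cell_integral (\<lambda>x. (g x)\<^sup>2))"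
    and "\<And>\<mu>. (AE x in lebesgue. \<mu> \<le> g x) \<Longrightarrow> \<mu> \<le> cell_integral (\<lambda>x. rt x * g x)"
proof -
  note rtD = L2_per_D[OF rt(1)]
  note gi = integrable_cell_bounded[OF g(1,3)]
  note T = very_weak_solution_trig[OF m per s psd k s0 rt sol]
  obtain r :: "nat \<Rightarrow> nat" where r: "AE x in lebesgue_on (cell :: (real ^ 'n) set). (\<lambda>k. conv (r k) g x) \<longlonglongrightarrow> g x"
    using conv_AE_subseq[OF g(1,2) gi] by blast
  have lim: "(\<lambda>k. cell_integral (\<lambda>x. rt x * conv (r k) g x)) \<longlonglongrightarrow> cell_integral (\<lambda>x. rt x * g x)"
    unfolding cell_integral_def
  proof (rule integral_dominated_convergence[where w="\<lambda>x. C * \<bar>rt x\<bar>"])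
    show "AE x in lebesgue_on cell. (\<lambda>k. rt x * conv (r k) g x) \<longlonglongrightarrow> rt x * g x"
      using r by eventually_elim (intro tendsto_intros)
    have "norm (rt x * conv N g x) \<le> C * \<bar>rt x\<bar>" for N x
      using mult_left_mono[OF norm_conv_le[OF gi(1) g(3), of N x], of "\<bar>rt x\<bar>"] by (simp add: abs_mult mult.commute)
    then show "AE x in lebesgue_on cell. norm (rt x * conv (r k) g x) \<le> C * \<bar>rt x\<bar>" for k by simp
    show "(\<lambda>x. rt x * conv (r k) g x) \<in> borel_measurable (lebesgue_on cell)" for k
      by (intro measurable_restrict_space1 borel_measurable_times rtD continuous_borel_lebesgue continuous_conv gi)
    show "(\<lambda>x. rt x * g x) \<in> borel_measurable (lebesgue_on cell)"
      by (intro measurable_restrict_space1 borel_measurable_times rtD g)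
  qed (use rtD(4) in auto)
  have g2: "integrable (lebesgue_on cell) (\<lambda>x. (g x)\<^sup>2)"
  proof (rule integrable_cell_bounded(1))
    show "AE x in lebesgue. norm ((g x)\<^sup>2) \<le> C\<^sup>2"
      using g(3)
    proof eventually_elim
      case (elim x)
      then have "\<bar>g x\<bar>\<^sup>2 \<le> C\<^sup>2" by (intro power_mono) auto
      then show ?case by simp
    qed
  qed (use g(1) in measurable)
  show "\<bar>cell_integral (\<lambda>x. rt x * g x)\<bar> \<le> (1 + 1 / (1 - \<kappa>)) * sqrt (cell_integral (\<lambda>x. (g x)\<^sup>2))"
  proof (rule LIMSEQ_le_const2[OF tendsto_rabs[OF lim]], intro exI allI impI)
    fix j
    have "\<bar>cell_integral (\<lambda>x. rt x * conv (r j) g x)\<bar> \<le> (1 + 1 / (1 - \<kappa>)) * sqrt (cell_integral (\<lambda>x. (conv (r j) g x)\<^sup>2))"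
      by (rule T(1)[OF _ conv_real_trig_poly[OF gi(1)]])
    also have "\<dots> \<le> (1 + 1 / (1 - \<kappa>)) * sqrt (cell_integral (\<lambda>x. (g x)\<^sup>2))"
      using k by (intro mult_left_mono real_sqrt_le_mono conv_L2_le g g2) auto
    finally show "\<bar>cell_integral (\<lambda>x. rt x * conv (r j) g x)\<bar> \<le> (1 + 1 / (1 - \<kappa>)) * sqrt (cell_integral (\<lambda>x. (g x)\<^sup>2))" .
  qed
  fix \<mu> assume mu: "AE x in lebesgue. \<mu> \<le> g x"
  show "\<mu> \<le> cell_integral (\<lambda>x. rt x * g x)"
  proof (rule LIMSEQ_le_const[OF lim], intro exI allI impI)
    fix j
    have mu': "\<mu> \<le> conv (r j) g x" for x
    proof -
      have "\<mu> = conv (r j) (\<lambda>y. \<mu>) x" by (simp add: conv_const)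
      also have "\<dots> \<le> conv (r j) g x" by (rule conv_mono_AE[OF _ gi(1) mu]) (simp add: integrable_cell_continuous)
      finally show ?thesis .
    qed
    show "\<mu> \<le> cell_integral (\<lambda>x. rt x * conv (r j) g x)"
      by (rule T(2)[OF _ conv_real_trig_poly[OF gi(1)] mu'])
  qed
qed

text \<open>Take \<open>g\<close> to be \<open>rt\<close> truncated, which is bounded and satisfies
  \<open>g^2 \<le> rt * g\<close>. The duality bound then reads \<open>Q \<le> C1 * sqrt Q\<close>
  for the integral \<open>Q\<close> of \<open>g^2\<close>, which is finite; hence
  \<open>sqrt Q \<le> C1\<close> at every truncation level.\<close>

lemma very_weak_solution_L2:
  fixes At :: "real ^ 'n \<Rightarrow> real ^ 'n ^ 'n" and bt :: "real ^ 'n \<Rightarrow> real ^ 'n" and rt :: "real ^ 'n \<Rightarrow> real"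
  assumes m: "At \<in> borel_measurable lebesgue" "bt \<in> borel_measurable lebesgue" and per: "periodic At" "periodic bt"
    and s: "AE x in lebesgue. (norm (At x - mat 1))\<^sup>2 + (norm (bt x))\<^sup>2 \<le> s"
    and psd: "AE x in lebesgue. \<forall>v. 0 \<le> v \<bullet> (At x *v v)"
    and k: "s * (1 + 1 / (4 * pi\<^sup>2)) \<le> \<kappa>\<^sup>2" "0 < \<kappa>" "\<kappa> < 1" and s0: "0 \<le> s"
    and rt: "rt \<in> L2_per" "cell_integral rt = 1"
    and sol: "\<And>\<phi>. \<phi> \<in> H2_per \<Longrightarrow> cell_integral (\<lambda>x. rt x * (At x \<bullet> weak_hessian \<phi> x + bt x \<bullet> weak_grad \<phi> x)) = 0"
  shows "L2_norm rt \<le> 1 + 1 / (1 - \<kappa>)"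
proof -
  note rtD = L2_per_D[OF rt(1)]
  define C1 where "C1 = 1 + 1 / (1 - \<kappa>)"
  have C1: "0 \<le> C1" using k by (simp add: C1_def)
  define g where "g M x = trunc (real (Suc M)) (rt x)" for M x
  have gm: "g M \<in> borel_measurable lebesgue" for M
    unfolding g_def[abs_def] by (intro measurable_trunc rtD) simp
  have gb: "norm (g M x) \<le> real (Suc M)" for M x unfolding g_def by (rule trunc_bound) simp
  have gr: "(g M x)\<^sup>2 \<le> rt x * g M x" "(g M x)\<^sup>2 \<le> (rt x)\<^sup>2" for M x
  proof -
    define q where "q = real (Suc M) / max (real (Suc M)) (norm (rt x))"
    have q: "0 \<le> q" "q \<le> 1" by (auto simp: q_def divide_simps)
    have e: "g M x = q * rt x" by (simp add: g_def trunc_def q_def del: of_nat_Suc)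
    have "q * (q * (rt x * rt x)) \<le> 1 * (q * (rt x * rt x))" using q by (intro mult_right_mono) auto
    then show "(g M x)\<^sup>2 \<le> rt x * g M x" by (simp add: e power2_eq_square mult_ac)
    have "q\<^sup>2 * (rt x)\<^sup>2 \<le> 1 * (rt x)\<^sup>2" using q by (intro mult_right_mono power_le_one) auto
    then show "(g M x)\<^sup>2 \<le> (rt x)\<^sup>2" by (simp add: e power_mult_distrib)
  qed
  have gp: "periodic (g M)" for M
    unfolding periodic_def
  proof
    fix i
    have "AE x in lebesgue. rt (x + axis i 1) = rt x" using rtD(2) by (simp add: periodic_def)
    then show "AE x in lebesgue. g M (x + axis i 1) = g M x" by eventually_elim (simp add: g_def)
  qed
  have rt2: "integrable (lebesgue_on cell) (\<lambda>x. (rt x)\<^sup>2)" using rtD(3) by simp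
  have g2: "integrable (lebesgue_on cell) (\<lambda>x. (g M x)\<^sup>2)" for M
    by (rule Bochner_Integration.integrable_bound[OF rt2])
      (use gr(2) gm in \<open>auto intro!: measurable_restrict_space1 borel_measurable_power\<close>)
  have le: "cell_integral (\<lambda>x. (g M x)\<^sup>2) \<le> C1\<^sup>2" for M
  proof -
    define Q where "Q = cell_integral (\<lambda>x. (g M x)\<^sup>2)"
    have Q0: "0 \<le> Q" by (simp add: Q_def cell_integral_def)
    have "Q \<le> cell_integral (\<lambda>x. rt x * g M x)"
      unfolding Q_def cell_integral_def
      by (rule integral_mono[OF g2 integrable_L2_mult[OF rt(1) gm g2] gr(1)])
    also have "\<dots> \<le> C1 * sqrt Q"
    proof -
      have "\<bar>cell_integral (\<lambda>x. rt x * g M x)\<bar> \<le> C1 * sqrt Q"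
        unfolding Q_def C1_def
        by (rule very_weak_solution_bounded(1)[OF m per s psd k s0 rt sol gm gp AE_I2[OF gb]])
      then show ?thesis by simp
    qed
    finally have "sqrt Q * sqrt Q \<le> C1 * sqrt Q" using Q0 by simp
    have "sqrt Q \<le> C1"
    proof (cases "Q = 0")
      case False
      then have "0 < sqrt Q" using Q0 by simp
      with \<open>sqrt Q * sqrt Q \<le> C1 * sqrt Q\<close> show ?thesis by (rule mult_right_le_imp_le)
    qed (use C1 in simp)
    then have "(sqrt Q)\<^sup>2 \<le> C1\<^sup>2" by (intro power_mono) (use Q0 in auto)
    then show ?thesis using Q0 by (simp add: Q_def)
  qed
  have "(\<lambda>M. cell_integral (\<lambda>x. (g M x)\<^sup>2)) \<longlonglongrightarrow> cell_integral (\<lambda>x. (rt x)\<^sup>2)"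
    unfolding cell_integral_def
  proof (rule integral_dominated_convergence[where w="\<lambda>x. (rt x)\<^sup>2"])
    show "AE x in lebesgue_on cell. (\<lambda>M. (g M x)\<^sup>2) \<longlonglongrightarrow> (rt x)\<^sup>2"
    proof (rule AE_I2)
      fix x
      obtain m0 :: nat where m0: "norm (rt x) \<le> m0" using real_arch_simple by blast
      have "\<forall>\<^sub>F M in sequentially. (g M x)\<^sup>2 = (rt x)\<^sup>2"
        unfolding eventually_sequentially g_def
        by (intro exI[of _ m0] allI impI) (use m0 in \<open>subst trunc_eq; auto\<close>)
      then show "(\<lambda>M. (g M x)\<^sup>2) \<longlonglongrightarrow> (rt x)\<^sup>2" by (rule tendsto_eventually)
    qed
    show "AE x in lebesgue_on cell. norm ((g M x)\<^sup>2) \<le> (rt x)\<^sup>2" for M using gr(2) by simp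
  qed (use rt2 gm rtD in \<open>auto intro!: measurable_restrict_space1 borel_measurable_power\<close>)
  then have "cell_integral (\<lambda>x. (rt x)\<^sup>2) \<le> C1\<^sup>2" by (rule LIMSEQ_le_const2) (use le in auto)
  then have "L2_norm rt \<le> sqrt (C1\<^sup>2)" unfolding L2_norm_def by (intro real_sqrt_le_mono) simp
  then show ?thesis using C1 by (simp add: C1_def)
qed

subsection \<open>The effective matrix\<close>

text \<open>With \<open>t\<close> the trace and \<open>D\<close> the denominator of
  \<open>\<gamma>\<close>, the number \<open>\<gamma> = t / D\<close> minimises the quadratic
  \<open>\<gamma>^2 * D - 2 * \<gamma> * t + n\<close>. The minimum is \<open>n - t^2 / D\<close>,
  and the Cordes condition says \<open>t^2 / D \<ge> n - 1 + \<delta>\<close>. The same condition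
  with \<open>t \<le> n * Lam\<close> bounds \<open>\<gamma>\<close> from below;
  \<open>D \<ge> lam^2\<close> bounds it from above.\<close>

lemma cordes_pointwise:
  fixes M :: "real ^ 'n ^ 'n" and \<beta> :: "real ^ 'n"
  assumes lam: "0 < lam" and ell: "\<And>v. lam * (v \<bullet> v) \<le> v \<bullet> (M *v v) \<and> v \<bullet> (M *v v) \<le> Lam * (v \<bullet> v)"
    and del: "0 < \<delta>" and cordes: "((norm M)\<^sup>2 + (norm \<beta>)\<^sup>2) / (trace M)\<^sup>2 \<le> 1 / (real CARD('n) - 1 + \<delta>)"
  defines "\<gamma> \<equiv> trace M / ((norm M)\<^sup>2 + (norm \<beta>)\<^sup>2)"
  shows "(real CARD('n) - 1 + \<delta>) / (real CARD('n) * Lam) \<le> \<gamma>" "\<gamma> \<le> real CARD('n) * Lam / lam\<^sup>2"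
    "(norm (\<gamma> *\<^sub>R M - mat 1))\<^sup>2 + (norm (\<gamma> *\<^sub>R \<beta>))\<^sup>2 \<le> 1 - \<delta>"
    "0 \<le> v \<bullet> ((\<gamma> *\<^sub>R M) *v v)"
proof -
  define n where "n = real CARD('n)"
  have n1: "1 \<le> n" unfolding n_def by (simp add: Suc_le_eq)
  define t where "t = trace M"
  define D where "D = (norm M)\<^sup>2 + (norm \<beta>)\<^sup>2"
  have diag: "axis i 1 \<bullet> (M *v axis i 1) = M $ i $ i" for i
    by (simp add: matrix_vector_mult_basis inner_axis' column_def)
  have ii: "lam \<le> M $ i $ i" "M $ i $ i \<le> Lam" for i
    using ell[of "axis i 1"] unfolding diag by (simp_all add: inner_axis_axis)
  have t1: "n * lam \<le> t" unfolding t_def trace_def n_def using sum_mono[of UNIV "\<lambda>_. lam" "\<lambda>i. M $ i $ i"] ii by simp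
  have t2: "t \<le> n * Lam" unfolding t_def trace_def n_def using sum_mono[of UNIV "\<lambda>i. M $ i $ i" "\<lambda>_. Lam"] ii by simp
  have nl: "0 < n * lam" using n1 lam by (intro mult_pos_pos) auto
  then have t0: "0 < t" using t1 by simp
  have nL: "0 < n * Lam" using t0 t2 by simp
  have "lam\<^sup>2 \<le> (norm M)\<^sup>2"
  proof (rule power_mono)
    fix i :: 'n
    have "lam \<le> \<bar>M $ i $ i\<bar>" using ii(1)[of i] by simp
    also have "\<dots> \<le> norm (M $ i)" by (rule component_le_norm_cart)
    also have "\<dots> \<le> norm M" by (rule Finite_Cartesian_Product.norm_nth_le)
    finally show "lam \<le> norm M" .
  qed (use lam in simp)
  then have Dl: "lam\<^sup>2 \<le> D" unfolding D_def using zero_le_power2[of "norm \<beta>"] by linarith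
  have l2: "0 < lam\<^sup>2" using lam by simp
  have D0: "0 < D" using Dl l2 by linarith
  have m0: "0 < n - 1 + \<delta>" using n1 del by simp
  have "D / t\<^sup>2 \<le> 1 / (n - 1 + \<delta>)" using cordes by (simp add: D_def t_def n_def)
  then have cd: "D * (n - 1 + \<delta>) \<le> t\<^sup>2" using t0 m0 by (simp add: divide_simps)
  have g: "\<gamma> = t / D" by (simp add: \<gamma>_def t_def D_def)
  have g0: "0 < \<gamma>" using t0 D0 by (simp add: g)
  have "(n - 1 + \<delta>) / t \<le> t / D" using cd t0 D0 by (simp add: divide_simps power2_eq_square mult.commute)
  moreover have "(n - 1 + \<delta>) / (n * Lam) \<le> (n - 1 + \<delta>) / t" using t0 t2 m0 by (intro divide_left_mono) auto
  ultimately show "(real CARD('n) - 1 + \<delta>) / (real CARD('n) * Lam) \<le> \<gamma>" by (simp add: g n_def)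
  have "t / D \<le> n * Lam / lam\<^sup>2" using t0 t2 Dl l2 by (intro frac_le) auto
  then show "\<gamma> \<le> real CARD('n) * Lam / lam\<^sup>2" by (simp add: g n_def)
  have I1: "M \<bullet> mat 1 = t" and I2: "(mat 1 :: real ^ 'n ^ 'n) \<bullet> mat 1 = n"
    by (simp_all add: frobenius_inner mat_def t_def trace_def n_def if_distrib[where f="\<lambda>c. _ * c"] cong: if_cong)
  have "(norm (\<gamma> *\<^sub>R M - mat 1))\<^sup>2 + (norm (\<gamma> *\<^sub>R \<beta>))\<^sup>2 = \<gamma>\<^sup>2 * D - 2 * \<gamma> * t + n"
    unfolding D_def power2_norm_eq_inner
    by (simp add: inner_diff_left inner_diff_right I1 I2 inner_commute[of "mat 1" M] power2_eq_square algebra_simps)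
  also have "\<dots> = n - t\<^sup>2 / D" unfolding g using D0 by (simp add: field_simps power2_eq_square)
  also have "\<dots> \<le> 1 - \<delta>" using cd D0 by (simp add: field_simps)
  finally show "(norm (\<gamma> *\<^sub>R M - mat 1))\<^sup>2 + (norm (\<gamma> *\<^sub>R \<beta>))\<^sup>2 \<le> 1 - \<delta>" .
  have "0 \<le> lam * (v \<bullet> v)" using lam by simp
  then have "0 \<le> v \<bullet> (M *v v)" using ell[of v] by linarith
  then show "0 \<le> v \<bullet> ((\<gamma> *\<^sub>R M) *v v)" using g0 by (simp add: scaleR_matrix_vector_assoc[symmetric])
qed

lemma setting_B_facts:
  fixes A :: "real ^ 'n \<Rightarrow> real ^ 'n ^ 'n" and b :: "real ^ 'n \<Rightarrow> real ^ 'n"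
  assumes B: "setting_B A b"
  obtains s \<kappa> g0 g1 KA where
    "A \<in> borel_measurable lebesgue" "gam A b \<in> borel_measurable lebesgue" "periodic (gam A b)"
    "At A b \<in> borel_measurable lebesgue" "bt A b \<in> borel_measurable lebesgue" "periodic (At A b)" "periodic (bt A b)"
    "AE x in lebesgue. (norm (At A b x - mat 1))\<^sup>2 + (norm (bt A b x))\<^sup>2 \<le> s"
    "AE x in lebesgue. \<forall>v. 0 \<le> v \<bullet> (At A b x *v v)"
    "s * (1 + 1 / (4 * pi\<^sup>2)) \<le> \<kappa>\<^sup>2" "0 < \<kappa>" "\<kappa> < 1" "0 \<le> s"
    "0 < g0" "0 < g1" "AE x in lebesgue. g0 \<le> gam A b x \<and> gam A b x \<le> g1"
    "0 \<le> KA" "AE x in lebesgue. norm (A x) \<le> KA"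
proof -
  define n where "n = real CARD('n)"
  have n1: "1 \<le> n" unfolding n_def by (simp add: Suc_le_eq)
  have mA: "A \<in> borel_measurable lebesgue" "periodic A" and mb: "b \<in> borel_measurable lebesgue" "periodic b"
    using B by (auto simp: setting_B_def Linf_per_def)
  obtain KA where KA: "AE x in lebesgue. norm (A x) \<le> KA" using B by (auto simp: setting_B_def Linf_per_def)
  obtain lam Lam where lam: "0 < lam" "0 < Lam"
    and ell: "AE x in lebesgue. \<forall>v. lam * (v \<bullet> v) \<le> v \<bullet> (A x *v v) \<and> v \<bullet> (A x *v v) \<le> Lam * (v \<bullet> v)"
    using B by (auto simp: setting_B_def)
  obtain \<delta> where del: "n / (n + pi\<^sup>2) < \<delta>" "\<delta> \<le> 1"
    and cordes: "AE x in lebesgue. ((norm (A x))\<^sup>2 + (norm (b x))\<^sup>2) / (trace (A x))\<^sup>2 \<le> 1 / (real CARD('n) - 1 + \<delta>)"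
    using B by (auto simp: setting_B_def n_def)
  have d0: "0 < \<delta>"
  proof -
    have "0 \<le> n / (n + pi\<^sup>2)" using n1 by simp
    then show ?thesis using del by linarith
  qed
  define s where "s = 1 - \<delta>"
  have s0: "0 \<le> s" using del by (simp add: s_def)
  have pp: "0 < pi\<^sup>2" by simp
  define q where "q = s * (1 + 1 / (4 * pi\<^sup>2))"
  have q0: "0 \<le> q" using s0 unfolding q_def by (intro mult_nonneg_nonneg add_nonneg_nonneg) auto
  \<comment> \<open>The lower bound on \<open>\<delta>\<close> says that \<open>s\<close> lies below
    \<open>pi^2 / (n + pi^2)\<close>, the reciprocal of \<open>1 + n / pi^2\<close>, and the factor
    \<open>1 + 1 / (4 * pi^2)\<close> in \<open>q\<close> is no larger than
    \<open>1 + n / pi^2\<close>.\<close>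
  have q1: "q < 1"
  proof -
    have "n + pi\<^sup>2 \<noteq> 0" using n1 pp by linarith
    then have "pi\<^sup>2 / (n + pi\<^sup>2) = 1 - n / (n + pi\<^sup>2)" by (simp add: field_simps)
    then have "s < pi\<^sup>2 / (n + pi\<^sup>2)" using del(1) by (simp add: s_def)
    moreover have "1 / (4 * pi\<^sup>2) \<le> n / pi\<^sup>2" using n1 pp by (simp add: divide_simps)
    ultimately have "q < pi\<^sup>2 / (n + pi\<^sup>2) * (1 + n / pi\<^sup>2)"
      unfolding q_def using pp s0 n1 by (intro mult_less_le_imp_less) (auto intro: add_pos_nonneg)
    also have "pi\<^sup>2 / (n + pi\<^sup>2) * (1 + n / pi\<^sup>2) = 1"
    proof -
      have ne: "n + pi\<^sup>2 \<noteq> 0" using n1 pp by linarith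
      have "1 + n / pi\<^sup>2 = (n + pi\<^sup>2) / pi\<^sup>2" using pp by (simp add: add_divide_distrib)
      then show ?thesis using ne pp by simp
    qed
    finally show ?thesis .
  qed
  \<comment> \<open>Strictly larger than \<open>sqrt q\<close>, so that \<open>\<kappa>\<close> is
    positive even for \<open>\<delta> = 1\<close>, where \<open>q = 0\<close>.\<close>
  define \<kappa> where "\<kappa> = sqrt ((1 + q) / 2)"
  have k: "q \<le> \<kappa>\<^sup>2" "0 < \<kappa>" "\<kappa> < 1" using q0 q1 by (auto simp: \<kappa>_def real_sqrt_lt_1_iff)
  define g0 where "g0 = (n - 1 + \<delta>) / (n * Lam)"
  define g1 where "g1 = n * Lam / lam\<^sup>2"
  have g: "0 < g0" "0 < g1" using n1 d0 lam by (auto simp: g0_def g1_def)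
  have pt: "AE x in lebesgue. g0 \<le> gam A b x \<and> gam A b x \<le> g1 \<and>
      (norm (At A b x - mat 1))\<^sup>2 + (norm (bt A b x))\<^sup>2 \<le> s \<and> (\<forall>v. 0 \<le> v \<bullet> (At A b x *v v))"
    using ell cordes
  proof eventually_elim
    case (elim x)
    note cp = cordes_pointwise[OF lam(1) _ d0 elim(2), of Lam, folded gam_def n_def]
    show ?case
      unfolding g0_def g1_def s_def At_def bt_def using cp elim(1) by blast
  qed
  have gm: "gam A b \<in> borel_measurable lebesgue"
  proof -
    have "(\<lambda>x. trace (A x)) \<in> borel_measurable lebesgue"
    proof -
      have "(\<lambda>x. A x \<bullet> mat 1) \<in> borel_measurable lebesgue" using mA(1) by (intro borel_measurable_inner) auto
      moreover have "M \<bullet> mat 1 = trace M" for M :: "real ^ 'n ^ 'n"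
        by (simp add: frobenius_inner mat_def trace_def if_distrib[where f="\<lambda>c. _ * c"] cong: if_cong)
      ultimately show ?thesis by simp
    qed
    then show ?thesis unfolding gam_def[abs_def] using mA(1) mb(1) by measurable
  qed
  have pA: "AE x in lebesgue. A (x + axis i 1) = A x" "AE x in lebesgue. b (x + axis i 1) = b x" for i
    using mA(2) mb(2) by (auto simp: periodic_def)
  have "periodic (gam A b)" "periodic (At A b)" "periodic (bt A b)"
    unfolding periodic_def
  proof (safe)
    fix i
    show "AE x in lebesgue. gam A b (x + axis i 1) = gam A b x"
      using pA[of i] by eventually_elim (simp add: gam_def)
    show "AE x in lebesgue. At A b (x + axis i 1) = At A b x"
      using pA[of i] by eventually_elim (simp add: gam_def At_def)
    show "AE x in lebesgue. bt A b (x + axis i 1) = bt A b x"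
      using pA[of i] by eventually_elim (simp add: gam_def bt_def)
  qed
  moreover have "At A b \<in> borel_measurable lebesgue" "bt A b \<in> borel_measurable lebesgue"
    unfolding At_def[abs_def] bt_def[abs_def] using gm mA(1) mb(1) by (auto intro!: borel_measurable_scaleR)
  moreover have "AE x in lebesgue. norm (A x) \<le> \<bar>KA\<bar>" using KA by eventually_elim simp
  moreover have "AE x in lebesgue. (norm (At A b x - mat 1))\<^sup>2 + (norm (bt A b x))\<^sup>2 \<le> s"
    "AE x in lebesgue. \<forall>v. 0 \<le> v \<bullet> (At A b x *v v)" "AE x in lebesgue. g0 \<le> gam A b x \<and> gam A b x \<le> g1"
    using pt by (auto elim: eventually_mono)
  ultimately show ?thesis
    using that[of s \<kappa> g0 g1 "\<bar>KA\<bar>"] mA(1) gm k s0 g unfolding q_def by simp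
qed

section \<open>Norms of matrix-valued functions and their products\<close>

lemma norm_matrix_mult_le: "norm ((M :: real ^ 'n ^ 'n) ** (N :: real ^ 'n ^ 'n)) \<le> norm M * norm N"
proof -
  have "(norm (M ** N))\<^sup>2 = (\<Sum>i\<in>UNIV. \<Sum>j\<in>UNIV. (row i M \<bullet> column j N)\<^sup>2)"
    unfolding norm_sq_mat by (simp add: matrix_matrix_mult_def row_def column_def inner_vec_def)
  also have "\<dots> \<le> (\<Sum>i\<in>UNIV. \<Sum>j\<in>UNIV. (row i M \<bullet> row i M) * (column j N \<bullet> column j N))"
    by (intro sum_mono Cauchy_Schwarz_ineq)
  also have "\<dots> = (\<Sum>i\<in>UNIV. row i M \<bullet> row i M) * (\<Sum>j\<in>UNIV. column j N \<bullet> column j N)"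
    by (simp add: sum_product)
  also have "(\<Sum>i\<in>UNIV. row i M \<bullet> row i M) = (norm M)\<^sup>2"
    unfolding norm_sq_mat by (simp add: row_def inner_vec_def power2_eq_square)
  also have "(\<Sum>j\<in>UNIV. column j N \<bullet> column j N) = (norm N)\<^sup>2"
    unfolding norm_sq_mat by (subst sum.swap) (simp add: column_def inner_vec_def power2_eq_square)
  finally have "(norm (M ** N))\<^sup>2 \<le> (norm M * norm N)\<^sup>2" by (simp add: power_mult_distrib)
  then show ?thesis by (rule power2_le_imp_le) simp
qed

lemma norm_transpose: "norm (transpose (M :: real ^ 'n ^ 'n)) = norm M"
proof -
  have "(norm (transpose M))\<^sup>2 = (norm M)\<^sup>2"
    unfolding norm_sq_mat transpose_def by (subst sum.swap) simp
  then show ?thesis by simp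
qed

lemma transpose_diff: "transpose (M - N) = transpose M - transpose (N :: real ^ 'n ^ 'n)"
  by (simp add: transpose_def vec_eq_iff)

text \<open>Telescoping changes one outer factor at a time. The weight \<open>w\<close> dominates
  the norms of both \<open>I + X\<close> and \<open>I + Y\<close>, the latter by writing
  \<open>Y = X - (X - Y)\<close>; thus all bounds are expressed through \<open>X\<close> and the
  error, never through \<open>Y\<close> alone.\<close>

lemma sandwich_bounds:
  fixes A X Y :: "real ^ 'n ^ 'n"
  assumes A: "norm A \<le> KA"
  defines "P \<equiv> \<lambda>X. (mat 1 + X) ** A ** (mat 1 + transpose X)"
    and "w \<equiv> norm (mat 1 :: real ^ 'n ^ 'n) + norm X + norm (X - Y)"
  shows "norm (P X - P Y) \<le> 2 * KA * (norm (X - Y) * w)" "norm (P Y) \<le> KA * (w * w)" "norm (P X) \<le> KA * (w * w)"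
proof -
  have K0: "0 \<le> KA" using A norm_ge_zero order_trans by blast
  have w0: "0 \<le> w" by (simp add: w_def)
  have nX: "norm (mat 1 + X) \<le> w" "norm (mat 1 + transpose X) \<le> w"
    using norm_triangle_ineq[of "mat 1" X] norm_triangle_ineq[of "mat 1" "transpose X"] norm_ge_zero[of "X - Y"]
    unfolding w_def norm_transpose by linarith+
  have nY: "norm (mat 1 + Y) \<le> w" "norm (mat 1 + transpose Y) \<le> w"
    using norm_triangle_ineq[of "mat 1" Y] norm_triangle_ineq[of "mat 1" "transpose Y"] norm_triangle_ineq4[of X "X - Y"]
    by (auto simp: w_def norm_transpose)
  have t: "norm (U ** A ** V) \<le> KA * (u * v)" if "norm U \<le> u" "norm V \<le> v" for U V :: "real ^ 'n ^ 'n" and u v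
  proof -
    have "norm (U ** A ** V) \<le> (norm U * norm A) * norm V"
      by (rule order_trans[OF norm_matrix_mult_le mult_right_mono[OF norm_matrix_mult_le]]) simp
    also have "\<dots> \<le> (u * KA) * v"
      by (intro mult_mono that A mult_nonneg_nonneg order_trans[OF norm_ge_zero that(1)] K0 norm_ge_zero)
    finally show ?thesis by (simp add: mult_ac)
  qed
  show "norm (P Y) \<le> KA * (w * w)" "norm (P X) \<le> KA * (w * w)" unfolding P_def by (intro t nX nY)+
  have "P X - P Y = (X - Y) ** A ** (mat 1 + transpose X) + (mat 1 + Y) ** A ** transpose (X - Y)"
  proof -
    have l: "(U - V) ** C = U ** C - V ** C" and r: "C ** (U - V) = C ** U - C ** V" for U V C :: "real ^ 'n ^ 'n"
      by (simp_all add: matrix_matrix_mult_def vec_eq_iff left_diff_distrib right_diff_distrib sum_subtractf)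
    have "P X - P Y = ((mat 1 + X) - (mat 1 + Y)) ** A ** (mat 1 + transpose X) + (mat 1 + Y) ** A ** ((mat 1 + transpose X) - (mat 1 + transpose Y))"
      unfolding P_def l r by simp
    then show ?thesis by (simp add: transpose_diff)
  qed
  also have "norm \<dots> \<le> KA * (norm (X - Y) * w) + KA * (w * norm (X - Y))"
    by (rule order_trans[OF norm_triangle_ineq add_mono[OF t t]]) (use nX nY in \<open>auto simp: norm_transpose\<close>)
  finally show "norm (P X - P Y) \<le> 2 * KA * (norm (X - Y) * w)" by (simp add: mult_ac)
qed

lemma matrix_basis_mem: "axis i (axis j 1) \<in> (Basis :: (real ^ 'n ^ 'n) set)"
  by (auto simp: Basis_vec_def)

lemma H1_norm_bounds:
  fixes M :: "real ^ 'n \<Rightarrow> real ^ 'n ^ 'n"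
  assumes M: "\<And>i j. (\<lambda>x. M x $ i $ j) \<in> H1_per"
  shows "sqrt (cell_integral (\<lambda>x. (M x $ i $ j)\<^sup>2)) \<le> H1_norm M"
    and "sqrt (cell_integral (\<lambda>x. (weak_partial k (\<lambda>y. M y $ i $ j) x)\<^sup>2)) \<le> H1_norm M"
    and "integrable (lebesgue_on cell) (\<lambda>x. (norm (M x))\<^sup>2)" "0 \<le> H1_norm M"
proof -
  have L2: "integrable (lebesgue_on cell) (\<lambda>x. (M x $ i $ j)\<^sup>2)" for i j
    using L2_per_D(3)[OF H1_per_L2[OF M]] by simp
  have L2g: "integrable (lebesgue_on cell) (\<lambda>x. (weak_partial k (\<lambda>y. M y $ i $ j) x)\<^sup>2)" for i j k
    using L2_per_D(3)[OF H1_per_weak_partial(2)[OF M]] by simp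
  show nM: "integrable (lebesgue_on cell) (\<lambda>x. (norm (M x))\<^sup>2)" unfolding norm_sq_mat using L2 by simp
  define G where "G = (\<Sum>e\<in>(Basis :: (real ^ 'n ^ 'n) set). cell_integral (\<lambda>x. (norm (weak_grad (\<lambda>y. M y \<bullet> e) x))\<^sup>2))"
  have Gt: "0 \<le> cell_integral (\<lambda>x. (norm (weak_grad (\<lambda>y. M y \<bullet> e) x))\<^sup>2)" for e
    by (simp add: cell_integral_def)
  have G0: "0 \<le> G" unfolding G_def by (intro sum_nonneg Gt)
  have n0: "0 \<le> cell_integral (\<lambda>x. (norm (M x))\<^sup>2)" by (simp add: cell_integral_def)
  have H: "H1_norm M = sqrt (cell_integral (\<lambda>x. (norm (M x))\<^sup>2) + G)" by (simp add: H1_norm_def G_def)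
  show "0 \<le> H1_norm M" unfolding H using n0 G0 by simp
  have "cell_integral (\<lambda>x. (M x $ i $ j)\<^sup>2) \<le> cell_integral (\<lambda>x. (norm (M x))\<^sup>2)"
    unfolding cell_integral_def
  proof (rule integral_mono[OF L2 nM])
    fix x
    have "\<bar>M x $ i $ j\<bar> \<le> norm (M x)"
      by (rule order_trans[OF component_le_norm_cart Finite_Cartesian_Product.norm_nth_le])
    then have "\<bar>M x $ i $ j\<bar>\<^sup>2 \<le> (norm (M x))\<^sup>2" by (intro power_mono) auto
    then show "(M x $ i $ j)\<^sup>2 \<le> (norm (M x))\<^sup>2" by simp
  qed
  then show "sqrt (cell_integral (\<lambda>x. (M x $ i $ j)\<^sup>2)) \<le> H1_norm M" unfolding H using G0 by simp
  define e :: "real ^ 'n ^ 'n" where "e = axis i (axis j 1)"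
  have e: "(\<lambda>y. M y \<bullet> e) = (\<lambda>y. M y $ i $ j)" by (simp add: e_def inner_axis)
  have eb: "e \<in> Basis" unfolding e_def by (rule matrix_basis_mem)
  have "cell_integral (\<lambda>x. (weak_partial k (\<lambda>y. M y $ i $ j) x)\<^sup>2) \<le> cell_integral (\<lambda>x. (norm (weak_grad (\<lambda>y. M y \<bullet> e) x))\<^sup>2)"
    unfolding e norm_sq_vec weak_grad_def cell_integral_def
    by (rule integral_mono) (use L2g in \<open>auto intro: member_le_sum\<close>)
  also have "\<dots> \<le> G" unfolding G_def using eb Gt by (intro member_le_sum) auto
  finally show "sqrt (cell_integral (\<lambda>x. (weak_partial k (\<lambda>y. M y $ i $ j) x)\<^sup>2)) \<le> H1_norm M"
    unfolding H using n0 by simp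
qed

lemma measurable_matrixI:
  fixes F :: "real ^ 'n \<Rightarrow> real ^ 'n ^ 'n"
  assumes "\<And>i j. (\<lambda>x. F x $ i $ j) \<in> borel_measurable lebesgue"
  shows "F \<in> borel_measurable lebesgue"
proof (subst borel_measurable_euclidean_space, intro ballI)
  fix e :: "real ^ 'n ^ 'n" assume "e \<in> Basis"
  have "(\<lambda>x. \<Sum>i\<in>UNIV. \<Sum>j\<in>UNIV. F x $ i $ j * e $ i $ j) \<in> borel_measurable lebesgue"
    by (intro borel_measurable_sum borel_measurable_times assms) simp
  then show "(\<lambda>x. F x \<bullet> e) \<in> borel_measurable lebesgue" by (simp add: frobenius_inner)
qed

text \<open>The scalar inequality is applied to each entry: one function norm and three times
  \<open>n\<close> derivative norms, each at most \<open>H1_norm M\<close>, give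
  \<open>1 + 3 * n\<close>. The factor \<open>n\<close> arises as a fourth root: \<open>n^2\<close>
  from comparing the norm with the sum of fourth powers, and \<open>n^2\<close> from the number of
  entries.\<close>

lemma sobolev_matrix:
  fixes M :: "real ^ 'n \<Rightarrow> real ^ 'n ^ 'n"
  assumes card: "CARD('n) \<le> 4" and M: "\<And>i j. (\<lambda>x. M x $ i $ j) \<in> H1_per"
  defines "K \<equiv> real CARD('n) * (1 + 3 * real CARD('n)) * H1_norm M"
  shows "M \<in> borel_measurable lebesgue" "integrable (lebesgue_on cell) (\<lambda>x. norm (M x) ^ 4)"
    "cell_integral (\<lambda>x. norm (M x) ^ 4) \<le> K ^ 4"
proof -
  define n where "n = real CARD('n)"
  define H where "H = H1_norm M"
  have n1: "1 \<le> n" unfolding n_def by (simp add: Suc_le_eq)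
  have H0: "0 \<le> H" unfolding H_def by (rule H1_norm_bounds(4)[OF M])
  have em: "(\<lambda>x. M x $ i $ j) \<in> borel_measurable lebesgue" for i j by (rule L2_per_D(1)[OF H1_per_L2[OF M]])
  have Mm: "M \<in> borel_measurable lebesgue" by (rule measurable_matrixI[OF em])
  then show "M \<in> borel_measurable lebesgue" .
  note S = sobolev_H1_per[OF card M]
  have ent: "cell_integral (\<lambda>x. (M x $ i $ j) ^ 4) \<le> ((1 + 3 * n) * H) ^ 4" for i j
  proof -
    have "(\<Sum>k\<in>UNIV. sqrt (cell_integral (\<lambda>x. (weak_partial k (\<lambda>y. M y $ i $ j) x)\<^sup>2))) \<le> (\<Sum>k\<in>(UNIV :: 'n set). H)"
      unfolding H_def by (intro sum_mono H1_norm_bounds(2)[OF M])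
    then have a: "sqrt (cell_integral (\<lambda>x. (M x $ i $ j)\<^sup>2)) + 3 * (\<Sum>k\<in>UNIV. sqrt (cell_integral (\<lambda>x. (weak_partial k (\<lambda>y. M y $ i $ j) x)\<^sup>2))) \<le> (1 + 3 * n) * H"
      using H1_norm_bounds(1)[OF M, of i j] by (simp add: n_def H_def algebra_simps)
    have "0 \<le> sqrt (cell_integral (\<lambda>x. (M x $ i $ j)\<^sup>2)) + 3 * (\<Sum>k\<in>UNIV. sqrt (cell_integral (\<lambda>x. (weak_partial k (\<lambda>y. M y $ i $ j) x)\<^sup>2)))"
      by (intro add_nonneg_nonneg mult_nonneg_nonneg sum_nonneg) (auto simp: cell_integral_def)
    from power_mono[OF a this, of 4] show ?thesis using S(2)[of i j] by linarith
  qed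
  have pt: "norm (M x) ^ 4 \<le> n ^ 2 * (\<Sum>i\<in>UNIV. \<Sum>j\<in>UNIV. (M x $ i $ j) ^ 4)" for x
  proof -
    have "norm (M x) ^ 4 = ((norm (M x))\<^sup>2)\<^sup>2" by (simp add: power_mult[symmetric])
    also have "\<dots> = (\<Sum>i\<in>UNIV. \<Sum>j\<in>UNIV. (M x $ i $ j)\<^sup>2)\<^sup>2" by (simp add: norm_sq_mat)
    also have "\<dots> \<le> (\<Sum>i\<in>UNIV. (\<Sum>j\<in>UNIV. (M x $ i $ j)\<^sup>2)\<^sup>2) * n"
      unfolding n_def by (rule sum_squared_le_sum_of_squares)
    also have "\<dots> \<le> (\<Sum>i\<in>UNIV. (\<Sum>j\<in>UNIV. ((M x $ i $ j)\<^sup>2)\<^sup>2) * n) * n"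
      unfolding n_def by (intro mult_right_mono sum_mono sum_squared_le_sum_of_squares) auto
    also have "\<dots> = n ^ 2 * (\<Sum>i\<in>UNIV. \<Sum>j\<in>UNIV. (M x $ i $ j) ^ 4)"
    proof -
      have "((M x $ i $ j)\<^sup>2)\<^sup>2 = (M x $ i $ j) ^ 4" for i j by (simp add: power_mult[symmetric])
      then show ?thesis by (simp add: sum_distrib_right[symmetric] power2_eq_square[of n])
    qed
    finally show ?thesis .
  qed
  have ib: "integrable (lebesgue_on cell) (\<lambda>x. n ^ 2 * (\<Sum>i\<in>UNIV. \<Sum>j\<in>UNIV. (M x $ i $ j) ^ 4))" using S(1) by simp
  show i4: "integrable (lebesgue_on cell) (\<lambda>x. norm (M x) ^ 4)"
  proof (rule Bochner_Integration.integrable_bound[OF ib])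
    show "AE x in lebesgue_on cell. norm (norm (M x) ^ 4) \<le> norm (n ^ 2 * (\<Sum>i\<in>UNIV. \<Sum>j\<in>UNIV. (M x $ i $ j) ^ 4))"
      using pt by (intro AE_I2) (simp add: order_trans[OF _ abs_ge_self])
    show "(\<lambda>x. norm (M x) ^ 4) \<in> borel_measurable (lebesgue_on cell)"
      using Mm by (intro measurable_restrict_space1) measurable
  qed
  have "cell_integral (\<lambda>x. norm (M x) ^ 4) \<le> cell_integral (\<lambda>x. n ^ 2 * (\<Sum>i\<in>UNIV. \<Sum>j\<in>UNIV. (M x $ i $ j) ^ 4))"
    unfolding cell_integral_def by (rule integral_mono[OF i4 ib pt])
  also have "\<dots> = n ^ 2 * (\<Sum>i\<in>UNIV. \<Sum>j\<in>UNIV. cell_integral (\<lambda>x. (M x $ i $ j) ^ 4))"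
    unfolding cell_integral_def using S(1) by simp
  also have "\<dots> \<le> n ^ 2 * (\<Sum>i\<in>(UNIV :: 'n set). \<Sum>j\<in>(UNIV :: 'n set). ((1 + 3 * n) * H) ^ 4)"
    by (intro mult_left_mono sum_mono ent) simp
  also have "\<dots> = (n * (1 + 3 * n) * H) ^ 4" by (simp add: n_def power_mult_distrib power4_eq_xxxx power2_eq_square)
  finally show "cell_integral (\<lambda>x. norm (M x) ^ 4) \<le> K ^ 4" by (simp add: K_def n_def H_def)
qed

text \<open>Hoelder's inequality with exponents 2, 4, 4, obtained by applying Cauchy-Schwarz first
  to \<open>g^2\<close> and \<open>h^2\<close> and then to \<open>f\<close> and
  \<open>g * h\<close>.\<close>

lemma triple_product_bound:
  fixes f g h :: "real ^ 'n \<Rightarrow> real"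
  assumes m: "f \<in> borel_measurable lebesgue" "g \<in> borel_measurable lebesgue" "h \<in> borel_measurable lebesgue"
    and f: "integrable (lebesgue_on cell) (\<lambda>x. (f x)\<^sup>2)" "sqrt (cell_integral (\<lambda>x. (f x)\<^sup>2)) \<le> F"
    and g: "integrable (lebesgue_on cell) (\<lambda>x. g x ^ 4)" "cell_integral (\<lambda>x. g x ^ 4) \<le> G ^ 4" "0 \<le> G"
    and h: "integrable (lebesgue_on cell) (\<lambda>x. h x ^ 4)" "cell_integral (\<lambda>x. h x ^ 4) \<le> H ^ 4" "0 \<le> H"
  shows "integrable (lebesgue_on cell) (\<lambda>x. f x * (g x * h x))"
    and "cell_integral (\<lambda>x. \<bar>f x * (g x * h x)\<bar>) \<le> F * (G * H)"
proof -
  have p4: "((a :: real)\<^sup>2)\<^sup>2 = a ^ 4" for a by (simp add: power_mult[symmetric])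
  have m2: "(\<lambda>x. (g x)\<^sup>2) \<in> borel_measurable lebesgue" "(\<lambda>x. (h x)\<^sup>2) \<in> borel_measurable lebesgue"
    "(\<lambda>x. g x * h x) \<in> borel_measurable lebesgue" using m by measurable
  note c1 = cauchy_schwarz_cell[OF m2(1,2), unfolded p4, OF g(1) h(1)]
  have gh: "integrable (lebesgue_on cell) (\<lambda>x. (g x * h x)\<^sup>2)" using c1(1) by (simp add: power_mult_distrib)
  have s4: "sqrt (cell_integral (\<lambda>x. u x ^ 4)) \<le> U\<^sup>2" if "cell_integral (\<lambda>x. u x ^ 4) \<le> U ^ 4"
    for u :: "real ^ 'n \<Rightarrow> real" and U
  proof -
    have "sqrt (cell_integral (\<lambda>x. u x ^ 4)) \<le> sqrt ((U\<^sup>2)\<^sup>2)" unfolding p4 by (rule real_sqrt_le_mono[OF that])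
    then show ?thesis unfolding real_sqrt_abs abs_power2 .
  qed
  have "cell_integral (\<lambda>x. (g x * h x)\<^sup>2) = cell_integral (\<lambda>x. \<bar>(g x)\<^sup>2 * (h x)\<^sup>2\<bar>)" by (simp add: power_mult_distrib)
  also have "\<dots> \<le> sqrt (cell_integral (\<lambda>x. g x ^ 4)) * sqrt (cell_integral (\<lambda>x. h x ^ 4))" by (rule c1(2))
  also have "\<dots> \<le> G\<^sup>2 * H\<^sup>2" by (intro mult_mono s4 g h) (auto simp: cell_integral_def)
  finally have gh2: "cell_integral (\<lambda>x. (g x * h x)\<^sup>2) \<le> (G * H)\<^sup>2" by (simp add: power_mult_distrib)
  have "sqrt (cell_integral (\<lambda>x. (g x * h x)\<^sup>2)) \<le> sqrt ((G * H)\<^sup>2)" by (rule real_sqrt_le_mono[OF gh2])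
  then have gh3: "sqrt (cell_integral (\<lambda>x. (g x * h x)\<^sup>2)) \<le> G * H" using g(3) h(3) by simp
  note c2 = cauchy_schwarz_cell[OF m(1) m2(3) f(1) gh]
  show "integrable (lebesgue_on cell) (\<lambda>x. f x * (g x * h x))" by (rule c2(1))
  have "0 \<le> F" by (rule order_trans[OF _ f(2)]) (simp add: cell_integral_def)
  then show "cell_integral (\<lambda>x. \<bar>f x * (g x * h x)\<bar>) \<le> F * (G * H)"
    by (intro order_trans[OF c2(2)] mult_mono f gh3) (auto simp: cell_integral_def)
qed

section \<open>The error estimate for the effective matrix\<close>

lemma L2_per_add:
  fixes f g :: "real ^ 'n \<Rightarrow> real"
  assumes "f \<in> L2_per" "g \<in> L2_per" shows "(\<lambda>x. f x + g x) \<in> L2_per"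
proof -
  have z: "(\<lambda>x. 0 :: real) \<in> L2_per" by (simp add: L2_per_def periodic_def)
  show ?thesis using L2_per_diff[OF assms(1) L2_per_diff[OF z assms(2)]] by simp
qed

lemma L2_per_const: "(\<lambda>x :: real ^ 'n. c :: real) \<in> L2_per"
  by (simp add: L2_per_def periodic_def integrable_cell_continuous)

lemma L2_per_sum: "(\<And>i. i \<in> I \<Longrightarrow> f i \<in> L2_per) \<Longrightarrow> (\<lambda>x. \<Sum>i\<in>I. f i x :: real) \<in> L2_per"
  by (induction I rule: infinite_finite_induct) (auto intro: L2_per_add L2_per_const)

lemma power4_sum3: "((a :: real) + b + c) ^ 4 \<le> 27 * (a ^ 4 + b ^ 4 + c ^ 4)"
proof -
  have sq: "(x + y + z)\<^sup>2 \<le> 3 * (x\<^sup>2 + y\<^sup>2 + z\<^sup>2)" for x y z :: real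
    using zero_le_power2[of "x - y"] zero_le_power2[of "y - z"] zero_le_power2[of "x - z"]
    by (simp add: power2_eq_square algebra_simps)
  have "(a + b + c) ^ 4 = ((a + b + c)\<^sup>2)\<^sup>2" by (simp add: power_mult[symmetric])
  also have "\<dots> \<le> (3 * (a\<^sup>2 + b\<^sup>2 + c\<^sup>2))\<^sup>2" by (intro power_mono sq) simp
  also have "\<dots> = 9 * (a\<^sup>2 + b\<^sup>2 + c\<^sup>2)\<^sup>2" by (simp only: power_mult_distrib) simp
  also have "\<dots> \<le> 9 * (3 * ((a\<^sup>2)\<^sup>2 + (b\<^sup>2)\<^sup>2 + (c\<^sup>2)\<^sup>2))" by (intro mult_left_mono sq) simp
  finally show ?thesis by (simp add: power_mult[symmetric])
qed

lemma integrable_L2_mult_bounded: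
  fixes f :: "real ^ 'n \<Rightarrow> real"
  assumes "f \<in> L2_per" "g \<in> borel_measurable lebesgue" "AE x in lebesgue. \<bar>g x\<bar> \<le> C"
  shows "integrable (lebesgue_on cell) (\<lambda>x. g x * f x)"
proof (rule Bochner_Integration.integrable_bound)
  show "integrable (lebesgue_on cell) (\<lambda>x. C * f x)" using L2_per_D(4)[OF assms(1)] by simp
  show "(\<lambda>x. g x * f x) \<in> borel_measurable (lebesgue_on cell)"
    by (intro measurable_restrict_space1 borel_measurable_times assms L2_per_D(1)[OF assms(1)])
  show "AE x in lebesgue_on cell. norm (g x * f x) \<le> norm (C * f x)"
    using AE_cell[OF assms(3)]
  proof eventually_elim
    case (elim x)
    then have "\<bar>g x\<bar> * \<bar>f x\<bar> \<le> \<bar>C\<bar> * \<bar>f x\<bar>" by (intro mult_right_mono) auto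
    then show ?case by (simp add: abs_mult)
  qed
qed

lemma L1_le_L2:
  fixes f :: "real ^ 'n \<Rightarrow> real"
  assumes "f \<in> L2_per" shows "cell_integral (\<lambda>x. \<bar>f x\<bar>) \<le> L2_norm f"
  using cauchy_schwarz_cell(2)[of f "\<lambda>x. 1"] L2_per_D[OF assms] by (simp add: L2_norm_def integrable_cell_continuous)

text \<open>The two smallness assumptions do different jobs. The first keeps \<open>Y\<close> within
  distance 1 of \<open>X\<close>, so that weights depend on \<open>H1_norm X\<close> only; the
  second keeps the normalising integral of \<open>rh\<close> above \<open>g0 / 2\<close>, which
  makes \<open>r\<^sub>h\<close>-type quotients meaningful and bounded.\<close>

lemma effective_matrix_estimate:
  fixes A :: "real ^ 'n \<Rightarrow> real ^ 'n ^ 'n" and b :: "real ^ 'n \<Rightarrow> real ^ 'n"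
    and X Y :: "real ^ 'n \<Rightarrow> real ^ 'n ^ 'n" and rt rh :: "real ^ 'n \<Rightarrow> real"
  assumes card: "CARD('n) \<le> 4"
    and Am: "A \<in> borel_measurable lebesgue" and KA: "AE x in lebesgue. norm (A x) \<le> KA" "0 \<le> KA"
    and gm: "gam A b \<in> borel_measurable lebesgue" and gb: "AE x in lebesgue. \<bar>gam A b x\<bar> \<le> g1" "0 < g1"
    and rt: "rt \<in> L2_per" "L2_norm rt \<le> C1" and rh: "rh \<in> L2_per"
    and low: "0 < g0" "g0 \<le> cell_integral (\<lambda>x. gam A b x * rt x)"
    and X: "\<And>i j. (\<lambda>x. X x $ i $ j) \<in> H1_per" and Y: "\<And>i j. (\<lambda>x. Y x $ i $ j) \<in> H1_per"
    and small: "H1_norm (\<lambda>x. X x - Y x) \<le> 1" "g1 * L2_norm (\<lambda>x. rt x - rh x) \<le> g0 / 2"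
  defines "Cs \<equiv> real CARD('n) * (1 + 3 * real CARD('n))"
  defines "W \<equiv> 3 * (real CARD('n) + Cs)"
  defines "K1 \<equiv> 2 * (g1 / g0) * KA * C1 * Cs * W"
    and "K2 \<equiv> KA * (2 * (g1 / g0) + 2 * (g1 / g0)\<^sup>2 * C1) * W\<^sup>2"
  shows "cell_integral (\<lambda>x. gam A b x * rh x) \<noteq> 0"
    and "norm (effective_matrix A (renormalize A b rt) X - effective_matrix A (renormalize A b rh) Y)
      \<le> K1 * (H1_norm (\<lambda>x. X x - Y x) * (1 + H1_norm X)) + K2 * (L2_norm (\<lambda>x. rt x - rh x) * (1 + H1_norm X)\<^sup>2)"
proof -
  define n where "n = real CARD('n)"
  have n1: "1 \<le> n" unfolding n_def by (simp add: Suc_le_eq)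
  have Cs0: "0 \<le> Cs" by (simp add: Cs_def)
  define HX where "HX = H1_norm X"
  define xi where "xi = H1_norm (\<lambda>x. X x - Y x)"
  define t where "t = L2_norm (\<lambda>x. rt x - rh x)"
  have XY: "(\<lambda>x. (X x - Y x) $ i $ j) \<in> H1_per" for i j using H1_per_diff[OF X Y] by simp
  have HX0: "0 \<le> HX" unfolding HX_def by (rule H1_norm_bounds(4)[OF X])
  have xi0: "0 \<le> xi" unfolding xi_def by (rule H1_norm_bounds(4)[OF XY])
  have dL: "(\<lambda>x. rt x - rh x) \<in> L2_per" by (rule L2_per_diff[OF rt(1) rh])
  have t0: "0 \<le> t" unfolding t_def L2_norm_def by (simp add: cell_integral_def)
  have C10: "0 \<le> C1" using rt(2) unfolding L2_norm_def by (rule order_trans[rotated]) (simp add: cell_integral_def)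
  let ?g = "gam A b"
  define al where "al = cell_integral (\<lambda>x. ?g x * rt x)"
  define ah where "ah = cell_integral (\<lambda>x. ?g x * rh x)"
  note gi = integrable_L2_mult_bounded[OF _ gm gb(1)]
  have diff: "\<bar>al - ah\<bar> \<le> g1 * t"
  proof -
    have "al - ah = cell_integral (\<lambda>x. ?g x * (rt x - rh x))"
      unfolding al_def ah_def cell_integral_def using gi[OF rt(1)] gi[OF rh] by (simp add: right_diff_distrib)
    also have "\<bar>\<dots>\<bar> \<le> cell_integral (\<lambda>x. \<bar>?g x * (rt x - rh x)\<bar>)" by (rule cell_integral_abs_le)
    also have "\<dots> \<le> cell_integral (\<lambda>x. g1 * \<bar>rt x - rh x\<bar>)"
      unfolding cell_integral_def
    proof (rule integral_mono_AE)
      show "integrable (lebesgue_on cell) (\<lambda>x. \<bar>?g x * (rt x - rh x)\<bar>)" using gi[OF dL] by simp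
      show "integrable (lebesgue_on cell) (\<lambda>x. g1 * \<bar>rt x - rh x\<bar>)" using L2_per_D(4)[OF dL] by simp
      show "AE x in lebesgue_on cell. \<bar>?g x * (rt x - rh x)\<bar> \<le> g1 * \<bar>rt x - rh x\<bar>"
        using AE_cell[OF gb(1)] by eventually_elim (simp add: abs_mult mult_right_mono)
    qed
    also have "\<dots> = g1 * cell_integral (\<lambda>x. \<bar>rt x - rh x\<bar>)" by (simp add: cell_integral_def)
    also have "\<dots> \<le> g1 * t" unfolding t_def using L1_le_L2[OF dL] gb(2) by simp
    finally show ?thesis .
  qed
  have al: "g0 \<le> al" using low by (simp add: al_def)
  have ah: "g0 / 2 \<le> ah" using diff small(2) al unfolding t_def by linarith
  have al0: "0 < al" and ah0: "0 < ah" using al ah low by linarith+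
  then show "cell_integral (\<lambda>x. gam A b x * rh x) \<noteq> 0" by (simp add: ah_def)
  define r where "r = renormalize A b rt"
  define s where "s = renormalize A b rh"
  have rs: "r x = ?g x * rt x / al" "s x = ?g x * rh x / ah" for x
    by (simp_all add: r_def s_def renormalize_def al_def ah_def)
  define q where "q = g1 / g0"
  have q0: "0 \<le> q" using gb low by (simp add: q_def)
  have inv: "1 / al \<le> 1 / g0" "1 / ah \<le> 2 / g0"
    using al ah al0 ah0 low by (auto simp: divide_simps)
  have rb: "\<bar>r x\<bar> \<le> q * \<bar>rt x\<bar>" if gx: "\<bar>?g x\<bar> \<le> g1" for x
  proof -
    have "\<bar>r x\<bar> = \<bar>?g x\<bar> * (1 / al) * \<bar>rt x\<bar>" using al0 by (simp add: rs abs_mult)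
    also have "\<dots> \<le> g1 * (1 / g0) * \<bar>rt x\<bar>"
      using gx gb inv al0 by (intro mult_right_mono mult_mono) auto
    finally show ?thesis by (simp add: q_def)
  qed
  have rsb: "\<bar>r x - s x\<bar> \<le> 2 * q * \<bar>rt x - rh x\<bar> + 2 * q\<^sup>2 * t * \<bar>rt x\<bar>" if gx: "\<bar>?g x\<bar> \<le> g1" for x
  proof -
    \<comment> \<open>The difference of the quotients is arranged so that \<open>rh\<close> never
      occurs alone: one term carries \<open>rt - rh\<close>, the other the difference of the
      normalising integrals times \<open>rt\<close>, whose \<open>L^2\<close> norm is under
      control.\<close>
    have e: "r x - s x = ?g x * (1 / ah) * (rt x - rh x) + ?g x * (1 / al) * ((ah - al) * (1 / ah)) * rt x"
      unfolding rs using al0 ah0 by (simp add: field_simps)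
    have a1: "\<bar>?g x * (1 / ah) * (rt x - rh x)\<bar> \<le> g1 * (2 / g0) * \<bar>rt x - rh x\<bar>"
      unfolding abs_mult using gx gb inv ah0 by (intro mult_right_mono mult_mono) auto
    have "\<bar>?g x * (1 / al) * ((ah - al) * (1 / ah)) * rt x\<bar> \<le> g1 * (1 / g0) * ((g1 * t) * (2 / g0)) * \<bar>rt x\<bar>"
      unfolding abs_mult using gx gb inv ah0 al0 diff low t0 by (intro mult_right_mono mult_mono) auto
    also have "\<dots> = 2 * q\<^sup>2 * t * \<bar>rt x\<bar>" by (simp add: q_def power2_eq_square)
    finally have a2: "\<bar>?g x * (1 / al) * ((ah - al) * (1 / ah)) * rt x\<bar> \<le> 2 * q\<^sup>2 * t * \<bar>rt x\<bar>" .
    have a3: "g1 * (2 / g0) * \<bar>rt x - rh x\<bar> = 2 * q * \<bar>rt x - rh x\<bar>" by (simp add: q_def)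
    show ?thesis unfolding e by (rule order_trans[OF abs_triangle_ineq add_mono[OF a1[unfolded a3] a2]])
  qed
  define e where "e x = norm (X x - Y x)" for x
  define c0 where "c0 = norm (mat 1 :: real ^ 'n ^ 'n)"
  define w where "w x = c0 + norm (X x) + e x" for x
  note SX = sobolev_matrix[OF card X, folded Cs_def HX_def]
  note SE = sobolev_matrix[OF card XY, folded Cs_def xi_def e_def]
  have Ym: "Y \<in> borel_measurable lebesgue" by (rule sobolev_matrix(1)[OF card Y])
  have em: "e \<in> borel_measurable lebesgue" unfolding e_def[abs_def] using SX(1) Ym by measurable
  have wm: "w \<in> borel_measurable lebesgue" unfolding w_def[abs_def] using SX(1) em by measurable
  have w0: "0 \<le> w x" "0 \<le> e x" for x by (auto simp: w_def e_def c0_def)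
  have c02: "c0\<^sup>2 = n"
    unfolding c0_def n_def norm_sq_mat by (simp add: mat_def if_distrib[where f="\<lambda>c. c\<^sup>2"] cong: if_cong)
  have iw: "integrable (lebesgue_on cell) (\<lambda>x. 27 * (c0 ^ 4 + norm (X x) ^ 4 + e x ^ 4))"
  proof -
    interpret finite_measure "lebesgue_on (cell :: (real ^ 'n) set)" by (rule cell_finite_measure)
    show ?thesis using SX(2) SE(2) by simp
  qed
  have wle: "w x ^ 4 \<le> 27 * (c0 ^ 4 + norm (X x) ^ 4 + e x ^ 4)" for x unfolding w_def by (rule power4_sum3)
  have w4i: "integrable (lebesgue_on cell) (\<lambda>x. w x ^ 4)"
    by (rule Bochner_Integration.integrable_bound[OF iw])
      (use wle wm in \<open>auto intro!: measurable_restrict_space1 borel_measurable_power AE_I2 simp: order_trans[OF _ abs_ge_self]\<close>)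
  define W' where "W' = W * (1 + HX)"
  have W'0: "0 \<le> W'" using HX0 n1 Cs0 by (simp add: W'_def W_def n_def[symmetric])
  have w4: "cell_integral (\<lambda>x. w x ^ 4) \<le> W' ^ 4"
  proof -
    have "cell_integral (\<lambda>x. w x ^ 4) \<le> cell_integral (\<lambda>x. 27 * (c0 ^ 4 + norm (X x) ^ 4 + e x ^ 4))"
      unfolding cell_integral_def by (rule integral_mono[OF w4i iw wle])
    also have "\<dots> = 27 * (c0 ^ 4 + cell_integral (\<lambda>x. norm (X x) ^ 4) + cell_integral (\<lambda>x. e x ^ 4))"
    proof -
      interpret finite_measure "lebesgue_on (cell :: (real ^ 'n) set)" by (rule cell_finite_measure)
      show ?thesis using SX(2) SE(2) by (simp add: cell_integral_def measure_restrict_space)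
    qed
    also have "\<dots> \<le> 27 * (n ^ 4 + (Cs * HX) ^ 4 + (Cs * xi) ^ 4)"
    proof -
      have "c0 ^ 4 = (c0\<^sup>2)\<^sup>2" by (simp add: power_mult[symmetric])
      also have "\<dots> = n\<^sup>2" by (simp only: c02)
      also have "\<dots> \<le> n ^ 4" using n1 by (intro power_increasing) auto
      finally show ?thesis using SX(3) SE(3) by simp
    qed
    \<comment> \<open>Each of the three fourth powers is at most the fourth power of the sum, and
      \<open>27 * 3 = 3 ^ 4\<close> makes the result a fourth power again.\<close>
    also have "\<dots> \<le> 81 * (n + Cs * HX + Cs * xi) ^ 4"
    proof -
      have s3: "x ^ 4 \<le> (x + y + z) ^ 4 \<and> y ^ 4 \<le> (x + y + z) ^ 4 \<and> z ^ 4 \<le> (x + y + z) ^ 4"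
        if "0 \<le> x" "0 \<le> y" "0 \<le> z" for x y z :: real using that by (auto intro!: power_mono)
      have "0 \<le> n" "0 \<le> Cs * HX" "0 \<le> Cs * xi" using n1 Cs0 HX0 xi0 by simp_all
      note p = s3[OF this]
      have l: "27 * (u + v + w) \<le> 81 * d" if "u \<le> d" "v \<le> d" "w \<le> d" for u v w d :: real using that by (simp add: distrib_left)
      show ?thesis by (rule l[OF p[THEN conjunct1] p[THEN conjunct2, THEN conjunct1] p[THEN conjunct2, THEN conjunct2]])
    qed
    also have "\<dots> = (3 * (n + Cs * HX + Cs * xi)) ^ 4" by (simp only: power_mult_distrib) simp
    also have "\<dots> \<le> W' ^ 4"
    proof (rule power_mono)
      \<comment> \<open>Here the error in \<open>X\<close> is absorbed by the bound 1, so that the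
        weight \<open>W'\<close> depends on \<open>X\<close> alone and the final bound is linear in
        \<open>xi\<close>.\<close>
      have "Cs * xi \<le> Cs * 1" using small(1) Cs0 unfolding xi_def by (intro mult_left_mono)
      moreover have "0 \<le> n * HX" using n1 HX0 by simp
      ultimately show "3 * (n + Cs * HX + Cs * xi) \<le> W'"
        unfolding W'_def W_def n_def[symmetric] by (simp add: algebra_simps)
      show "0 \<le> 3 * (n + Cs * HX + Cs * xi)" using n1 Cs0 HX0 xi0 by simp
    qed
    finally show ?thesis .
  qed
  define P where "P x V = (mat 1 + V) ** A x ** (mat 1 + transpose V)" for x and V :: "real ^ 'n ^ 'n"
  have Pb: "norm (P x (X x) - P x (Y x)) \<le> 2 * KA * (e x * w x)" "norm (P x (Y x)) \<le> KA * (w x * w x)"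
    "norm (P x (X x)) \<le> KA * (w x * w x)" if "norm (A x) \<le> KA" for x
    using sandwich_bounds[OF that, where X="X x" and Y="Y x"] by (simp_all add: P_def e_def w_def c0_def)
  have entry: "(\<lambda>x. F x $ i $ j) \<in> borel_measurable lebesgue" if "F \<in> borel_measurable lebesgue"
    for F :: "real ^ 'n \<Rightarrow> real ^ 'n ^ 'n" and i j
  proof -
    have "(\<lambda>x. F x \<bullet> axis i (axis j 1)) \<in> borel_measurable lebesgue" using that by (intro borel_measurable_inner) auto
    then show ?thesis by (simp add: inner_axis)
  qed
  have Pm: "(\<lambda>x. P x (V x)) \<in> borel_measurable lebesgue" if V: "V \<in> borel_measurable lebesgue" for V
    by (rule measurable_matrixI) (auto simp: P_def matrix_matrix_mult_def transpose_def intro!: borel_measurable_sum borel_measurable_times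
        borel_measurable_add entry V Am)
  have rm: "r \<in> borel_measurable lebesgue" "s \<in> borel_measurable lebesgue"
    unfolding rs[abs_def] using gm L2_per_D(1)[OF rt(1)] L2_per_D(1)[OF rh] by measurable
  have abs2: "integrable (lebesgue_on cell) (\<lambda>x. \<bar>f x\<bar>\<^sup>2)" "sqrt (cell_integral (\<lambda>x. \<bar>f x\<bar>\<^sup>2)) = L2_norm f"
    "(\<lambda>x. \<bar>f x\<bar>) \<in> borel_measurable lebesgue" if "f \<in> L2_per" for f :: "real ^ 'n \<Rightarrow> real"
    using L2_per_D[OF that] by (auto simp: L2_norm_def)
  note T1 = triple_product_bound[OF abs2(3)[OF rt(1)] em wm abs2(1)[OF rt(1)] _ SE(2,3) _ w4i w4 W'0, of C1, unfolded abs2(2)[OF rt(1)]]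
  note T2 = triple_product_bound[OF abs2(3)[OF rt(1)] wm wm abs2(1)[OF rt(1)] _ w4i w4 W'0 w4i w4 W'0, of C1, unfolded abs2(2)[OF rt(1)]]
  note T3 = triple_product_bound[OF abs2(3)[OF dL] wm wm abs2(1)[OF dL] _ w4i w4 W'0 w4i w4 W'0, of t, unfolded abs2(2)[OF dL]]
  have Cxi: "0 \<le> Cs * xi" using Cs0 xi0 by simp
  \<comment> \<open>Three majorants: \<open>B1\<close> carries the error in \<open>X\<close>,
    \<open>B3\<close> the error in the unnormalised density, and \<open>B2\<close>, multiplied by
    \<open>t\<close>, the error in the normalising constant. Each is a product of one
    \<open>L^2\<close> and two \<open>L^4\<close> functions.\<close>
  define B1 where "B1 x = \<bar>rt x\<bar> * (e x * w x)" for x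
  define B2 where "B2 x = \<bar>rt x\<bar> * (w x * w x)" for x
  define B3 where "B3 x = \<bar>rt x - rh x\<bar> * (w x * w x)" for x
  have B1: "integrable (lebesgue_on cell) B1" "cell_integral B1 \<le> C1 * (Cs * xi * W')"
    using T1[OF rt(2) Cxi] by (simp_all add: B1_def[abs_def] w0)
  have B2: "integrable (lebesgue_on cell) B2" "cell_integral B2 \<le> C1 * (W' * W')"
    using T2[OF rt(2)] by (simp_all add: B2_def[abs_def] w0)
  have B3: "integrable (lebesgue_on cell) B3" "cell_integral B3 \<le> t * (W' * W')"
    using T3 by (simp_all add: B3_def[abs_def] w0 t_def)
  have ae: "AE x in lebesgue_on (cell :: (real ^ 'n) set). norm (A x) \<le> KA \<and> \<bar>?g x\<bar> \<le> g1"
    using AE_cell[OF KA(1)] AE_cell[OF gb(1)] by eventually_elim simp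
  have i1: "integrable (lebesgue_on cell) (\<lambda>x. r x *\<^sub>R P x (X x))"
  proof (rule Bochner_Integration.integrable_bound)
    show "integrable (lebesgue_on cell) (\<lambda>x. q * KA * B2 x)" using B2 by simp
    show "(\<lambda>x. r x *\<^sub>R P x (X x)) \<in> borel_measurable (lebesgue_on cell)"
      by (intro measurable_restrict_space1 borel_measurable_scaleR rm Pm SX)
    show "AE x in lebesgue_on cell. norm (r x *\<^sub>R P x (X x)) \<le> norm (q * KA * B2 x)"
      using ae
    proof eventually_elim
      case (elim x)
      have "norm (r x *\<^sub>R P x (X x)) \<le> (q * \<bar>rt x\<bar>) * (KA * (w x * w x))"
        unfolding norm_scaleR using elim rb[of x] Pb(3)[of x] q0 by (intro mult_mono) auto
      also have "\<dots> = q * KA * B2 x" by (simp add: B2_def)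
      finally show ?case by simp
    qed
  qed
  have bd: "AE x in lebesgue_on cell. norm (r x *\<^sub>R P x (X x) - s x *\<^sub>R P x (Y x))
      \<le> 2 * q * KA * B1 x + KA * (2 * q * B3 x + 2 * q\<^sup>2 * t * B2 x)"
    using ae
  proof eventually_elim
    case (elim x)
    have "r x *\<^sub>R P x (X x) - s x *\<^sub>R P x (Y x) = r x *\<^sub>R (P x (X x) - P x (Y x)) + (r x - s x) *\<^sub>R P x (Y x)"
      by (simp add: algebra_simps)
    also have "norm \<dots> \<le> \<bar>r x\<bar> * norm (P x (X x) - P x (Y x)) + \<bar>r x - s x\<bar> * norm (P x (Y x))"
      by (rule order_trans[OF norm_triangle_ineq]) simp
    also have "\<dots> \<le> (q * \<bar>rt x\<bar>) * (2 * KA * (e x * w x)) + (2 * q * \<bar>rt x - rh x\<bar> + 2 * q\<^sup>2 * t * \<bar>rt x\<bar>) * (KA * (w x * w x))"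
      using elim rb[of x] rsb[of x] Pb[of x] q0 t0 by (intro add_mono mult_mono) auto
    also have "\<dots> = 2 * q * KA * B1 x + KA * (2 * q * B3 x + 2 * q\<^sup>2 * t * B2 x)"
      by (simp add: B1_def B2_def B3_def algebra_simps)
    finally show ?case .
  qed
  have iB: "integrable (lebesgue_on cell) (\<lambda>x. 2 * q * KA * B1 x + KA * (2 * q * B3 x + 2 * q\<^sup>2 * t * B2 x))"
    using B1 B2 B3 by simp
  have iD: "integrable (lebesgue_on cell) (\<lambda>x. r x *\<^sub>R P x (X x) - s x *\<^sub>R P x (Y x))"
  proof (rule Bochner_Integration.integrable_bound[OF iB])
    show "(\<lambda>x. r x *\<^sub>R P x (X x) - s x *\<^sub>R P x (Y x)) \<in> borel_measurable (lebesgue_on cell)"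
      by (intro measurable_restrict_space1 borel_measurable_diff borel_measurable_scaleR rm Pm SX Ym)
    show "AE x in lebesgue_on cell. norm (r x *\<^sub>R P x (X x) - s x *\<^sub>R P x (Y x))
        \<le> norm (2 * q * KA * B1 x + KA * (2 * q * B3 x + 2 * q\<^sup>2 * t * B2 x))"
      using bd by eventually_elim simp
  qed
  \<comment> \<open>The second integrand is the first minus the difference, both of which are
    integrable; this spares a separate bound on \<open>s\<close>.\<close>
  have i2: "integrable (lebesgue_on cell) (\<lambda>x. s x *\<^sub>R P x (Y x))"
    using Bochner_Integration.integrable_diff[OF i1 iD] by simp
  have "effective_matrix A r X - effective_matrix A s Y = cell_integral (\<lambda>x. r x *\<^sub>R P x (X x) - s x *\<^sub>R P x (Y x))"
    unfolding effective_matrix_def P_def[symmetric] cell_integral_def using i1 i2 by simp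
  also have "norm \<dots> \<le> cell_integral (\<lambda>x. 2 * q * KA * B1 x + KA * (2 * q * B3 x + 2 * q\<^sup>2 * t * B2 x))"
    unfolding cell_integral_def
    by (rule order_trans[OF integral_norm_bound]) (intro integral_mono_AE integrable_norm iD iB bd)
  also have "\<dots> = 2 * q * KA * cell_integral B1 + KA * (2 * q * cell_integral B3 + 2 * q\<^sup>2 * t * cell_integral B2)"
    unfolding cell_integral_def using B1 B2 B3 by simp
  also have "\<dots> \<le> 2 * q * KA * (C1 * (Cs * xi * W')) + KA * (2 * q * (t * (W' * W')) + 2 * q\<^sup>2 * t * (C1 * (W' * W')))"
    using q0 KA(2) t0 by (intro add_mono mult_left_mono B1 B2 B3) auto
  also have "\<dots> = K1 * (xi * (1 + HX)) + K2 * (t * (1 + HX)\<^sup>2)"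
    by (simp add: K1_def K2_def W'_def q_def[symmetric] power2_eq_square algebra_simps)
  finally show "norm (effective_matrix A (renormalize A b rt) X - effective_matrix A (renormalize A b rh) Y)
      \<le> K1 * (H1_norm (\<lambda>x. X x - Y x) * (1 + H1_norm X)) + K2 * (L2_norm (\<lambda>x. rt x - rh x) * (1 + H1_norm X)\<^sup>2)"
    by (simp add: r_def s_def xi_def HX_def t_def)
qed

lemma H2_per_weak_partial_H1:
  assumes "u \<in> H2_per" shows "weak_partial i u \<in> H1_per"
proof -
  obtain g where g: "g \<in> H1_per" "has_weak_partial i u g" using assms by (auto simp: H2_per_def)
  show ?thesis
    by (rule H1_per_cong_AE[OF g(1)]) (use weak_partial_works(2)[OF g(2)] in \<open>auto elim: eventually_mono\<close>)
qed

lemma L2_per_weak_divergence: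
  assumes "w \<in> H1_per0_vec" shows "(\<lambda>x. 1 - weak_divergence w x) \<in> L2_per"
  unfolding weak_divergence_def
proof (rule L2_per_diff[OF L2_per_const L2_per_sum])
  fix i
  have "(\<lambda>x. w x $ i) \<in> H1_per" using assms by (simp add: H1_per0_vec_def)
  then show "weak_partial i (\<lambda>y. w y $ i) \<in> L2_per" by (rule H1_per_weak_partial)
qed

theorem corollary4p2:
  fixes A :: "real ^ 'n \<Rightarrow> real ^ 'n ^ 'n" and b :: "real ^ 'n \<Rightarrow> real ^ 'n"
  assumes "CARD('n) \<le> 4" and "setting_B A b"
  shows "\<exists>C>0. \<forall>(rt :: real ^ 'n \<Rightarrow> real)
      (chi :: 'n \<Rightarrow> real ^ 'n \<Rightarrow> real)
      (P :: real \<Rightarrow> (real ^ 'n \<Rightarrow> real ^ 'n) set)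
      (P' :: real \<Rightarrow> (real ^ 'n \<Rightarrow> real ^ 'n) set)
      (\<xi> :: real \<Rightarrow> 'n \<Rightarrow> real ^ 'n \<Rightarrow> real ^ 'n)
      (\<rho> :: real \<Rightarrow> real ^ 'n \<Rightarrow> real ^ 'n).
    let r = renormalize A b rt;
        Dchi = weak_jacobian (\<lambda>x. \<chi> j. chi j x);
        xi_mat = (\<lambda>h x. \<chi> j. \<xi> h j x);
        rt_h = (\<lambda>h x. 1 - weak_divergence (\<rho> h) x);
        xi_err = (\<lambda>h. H1_norm (\<lambda>x. Dchi x - xi_mat h x));
        rt_err = (\<lambda>h. L2_norm (\<lambda>x. rt x - rt_h h x));
        A_bar = effective_matrix A r Dchi;
        A_bar_h = (\<lambda>h. effective_matrix A (renormalize A b (rt_h h)) (xi_mat h))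
    in is_r_tilde A b rt \<longrightarrow>
       cell_integral (\<lambda>x. r x *\<^sub>R b x) = 0 \<longrightarrow>
       (\<forall>j. is_corrector A b j (chi j)) \<longrightarrow>
       (\<forall>h>0. closed_subspace (P h) \<and> (\<forall>j. is_xi_approx A b (P h) j (\<xi> h j))) \<longrightarrow>
       (xi_err \<longlongrightarrow> 0) (at_right 0) \<longrightarrow>
       (\<forall>h>0. closed_subspace (P' h) \<and> is_rho_approx A b (P' h) (\<rho> h)) \<longrightarrow>
       (rt_err \<longlongrightarrow> 0) (at_right 0) \<longrightarrow>
       (\<forall>\<^sub>F h in at_right 0.
          cell_integral (\<lambda>x. gam A b x * rt_h h x) \<noteq> 0 \<and>
          norm (A_bar - A_bar_h h)
            \<le> C * (xi_err h * (1 + H1_norm Dchi) + rt_err h * (1 + H1_norm Dchi)\<^sup>2))"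
proof -
  obtain s \<kappa> g0 g1 KA where
    m: "A \<in> borel_measurable lebesgue" "gam A b \<in> borel_measurable lebesgue" "periodic (gam A b)"
      "At A b \<in> borel_measurable lebesgue" "bt A b \<in> borel_measurable lebesgue" "periodic (At A b)" "periodic (bt A b)"
    and s: "AE x in lebesgue. (norm (At A b x - mat 1))\<^sup>2 + (norm (bt A b x))\<^sup>2 \<le> s"
    and psd: "AE x in lebesgue. \<forall>v. 0 \<le> v \<bullet> (At A b x *v v)"
    and k: "s * (1 + 1 / (4 * pi\<^sup>2)) \<le> \<kappa>\<^sup>2" "0 < \<kappa>" "\<kappa> < 1" "0 \<le> s"
    and g: "0 < g0" "0 < g1" "AE x in lebesgue. g0 \<le> gam A b x \<and> gam A b x \<le> g1"
    and KA: "0 \<le> KA" "AE x in lebesgue. norm (A x) \<le> KA"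
    by (rule setting_B_facts[OF assms(2)])
  have gabs: "AE x in lebesgue. \<bar>gam A b x\<bar> \<le> g1"
    using g(3) by eventually_elim (use g(1) in auto)
  have glow: "AE x in lebesgue. g0 \<le> gam A b x" using g(3) by eventually_elim simp
  define C1 where "C1 = 1 + 1 / (1 - \<kappa>)"
  have C1: "0 \<le> C1" using k by (simp add: C1_def)
  define Cs where "Cs = real CARD('n) * (1 + 3 * real CARD('n))"
  define W where "W = 3 * (real CARD('n) + Cs)"
  define K1 where "K1 = 2 * (g1 / g0) * KA * C1 * Cs * W"
  define K2 where "K2 = KA * (2 * (g1 / g0) + 2 * (g1 / g0)\<^sup>2 * C1) * W\<^sup>2"
  have W: "0 \<le> Cs" "0 \<le> W" by (simp_all add: Cs_def W_def)
  have K: "0 \<le> K1" "0 \<le> K2" unfolding K1_def K2_def using g KA(1) C1 W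
    by (auto intro!: mult_nonneg_nonneg add_nonneg_nonneg divide_nonneg_nonneg)
  show ?thesis
    unfolding Let_def
  proof (intro exI[of _ "K1 + K2 + 1"] conjI allI impI)
    \<comment> \<open>\<open>K1\<close> and \<open>K2\<close> are known only to be nonnegative; the
      summand 1 makes the constant positive.\<close>
    show "0 < K1 + K2 + 1" using K by simp
    fix rt :: "real ^ 'n \<Rightarrow> real" and chi :: "'n \<Rightarrow> real ^ 'n \<Rightarrow> real"
      and P P' :: "real \<Rightarrow> (real ^ 'n \<Rightarrow> real ^ 'n) set"
      and \<xi> :: "real \<Rightarrow> 'n \<Rightarrow> real ^ 'n \<Rightarrow> real ^ 'n" and \<rho> :: "real \<Rightarrow> real ^ 'n \<Rightarrow> real ^ 'n"
    define X where "X = weak_jacobian (\<lambda>x. \<chi> j. chi j x)"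
    define Y where "Y h x = (\<chi> j. \<xi> h j x)" for h x
    define rh where "rh h x = 1 - weak_divergence (\<rho> h) x" for h x
    assume rt: "is_r_tilde A b rt" and chi: "\<forall>j. is_corrector A b j (chi j)"
      and xi: "\<forall>h>0. closed_subspace (P h) \<and> (\<forall>j. is_xi_approx A b (P h) j (\<xi> h j))"
      and xi0: "((\<lambda>h. H1_norm (\<lambda>x. weak_jacobian (\<lambda>x. \<chi> j. chi j x) x - (\<chi> j. \<xi> h j x))) \<longlongrightarrow> 0) (at_right 0)"
      and rho: "\<forall>h>0. closed_subspace (P' h) \<and> is_rho_approx A b (P' h) (\<rho> h)"
      and rt0: "((\<lambda>h. L2_norm (\<lambda>x. rt x - (1 - weak_divergence (\<rho> h) x))) \<longlongrightarrow> 0) (at_right 0)"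
    have rt': "rt \<in> L2_per" "cell_integral rt = 1"
      and sol: "\<And>\<phi>. \<phi> \<in> H2_per \<Longrightarrow> cell_integral (\<lambda>x. rt x * (At A b x \<bullet> weak_hessian \<phi> x + bt A b x \<bullet> weak_grad \<phi> x)) = 0"
      using rt by (auto simp: is_r_tilde_def)
    have rtC: "L2_norm rt \<le> C1"
      unfolding C1_def by (rule very_weak_solution_L2[OF m(4-7) s psd k rt' sol])
    \<comment> \<open>The lower duality bound is applied with \<open>gam\<close> itself in the role
      of the right-hand side, since it lies above \<open>g0\<close> almost everywhere.\<close>
    have low: "g0 \<le> cell_integral (\<lambda>x. gam A b x * rt x)"
      using very_weak_solution_bounded(2)[OF m(4-7) s psd k rt' sol m(2,3) _ glow, of g1] gabs by (simp add: mult.commute)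
    have X: "(\<lambda>x. X x $ i $ j) \<in> H1_per" for i j
      using chi H2_per_weak_partial_H1[of "chi i" j]
      by (auto simp: X_def weak_jacobian_def is_corrector_def H2_per0_def)
    have e1: "\<forall>\<^sub>F h in at_right 0. H1_norm (\<lambda>x. X x - Y h x) < 1"
      using order_tendstoD(2)[OF xi0, of 1] by (simp add: X_def Y_def)
    \<comment> \<open>Below this threshold the normalising integral moves by at most
      \<open>g0 / 2\<close>, since \<open>gam\<close> is bounded by \<open>g1\<close> and the mean
      of \<open>\<bar>rt - rh h\<bar>\<close> by its \<open>L^2\<close> norm.\<close>
    have e2: "\<forall>\<^sub>F h in at_right 0. L2_norm (\<lambda>x. rt x - rh h x) < g0 / (2 * g1)"
      using order_tendstoD(2)[OF rt0, of "g0 / (2 * g1)"] g by (simp add: rh_def)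
    have "\<forall>\<^sub>F h in at_right 0. cell_integral (\<lambda>x. gam A b x * rh h x) \<noteq> 0 \<and>
        norm (effective_matrix A (renormalize A b rt) X - effective_matrix A (renormalize A b (rh h)) (Y h))
          \<le> (K1 + K2 + 1) * (H1_norm (\<lambda>x. X x - Y h x) * (1 + H1_norm X)
            + L2_norm (\<lambda>x. rt x - rh h x) * (1 + H1_norm X)\<^sup>2)"
      using eventually_at_right_less[of "0 :: real"] e1 e2
    proof eventually_elim
      case (elim h)
      have Y: "(\<lambda>x. Y h x $ i $ j) \<in> H1_per" for i j
      proof -
        have "\<xi> h i \<in> H1_per0_vec" using xi elim(1) unfolding closed_subspace_def is_xi_approx_def by blast
        then show ?thesis by (simp add: Y_def H1_per0_vec_def)
      qed
      have "\<rho> h \<in> H1_per0_vec" using rho elim(1) unfolding closed_subspace_def is_rho_approx_def by blast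
      then have rh: "rh h \<in> L2_per" unfolding rh_def[abs_def] by (rule L2_per_weak_divergence)
      have small: "H1_norm (\<lambda>x. X x - Y h x) \<le> 1" "g1 * L2_norm (\<lambda>x. rt x - rh h x) \<le> g0 / 2"
        using elim(2,3) g by (simp_all add: field_simps)
      note E = effective_matrix_estimate[OF assms(1) m(1) KA(2,1) m(2) gabs g(2) rt'(1) rtC rh g(1) low X Y small]
      define p where "p = H1_norm (\<lambda>x. X x - Y h x) * (1 + H1_norm X)"
      define q where "q = L2_norm (\<lambda>x. rt x - rh h x) * (1 + H1_norm X)\<^sup>2"
      have HX: "0 \<le> H1_norm X" by (rule H1_norm_bounds(4)[OF X])
      have Hd: "0 \<le> H1_norm (\<lambda>x. X x - Y h x)"
        by (rule H1_norm_bounds(4)) (use H1_per_diff[OF X Y] in simp)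
      have p0: "0 \<le> p" "0 \<le> q"
        using HX Hd by (auto simp: p_def q_def L2_norm_def cell_integral_def)
      have "K1 * p + K2 * q \<le> (K1 + K2 + 1) * p + (K1 + K2 + 1) * q"
        using K p0 by (intro add_mono mult_right_mono) auto
      also have "\<dots> = (K1 + K2 + 1) * (p + q)" by (simp add: distrib_left)
      finally have "K1 * p + K2 * q \<le> (K1 + K2 + 1) * (p + q)" .
      then show ?case
        using E(1) order_trans[OF E(2)[folded Cs_def, folded W_def, folded K1_def K2_def, folded p_def q_def]]
        unfolding p_def[symmetric] q_def[symmetric] by blast
    qed
    then show "\<forall>\<^sub>F h in at_right 0.
        cell_integral (\<lambda>x. gam A b x * (1 - weak_divergence (\<rho> h) x)) \<noteq> 0 \<and>
        norm (effective_matrix A (renormalize A b rt) (weak_jacobian (\<lambda>x. \<chi> j. chi j x))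
            - effective_matrix A (renormalize A b (\<lambda>x. 1 - weak_divergence (\<rho> h) x)) (\<lambda>x. \<chi> j. \<xi> h j x))
          \<le> (K1 + K2 + 1) * (H1_norm (\<lambda>x. weak_jacobian (\<lambda>x. \<chi> j. chi j x) x - (\<chi> j. \<xi> h j x))
              * (1 + H1_norm (weak_jacobian (\<lambda>x. \<chi> j. chi j x)))
            + L2_norm (\<lambda>x. rt x - (1 - weak_divergence (\<rho> h) x)) * (1 + H1_norm (weak_jacobian (\<lambda>x. \<chi> j. chi j x)))\<^sup>2)"
      unfolding X_def Y_def[abs_def] rh_def[abs_def] .
  qed
qed

end
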